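(* Let $\mathbf{k}\in\mathbb{N}^d$. The following are equivalent: (i) There exists an $S_{++}$-filter-regular sequence $\mathbf{x}$ with respect to $M$ of the type $\mathbf{k}$ such that $\mathbf{x}$ is a mixed multiplicity system of $M$. (ii) There exists a mixed multiplicity system of $M$ of the type $\mathbf{k}$. (iii) $\triangle^{\mathbf{k}}P_M(\mathbf{n})$ is a constant. (iv) The mixed multiplicity of $M$ of the type $\mathbf{k}$ is defined.
   Context: $\mathbb{N}$ denotes the nonnegative integers and $d\ge 1$ is an integer. $(A,\mathfrak{m})$ is an Artinian local ring with infinite residue field; $S=\bigoplus_{\mathbf{n}\in\mathbb{N}^d}S_{\mathbf{n}}$ is a finitely generated standard $\mathbb{N}^d$-graded (commutative) algebra over $A$, i.e. $S$ is generated over $A$ by elements of total degree $1$; $M=\bigoplus_{\mathbf{n}\in\mathbb{N}^d}M_{\mathbf{n}}$ is a finitely generated $\mathbb{N}^d$-graded $S$-module. On $\mathbb{N}^d$, $\le$ is componentwise, and $\mathbf{h}>\mathbf{k}$ means $\mathbf{h}\ge\mathbf{k}$ and $\mathbf{h}\ne\mathbf{k}$. "For all large $\mathbf{n}$" means for all $\mathbf{n}$ with every component sufficiently large. Let $\mathbf{e}_i$ be the $i$-th unit vector of $\mathbb{N}^d$, $S_i=S_{\mathbf{e}_i}$, and $S_{++}=\bigoplus_{\mathbf{n}\ge(1,\ldots,1)}S_{\mathbf{n}}$. $\mathrm{Proj}\,S$ is the set of homogeneous prime ideals of $S$ not containing $S_{++}$; $\mathrm{Supp}_{++}M=\{P\in\mathrm{Proj}\,S: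 M_P\ne0\}$; its dimension is the supremum of lengths of chains of primes in it, with $\dim\emptyset=-\infty$. Mixed multiplicities: $\ell_A$ denotes length. For all large $\mathbf{n}$, $\ell_A[M_{\mathbf{n}}]$ equals a polynomial $P_M(\mathbf{n})$ (the Hilbert polynomial), written uniquely as $P_M(\mathbf{n})=\sum_{\mathbf{k}\in\mathbb{N}^d}e(M;\mathbf{k})\binom{\mathbf{n}+\mathbf{k}}{\mathbf{k}}$ with $e(M;\mathbf{k})\in\mathbb{Z}$, where $\binom{\mathbf{n}+\mathbf{k}}{\mathbf{k}}=\prod_{i=1}^d\binom{n_i+k_i}{k_i}$. The mixed multiplicity (of maximal degree) of $M$ of the type $\mathbf{k}$ is defined if $e(M;\mathbf{h})=0$ for all $\mathbf{h}>\mathbf{k}$, and is then the number $e(M;\mathbf{k})$. $\triangle^{\mathbf{k}}f$ denotes the $\mathbf{k}$-difference of a function $f(\mathbf{n})$: $\triangle^{\mathbf{e}_i}f(\mathbf{n})=f(\mathbf{n})-f(\mathbf{n}-\mathbf{e}_i)$ and $\triangle^{\mathbf{k}}=(\triangle^{\mathbf{e}_1})^{k_1}\cdots(\triangle^{\mathbf{e}_d})^{k_d}$. A sequence of elements of $\bigcup_{j=1}^dS_j$ consisting of $k_1$ elements of $S_1$, ..., $k_d$ elements of $S_d$ (in any order) is said to be of the type $\mathbf{k}=(k_1,\ldots,k_d)$. A sequence $\mathbf{x}$ of the type $\mathbf{k}$ is a mixed multiplicity system of $M$ of the type $\mathbf{k}$ if $\dim\mathrm{Supp}_{++}(M/\mathbf{x}M)\le0$.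 A homogeneous element $a\in S$ is $S_{++}$-filter-regular with respect to $M$ if $(0_M:a)_{\mathbf{n}}=0$ for all large $\mathbf{n}$, where $0_M:a=\{m\in M: am=0\}$; a sequence $x_1,\ldots,x_t$ of homogeneous elements is an $S_{++}$-filter-regular sequence with respect to $M$ if each $x_i$ is $S_{++}$-filter-regular with respect to $M/(x_1,\ldots,x_{i-1})M$. *)

theory Defs
  imports
    "HOL-Analysis.Finite_Cartesian_Product"
    "HOL-Library.Extended_Real"
    "HOL-Algebra.QuotRing"
    "HOL-Algebra.Generated_Rings"
    "HOL-Algebra.Module"
begin

text \<open>
  Multidegrees are vectors of type \<^typ>\<open>nat ^ 'd\<close>, where the finite (and nonempty) index type
  \<open>'d\<close> plays the role of $\{1,\dots,d\}$.  The library orders on this type are the ones needed: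
  \<open>\<le>\<close> is componentwise, and \<open>h > k\<close> means \<open>h \<ge> k\<close> and \<open>h \<noteq> k\<close>.
\<close>

definition for_all_large :: "(nat ^ 'd::finite \<Rightarrow> bool) \<Rightarrow> bool"
  where "for_all_large Q \<longleftrightarrow> (\<exists>N. \<forall>n. (\<forall>i. N \<le> n $ i) \<longrightarrow> Q n)"


section \<open>Rings and modules\<close>

locale artinian_ring = ring +
  assumes descending_chain:
    "\<lbrakk>\<And>n. ideal (I n) R; \<And>n. I (Suc n) \<subseteq> I n\<rbrakk> \<Longrightarrow> \<exists>N::nat. \<forall>n\<ge>N. I n = I N"

locale local_ring = cring R + maximalideal \<mm> R for R (structure) and \<mm> +
  assumes unique_maximalideal: "maximalideal J R \<Longrightarrow> J = \<mm>"

definition gen_submodule :: "('a, 'b) ring_scheme \<Rightarrow> ('a, 'm) module \<Rightarrow> 'm set \<Rightarrow> 'm set"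
  where "gen_submodule R M Y = \<Inter>{N. submodule N R M \<and> Y \<subseteq> N}"

definition fin_gen_module :: "('a, 'b) ring_scheme \<Rightarrow> ('a, 'm) module \<Rightarrow> bool"
  where "fin_gen_module R M \<longleftrightarrow> (\<exists>Y. finite Y \<and> Y \<subseteq> carrier M \<and> gen_submodule R M Y = carrier M)"

definition module_length :: "('a, 'b) ring_scheme \<Rightarrow> ('a, 'm) module \<Rightarrow> enat"
  where "module_length R M =
    Sup {enat l | l. \<exists>C :: nat \<Rightarrow> 'm set.
      (\<forall>i\<le>l. submodule (C i) R M) \<and> (\<forall>i<l. C i \<subset> C (Suc i))}"

text \<open>
  A module record contains the (for a module irrelevant) ring fields \<open>mult\<close> and \<open>one\<close>; in the
  modules constructed below they are left undefined.
\<close>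

definition quot_module :: "('a, 'm) module \<Rightarrow> 'm set \<Rightarrow> ('a, 'm set) module"
  where "quot_module M N =
    \<lparr>carrier = a_rcosets\<^bsub>M\<^esub> N, mult = undefined, one = undefined, zero = N,
     add = (<+>\<^bsub>M\<^esub>), smult = (\<lambda>a X. \<Union>m\<in>X. N +>\<^bsub>M\<^esub> (a \<odot>\<^bsub>M\<^esub> m))\<rparr>"

text \<open>The localization $M_P$ at a prime ideal $P$, as classes of fractions $m/s$, \<open>s \<notin> P\<close>.\<close>

definition loc_rel ::
    "('a, 'b) ring_scheme \<Rightarrow> ('a, 'm) module \<Rightarrow> 'a set \<Rightarrow> (('m \<times> 'a) \<times> ('m \<times> 'a)) set"
  where "loc_rel R M P =
    {((m, s), (m', s')). m \<in> carrier M \<and> s \<in> carrier R - P \<and> m' \<in> carrier M \<and> s' \<in> carrier R - P \<and>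
       (\<exists>u \<in> carrier R - P. u \<odot>\<^bsub>M\<^esub> (s' \<odot>\<^bsub>M\<^esub> m) = u \<odot>\<^bsub>M\<^esub> (s \<odot>\<^bsub>M\<^esub> m'))}"

definition localization ::
    "('a, 'b) ring_scheme \<Rightarrow> ('a, 'm) module \<Rightarrow> 'a set \<Rightarrow> ('a, ('m \<times> 'a) set) module"
  where "localization R M P =
    \<lparr>carrier = (carrier M \<times> (carrier R - P)) // loc_rel R M P,
     mult = undefined, one = undefined,
     zero = loc_rel R M P `` {(\<zero>\<^bsub>M\<^esub>, \<one>\<^bsub>R\<^esub>)},
     add = (\<lambda>X Y. \<Union>(m, s)\<in>X. \<Union>(m', s')\<in>Y.
              loc_rel R M P `` {(s' \<odot>\<^bsub>M\<^esub> m \<oplus>\<^bsub>M\<^esub> s \<odot>\<^bsub>M\<^esub> m', s \<otimes>\<^bsub>R\<^esub> s')}),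
     smult = (\<lambda>a X. \<Union>(m, s)\<in>X. loc_rel R M P `` {(a \<odot>\<^bsub>M\<^esub> m, s)})\<rparr>"


section \<open>Multigraded algebras and modules\<close>

definition direct_sum_decomp :: "('b, 'c) ring_scheme \<Rightarrow> ('i \<Rightarrow> 'b set) \<Rightarrow> bool"
  where "direct_sum_decomp G Gr \<longleftrightarrow>
    (\<forall>n. additive_subgroup (Gr n) G) \<and>
    (\<forall>x\<in>carrier G. \<exists>!f. (\<forall>n. f n \<in> Gr n) \<and> finite {n. f n \<noteq> \<zero>\<^bsub>G\<^esub>} \<and>
                          x = finsum G f {n. f n \<noteq> \<zero>\<^bsub>G\<^esub>})"

text \<open>The structure map \<open>A \<rightarrow> S\<close> need not be injective.\<close>

definition structure_map :: "('a, 's) module \<Rightarrow> 'a \<Rightarrow> 's"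
  where "structure_map S a = a \<odot>\<^bsub>S\<^esub> \<one>\<^bsub>S\<^esub>"

definition gen_subalgebra :: "('a, 'b) ring_scheme \<Rightarrow> ('a, 's) module \<Rightarrow> 's set \<Rightarrow> 's set"
  where "gen_subalgebra A S X = generate_ring S (structure_map S ` carrier A \<union> X)"

locale multigraded_algebra = algebra A S
  for A :: "('a, 'b) ring_scheme" and S :: "('a, 's) module" +
  fixes Sg :: "nat ^ 'd::finite \<Rightarrow> 's set"
  assumes ring_decomp: "direct_sum_decomp S Sg"
    and ring_mult: "\<lbrakk>s \<in> Sg m; t \<in> Sg n\<rbrakk> \<Longrightarrow> s \<otimes>\<^bsub>S\<^esub> t \<in> Sg (m + n)"
    and ring_smult: "\<lbrakk>a \<in> carrier A; s \<in> Sg n\<rbrakk> \<Longrightarrow> a \<odot>\<^bsub>S\<^esub> s \<in> Sg n"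

locale fin_gen_standard_algebra = multigraded_algebra +
  assumes fin_gen: "\<exists>X. finite X \<and> X \<subseteq> carrier S \<and> gen_subalgebra A S X = carrier S"
    and standard: "gen_subalgebra A S (\<Union>i. Sg (axis i 1)) = carrier S"

locale multigraded_module = Module.module S M
  for S :: "('s, 'b) ring_scheme" and Sg :: "nat ^ 'd::finite \<Rightarrow> 's set" and M :: "('s, 'm) module" +
  fixes Mg :: "nat ^ 'd::finite \<Rightarrow> 'm set"
  assumes module_decomp: "direct_sum_decomp M Mg"
    and module_smult: "\<lbrakk>s \<in> Sg m; x \<in> Mg n\<rbrakk> \<Longrightarrow> s \<odot>\<^bsub>M\<^esub> x \<in> Mg (m + n)"

definition homogeneous_ideal :: "('s, 'b) ring_scheme \<Rightarrow> (nat ^ 'd::finite \<Rightarrow> 's set) \<Rightarrow> 's set \<Rightarrow> bool"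
  where "homogeneous_ideal S Sg I \<longleftrightarrow> (\<exists>H \<subseteq> (\<Union>n. Sg n). I = Idl\<^bsub>S\<^esub> H)"

definition S_plus_plus :: "('s, 'b) ring_scheme \<Rightarrow> (nat ^ 'd::finite \<Rightarrow> 's set) \<Rightarrow> 's set"
  where "S_plus_plus S Sg =
    {finsum S f F | f F. finite F \<and> F \<subseteq> {n. \<forall>i. 1 \<le> n $ i} \<and> (\<forall>n\<in>F. f n \<in> Sg n)}"

definition Proj :: "('s, 'b) ring_scheme \<Rightarrow> (nat ^ 'd::finite \<Rightarrow> 's set) \<Rightarrow> 's set set"
  where "Proj S Sg = {P. primeideal P S \<and> homogeneous_ideal S Sg P \<and> \<not> S_plus_plus S Sg \<subseteq> P}"

definition Supp_plus_plus ::
    "('s, 'b) ring_scheme \<Rightarrow> (nat ^ 'd::finite \<Rightarrow> 's set) \<Rightarrow> ('s, 'm) module \<Rightarrow> 's set set"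
  where "Supp_plus_plus S Sg M =
    {P \<in> Proj S Sg. carrier (localization S M P) \<noteq> {\<zero>\<^bsub>localization S M P\<^esub>}}"

text \<open>For \<open>X = {}\<close> the supremum is \<open>-\<infinity>\<close>.\<close>

definition chain_dim :: "'s set set \<Rightarrow> ereal"
  where "chain_dim X =
    Sup {ereal (real l) | l. \<exists>P :: nat \<Rightarrow> 's set. (\<forall>i\<le>l. P i \<in> X) \<and> (\<forall>i<l. P i \<subset> P (Suc i))}"


section \<open>Hilbert polynomials and mixed multiplicities\<close>

text \<open>The homogeneous component $M_{\mathbf n}$ as an \<open>A\<close>-module.\<close>

definition component_module ::
    "('a, 's) module \<Rightarrow> ('s, 'm) module \<Rightarrow> 'm set \<Rightarrow> ('a, 'm) module"
  where "component_module S M C =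
    \<lparr>carrier = C, mult = undefined, one = undefined, zero = \<zero>\<^bsub>M\<^esub>, add = (\<oplus>\<^bsub>M\<^esub>),
     smult = (\<lambda>a m. structure_map S a \<odot>\<^bsub>M\<^esub> m)\<rparr>"

text \<open>
  Polynomials in \<open>d\<close> variables over the rationals are represented by the functions they induce
  on the integer lattice, which determine them.
\<close>

definition polynomial_fun :: "(int ^ 'd::finite \<Rightarrow> rat) \<Rightarrow> bool"
  where "polynomial_fun P \<longleftrightarrow>
    (\<exists>c :: nat ^ 'd \<Rightarrow> rat. finite {k. c k \<noteq> 0} \<and>
       (\<forall>n. P n = (\<Sum>k | c k \<noteq> 0. c k * (\<Prod>i\<in>UNIV. of_int (n $ i) ^ (k $ i)))))"

definition hilbert_poly ::
    "('a, 'b) ring_scheme \<Rightarrow> ('a, 's) module \<Rightarrow> ('s, 'm) module \<Rightarrow>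
     (nat ^ 'd::finite \<Rightarrow> 'm set) \<Rightarrow> int ^ 'd \<Rightarrow> rat"
  where "hilbert_poly A S M Mg =
    (THE P. polynomial_fun P \<and>
       for_all_large (\<lambda>n. \<exists>l. module_length A (component_module S M (Mg n)) = enat l \<and>
                               P (\<chi> i. int (n $ i)) = of_nat l))"

text \<open>The family $e(M;\mathbf k)$.\<close>

definition hilbert_coeff ::
    "('a, 'b) ring_scheme \<Rightarrow> ('a, 's) module \<Rightarrow> ('s, 'm) module \<Rightarrow>
     (nat ^ 'd::finite \<Rightarrow> 'm set) \<Rightarrow> nat ^ 'd \<Rightarrow> int"
  where "hilbert_coeff A S M Mg =
    (THE e. finite {k. e k \<noteq> 0} \<and>
       (\<forall>n. hilbert_poly A S M Mg n =
          (\<Sum>k | e k \<noteq> 0. of_int (e k) *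
             (\<Prod>i\<in>UNIV. (of_int (n $ i) + of_nat (k $ i)) gchoose (k $ i)))))"

definition mixed_multiplicity_defined ::
    "('a, 'b) ring_scheme \<Rightarrow> ('a, 's) module \<Rightarrow> ('s, 'm) module \<Rightarrow>
     (nat ^ 'd::finite \<Rightarrow> 'm set) \<Rightarrow> nat ^ 'd \<Rightarrow> bool"
  where "mixed_multiplicity_defined A S M Mg k \<longleftrightarrow> (\<forall>h>k. hilbert_coeff A S M Mg h = 0)"

definition unit_difference :: "'d::finite \<Rightarrow> (int ^ 'd \<Rightarrow> rat) \<Rightarrow> int ^ 'd \<Rightarrow> rat"
  where "unit_difference i f n = f n - f (n - axis i 1)"

text \<open>
  The composite of the powers $(\triangle^{\mathbf e_i})^{k_i}$ over all \<open>i\<close>; the order of the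
  factors does not matter because they commute.
\<close>

definition multi_difference :: "nat ^ 'd::finite \<Rightarrow> (int ^ 'd \<Rightarrow> rat) \<Rightarrow> int ^ 'd \<Rightarrow> rat"
  where "multi_difference k f = Finite_Set.fold (\<lambda>i. unit_difference i ^^ (k $ i)) f UNIV"

lemma unit_difference_commute:
  "unit_difference i \<circ> unit_difference j = unit_difference j \<circ> unit_difference i"
  by (simp add: unit_difference_def fun_eq_iff diff_diff_eq add.commute)

lemma unit_difference_pow_commute:
  "(unit_difference i ^^ a) \<circ> (unit_difference j ^^ b) = (unit_difference j ^^ b) \<circ> (unit_difference i ^^ a)"
proof -
  have *: "f \<circ> (g ^^ b) = (g ^^ b) \<circ> f" if "f \<circ> g = g \<circ> f" for f g :: "'x \<Rightarrow> 'x" and b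
    using that by (induction b) (auto simp: fun_eq_iff)
  show ?thesis
    by (metis * unit_difference_commute)
qed

lemma comp_fun_commute_unit_difference:
  "comp_fun_commute (\<lambda>i. unit_difference i ^^ (k $ i))"
  by standard (rule unit_difference_pow_commute)


section \<open>Mixed multiplicity systems and filter-regular sequences\<close>

text \<open>
  The components \<open>Sg (axis j 1)\<close> all contain zero, so the type of a sequence is read off from an
  assignment \<open>js\<close> of an index to each of its members.
\<close>

definition sequence_of_type :: "(nat ^ 'd::finite \<Rightarrow> 's set) \<Rightarrow> 's list \<Rightarrow> nat ^ 'd \<Rightarrow> bool"
  where "sequence_of_type Sg xs k \<longleftrightarrow>
    (\<exists>js. list_all2 (\<lambda>x j. x \<in> Sg (axis j 1)) xs js \<and> (\<forall>j. count_list js j = k $ j))"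

text \<open>The submodule $\mathbf x M = x_1 M + \dots + x_t M$.\<close>

definition seq_submodule :: "('s, 'b) ring_scheme \<Rightarrow> ('s, 'm) module \<Rightarrow> 's list \<Rightarrow> 'm set"
  where "seq_submodule S M xs =
    gen_submodule S M {x \<odot>\<^bsub>M\<^esub> m | x m. x \<in> set xs \<and> m \<in> carrier M}"

text \<open>The grading induced on a quotient by a homogeneous submodule \<open>N\<close>.\<close>

definition quot_grading ::
    "('s, 'm) module \<Rightarrow> (nat ^ 'd::finite \<Rightarrow> 'm set) \<Rightarrow> 'm set \<Rightarrow> nat ^ 'd \<Rightarrow> 'm set set"
  where "quot_grading M Mg N n = (\<lambda>m. N +>\<^bsub>M\<^esub> m) ` Mg n"

definition mixed_multiplicity_system ::
    "('s, 'b) ring_scheme \<Rightarrow> (nat ^ 'd::finite \<Rightarrow> 's set) \<Rightarrow> ('s, 'm) module \<Rightarrow> 's list \<Rightarrow> nat ^ 'd \<Rightarrow> bool"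
  where "mixed_multiplicity_system S Sg M xs k \<longleftrightarrow>
    sequence_of_type Sg xs k \<and>
    chain_dim (Supp_plus_plus S Sg (quot_module M (seq_submodule S M xs))) \<le> 0"

definition annihilated_by :: "('s, 'm) module \<Rightarrow> 's \<Rightarrow> 'm set"
  where "annihilated_by M a = {m \<in> carrier M. a \<odot>\<^bsub>M\<^esub> m = \<zero>\<^bsub>M\<^esub>}"

definition filter_regular ::
    "(nat ^ 'd::finite \<Rightarrow> 's set) \<Rightarrow> ('s, 'm) module \<Rightarrow> (nat ^ 'd \<Rightarrow> 'm set) \<Rightarrow> 's \<Rightarrow> bool"
  where "filter_regular Sg M Mg a \<longleftrightarrow>
    a \<in> (\<Union>n. Sg n) \<and> for_all_large (\<lambda>n. annihilated_by M a \<inter> Mg n = {\<zero>\<^bsub>M\<^esub>})"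

definition filter_regular_sequence ::
    "('s, 'b) ring_scheme \<Rightarrow> (nat ^ 'd::finite \<Rightarrow> 's set) \<Rightarrow> ('s, 'm) module \<Rightarrow>
     (nat ^ 'd \<Rightarrow> 'm set) \<Rightarrow> 's list \<Rightarrow> bool"
  where "filter_regular_sequence S Sg M Mg xs \<longleftrightarrow>
    (\<forall>i<length xs. let N = seq_submodule S M (take i xs) in
       filter_regular Sg (quot_module M N) (quot_grading M Mg N) (xs ! i))"

end

theory Submission
  imports Defs "HOL-Computational_Algebra.Polynomial"
begin

text \<open>
  The whole proof works with pairs \<open>N \<le> L\<close> of graded submodules of \<open>M\<close> and the Hilbert polynomial
  \<open>P(L/N)\<close> of the subquotient.  Quotients by elements and kernels of multiplications are again of this
  form, so all modules that occur live inside the fixed \<open>M\<close>, and inductions can range over all pairs.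

  \<^emph>\<open>Devissage\<close> (\<open>devissage\<close>).  Graded submodules of \<open>M\<close> satisfy the ascending chain condition.  If
  \<open>N \<noteq> L\<close>, some homogeneous \<open>m \<in> L\<close> has a prime annihilator \<open>P = (N : m)\<close>, and \<open>(N + Sm)/N\<close> is a shifted
  copy of \<open>S/P\<close>, on which a homogeneous element outside \<open>P\<close> acts injectively.  Noetherian induction on
  \<open>N\<close> therefore proves a statement about all pairs from the step \<open>N \<le> N + Sm\<close>, and in that step the
  statement may be used for all \<open>N' > N\<close>.  In this way: Hilbert polynomials exist (\<open>hilbert_exists\<close>); a
  subquotient with empty support vanishes in large degrees (\<open>relevant_supp_empty\<close>); a support without
  inclusions forces a constant Hilbert polynomial (\<open>dim_le_0_hilb_poly_const\<close>); and an element is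
  filter-regular as soon as it avoids finitely many primes (\<open>filter_regular_primes\<close>).

  \<^emph>\<open>The difference formula\<close> (\<open>hilb_poly_unit_difference\<close>).  For \<open>x \<in> S\<^sub>i\<close> the exact sequence given by
  multiplication with \<open>x\<close> on \<open>L/N\<close> shows that the difference of \<open>P(L/N)\<close> in direction \<open>i\<close> is
  \<open>P(L/(N + xL))\<close> minus a translate of \<open>P((N : x)/N)\<close>.

  (ii) implies (iii): induction along the sequence, for all pairs at once.  The kernel \<open>(N : x)/N\<close> is
  annihilated by \<open>x\<close>, so by Nakayama's lemma the support of its quotient by the remaining elements lies in
  the support of \<open>L\<close> modulo the whole sequence (\<open>relevant_supp_colon\<close>).  Hence the induction hypothesis
  applies to both terms of the difference formula.

  (iii) implies (i): since the residue field is infinite, there is \<open>x \<in> S\<^sub>i\<close> that avoids the finitely many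
  primes of \<open>filter_regular_primes\<close>.  For it the kernel term vanishes, and \<open>M/xM\<close> satisfies (iii) for
  \<open>k - e\<^sub>i\<close>.  At the end the quotient has a constant Hilbert polynomial, and this excludes an inclusion
  \<open>P \<subset> Q\<close> in its support (\<open>hilb_poly_const_dim_le_0\<close>): multiplication by some \<open>a \<in> Q - P\<close> is injective on a
  copy of \<open>S/P\<close>, hence bijective in a degree where the length is maximal, so an element outside \<open>Q\<close> would
  be a multiple of \<open>a\<close> modulo \<open>P\<close>.

  (iii) and (iv) are equivalent because \<open>k\<close>-fold differences just shift the coefficients in the basis of
  binomial coefficients (\<open>multi_difference_binom_sum\<close>).

  Graded submodules and graded ideals are represented by the families of their homogeneous components.
  Only homogeneous elements of equal degree are ever added there, and the direct sum decompositions enter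
  where families are compared with submodules, prime ideals and localizations.
\<close>

declare One_nat_def [simp del]

section \<open>Sums of products of binomial coefficients\<close>

definition binom_basis :: "nat ^ 'd::finite \<Rightarrow> int ^ 'd \<Rightarrow> rat"
  where "binom_basis k n = (\<Prod>i\<in>UNIV. (of_int (n $ i) + of_nat (k $ i)) gchoose (k $ i))"

definition binom_sum :: "(nat ^ 'd::finite \<Rightarrow> int) \<Rightarrow> int ^ 'd \<Rightarrow> rat"
  where "binom_sum e n = (\<Sum>k | e k \<noteq> 0. of_int (e k) * binom_basis k n)"

definition int_vec :: "nat ^ 'd::finite \<Rightarrow> int ^ 'd"
  where "int_vec n = (\<chi> i. int (n $ i))"

lemma int_vec_nth [simp]: "int_vec n $ i = int (n $ i)"
  by (simp add: int_vec_def)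

lemma vec_minus_axis_add: "1 \<le> k $ i \<Longrightarrow> k - axis i 1 + axis i 1 = (k :: nat ^ 'd::finite)"
  by (auto simp: vec_eq_iff axis_def)

lemma vec_le_minus_add: "b \<le> n \<Longrightarrow> n - b + b = (n :: nat ^ 'd::finite)"
  by (auto simp: vec_eq_iff less_eq_vec_def)

lemma binom_basis_split:
  "binom_basis k n = ((of_int (n $ i) + of_nat (k $ i)) gchoose (k $ i)) *
     (\<Prod>j\<in>UNIV - {i}. (of_int (n $ j) + of_nat (k $ j)) gchoose (k $ j))"
  unfolding binom_basis_def by (rule prod.remove) auto

text \<open>
  Pascal's rule in the direction \<open>i\<close>: the differences permute the basis, up to zero.  This is the reason
  for working with the products of \<open>n\<^sub>i + k\<^sub>i\<close> over \<open>k\<^sub>i\<close>.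
\<close>

lemma binom_basis_diff:
  "binom_basis k n - binom_basis k (n - axis i 1) =
     (if k $ i = 0 then 0 else binom_basis (k - axis i 1) n)"
proof -
  define R where "R = (\<Prod>j\<in>UNIV - {i}. (of_int (n $ j) + of_nat (k $ j) :: rat) gchoose (k $ j))"
  have 1: "binom_basis k n = ((of_int (n $ i) + of_nat (k $ i)) gchoose (k $ i)) * R"
    unfolding R_def by (rule binom_basis_split)
  have 2: "binom_basis k (n - axis i 1) = ((of_int (n $ i) - 1 + of_nat (k $ i)) gchoose (k $ i)) * R"
    unfolding R_def by (subst binom_basis_split[of _ _ i]) (auto simp: axis_def intro!: prod.cong)
  show ?thesis
  proof (cases "k $ i")
    case 0
    then show ?thesis by (simp add: 1 2)
  next
    case (Suc m)
    have 3: "binom_basis (k - axis i 1) n = ((of_int (n $ i) + of_nat m) gchoose m) * R"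
      unfolding R_def by (subst binom_basis_split[of _ _ i]) (auto simp: axis_def Suc intro!: prod.cong)
    have "((of_int (n $ i) + of_nat m + 1 :: rat) gchoose Suc m) =
          ((of_int (n $ i) + of_nat m) gchoose m) + ((of_int (n $ i) + of_nat m) gchoose Suc m)"
      by (rule gbinomial_Suc_Suc)
    then show ?thesis by (simp add: 1 2 3 Suc algebra_simps)
  qed
qed

text \<open>
  At \<open>n\<^sub>i = -1\<close> the factor for \<open>k\<^sub>i > 0\<close> is \<open>k\<^sub>i - 1\<close> over \<open>k\<^sub>i\<close>, which is zero.  Evaluation at this point
  therefore reads off the coefficient of degree zero, and after differences every coefficient.
\<close>

lemma binom_basis_minus_one: "binom_basis k (\<chi> i. -1) = (if k = 0 then 1 else 0)"
proof (cases "k = 0")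
  case False
  then obtain i where i: "k $ i \<noteq> 0" by (auto simp: vec_eq_iff)
  then obtain m where m: "k $ i = Suc m" by (cases "k $ i") auto
  have "((of_int (-1) + of_nat (k $ i) :: rat) gchoose (k $ i)) = of_nat (m choose Suc m)"
    by (simp only: binomial_gbinomial m) simp
  then have "((of_int ((\<chi> i. -1) $ i) + of_nat (k $ i) :: rat) gchoose (k $ i)) = 0" by simp
  then show ?thesis using False unfolding binom_basis_split[of _ _ i] by simp
qed (simp add: binom_basis_def)

lemma binom_sum_superset:
  "finite K \<Longrightarrow> {k. e k \<noteq> 0} \<subseteq> K \<Longrightarrow> binom_sum e n = (\<Sum>k\<in>K. of_int (e k) * binom_basis k n)"
  unfolding binom_sum_def by (rule sum.mono_neutral_left) auto

lemma finite_shift_support: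
  "finite {k. e k \<noteq> 0} \<Longrightarrow> finite {k. e (k + h) \<noteq> 0}" for h :: "nat ^ 'd::finite"
  by (rule finite_subset[OF _ finite_vimageI[of "{k. e k \<noteq> 0}" "\<lambda>k. k + h"]]) (auto simp: inj_on_def)

lemma binom_sum_add:
  assumes "finite {k. e k \<noteq> 0}" "finite {k. e' k \<noteq> 0}"
  shows "binom_sum (\<lambda>k. e k + e' k) n = binom_sum e n + binom_sum e' n"
proof -
  let ?K = "{k. e k \<noteq> 0} \<union> {k. e' k \<noteq> 0}"
  have "binom_sum (\<lambda>k. e k + e' k) n = (\<Sum>k\<in>?K. of_int (e k + e' k) * binom_basis k n)"
    using assms by (intro binom_sum_superset) auto
  moreover have "binom_sum e n = (\<Sum>k\<in>?K. of_int (e k) * binom_basis k n)"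
    using assms by (intro binom_sum_superset) auto
  moreover have "binom_sum e' n = (\<Sum>k\<in>?K. of_int (e' k) * binom_basis k n)"
    using assms by (intro binom_sum_superset) auto
  ultimately show ?thesis by (simp add: sum.distrib algebra_simps)
qed

lemma unit_difference_binom_sum:
  assumes "finite {k. e k \<noteq> 0}"
  shows "unit_difference i (binom_sum e) = binom_sum (\<lambda>k. e (k + axis i 1))"
proof
  fix n
  let ?K = "{k. e k \<noteq> 0}"
  have "unit_difference i (binom_sum e) n =
      (\<Sum>k\<in>?K. of_int (e k) * (if k $ i = 0 then 0 else binom_basis (k - axis i 1) n))"
    by (simp add: unit_difference_def binom_sum_def sum_subtractf[symmetric] right_diff_distrib[symmetric]
        binom_basis_diff)
  also have "\<dots> = (\<Sum>k\<in>{k\<in>?K. k $ i \<noteq> 0}. of_int (e k) * binom_basis (k - axis i 1) n)"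
    using assms by (intro sum.mono_neutral_cong_right) auto
  also have "\<dots> = (\<Sum>k | e (k + axis i 1) \<noteq> 0. of_int (e (k + axis i 1)) * binom_basis k n)"
  proof (rule sum.reindex_bij_witness[where i = "\<lambda>k. k + axis i 1" and j = "\<lambda>k. k - axis i 1"])
    fix k assume "k \<in> {k \<in> ?K. k $ i \<noteq> 0}"
    then have k: "1 \<le> k $ i" "e k \<noteq> 0" by auto
    show "k - axis i 1 + axis i 1 = k" by (rule vec_minus_axis_add[OF k(1)])
    then show "k - axis i 1 \<in> {k. e (k + axis i 1) \<noteq> 0}"
      and "of_int (e (k - axis i 1 + axis i 1)) * binom_basis (k - axis i 1) n = of_int (e k) * binom_basis (k - axis i 1) n"
      using k by auto
  next
    fix k assume "k \<in> {k. e (k + axis i 1) \<noteq> 0}"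
    then show "k + axis i 1 \<in> {k \<in> ?K. k $ i \<noteq> 0}" by (auto simp: axis_def)
    show "k + axis i 1 - axis i 1 = k" by (simp add: vec_eq_iff)
  qed
  finally show "unit_difference i (binom_sum e) n = binom_sum (\<lambda>k. e (k + axis i 1)) n"
    by (simp add: binom_sum_def)
qed

lemma multi_difference_zero:
  fixes f :: "int ^ 'd::finite \<Rightarrow> rat"
  shows "multi_difference 0 f = f"
proof -
  interpret comp_fun_commute "\<lambda>i. unit_difference i ^^ ((0 :: nat ^ 'd) $ i)"
    by (rule comp_fun_commute_unit_difference)
  have "Finite_Set.fold (\<lambda>i. unit_difference i ^^ ((0 :: nat ^ 'd) $ i)) f I = f" if "finite I" for I
    using that
  proof induction
    case (insert x F)
    then show ?case by (subst fold_insert) (auto simp: id_def)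
  qed simp
  then show ?thesis unfolding multi_difference_def by simp
qed

text \<open>
  The factors of \<open>multi_difference\<close> commute, so one more difference in direction \<open>i\<close> may be taken first.
  This is the recursion used in all inductions on the type of a sequence.
\<close>

lemma multi_difference_add_axis:
  fixes k :: "nat ^ 'd::finite"
  shows "multi_difference (k + axis i 1) f = multi_difference k (unit_difference i f)"
proof -
  interpret k: comp_fun_commute "\<lambda>j. unit_difference j ^^ (k $ j)"
    by (rule comp_fun_commute_unit_difference)
  interpret k1: comp_fun_commute "\<lambda>j. unit_difference j ^^ ((k + axis i 1) $ j)"
    by (rule comp_fun_commute_unit_difference)
  have *: "Finite_Set.fold (\<lambda>j. unit_difference j ^^ ((k + axis i 1) $ j)) g I =
        Finite_Set.fold (\<lambda>j. unit_difference j ^^ (k $ j)) g I" if "finite I" "i \<notin> I" for I g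
    using that
  proof (induction I)
    case (insert x F)
    then show ?case by (subst k1.fold_insert) (auto simp: axis_def)
  qed simp
  have "multi_difference (k + axis i 1) f =
      Finite_Set.fold (\<lambda>j. unit_difference j ^^ ((k + axis i 1) $ j))
        ((unit_difference i ^^ ((k + axis i 1) $ i)) f) (UNIV - {i})"
    unfolding multi_difference_def
    using k1.fold_fun_left_comm k1.fold_rec[of UNIV i f] k1.fold_fun_left_comm[of "UNIV - {i}" i f] by simp
  also have "(unit_difference i ^^ ((k + axis i 1) $ i)) f = (unit_difference i ^^ (k $ i)) (unit_difference i f)"
    by (simp add: axis_def One_nat_def funpow_swap1)
  also have "Finite_Set.fold (\<lambda>j. unit_difference j ^^ ((k + axis i 1) $ j)) \<dots> (UNIV - {i}) =
      Finite_Set.fold (\<lambda>j. unit_difference j ^^ (k $ j)) ((unit_difference i ^^ (k $ i)) (unit_difference i f)) (UNIV - {i})"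
    by (rule *) auto
  also have "\<dots> = multi_difference k (unit_difference i f)"
    unfolding multi_difference_def
    using k.fold_rec[of UNIV i "unit_difference i f"] k.fold_fun_left_comm[of "UNIV - {i}" i "unit_difference i f"] by simp
  finally show ?thesis .
qed

lemma multidegree_induct [case_names zero step]:
  fixes k :: "nat ^ 'd::finite"
  assumes zero: "P 0" and step: "\<And>k i. P k \<Longrightarrow> P (k + axis i 1)"
  shows "P k"
proof (induction "\<Sum>i\<in>UNIV. k $ i" arbitrary: k)
  case 0
  then have "k = 0" by (auto simp: vec_eq_iff)
  then show ?case using zero by simp
next
  case (Suc m)
  then obtain i where i: "1 \<le> k $ i"
    by (metis One_nat_def Suc_neq_Zero Suc_leI gr0I sum.neutral)
  have k: "k - axis i 1 + axis i 1 = k" by (rule vec_minus_axis_add[OF i])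
  have "(\<Sum>j\<in>UNIV. k $ j) = (\<Sum>j\<in>UNIV. (k - axis i 1) $ j + axis i 1 $ j)"
    by (metis (no_types) k vector_add_component)
  also have "\<dots> = (\<Sum>j\<in>UNIV. (k - axis i 1) $ j) + 1"
    by (simp add: sum.distrib axis_def)
  finally have "m = (\<Sum>j\<in>UNIV. (k - axis i 1) $ j)" using Suc.hyps(2) by simp
  then show ?case using step[of "k - axis i 1" i] Suc.hyps(1) k by simp
qed

lemma multi_difference_binom_sum:
  assumes "finite {h. e h \<noteq> 0}"
  shows "multi_difference k (binom_sum e) = binom_sum (\<lambda>h. e (h + k))"
  using assms
proof (induction k arbitrary: e rule: multidegree_induct)
  case zero
  then show ?case by (simp add: multi_difference_zero)
next
  case (step k i)
  have "multi_difference (k + axis i 1) (binom_sum e) = multi_difference k (binom_sum (\<lambda>h. e (h + axis i 1)))"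
    by (simp add: multi_difference_add_axis unit_difference_binom_sum[OF step.prems])
  also have "\<dots> = binom_sum (\<lambda>h. e (h + k + axis i 1))"
    by (rule step.IH) (rule finite_shift_support[OF step.prems])
  finally show ?case by (simp add: add.assoc)
qed

lemma binom_sum_minus_one:
  assumes "finite {h. e h \<noteq> 0}"
  shows "binom_sum e (\<chi> i. -1) = of_int (e 0)"
proof -
  have "binom_sum e (\<chi> i. -1) = (\<Sum>k\<in>insert 0 {h. e h \<noteq> 0}. of_int (e k) * binom_basis k (\<chi> i. -1))"
    using assms by (intro binom_sum_superset) auto
  also have "\<dots> = (\<Sum>k\<in>{0}. of_int (e k) * binom_basis k (\<chi> i. -1))"
    using assms by (intro sum.mono_neutral_right) (auto simp: binom_basis_minus_one)
  finally show ?thesis by (simp add: binom_basis_minus_one)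
qed

lemma binom_sum_coeff:
  assumes "finite {h. e h \<noteq> 0}"
  shows "of_int (e k) = multi_difference k (binom_sum e) (\<chi> i. -1)"
  by (simp add: multi_difference_binom_sum[OF assms] binom_sum_minus_one finite_shift_support[OF assms])

text \<open>
  The coefficients are values of differences at the point \<open>-1\<close>, so they are unique.
\<close>

lemma binom_sum_inject:
  assumes "finite {h. e h \<noteq> 0}" "finite {h. e' h \<noteq> 0}" "binom_sum e = binom_sum e'"
  shows "e = e'"
proof
  fix k
  have "(of_int (e k) :: rat) = of_int (e' k)"
    unfolding binom_sum_coeff[OF assms(1)] binom_sum_coeff[OF assms(2)] assms(3) by simp
  then show "e k = e' k" by simp
qed

lemma binom_sum_const_iff:
  fixes e :: "nat ^ 'd::finite \<Rightarrow> int"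
  assumes "finite {h. e h \<noteq> 0}"
  shows "(\<exists>c. \<forall>n. binom_sum e n = c) \<longleftrightarrow> (\<forall>h. h \<noteq> 0 \<longrightarrow> e h = 0)"
proof
  assume "\<exists>c. \<forall>n. binom_sum e n = c"
  then obtain c where c: "binom_sum e = (\<lambda>_. c)" by blast
  show "\<forall>h. h \<noteq> 0 \<longrightarrow> e h = 0"
  proof (intro allI impI)
    fix h :: "nat ^ 'd" assume "h \<noteq> 0"
    then obtain i where i: "1 \<le> h $ i" by (auto simp: vec_eq_iff Suc_le_eq One_nat_def)
    have fin: "finite {h. e (h + axis i 1) \<noteq> 0}" by (rule finite_shift_support[OF assms])
    have "binom_sum (\<lambda>h. e (h + axis i 1)) = (\<lambda>_. 0)"
      by (simp add: unit_difference_binom_sum[OF assms, symmetric] c unit_difference_def fun_eq_iff)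
    also have "\<dots> = binom_sum (\<lambda>_. 0)" by (simp add: binom_sum_def fun_eq_iff)
    finally have "(\<lambda>h. e (h + axis i 1)) = (\<lambda>_. 0)" using fin by (intro binom_sum_inject) auto
    from fun_cong[OF this, of "h - axis i 1"] show "e h = 0" by (simp add: vec_minus_axis_add[OF i])
  qed
next
  assume *: "\<forall>h. h \<noteq> 0 \<longrightarrow> e h = 0"
  have "binom_sum e n = of_int (e 0)" for n
    using binom_sum_superset[of "{0}" e n] * by (fastforce simp: binom_basis_def)
  then show "\<exists>c. \<forall>n. binom_sum e n = c" by blast
qed

section \<open>Functions that are polynomial in each variable\<close>

text \<open>
  A convenient weakening of being a polynomial: it is closed under differences, and it still determines
  the function from its values in large degrees.
\<close>

definition sep_poly :: "(int ^ 'd::finite \<Rightarrow> rat) \<Rightarrow> bool"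
  where "sep_poly P \<longleftrightarrow> (\<forall>n i. \<exists>p. \<forall>t. P (\<chi> j. if j = i then t else n $ j) = poly p (of_int t))"

lemma sep_poly_diff: "sep_poly P \<Longrightarrow> sep_poly Q \<Longrightarrow> sep_poly (\<lambda>n. P n - Q n)"
  unfolding sep_poly_def by (metis poly_diff)

lemma sep_poly_sum:
  fixes f :: "'k \<Rightarrow> int ^ 'd::finite \<Rightarrow> rat"
  assumes "\<And>k. k \<in> K \<Longrightarrow> sep_poly (f k)"
  shows "sep_poly (\<lambda>n. \<Sum>k\<in>K. f k n)"
  unfolding sep_poly_def
proof (intro allI)
  fix n :: "int ^ 'd" and i
  from assms have "\<forall>k\<in>K. \<exists>p. \<forall>t. f k (\<chi> j. if j = i then t else n $ j) = poly p (of_int t)"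
    by (simp add: sep_poly_def)
  from bchoice[OF this] obtain p where
    "\<forall>k\<in>K. \<forall>t. f k (\<chi> j. if j = i then t else n $ j) = poly (p k) (of_int t)"
    by blast
  then show "\<exists>p. \<forall>t. (\<Sum>k\<in>K. f k (\<chi> j. if j = i then t else n $ j)) = poly p (of_int t)"
    by (intro exI[of _ "\<Sum>k\<in>K. p k"]) (simp add: poly_sum)
qed

lemma sep_poly_prod:
  fixes f :: "'d::finite \<Rightarrow> int \<Rightarrow> rat"
  assumes "\<And>j. \<exists>p. \<forall>t. f j t = poly p (of_int t)"
  shows "sep_poly (\<lambda>n. c * (\<Prod>j\<in>UNIV. f j (n $ j)))"
  unfolding sep_poly_def
proof (intro allI)
  fix n :: "int ^ 'd" and i
  from assms obtain p where p: "\<forall>j t. f j t = poly (p j) (of_int t)" by metis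
  have "(\<Prod>j\<in>UNIV. f j (if j = i then t else n $ j)) = poly (p i) (of_int t) * (\<Prod>j\<in>UNIV-{i}. f j (n $ j))" for t
    by (subst prod.remove[of _ i]) (auto simp: p)
  then show "\<exists>p. \<forall>t. c * (\<Prod>j\<in>UNIV. f j ((\<chi> j. if j = i then t else n $ j) $ j)) = poly p (of_int t)"
    by (intro exI[of _ "smult (c * (\<Prod>j\<in>UNIV-{i}. f j (n $ j))) (p i)"]) (simp add: mult_ac)
qed

lemma sep_poly_polynomial_fun: "polynomial_fun P \<Longrightarrow> sep_poly P"
proof -
  assume "polynomial_fun P"
  then obtain c :: "nat ^ 'a \<Rightarrow> rat" where
    "\<forall>n. P n = (\<Sum>k | c k \<noteq> 0. c k * (\<Prod>i\<in>UNIV. of_int (n $ i) ^ (k $ i)))"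
    by (auto simp: polynomial_fun_def)
  then have P: "P = (\<lambda>n. \<Sum>k | c k \<noteq> 0. c k * (\<Prod>i\<in>UNIV. of_int (n $ i) ^ (k $ i)))" by auto
  show ?thesis unfolding P
  proof (intro sep_poly_sum sep_poly_prod)
    fix k :: "nat ^ 'a" and j
    show "\<exists>p. \<forall>t. (of_int t :: rat) ^ (k $ j) = poly p (of_int t)"
      by (rule exI[of _ "monom 1 (k $ j)"]) (simp add: poly_monom)
  qed
qed

lemma poly_eq_0_eventually:
  fixes p :: "rat poly"
  assumes "\<And>t. int N \<le> t \<Longrightarrow> poly p (of_int t) = 0"
  shows "p = 0"
proof (rule ccontr)
  assume "p \<noteq> 0"
  then have "finite {x. poly p x = 0}" by (rule poly_roots_finite)
  moreover have "of_int ` {int N..} \<subseteq> {x. poly p x = 0}" using assms by auto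
  ultimately have "finite ((of_int :: int \<Rightarrow> rat) ` {int N..})" by (rule finite_subset[rotated])
  then show False by (auto dest!: finite_imageD simp: inj_on_def infinite_Ici)
qed

text \<open>
  A one-variable polynomial with infinitely many zeros vanishes.  Applied to one coordinate after the
  other, this frees the coordinates from the restriction of being large.
\<close>

lemma sep_poly_zero:
  fixes P :: "int ^ 'd::finite \<Rightarrow> rat"
  assumes P: "sep_poly P" and zero: "for_all_large (\<lambda>n. P (int_vec n) = 0)"
  shows "P n = 0"
proof -
  from zero obtain N where N: "\<And>n. (\<forall>i. N \<le> n $ i) \<Longrightarrow> P (int_vec n) = 0"
    by (auto simp: for_all_large_def)
  have "\<forall>n. (\<forall>i. i \<notin> J \<longrightarrow> int N \<le> n $ i) \<longrightarrow> P n = 0" if "finite J" for J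
    using that
  proof induction
    case empty
    show ?case
    proof (intro allI impI)
      fix n :: "int ^ 'd" assume "\<forall>i. i \<notin> {} \<longrightarrow> int N \<le> n $ i"
      then have *: "int N \<le> n $ i" for i by simp
      then have n: "int_vec (\<chi> i. nat (n $ i)) = n"
        by (auto simp: vec_eq_iff) (metis of_nat_0_le_iff order_trans)
      have "N \<le> nat (n $ i)" for i using *[of i] by linarith
      then show "P n = 0" using N[of "\<chi> i. nat (n $ i)"] n by simp
    qed
  next
    case (insert i J)
    show ?case
    proof (intro allI impI)
      fix n :: "int ^ 'd" assume *: "\<forall>j. j \<notin> insert i J \<longrightarrow> int N \<le> n $ j"
      obtain p where p: "\<And>t. P (\<chi> j. if j = i then t else n $ j) = poly p (of_int t)"
        using P unfolding sep_poly_def by metis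
      have "p = 0"
      proof (rule poly_eq_0_eventually)
        fix t assume "int N \<le> t"
        then have "P (\<chi> j. if j = i then t else n $ j) = 0" using insert.IH * by auto
        then show "poly p (of_int t) = 0" by (simp add: p)
      qed
      moreover have "(\<chi> j. if j = i then n $ i else n $ j) = n" by (simp add: vec_eq_iff)
      ultimately show "P n = 0" using p[of "n $ i"] by simp
    qed
  qed
  from this[of UNIV] show ?thesis by auto
qed

lemma polynomial_fun_finite_sum:
  assumes "finite K"
    and "\<And>n. P n = (\<Sum>k\<in>K. c k * (\<Prod>i\<in>UNIV. of_int (n $ i) ^ (k $ i)))"
  shows "polynomial_fun P"
proof -
  define c' where "c' k = (if k \<in> K then c k else 0)" for k
  have sub: "{k. c' k \<noteq> 0} \<subseteq> K" by (auto simp: c'_def)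
  have "P n = (\<Sum>k | c' k \<noteq> 0. c' k * (\<Prod>i\<in>UNIV. of_int (n $ i) ^ (k $ i)))" for n
    unfolding assms(2) using assms(1) sub by (intro sum.mono_neutral_cong_right) (auto simp: c'_def)
  then show ?thesis unfolding polynomial_fun_def using finite_subset[OF sub assms(1)] by blast
qed

lemma polynomial_fun_add:
  assumes "polynomial_fun P" "polynomial_fun Q"
  shows "polynomial_fun (\<lambda>n. P n + Q n)"
proof -
  from assms obtain c d where c: "finite {k. c k \<noteq> 0}"
      "\<And>n. P n = (\<Sum>k | c k \<noteq> 0. c k * (\<Prod>i\<in>UNIV. of_int (n $ i) ^ (k $ i)))"
    and d: "finite {k. d k \<noteq> 0}"
      "\<And>n. Q n = (\<Sum>k | d k \<noteq> 0. d k * (\<Prod>i\<in>UNIV. of_int (n $ i) ^ (k $ i)))"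
    unfolding polynomial_fun_def by blast
  let ?K = "{k. c k \<noteq> 0} \<union> {k. d k \<noteq> 0}"
  have "P n = (\<Sum>k\<in>?K. c k * (\<Prod>i\<in>UNIV. of_int (n $ i) ^ (k $ i)))" for n
    unfolding c(2) using c(1) d(1) by (intro sum.mono_neutral_left) auto
  moreover have "Q n = (\<Sum>k\<in>?K. d k * (\<Prod>i\<in>UNIV. of_int (n $ i) ^ (k $ i)))" for n
    unfolding d(2) using c(1) d(1) by (intro sum.mono_neutral_left) auto
  ultimately show ?thesis
    using c(1) d(1) by (intro polynomial_fun_finite_sum[of ?K _ "\<lambda>k. c k + d k"]) (auto simp: sum.distrib algebra_simps)
qed

text \<open>
  Expand the product of the one-variable polynomials into monomials.
\<close>

lemma polynomial_fun_prod:
  fixes p :: "'d::finite \<Rightarrow> rat poly"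
  shows "polynomial_fun (\<lambda>n. c * (\<Prod>i\<in>UNIV. poly (p i) (of_int (n $ i))))"
proof -
  define F where "F = PiE (UNIV :: 'd set) (\<lambda>i. {..degree (p i)})"
  define V where "V f = (\<chi> i. f i)" for f :: "'d \<Rightarrow> nat"
  have F: "finite F" by (auto simp: F_def intro: finite_PiE)
  have inj: "inj_on V F" by (auto simp: V_def inj_on_def vec_eq_iff)
  show ?thesis
  proof (rule polynomial_fun_finite_sum)
    show "finite (V ` F)" using F by simp
    fix n :: "int ^ 'd"
    have "(\<Prod>i\<in>UNIV. poly (p i) (of_int (n $ i))) =
        (\<Prod>i\<in>UNIV. \<Sum>j\<le>degree (p i). coeff (p i) j * of_int (n $ i) ^ j)"
      by (simp add: poly_altdef)
    also have "\<dots> = (\<Sum>f\<in>F. \<Prod>i\<in>UNIV. coeff (p i) (f i) * of_int (n $ i) ^ f i)"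
      unfolding F_def by (rule prod_sum_PiE) auto
    finally have "c * (\<Prod>i\<in>UNIV. poly (p i) (of_int (n $ i))) =
        (\<Sum>f\<in>F. (c * (\<Prod>i\<in>UNIV. coeff (p i) (V f $ i))) * (\<Prod>i\<in>UNIV. of_int (n $ i) ^ (V f $ i)))"
      by (simp add: prod.distrib sum_distrib_left V_def mult_ac)
    also have "\<dots> = (\<Sum>k\<in>V ` F. (c * (\<Prod>i\<in>UNIV. coeff (p i) (k $ i))) * (\<Prod>i\<in>UNIV. of_int (n $ i) ^ (k $ i)))"
      by (simp add: sum.reindex[OF inj])
    finally show "c * (\<Prod>i\<in>UNIV. poly (p i) (of_int (n $ i))) =
        (\<Sum>k\<in>V ` F. (c * (\<Prod>i\<in>UNIV. coeff (p i) (k $ i))) * (\<Prod>i\<in>UNIV. of_int (n $ i) ^ (k $ i)))" .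
  qed
qed

lemma gbinomial_poly: "\<exists>p. \<forall>x. ((x + of_nat k) gchoose k) = poly p (x :: rat)"
proof -
  have "((x + of_nat k) gchoose k) = poly (smult (1 / fact k) (\<Prod>i=0..<k. [:of_nat k - of_nat i, 1:])) x" for x :: rat
    by (simp add: gbinomial_prod_rev poly_prod add_diff_eq add.commute)
  then show ?thesis by blast
qed

lemma polynomial_fun_binom_sum:
  assumes "finite {k. e k \<noteq> 0}"
  shows "polynomial_fun (binom_sum e)"
proof -
  have "polynomial_fun (\<lambda>n. \<Sum>k\<in>K. of_int (e k) * binom_basis k n)" if "finite K" for K
    using that
  proof induction
    case empty
    show ?case by (rule polynomial_fun_finite_sum[of "{}"]) auto
  next
    case (insert k K)
    obtain p where p: "\<And>j x. ((x + of_nat j) gchoose j) = poly (p j) (x :: rat)" using gbinomial_poly by metis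
    have "polynomial_fun (\<lambda>n. of_int (e k) * binom_basis k n)"
      unfolding binom_basis_def p by (rule polynomial_fun_prod)
    from polynomial_fun_add[OF this insert.IH] show ?case by (simp add: insert.hyps)
  qed
  from this[OF assms] show ?thesis by (simp add: binom_sum_def[abs_def])
qed


lemma sep_poly_unit_difference: "sep_poly P \<Longrightarrow> sep_poly (unit_difference i P)"
  unfolding sep_poly_def
proof (intro allI)
  fix n :: "int ^ 'a" and j
  assume P: "\<forall>n i. \<exists>p. \<forall>t. P (\<chi> j. if j = i then t else n $ j) = poly p (of_int t)"
  obtain p where p: "\<And>t. P (\<chi> l. if l = j then t else n $ l) = poly p (of_int t)" using P by metis
  obtain q where q: "\<And>t. P (\<chi> l. if l = j then t else (n - axis i 1) $ l) = poly q (of_int t)" using P by metis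
  have "\<exists>q. \<forall>t. P ((\<chi> l. if l = j then t else n $ l) - axis i 1) = poly q (of_int t)"
  proof (cases "i = j")
    case True
    have "(\<chi> l. if l = j then t else n $ l) - axis i 1 = (\<chi> l. if l = j then t - 1 else n $ l)" for t
      using True by (auto simp: vec_eq_iff axis_def)
    then have "P ((\<chi> l. if l = j then t else n $ l) - axis i 1) = poly (pcompose p [:-1, 1:]) (of_int t)" for t
      by (simp add: p poly_pcompose)
    then show ?thesis by blast
  next
    case False
    have "(\<chi> l. if l = j then t else n $ l) - axis i 1 = (\<chi> l. if l = j then t else (n - axis i 1) $ l)" for t
      using False by (auto simp: vec_eq_iff axis_def)
    then show ?thesis using q by auto
  qed
  then obtain q' where "\<And>t. P ((\<chi> l. if l = j then t else n $ l) - axis i 1) = poly q' (of_int t)" by blast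
  then show "\<exists>r. \<forall>t. unit_difference i P (\<chi> l. if l = j then t else n $ l) = poly r (of_int t)"
    by (intro exI[of _ "p - q'"]) (simp add: unit_difference_def p)
qed

section \<open>Numerical polynomials and their differences\<close>

lemma for_all_large_conj: "for_all_large P \<Longrightarrow> for_all_large Q \<Longrightarrow> for_all_large (\<lambda>n. P n \<and> Q n)"
proof -
  assume "for_all_large P" "for_all_large Q"
  then obtain N N' where "\<And>n. (\<forall>i. N \<le> n $ i) \<Longrightarrow> P n" "\<And>n. (\<forall>i. N' \<le> n $ i) \<Longrightarrow> Q n"
    unfolding for_all_large_def by blast
  then show ?thesis unfolding for_all_large_def by (intro exI[of _ "max N N'"]) simp
qed

lemma for_all_large_mono: "for_all_large P \<Longrightarrow> (\<And>n. P n \<Longrightarrow> Q n) \<Longrightarrow> for_all_large Q"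
  unfolding for_all_large_def by blast

lemma for_all_large_minus: "for_all_large P \<Longrightarrow> for_all_large (\<lambda>n. P (n - b))" for b :: "nat ^ 'd::finite"
proof -
  assume "for_all_large P"
  then obtain N where N: "\<And>n. (\<forall>i. N \<le> n $ i) \<Longrightarrow> P n" unfolding for_all_large_def by blast
  have "P (n - b)" if "\<forall>i. N + (\<Sum>i\<in>UNIV. b $ i) \<le> n $ i" for n
  proof (rule N, rule allI)
    fix i
    have "b $ i \<le> (\<Sum>i\<in>UNIV. b $ i)" by (rule member_le_sum) auto
    then show "N \<le> (n - b) $ i" using that[rule_format, of i] by simp
  qed
  then show ?thesis unfolding for_all_large_def by blast
qed

lemma for_all_large_ge: "for_all_large (\<lambda>n. b \<le> n)" for b :: "nat ^ 'd::finite"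
proof -
  have "b $ i \<le> (\<Sum>i\<in>UNIV. b $ i)" for i by (rule member_le_sum) auto
  then show ?thesis unfolding for_all_large_def less_eq_vec_def by (meson order_trans)
qed

lemma for_all_large_exists: "for_all_large P \<Longrightarrow> \<exists>n. P n" for P :: "nat ^ 'd::finite \<Rightarrow> bool"
proof -
  assume "for_all_large P"
  then obtain N where "\<And>n. (\<forall>i. N \<le> n $ i) \<Longrightarrow> P n" unfolding for_all_large_def by blast
  from this[of "\<chi> i. N"] show ?thesis by auto
qed

lemma int_vec_minus: "b \<le> n \<Longrightarrow> int_vec (n - b) = int_vec n - int_vec b"
  by (auto simp: vec_eq_iff less_eq_vec_def of_nat_diff)

lemma int_vec_axis [simp]: "int_vec (axis i 1) = axis i 1"
  by (simp add: vec_eq_iff axis_def)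

definition numerical_poly :: "(int ^ 'd::finite \<Rightarrow> rat) \<Rightarrow> bool"
  where "numerical_poly P \<longleftrightarrow> (\<exists>e. finite {k. e k \<noteq> 0} \<and> P = binom_sum e)"

lemma numerical_polyI: "finite {k. e k \<noteq> 0} \<Longrightarrow> numerical_poly (binom_sum e)"
  unfolding numerical_poly_def by blast

lemma numerical_poly_const: "numerical_poly (\<lambda>_. of_int c)"
proof -
  define e where "e k = (if k = 0 then c else 0)" for k :: "nat ^ 'a"
  have sub: "{k. e k \<noteq> 0} \<subseteq> {0}" by (auto simp: e_def)
  have "binom_sum e = (\<lambda>_. of_int c)"
    using binom_sum_superset[OF _ sub] by (simp add: fun_eq_iff) (simp add: e_def binom_basis_def)
  then show ?thesis using numerical_polyI[of e] finite_subset[OF sub] by simp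
qed

lemma numerical_poly_add: "numerical_poly P \<Longrightarrow> numerical_poly Q \<Longrightarrow> numerical_poly (\<lambda>n. P n + Q n)"
proof -
  assume "numerical_poly P" "numerical_poly Q"
  then obtain e e' where e: "finite {k. e k \<noteq> 0}" "P = binom_sum e"
    and e': "finite {k. e' k \<noteq> 0}" "Q = binom_sum e'"
    unfolding numerical_poly_def by blast
  have "finite {k. e k + e' k \<noteq> 0}" by (rule finite_subset[OF _ finite_UnI[OF e(1) e'(1)]]) auto
  moreover have "binom_sum (\<lambda>k. e k + e' k) = (\<lambda>n. P n + Q n)"
    using binom_sum_add[OF e(1) e'(1)] by (simp add: e e' fun_eq_iff)
  ultimately show ?thesis using numerical_polyI[of "\<lambda>k. e k + e' k"] by simp
qed

lemma numerical_poly_unit_difference: "numerical_poly P \<Longrightarrow> numerical_poly (unit_difference i P)"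
  unfolding numerical_poly_def by (metis unit_difference_binom_sum finite_shift_support)

lemma numerical_poly_polynomial_fun: "numerical_poly P \<Longrightarrow> polynomial_fun P"
  unfolding numerical_poly_def using polynomial_fun_binom_sum by blast

lemma sep_poly_eq:
  assumes "sep_poly P" "sep_poly Q" "for_all_large (\<lambda>n. P (int_vec n) = Q (int_vec n))"
  shows "P = Q"
proof
  fix n
  have "for_all_large (\<lambda>n. P (int_vec n) - Q (int_vec n) = 0)" using assms(3) by simp
  from sep_poly_zero[OF sep_poly_diff[OF assms(1,2)] this] show "P n = Q n" by (simp add: eq_diff_eq)
qed

lemma numerical_poly_int_vec: "numerical_poly P \<Longrightarrow> \<exists>c. P (int_vec n) = of_int c"
proof -
  assume "numerical_poly P"
  then obtain e where P: "P = binom_sum e" unfolding numerical_poly_def by blast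
  have "binom_basis k (int_vec n) = of_int (\<Prod>i\<in>UNIV. int ((n $ i + k $ i) choose (k $ i)))" for k
    unfolding binom_basis_def by (simp add: binomial_gbinomial)
  then have "P (int_vec n) = of_int (\<Sum>k | e k \<noteq> 0. e k * (\<Prod>i\<in>UNIV. int ((n $ i + k $ i) choose (k $ i))))"
    by (simp only: P binom_sum_def of_int_sum of_int_mult)
  then show ?thesis by blast
qed

lemma numerical_poly_constI:
  assumes "numerical_poly P" "\<And>i. unit_difference i P = (\<lambda>_. 0)"
  shows "\<exists>c. \<forall>n. P n = c"
proof -
  from assms(1) obtain e where e: "finite {k. e k \<noteq> 0}" and P: "P = binom_sum e"
    unfolding numerical_poly_def by blast
  have "e h = 0" if h: "h \<noteq> 0" for h
  proof -
    from h obtain i where i: "1 \<le> h $ i" by (auto simp: vec_eq_iff Suc_le_eq One_nat_def)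
    have "binom_sum (\<lambda>k. e (k + axis i 1)) = binom_sum (\<lambda>_. 0)"
      using assms(2)[of i] unfolding P unit_difference_binom_sum[OF e] by (simp add: binom_sum_def[abs_def])
    then have "(\<lambda>k. e (k + axis i 1)) = (\<lambda>_. 0)"
      by (rule binom_sum_inject[OF finite_shift_support[OF e], rotated]) simp
    from fun_cong[OF this, of "h - axis i 1"] show "e h = 0" by (simp add: vec_minus_axis_add[OF i])
  qed
  then show ?thesis using binom_sum_const_iff[OF e] P by blast
qed

lemma multi_difference_shift:
  "multi_difference k (\<lambda>n. f n - g (n - v)) = (\<lambda>n. multi_difference k f n - multi_difference k g (n - v))"
proof (induction k arbitrary: f g rule: multidegree_induct)
  case (step k i)
  have "unit_difference i (\<lambda>n. f n - g (n - v)) = (\<lambda>n. unit_difference i f n - unit_difference i g (n - v))"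
    by (simp add: unit_difference_def fun_eq_iff diff_diff_eq add.commute)
  then show ?case by (simp add: multi_difference_add_axis step.IH)
qed (simp add: multi_difference_zero)

text \<open>
  Any two points of a translated orthant are joined by unit steps inside it.
\<close>

lemma eventually_const:
  fixes u :: "nat ^ 'd::finite \<Rightarrow> 'c"
  assumes "for_all_large (\<lambda>n. \<forall>i. u n = u (n - axis i 1))"
  shows "\<exists>c. for_all_large (\<lambda>n. u n = c)"
proof -
  from assms obtain N where N: "\<And>n i. (\<forall>i. N \<le> n $ i) \<Longrightarrow> u n = u (n - axis i 1)"
    unfolding for_all_large_def by blast
  have "u ((\<chi> i. N) + k) = u (\<chi> i. N)" for k
  proof (induction k rule: multidegree_induct)
    case (step k i)
    have "u ((\<chi> i. N) + (k + axis i 1)) = u ((\<chi> i. N) + (k + axis i 1) - axis i 1)"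
      by (rule N) simp
    also have "(\<chi> i. N) + (k + axis i 1) - axis i 1 = (\<chi> i. N) + k"
      by (simp add: vec_eq_iff)
    finally show ?case using step.IH by simp
  qed simp
  moreover have "n = (\<chi> i. N) + (n - (\<chi> i. N))" if "\<forall>i. N \<le> n $ i" for n
    using that by (simp add: vec_eq_iff)
  ultimately have "u n = u (\<chi> i. N)" if "\<forall>i. N \<le> n $ i" for n using that by metis
  then show ?thesis unfolding for_all_large_def by blast
qed

text \<open>
  If all first differences of a function on the lattice are numerical polynomials in large degrees, so is
  the function.  The coefficient of an antiderivative at \<open>k\<close> with \<open>k\<^sub>i > 0\<close> has to be the coefficient of
  the \<open>i\<close>-th difference at \<open>k - e\<^sub>i\<close>; the prescriptions for different \<open>i\<close> agree because differences commute.
  What remains has vanishing differences in large degrees and is constant there.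
\<close>

theorem numerical_poly_integrate:
  fixes u :: "nat ^ 'd::finite \<Rightarrow> int"
  assumes "\<And>i. \<exists>P. numerical_poly P \<and> for_all_large (\<lambda>n. of_int (u n - u (n - axis i 1)) = P (int_vec n))"
  shows "\<exists>P. numerical_poly P \<and> for_all_large (\<lambda>n. of_int (u n) = P (int_vec n))"
proof -
  from assms obtain G where G: "\<And>i. numerical_poly (G i)"
      and uG: "\<And>i. for_all_large (\<lambda>n. of_int (u n - u (n - axis i 1)) = G i (int_vec n))"
    by metis
  then obtain e where fin: "\<And>i. finite {k. e i k \<noteq> 0}" and Ge: "\<And>i. G i = binom_sum (e i)"
    unfolding numerical_poly_def by metis
  have compat: "e i (k + axis j 1) = e j (k + axis i 1)" for i j k
  proof -
    have "for_all_large (\<lambda>n. unit_difference j (G i) (int_vec n) = unit_difference i (G j) (int_vec n))"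
    proof (rule for_all_large_mono)
      show "for_all_large (\<lambda>n. (axis i 1 \<le> n \<and> axis j 1 \<le> n) \<and>
         (of_int (u n - u (n - axis i 1)) = G i (int_vec n) \<and>
          of_int (u n - u (n - axis j 1)) = G j (int_vec n)) \<and>
         (of_int (u (n - axis j 1) - u (n - axis j 1 - axis i 1)) = G i (int_vec (n - axis j 1)) \<and>
          of_int (u (n - axis i 1) - u (n - axis i 1 - axis j 1)) = G j (int_vec (n - axis i 1))))"
        by (intro for_all_large_conj for_all_large_ge uG for_all_large_minus[OF uG])
    next
      fix n :: "nat ^ 'd"
      assume *: "(axis i 1 \<le> n \<and> axis j 1 \<le> n) \<and>
         (of_int (u n - u (n - axis i 1)) = G i (int_vec n) \<and>
          of_int (u n - u (n - axis j 1)) = G j (int_vec n)) \<and>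
         (of_int (u (n - axis j 1) - u (n - axis j 1 - axis i 1)) = G i (int_vec (n - axis j 1)) \<and>
          of_int (u (n - axis i 1) - u (n - axis i 1 - axis j 1)) = G j (int_vec (n - axis i 1)))"
      have "n - axis j 1 - axis i 1 = n - axis i 1 - axis j 1" by (simp add: vec_eq_iff add.commute)
      with * show "unit_difference j (G i) (int_vec n) = unit_difference i (G j) (int_vec n)"
        by (auto simp: unit_difference_def int_vec_minus simp flip: of_int_diff) 
    qed
    then have "unit_difference j (G i) = unit_difference i (G j)"
      by (intro sep_poly_eq sep_poly_polynomial_fun numerical_poly_polynomial_fun numerical_poly_unit_difference G)
    then have "binom_sum (\<lambda>k. e i (k + axis j 1)) = binom_sum (\<lambda>k. e j (k + axis i 1))"
      by (simp add: Ge unit_difference_binom_sum fin)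
    then have "(\<lambda>k. e i (k + axis j 1)) = (\<lambda>k. e j (k + axis i 1))"
      by (rule binom_sum_inject[OF finite_shift_support[OF fin] finite_shift_support[OF fin]])
    then show ?thesis by (rule fun_cong)
  qed
  \<comment> \<open>A direction in which k can be lowered; by compat all such directions give the same value.\<close>
  define dir :: "nat ^ 'd \<Rightarrow> 'd" where "dir k = (SOME i. k $ i \<noteq> 0)" for k
  define E where "E k = (if k = 0 then 0 else e (dir k) (k - axis (dir k) 1))" for k
  have E: "E (k + axis i 1) = e i k" for k i
  proof -
    let ?h = "k + axis i 1" and ?j = "dir (k + axis i 1)"
    have i: "?h $ i \<noteq> 0" by (simp add: axis_def)
    then have nz: "?h $ ?j \<noteq> 0" unfolding dir_def by (rule someI)
    have "?h \<noteq> 0" using i by (metis zero_index)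
    then have Eh: "E ?h = e ?j (?h - axis ?j 1)" by (simp add: E_def)
    show ?thesis
    proof (cases "?j = i")
      case True
      have "k + axis i 1 - axis i 1 = k" by (simp add: vec_eq_iff)
      then show ?thesis using Eh True by simp
    next
      case False
      then have "1 \<le> k $ ?j" using nz by (auto simp: axis_def split: if_splits)
      then have k: "k - axis ?j 1 + axis ?j 1 = k" by (rule vec_minus_axis_add)
      have "?h - axis ?j 1 = (k - axis ?j 1) + axis i 1"
        using False \<open>1 \<le> k $ ?j\<close> by (auto simp: vec_eq_iff axis_def)
      then show ?thesis using compat[of ?j "k - axis ?j 1" i] Eh k by simp
    qed
  qed
  have finE: "finite {k. E k \<noteq> 0}"
  proof (rule finite_subset)
    show "{k. E k \<noteq> 0} \<subseteq> (\<Union>i. (\<lambda>k. k + axis i 1) ` {k. e i k \<noteq> 0})"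
    proof
      fix k assume "k \<in> {k. E k \<noteq> 0}"
      then have k: "E k \<noteq> 0" "k \<noteq> 0" by (auto simp: E_def)
      then obtain i where "1 \<le> k $ i" by (auto simp: vec_eq_iff Suc_le_eq One_nat_def)
      then have "k - axis i 1 + axis i 1 = k" by (rule vec_minus_axis_add)
      then show "k \<in> (\<Union>i. (\<lambda>k. k + axis i 1) ` {k. e i k \<noteq> 0})"
        using k E[of "k - axis i 1" i] by (intro UN_I[of i] image_eqI[of _ _ "k - axis i 1"]) auto
    qed
    show "finite (\<Union>i. (\<lambda>k. k + axis i 1) ` {k. e i k \<noteq> 0})" using fin by auto
  qed
  have diffE: "unit_difference i (binom_sum E) = G i" for i
    by (simp add: unit_difference_binom_sum finE E Ge)
  define v where "v n = of_int (u n) - binom_sum E (int_vec n)" for n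
  have "for_all_large (\<lambda>n. v n = v (n - axis i 1))" for i
  proof (rule for_all_large_mono[OF for_all_large_conj[OF uG[of i] for_all_large_ge[of "axis i 1"]]])
    fix n :: "nat ^ 'd"
    assume *: "rat_of_int (u n - u (n - axis i 1)) = G i (int_vec n) \<and> axis i 1 \<le> n"
    have "G i (int_vec n) = binom_sum E (int_vec n) - binom_sum E (int_vec (n - axis i 1))"
      using * by (simp add: diffE[symmetric] unit_difference_def int_vec_minus)
    then show "v n = v (n - axis i 1)" using * by (simp add: v_def)
  qed
  then have "\<forall>i. \<exists>N. \<forall>n. (\<forall>i. N \<le> n $ i) \<longrightarrow> v n = v (n - axis i 1)"
    by (simp add: for_all_large_def)
  then obtain N where N: "\<And>i n. (\<forall>j. N i \<le> n $ j) \<Longrightarrow> v n = v (n - axis i 1)" by metis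
  have "for_all_large (\<lambda>n. \<forall>i. v n = v (n - axis i 1))"
    unfolding for_all_large_def
  proof (intro exI[of _ "\<Sum>i\<in>UNIV. N i"] allI impI N)
    fix n :: "nat ^ 'd" and i j assume *: "\<forall>i. sum N UNIV \<le> n $ i"
    have "N i \<le> sum N UNIV" by (rule member_le_sum) auto
    then show "N i \<le> n $ j" using * order_trans by blast
  qed
  then obtain c where c: "for_all_large (\<lambda>n. v n = c)" using eventually_const by blast
  then obtain n0 where "v n0 = c" using for_all_large_exists by blast
  \<comment> \<open>The constant is an integer, being a difference of integers at n0.\<close>
  moreover obtain b where "binom_sum E (int_vec n0) = of_int b"
    using numerical_poly_int_vec[OF numerical_polyI[OF finE]] by blast
  ultimately have c': "c = of_int (u n0 - b)" by (simp add: v_def)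
  have "numerical_poly (\<lambda>n. binom_sum E n + of_int (u n0 - b))"
    by (intro numerical_poly_add numerical_polyI finE numerical_poly_const)
  moreover have "for_all_large (\<lambda>n. of_int (u n) = binom_sum E (int_vec n) + of_int (u n0 - b))"
    by (rule for_all_large_mono[OF c]) (simp add: v_def c' algebra_simps)
  ultimately show ?thesis by blast
qed

section \<open>Submodules over a subring of scalars\<close>

text \<open>
  Lengths are taken over the image \<open>Z\<close> of \<open>A\<close> in \<open>S\<close>, while multiplication by any ring element, which
  commutes with \<open>Z\<close>, may be used to compare them.
\<close>

locale operator_module = module R M for R and M (structure) +
  fixes Z
  assumes subring_Z: "subring Z R"
begin

lemma Z_carrier: "z \<in> Z \<Longrightarrow> z \<in> carrier R"
  using subringE(1)[OF subring_Z] by blast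

lemma Z_minus_one: "\<ominus>\<^bsub>R\<^esub> \<one>\<^bsub>R\<^esub> \<in> Z"
  by (intro subringE(5)[OF subring_Z] subringE(3)[OF subring_Z])

definition Zsub :: "'c set \<Rightarrow> bool"
  where "Zsub D \<longleftrightarrow> D \<subseteq> carrier M \<and> \<zero> \<in> D \<and> (\<forall>x\<in>D. \<forall>y\<in>D. x \<oplus> y \<in> D) \<and> (\<forall>z\<in>Z. \<forall>x\<in>D. z \<odot> x \<in> D)"

definition ssum :: "'c set \<Rightarrow> 'c set \<Rightarrow> 'c set"
  where "ssum D E = {x \<oplus> y | x y. x \<in> D \<and> y \<in> E}"

definition smul :: "'a \<Rightarrow> 'c set \<Rightarrow> 'c set"
  where "smul a D = (\<lambda>x. a \<odot> x) ` D"

text \<open>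
  The kernel of multiplication by \<open>a\<close> from \<open>L\<close> to the ambient module modulo \<open>N\<close>.
\<close>

definition preim :: "'a \<Rightarrow> 'c set \<Rightarrow> 'c set \<Rightarrow> 'c set"
  where "preim a N L = {x \<in> L. a \<odot> x \<in> N}"

lemma ZsubD:
  assumes "Zsub D"
  shows "x \<in> D \<Longrightarrow> x \<in> carrier M" "\<zero> \<in> D" "x \<in> D \<Longrightarrow> y \<in> D \<Longrightarrow> x \<oplus> y \<in> D"
    "z \<in> Z \<Longrightarrow> x \<in> D \<Longrightarrow> z \<odot> x \<in> D"
  using assms unfolding Zsub_def by auto

lemma Zsub_neg: "Zsub D \<Longrightarrow> x \<in> D \<Longrightarrow> \<ominus> x \<in> D"
  using ZsubD(4)[of D "\<ominus>\<^bsub>R\<^esub> \<one>\<^bsub>R\<^esub>" x] Z_minus_one ZsubD(1)[of D x]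
  by (simp add: smult_l_minus)

lemma Zsub_minus: "Zsub D \<Longrightarrow> x \<in> D \<Longrightarrow> y \<in> D \<Longrightarrow> x \<ominus> y \<in> D"
  unfolding a_minus_def by (intro ZsubD(3) Zsub_neg)

lemma Zsub_cancel_left: "Zsub D \<Longrightarrow> x \<in> D \<Longrightarrow> y \<in> carrier M \<Longrightarrow> x \<oplus> y \<in> D \<Longrightarrow> y \<in> D"
proof -
  assume *: "Zsub D" "x \<in> D" "y \<in> carrier M" "x \<oplus> y \<in> D"
  then have x: "x \<in> carrier M" by (simp add: ZsubD(1))
  have "\<ominus> x \<oplus> (x \<oplus> y) \<in> D" by (intro ZsubD(3) Zsub_neg *)
  then show "y \<in> D" by (simp add: M.r_neg1 x *)
qed

lemma Zsub_zero: "Zsub {\<zero>}"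
  unfolding Zsub_def using Z_carrier by (auto simp: smult_r_null)

lemma Zsub_carrier: "Zsub (carrier M)"
  unfolding Zsub_def using Z_carrier by auto

lemma Zsub_inter: "Zsub D \<Longrightarrow> Zsub E \<Longrightarrow> Zsub (D \<inter> E)"
  unfolding Zsub_def by auto

lemma Zsub_ssum:
  assumes D: "Zsub D" and E: "Zsub E"
  shows "Zsub (ssum D E)"
  unfolding Zsub_def
proof (intro conjI ballI)
  show "ssum D E \<subseteq> carrier M" unfolding ssum_def using ZsubD(1)[OF D] ZsubD(1)[OF E] by auto
  show "\<zero> \<in> ssum D E" unfolding ssum_def using ZsubD(2)[OF D] ZsubD(2)[OF E] M.r_zero[OF M.zero_closed, symmetric] by blast
next
  fix x y assume "x \<in> ssum D E" "y \<in> ssum D E"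
  then obtain a b c d where *: "x = a \<oplus> b" "y = c \<oplus> d" "a \<in> D" "b \<in> E" "c \<in> D" "d \<in> E"
    unfolding ssum_def by blast
  then have "x \<oplus> y = (a \<oplus> c) \<oplus> (b \<oplus> d)"
    using ZsubD(1)[OF D] ZsubD(1)[OF E] by (simp add: M.a_ac)
  then show "x \<oplus> y \<in> ssum D E" unfolding ssum_def using * ZsubD(3)[OF D] ZsubD(3)[OF E] by blast
next
  fix z x assume z: "z \<in> Z" and "x \<in> ssum D E"
  then obtain a b where *: "x = a \<oplus> b" "a \<in> D" "b \<in> E" unfolding ssum_def by blast
  then have "z \<odot> x = z \<odot> a \<oplus> z \<odot> b"
    using ZsubD(1)[OF D] ZsubD(1)[OF E] Z_carrier[OF z] by (simp add: smult_r_distr)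
  then show "z \<odot> x \<in> ssum D E" unfolding ssum_def using * z ZsubD(4)[OF D] ZsubD(4)[OF E] by blast
qed

lemma ssum_upper1: "Zsub D \<Longrightarrow> Zsub E \<Longrightarrow> D \<subseteq> ssum D E"
  unfolding ssum_def
proof (intro subsetI CollectI exI conjI)
  assume "Zsub D" "Zsub E"
  fix x assume "x \<in> D"
  then show "x = x \<oplus> \<zero>" "x \<in> D" "\<zero> \<in> E"
    using ZsubD(1)[OF \<open>Zsub D\<close>] ZsubD(2)[OF \<open>Zsub E\<close>] by auto
qed

lemma ssum_upper2: "Zsub D \<Longrightarrow> Zsub E \<Longrightarrow> E \<subseteq> ssum D E"
  unfolding ssum_def
proof (intro subsetI CollectI exI conjI)
  assume "Zsub D" "Zsub E"
  fix x assume "x \<in> E"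
  then show "x = \<zero> \<oplus> x" "x \<in> E" "\<zero> \<in> D"
    using ZsubD(1)[OF \<open>Zsub E\<close>] ZsubD(2)[OF \<open>Zsub D\<close>] by auto
qed

lemma ssum_least: "Zsub L \<Longrightarrow> D \<subseteq> L \<Longrightarrow> E \<subseteq> L \<Longrightarrow> ssum D E \<subseteq> L"
  unfolding ssum_def using ZsubD(3)[of L] by auto

lemma ssum_mono: "D \<subseteq> D' \<Longrightarrow> E \<subseteq> E' \<Longrightarrow> ssum D E \<subseteq> ssum D' E'"
  unfolding ssum_def by blast

lemma Zsub_smul: "a \<in> carrier R \<Longrightarrow> Zsub D \<Longrightarrow> Zsub (smul a D)"
  unfolding Zsub_def
proof (intro conjI ballI)
  assume a: "a \<in> carrier R" and "D \<subseteq> carrier M \<and> \<zero> \<in> D \<and> (\<forall>x\<in>D. \<forall>y\<in>D. x \<oplus> y \<in> D) \<and> (\<forall>z\<in>Z. \<forall>x\<in>D. z \<odot> x \<in> D)"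
  then have D: "Zsub D" by (simp add: Zsub_def)
  show "smul a D \<subseteq> carrier M" unfolding smul_def using ZsubD(1)[OF D] a by auto
  show "\<zero> \<in> smul a D" unfolding smul_def by (rule image_eqI[of _ _ \<zero>]) (auto simp: ZsubD(2)[OF D] smult_r_null a)
  fix x y assume "x \<in> smul a D" "y \<in> smul a D"
  then obtain b c where *: "x = a \<odot> b" "y = a \<odot> c" "b \<in> D" "c \<in> D" unfolding smul_def by blast
  show "x \<oplus> y \<in> smul a D" unfolding smul_def
    by (rule image_eqI[of _ _ "b \<oplus> c"]) (use * a ZsubD(1,3)[OF D] in \<open>auto simp: smult_r_distr\<close>)
next
  assume a: "a \<in> carrier R" and "D \<subseteq> carrier M \<and> \<zero> \<in> D \<and> (\<forall>x\<in>D. \<forall>y\<in>D. x \<oplus> y \<in> D) \<and> (\<forall>z\<in>Z. \<forall>x\<in>D. z \<odot> x \<in> D)"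
  then have D: "Zsub D" by (simp add: Zsub_def)
  fix z x assume z: "z \<in> Z" and "x \<in> smul a D"
  then obtain b where *: "x = a \<odot> b" "b \<in> D" unfolding smul_def by blast
  have "z \<odot> x = a \<odot> (z \<odot> b)"
    using * a Z_carrier[OF z] ZsubD(1)[OF D] by (simp add: smult_assoc1[symmetric] R.m_comm)
  then show "z \<odot> x \<in> smul a D" unfolding smul_def using * z ZsubD(4)[OF D] by blast
qed

lemma Zsub_preim: "a \<in> carrier R \<Longrightarrow> Zsub N \<Longrightarrow> Zsub L \<Longrightarrow> Zsub (preim a N L)"
  unfolding Zsub_def[of "preim a N L"]
proof (intro conjI ballI)
  assume a: "a \<in> carrier R" and N: "Zsub N" and L: "Zsub L"
  show "preim a N L \<subseteq> carrier M" "\<zero> \<in> preim a N L"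
    unfolding preim_def using ZsubD[OF L] ZsubD(2)[OF N] a by (auto simp: smult_r_null)
  show "x \<oplus> y \<in> preim a N L" if "x \<in> preim a N L" "y \<in> preim a N L" for x y
    using that a ZsubD(1,3)[OF L] ZsubD(3)[OF N] by (auto simp: preim_def smult_r_distr)
  show "z \<odot> x \<in> preim a N L" if z: "z \<in> Z" and x: "x \<in> preim a N L" for z x
  proof -
    have x': "x \<in> L" "a \<odot> x \<in> N" using x by (auto simp: preim_def)
    have "a \<odot> (z \<odot> x) = z \<odot> (a \<odot> x)"
      using a Z_carrier[OF z] ZsubD(1)[OF L x'(1)] by (simp add: smult_assoc1[symmetric] R.m_comm)
    then show ?thesis using x' z ZsubD(4)[OF L] ZsubD(4)[OF N] by (auto simp: preim_def)
  qed
qed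

section \<open>Length\<close>

definition chain_between :: "'c set \<Rightarrow> 'c set \<Rightarrow> nat \<Rightarrow> bool"
  where "chain_between N L l \<longleftrightarrow> (\<exists>C :: nat \<Rightarrow> 'c set.
     (\<forall>i\<le>l. Zsub (C i) \<and> N \<subseteq> C i \<and> C i \<subseteq> L) \<and> (\<forall>i<l. C i \<subset> C (Suc i)))"

text \<open>
  The length of the subquotient \<open>L/N\<close>, through chains of submodules between \<open>N\<close> and \<open>L\<close>.
\<close>

definition len :: "'c set \<Rightarrow> 'c set \<Rightarrow> enat"
  where "len N L = Sup {enat l | l. chain_between N L l}"

lemma len_le: "(\<And>l. chain_between N L l \<Longrightarrow> enat l \<le> b) \<Longrightarrow> len N L \<le> b"
  unfolding len_def by (rule Sup_least) blast

lemma len_ge: "chain_between N L l \<Longrightarrow> enat l \<le> len N L"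
  unfolding len_def by (rule Sup_upper) blast

lemma chain_between_0: "Zsub N \<Longrightarrow> N \<subseteq> L \<Longrightarrow> chain_between N L 0"
  unfolding chain_between_def by (rule exI[of _ "\<lambda>_. N"]) auto

lemma len_attained:
  assumes "Zsub N" "N \<subseteq> L" "len N L \<noteq> \<infinity>"
  obtains l where "chain_between N L l" "len N L = enat l"
proof -
  from assms(3) obtain b where b: "len N L = enat b" by auto
  let ?m = "GREATEST l. chain_between N L l"
  have bd: "l \<le> b" if "chain_between N L l" for l using len_ge[OF that] b by simp
  have m: "chain_between N L ?m"
    by (rule GreatestI_nat[of "chain_between N L", OF chain_between_0[OF assms(1,2)]]) (use bd in auto)
  have "len N L \<le> enat ?m"
    by (rule len_le) (use Greatest_le_nat[of "chain_between N L" _ b] bd in auto)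
  then have "len N L = enat ?m" using len_ge[OF m] by (rule antisym)
  with m that show ?thesis by blast
qed

text \<open>
  A strictly monotone map between intervals of submodules transports chains.
\<close>

lemma len_embed:
  assumes "\<And>C. Zsub C \<Longrightarrow> N \<subseteq> C \<Longrightarrow> C \<subseteq> L \<Longrightarrow> Zsub (\<phi> C) \<and> N' \<subseteq> \<phi> C \<and> \<phi> C \<subseteq> L'"
    and "\<And>C D. Zsub C \<Longrightarrow> Zsub D \<Longrightarrow> N \<subseteq> C \<Longrightarrow> C \<subset> D \<Longrightarrow> D \<subseteq> L \<Longrightarrow> \<phi> C \<subset> \<phi> D"
  shows "len N L \<le> len N' L'"
proof (rule len_le)
  fix l assume "chain_between N L l"
  then obtain C where C: "\<And>i. i \<le> l \<Longrightarrow> Zsub (C i) \<and> N \<subseteq> C i \<and> C i \<subseteq> L" "\<And>i. i < l \<Longrightarrow> C i \<subset> C (Suc i)"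
    unfolding chain_between_def by blast
  have "chain_between N' L' l"
    unfolding chain_between_def
  proof (intro exI[of _ "\<lambda>i. \<phi> (C i)"] conjI allI impI)
    fix i assume "i < l"
    then show "\<phi> (C i) \<subset> \<phi> (C (Suc i))" using C(1)[of i] C(1)[of "Suc i"] C(2)[of i] by (intro assms(2)) auto
  qed (use C(1) assms(1) in blast)+
  then show "enat l \<le> len N' L'" by (rule len_ge)
qed

lemma len_mono: "N \<subseteq> N' \<Longrightarrow> L' \<subseteq> L \<Longrightarrow> len N' L' \<le> len N L"
  by (rule len_embed[of _ _ "\<lambda>C. C"]) auto

lemma chain_between_append:
  assumes "chain_between N L l" "chain_between L K l'"
  shows "N \<subseteq> L \<Longrightarrow> L \<subseteq> K \<Longrightarrow> chain_between N K (l + l')"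
proof -
  assume NL: "N \<subseteq> L" "L \<subseteq> K"
  from assms obtain C D where
    C: "\<And>i. i \<le> l \<Longrightarrow> Zsub (C i) \<and> N \<subseteq> C i \<and> C i \<subseteq> L" "\<And>i. i < l \<Longrightarrow> C i \<subset> C (Suc i)" and
    D: "\<And>i. i \<le> l' \<Longrightarrow> Zsub (D i) \<and> L \<subseteq> D i \<and> D i \<subseteq> K" "\<And>i. i < l' \<Longrightarrow> D i \<subset> D (Suc i)"
    unfolding chain_between_def by metis
  show ?thesis
    unfolding chain_between_def
  proof (intro exI[of _ "\<lambda>i. if i \<le> l then C i else D (i - l)"] conjI allI impI)
    fix i assume i: "i < l + l'"
    consider "Suc i \<le> l" | "i = l" | "l < i" by linarith
    then show "(if i \<le> l then C i else D (i - l)) \<subset> (if Suc i \<le> l then C (Suc i) else D (Suc i - l))"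
    proof cases
      case 2
      then have "C l \<subseteq> D 0" "D 0 \<subset> D (Suc 0)" using C(1)[of l] D(1)[of 0] D(2)[of 0] i by auto
      then show ?thesis using 2 by (auto simp: Suc_diff_le)
    next
      case 3
      then show ?thesis using D(2)[of "i - l"] i by (auto simp: Suc_diff_le)
    qed (use C(2) in auto)
  next
    fix i assume "i \<le> l + l'"
    then have "i \<le> l \<or> i - l \<le> l'" by linarith
    then show "Zsub (if i \<le> l then C i else D (i - l))" "N \<subseteq> (if i \<le> l then C i else D (i - l))"
       "(if i \<le> l then C i else D (i - l)) \<subseteq> K"
      using C(1)[of i] D(1)[of "i - l"] NL by (auto split: if_splits)
  qed
qed

lemma len_superadd:
  assumes "Zsub N" "Zsub L" "N \<subseteq> L" "L \<subseteq> K"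
  shows "len N L + len L K \<le> len N K"
proof (cases "len N K = \<infinity>")
  case False
  have "len N L \<noteq> \<infinity>" "len L K \<noteq> \<infinity>"
    using len_mono[of N N L K] len_mono[of N L K K] assms False by (metis enat_ord_simps(5) order_refl)+
  then obtain l l' where "chain_between N L l" "len N L = enat l" "chain_between L K l'" "len L K = enat l'"
    using len_attained assms by metis
  then show ?thesis using len_ge[OF chain_between_append[of N L l K l']] assms by simp
qed simp

lemma len_strict: "Zsub N \<Longrightarrow> Zsub D \<Longrightarrow> Zsub E \<Longrightarrow> N \<subseteq> D \<Longrightarrow> D \<subset> E \<Longrightarrow> len N D + 1 \<le> len N E"
proof -
  assume *: "Zsub N" "Zsub D" "Zsub E" "N \<subseteq> D" "D \<subset> E"
  have "chain_between D E 1"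
    unfolding chain_between_def by (rule exI[of _ "\<lambda>i. if i = 0 then D else E"]) (use * in auto)
  from len_ge[OF this] have "len N D + 1 \<le> len N D + len D E" by (simp add: one_enat_def)
  also have "\<dots> \<le> len N E" using * by (intro len_superadd) auto
  finally show ?thesis .
qed

text \<open>
  The modular law: a submodule between \<open>D\<close> and \<open>E\<close> cannot be invisible both in the intersection with \<open>L\<close>
  and in the sum with \<open>L\<close>.
\<close>

lemma modular_strict:
  assumes "Zsub D" "Zsub E" "Zsub L" "D \<subset> E" "D \<inter> L = E \<inter> L"
  shows "ssum D L \<subset> ssum E L"
proof -
  have "ssum D L \<noteq> ssum E L"
  proof
    assume eq: "ssum D L = ssum E L"
    have "E \<subseteq> D"
    proof
      fix e assume e: "e \<in> E"
      then have "e \<in> ssum D L" using eq ssum_upper1[OF assms(2,3)] by auto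
      then obtain d l where dl: "e = d \<oplus> l" "d \<in> D" "l \<in> L" unfolding ssum_def by blast
      then have "l \<in> E" using Zsub_cancel_left[OF assms(2), of d l] e assms(4) ZsubD(1)[OF assms(3)] by auto
      then have "l \<in> D" using dl assms(5) by blast
      then show "e \<in> D" using dl ZsubD(3)[OF assms(1)] by simp
    qed
    then show False using assms(4) by auto
  qed
  then show ?thesis using ssum_mono[of D E L L] assms(4) by (simp add: psubset_eq)
qed

text \<open>
  Along a chain from \<open>N\<close> to \<open>K\<close>, each strict step raises the intersection with \<open>L\<close> or the sum with \<open>L\<close>.
\<close>

lemma len_subadd:
  assumes N: "Zsub N" and L: "Zsub L" and "N \<subseteq> L" "L \<subseteq> K" and K: "Zsub K"
  shows "len N K \<le> len N L + len L K"
proof (rule len_le)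
  fix l assume "chain_between N K l"
  then obtain C where C0: "\<forall>i\<le>l. Zsub (C i) \<and> N \<subseteq> C i \<and> C i \<subseteq> K" "\<forall>i<l. C i \<subset> C (Suc i)"
    unfolding chain_between_def by blast
  then have C: "\<And>i. i \<le> l \<Longrightarrow> Zsub (C i)" "\<And>i. i \<le> l \<Longrightarrow> N \<subseteq> C i" "\<And>i. i \<le> l \<Longrightarrow> C i \<subseteq> K"
     "\<And>i. i < l \<Longrightarrow> C i \<subset> C (Suc i)"
    by simp_all
  have "enat i \<le> len N (C i \<inter> L) + len L (ssum (C i) L)" if "i \<le> l" for i
    using that
  proof (induction i)
    case (Suc i)
    note Z = C(1)[of i] C(1)[of "Suc i"]
    have sub: "C i \<subset> C (Suc i)" using C(4) Suc.prems by simp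
    have m1: "len N (C i \<inter> L) \<le> len N (C (Suc i) \<inter> L)" using sub by (intro len_mono) auto
    have m2: "len L (ssum (C i) L) \<le> len L (ssum (C (Suc i)) L)" using sub by (intro len_mono ssum_mono) auto
    have "enat (Suc i) \<le> len N (C i \<inter> L) + len L (ssum (C i) L) + 1"
    proof -
      have "enat (Suc i) = enat i + 1" by (simp add: one_enat_def)
      moreover have "enat i \<le> len N (C i \<inter> L) + len L (ssum (C i) L)" using Suc by simp
      ultimately show ?thesis by (simp add: add_right_mono)
    qed
    also have "\<dots> \<le> len N (C (Suc i) \<inter> L) + len L (ssum (C (Suc i)) L)"
    proof (cases "C i \<inter> L = C (Suc i) \<inter> L")
      case True
      have "len L (ssum (C i) L) + 1 \<le> len L (ssum (C (Suc i)) L)"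
        by (intro len_strict L Zsub_ssum ssum_upper2 modular_strict sub True Z) (use Suc.prems in simp_all)
      from add_mono[OF m1 this] show ?thesis by (simp add: add.assoc)
    next
      case False
      then have "C i \<inter> L \<subset> C (Suc i) \<inter> L" using sub by blast
      moreover have "N \<subseteq> C i \<inter> L" using C(2)[of i] Suc.prems \<open>N \<subseteq> L\<close> by simp
      ultimately have "len N (C i \<inter> L) + 1 \<le> len N (C (Suc i) \<inter> L)"
        by (intro len_strict N Zsub_inter L Z) (use Suc.prems in simp_all)
      from add_mono[OF this m2] show ?thesis by (simp add: ac_simps)
    qed
    finally show ?case .
  qed (simp add: zero_enat_def[symmetric])
  then have "enat l \<le> len N (C l \<inter> L) + len L (ssum (C l) L)" by blast
  also have "\<dots> \<le> len N L + len L (ssum (C l) L)" by (intro add_mono len_mono) auto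
  also have "len L (ssum (C l) L) \<le> len L K"
    using C(3)[of l] \<open>L \<subseteq> K\<close> by (intro len_mono ssum_least[OF K]) auto
  finally show "enat l \<le> len N L + len L K" by (simp add: add_left_mono)
qed

lemma len_add:
  assumes "Zsub N" "Zsub L" "Zsub K" "N \<subseteq> L" "L \<subseteq> K"
  shows "len N K = len N L + len L K"
  using len_subadd[OF assms(1,2,4,5,3)] len_superadd[OF assms(1,2,4,5)] by (rule antisym)

lemma len_same: "len N N = 0"
proof -
  have "l = 0" if "chain_between N N l" for l
    using that unfolding chain_between_def by (metis bot_nat_0.not_eq_extremum le_eq_less_or_eq less_eq_Suc_le
        psubset_eq subset_antisym zero_less_Suc)
  then have "len N N \<le> 0" by (intro len_le) (auto simp: zero_enat_def)
  then show ?thesis by simp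
qed

lemma len_eq_0: "Zsub N \<Longrightarrow> Zsub L \<Longrightarrow> N \<subseteq> L \<Longrightarrow> len N L = 0 \<longleftrightarrow> N = L"
proof
  assume *: "Zsub N" "Zsub L" "N \<subseteq> L" "len N L = 0"
  show "N = L"
  proof (rule ccontr)
    assume "N \<noteq> L"
    then have "len N N + 1 \<le> len N L" using * by (intro len_strict) auto
    then show False using * by (simp add: len_same)
  qed
qed (simp add: len_same)

text \<open>
  Multiplication by \<open>a\<close> identifies \<open>L/(N : a)\<close> with \<open>(N + aL)/N\<close>; images and preimages are inverse
  bijections between the two intervals of submodules.
\<close>

lemma len_mult:
  assumes a: "a \<in> carrier R" and N: "Zsub N" and L: "Zsub L"
  shows "len (preim a N L) L = len N (ssum N (smul a L))"
proof (rule antisym)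
  have pre: "Zsub (preim a N L)" by (rule Zsub_preim[OF a N L])
  have inj: "preim a (ssum N (smul a C)) L \<subseteq> C" if C: "Zsub C" "preim a N L \<subseteq> C" "C \<subseteq> L" for C
  proof
    fix x assume "x \<in> preim a (ssum N (smul a C)) L"
    then obtain n c where x: "x \<in> L" "a \<odot> x = n \<oplus> a \<odot> c" "n \<in> N" "c \<in> C"
      unfolding preim_def ssum_def smul_def by blast
    have car: "x \<in> carrier M" "c \<in> carrier M" "n \<in> carrier M"
      using x ZsubD(1)[OF L] ZsubD(1)[OF C(1)] ZsubD(1)[OF N] by auto
    have "a \<odot> (x \<ominus> c) = n"
      using x(2) car a by (simp add: a_minus_def smult_r_distr smult_r_minus M.a_assoc M.r_neg)
    then have "x \<ominus> c \<in> C" using x C Zsub_minus[OF L, of x c] by (auto simp: preim_def)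
    then have "x \<ominus> c \<oplus> c \<in> C" using x C(1) ZsubD(3) by blast
    then show "x \<in> C" using car by (simp add: a_minus_def M.a_assoc M.l_neg)
  qed
  show "len (preim a N L) L \<le> len N (ssum N (smul a L))"
  proof (rule len_embed[of _ _ "\<lambda>C. ssum N (smul a C)"])
    fix C assume C: "Zsub C" "preim a N L \<subseteq> C" "C \<subseteq> L"
    have "smul a C \<subseteq> smul a L" using C(3) by (auto simp: smul_def)
    then show "Zsub (ssum N (smul a C)) \<and> N \<subseteq> ssum N (smul a C) \<and> ssum N (smul a C) \<subseteq> ssum N (smul a L)"
      by (intro conjI Zsub_ssum ssum_upper1 ssum_mono N Zsub_smul a C(1) order_refl)
  next
    fix C D assume C: "Zsub C" "Zsub D" "preim a N L \<subseteq> C" "C \<subset> D" "D \<subseteq> L"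
    have D: "D \<subseteq> preim a (ssum N (smul a D)) L"
      using C(5) ssum_upper2[OF N Zsub_smul[OF a C(2)]] by (fastforce simp: preim_def smul_def)
    have "preim a (ssum N (smul a C)) L \<subseteq> C" using C by (intro inj) auto
    then have "ssum N (smul a C) \<noteq> ssum N (smul a D)" using C(4) D by (metis psubset_eq subset_trans subset_antisym)
    moreover have "ssum N (smul a C) \<subseteq> ssum N (smul a D)"
      using C(4) by (intro ssum_mono) (auto simp: smul_def)
    ultimately show "ssum N (smul a C) \<subset> ssum N (smul a D)" by (simp add: psubset_eq)
  qed
  show "len N (ssum N (smul a L)) \<le> len (preim a N L) L"
  proof (rule len_embed[of _ _ "\<lambda>D. preim a D L"])
    fix D assume D: "Zsub D" "N \<subseteq> D" "D \<subseteq> ssum N (smul a L)"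
    then show "Zsub (preim a D L) \<and> preim a N L \<subseteq> preim a D L \<and> preim a D L \<subseteq> L"
      using Zsub_preim[OF a D(1) L] by (auto simp: preim_def)
  next
    have surj: "D \<subseteq> ssum N (smul a (preim a D L))" if D: "Zsub D" "N \<subseteq> D" "D \<subseteq> ssum N (smul a L)" for D
    proof
      fix d assume d: "d \<in> D"
      then obtain n x where x: "d = n \<oplus> a \<odot> x" "n \<in> N" "x \<in> L" using D unfolding ssum_def smul_def by blast
      then have "a \<odot> x \<in> D"
        using Zsub_cancel_left[OF D(1), of n "a \<odot> x"] d D(2) a ZsubD(1)[OF L] by auto
      then show "d \<in> ssum N (smul a (preim a D L))" using x unfolding ssum_def smul_def preim_def by blast
    qed
    fix D E assume D: "Zsub D" "Zsub E" "N \<subseteq> D" "D \<subset> E" "E \<subseteq> ssum N (smul a L)"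
    have "ssum N (smul a (preim a D L)) \<subseteq> D"
      using D(3) by (intro ssum_least[OF D(1)]) (auto simp: smul_def preim_def)
    moreover have "E \<subseteq> ssum N (smul a (preim a E L))" using D by (intro surj) auto
    ultimately have "preim a D L \<noteq> preim a E L" using D(4) by (metis psubset_eq subset_trans subset_antisym)
    moreover have "preim a D L \<subseteq> preim a E L" using D(4) by (auto simp: preim_def)
    ultimately show "preim a D L \<subset> preim a E L" by (simp add: psubset_eq)
  qed
qed

end

section \<open>Artinian rings\<close>

text \<open>
  The ring as a module over itself, to apply results on modules to ideals.
\<close>

definition regular_module :: "('a, 'b) ring_scheme \<Rightarrow> ('a, 'a) module"
  where "regular_module R = \<lparr>carrier = carrier R, monoid.mult = (\<otimes>\<^bsub>R\<^esub>), one = \<one>\<^bsub>R\<^esub>, zero = \<zero>\<^bsub>R\<^esub>,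
    add = (\<oplus>\<^bsub>R\<^esub>), module.smult = (\<otimes>\<^bsub>R\<^esub>)\<rparr>"

lemma regular_module_simps [simp]:
  "carrier (regular_module R) = carrier R" "\<zero>\<^bsub>regular_module R\<^esub> = \<zero>\<^bsub>R\<^esub>"
  "x \<oplus>\<^bsub>regular_module R\<^esub> y = x \<oplus>\<^bsub>R\<^esub> y" "a \<odot>\<^bsub>regular_module R\<^esub> x = a \<otimes>\<^bsub>R\<^esub> x"
  "add (regular_module R) = add R"
  by (simp_all add: regular_module_def)

lemma (in cring) module_regular_module: "module R (regular_module R)"
proof (rule moduleI)
  show "cring R" by (rule cring_axioms)
  show "abelian_group (regular_module R)"
    by (rule abelian_groupI) (auto simp: a_ac intro: l_neg)
qed (auto simp: l_distr r_distr m_assoc)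

lemma (in artinian_ring) minimal_ideal:
  assumes "F \<noteq> {}" "\<And>I. I \<in> F \<Longrightarrow> ideal I R"
  obtains I where "I \<in> F" "\<And>J. J \<in> F \<Longrightarrow> J \<subseteq> I \<Longrightarrow> J = I"
proof (rule ccontr)
  assume "\<not> thesis"
  then have "\<forall>I\<in>F. \<exists>J\<in>F. J \<subset> I" using that by blast
  then obtain f where f: "\<And>I. I \<in> F \<Longrightarrow> f I \<in> F \<and> f I \<subset> I" by metis
  from assms(1) obtain I0 where I0: "I0 \<in> F" by blast
  define C where "C n = (f ^^ n) I0" for n
  have C: "C n \<in> F" for n by (induction n) (auto simp: C_def I0 f)
  have "C (Suc n) \<subset> C n" for n using f[OF C[of n]] by (simp add: C_def)
  moreover have "\<exists>N. \<forall>n\<ge>N. C n = C N"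
    using C assms(2) calculation by (intro descending_chain) auto
  ultimately show False by (metis le_Suc_eq order_refl psubset_eq)
qed

text \<open>
  The chain of the ideals \<open>(a\<^sup>n)\<close> stops, so \<open>a\<^sup>N = b a\<^sup>N\<^sup>+\<^sup>1\<close> for some \<open>b\<close>, and the prime ideal contains
  \<open>a\<^sup>N (1 - ab)\<close> without containing \<open>a\<^sup>N\<close>.
\<close>

lemma artinian_prime_inverse:
  assumes "artinian_ring A" "cring A" "primeideal p A" "a \<in> carrier A" "a \<notin> p"
  shows "\<exists>b\<in>carrier A. \<one>\<^bsub>A\<^esub> \<ominus>\<^bsub>A\<^esub> a \<otimes>\<^bsub>A\<^esub> b \<in> p"
proof -
  interpret A: artinian_ring A by fact
  interpret A: cring A by fact
  interpret p: primeideal p A by fact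
  define I where "I n = PIdl\<^bsub>A\<^esub> (a [^]\<^bsub>A\<^esub> (n::nat))" for n
  have pow: "a [^]\<^bsub>A\<^esub> (n::nat) \<in> carrier A" for n using assms(4) by simp
  have "ideal (I n) A" for n unfolding I_def by (rule A.cgenideal_ideal[OF pow])
  moreover have "I (Suc n) \<subseteq> I n" for n
  proof
    fix x assume "x \<in> I (Suc n)"
    then obtain r where r: "r \<in> carrier A" "x = r \<otimes>\<^bsub>A\<^esub> (a [^]\<^bsub>A\<^esub> Suc n)"
      unfolding I_def cgenideal_def by blast
    then have "x = (r \<otimes>\<^bsub>A\<^esub> a) \<otimes>\<^bsub>A\<^esub> a [^]\<^bsub>A\<^esub> n" using assms(4) by (simp add: A.m_ac)
    then show "x \<in> I n" unfolding I_def cgenideal_def using r assms(4) by blast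
  qed
  ultimately obtain N where "\<forall>n\<ge>N. I n = I N" using A.descending_chain by blast
  then have "I (Suc N) = I N" by (metis le_SucI order_refl)
  moreover have "a [^]\<^bsub>A\<^esub> N \<in> I N" unfolding I_def by (rule A.cgenideal_self[OF pow])
  ultimately have "a [^]\<^bsub>A\<^esub> N \<in> I (Suc N)" by simp
  then obtain b where b: "b \<in> carrier A" "a [^]\<^bsub>A\<^esub> N = b \<otimes>\<^bsub>A\<^esub> a [^]\<^bsub>A\<^esub> Suc N"
    unfolding I_def cgenideal_def by blast
  have "a [^]\<^bsub>A\<^esub> N \<otimes>\<^bsub>A\<^esub> (\<one>\<^bsub>A\<^esub> \<ominus>\<^bsub>A\<^esub> a \<otimes>\<^bsub>A\<^esub> b) = a [^]\<^bsub>A\<^esub> N \<ominus>\<^bsub>A\<^esub> b \<otimes>\<^bsub>A\<^esub> a [^]\<^bsub>A\<^esub> Suc N"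
    using b(1) assms(4) by (simp add: A.r_distr A.r_minus a_minus_def A.m_ac)
  also have "\<dots> = \<zero>\<^bsub>A\<^esub>" using b(2) pow[of N] by (metis A.r_right_minus_eq)
  finally have eq: "a [^]\<^bsub>A\<^esub> N \<otimes>\<^bsub>A\<^esub> (\<one>\<^bsub>A\<^esub> \<ominus>\<^bsub>A\<^esub> a \<otimes>\<^bsub>A\<^esub> b) \<in> p" by simp
  have npow: "a [^]\<^bsub>A\<^esub> (n::nat) \<notin> p" for n
  proof (induction n)
    case 0
    show ?case using p.one_imp_carrier p.I_notcarr by auto
  next
    case (Suc n)
    then show ?case using p.I_prime[of "a [^]\<^bsub>A\<^esub> n" a] assms(4,5) by auto
  qed
  show ?thesis using p.I_prime[OF pow _ eq] npow b(1) assms(4) by auto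
qed

lemma artinian_prime_maximal:
  assumes "artinian_ring A" "cring A" "primeideal p A"
  shows "maximalideal p A"
proof -
  interpret A: cring A by fact
  interpret p: primeideal p A by fact
  show ?thesis
  proof (rule maximalidealI[OF p.is_ideal])
    show "carrier A \<noteq> p" by (rule p.I_notcarr)
    fix J assume J: "ideal J A" "p \<subseteq> J" "J \<subseteq> carrier A"
    interpret J: ideal J A by fact
    show "J = p \<or> J = carrier A"
    proof (cases "J \<subseteq> p")
      case False
      then obtain a where a: "a \<in> J" "a \<notin> p" by blast
      then obtain b where b: "b \<in> carrier A" "\<one>\<^bsub>A\<^esub> \<ominus>\<^bsub>A\<^esub> a \<otimes>\<^bsub>A\<^esub> b \<in> p"
        using artinian_prime_inverse[OF assms, of a] J by blast
      have ab: "a \<otimes>\<^bsub>A\<^esub> b \<in> J" by (rule J.I_r_closed[OF a(1) b(1)])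
      have "\<one>\<^bsub>A\<^esub> \<ominus>\<^bsub>A\<^esub> a \<otimes>\<^bsub>A\<^esub> b \<oplus>\<^bsub>A\<^esub> a \<otimes>\<^bsub>A\<^esub> b \<in> J" using b(2) J(2) ab by (intro J.a_closed) auto
      moreover have "\<one>\<^bsub>A\<^esub> \<ominus>\<^bsub>A\<^esub> a \<otimes>\<^bsub>A\<^esub> b \<oplus>\<^bsub>A\<^esub> a \<otimes>\<^bsub>A\<^esub> b = \<one>\<^bsub>A\<^esub>"
        using b(1) a(1) J(3) by (auto simp: a_minus_def A.a_assoc A.l_neg)
      ultimately have "J = carrier A" using J.one_imp_carrier by simp
      then show ?thesis ..
    qed (use J in blast)
  qed
qed

lemma (in cring) Zsub_regular_iff:
  assumes "operator_module R (regular_module R) (carrier R)"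
  shows "operator_module.Zsub (regular_module R) (carrier R) D \<longleftrightarrow> ideal D R"
proof -
  interpret operator_module R "regular_module R" "carrier R" by fact
  show ?thesis
  proof
    assume D: "Zsub D"
    have "subgroup D (add_monoid R)"
    proof
      show "inv\<^bsub>add_monoid R\<^esub> x \<in> D" if "x \<in> D" for x
      proof -
        have x: "x \<in> carrier R" using ZsubD(1)[OF D that] by simp
        have "(\<ominus> \<one>) \<otimes> x \<in> D" using ZsubD(4)[OF D _ that, of "\<ominus> \<one>"] by simp
        then show ?thesis using x by (simp add: l_minus flip: a_inv_def)
      qed
    qed (use ZsubD[OF D] in auto)
    then show "ideal D R"
    proof (intro idealI ring_axioms)
      fix a x assume a: "a \<in> D" "x \<in> carrier R"
      then show x: "x \<otimes> a \<in> D" using ZsubD(4)[OF D, of x a] by simp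
      show "a \<otimes> x \<in> D" using x a ZsubD(1)[OF D a(1)] by (simp add: m_comm)
    qed
  next
    assume "ideal D R"
    then interpret D: ideal D R .
    show "Zsub D" unfolding Zsub_def
      using D.a_subset D.I_l_closed D.a_closed D.zero_closed by auto
  qed
qed

text \<open>
  Otherwise take a minimal ideal \<open>I\<close> among those of infinite length.  For every \<open>a\<close>, either \<open>aI = I\<close> or
  \<open>aI = 0\<close>, because length is additive along multiplication by \<open>a\<close>.  So the annihilator \<open>p\<close> of \<open>I\<close> is prime, hence
  maximal, and \<open>I\<close> is a vector space.  A hyperplane of it has finite length by minimality, so \<open>I\<close> has finite
  length after all.
\<close>

theorem artinian_finite_length:
  assumes "artinian_ring A" "cring A"
  shows "\<exists>B. \<forall>C l. (\<forall>i\<le>l. ideal (C i) A) \<longrightarrow> (\<forall>i<l. C i \<subset> C (Suc i)) \<longrightarrow> l \<le> (B :: nat)"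
proof -
  interpret A: artinian_ring A by fact
  interpret A: cring A by fact
  let ?M = "regular_module A"
  have om: "operator_module A ?M (carrier A)"
    by (intro operator_module.intro operator_module_axioms.intro A.module_regular_module A.carrier_is_subring)
  interpret operator_module A ?M "carrier A" by (rule om)
  have ideal: "Zsub D \<longleftrightarrow> ideal D A" for D by (rule A.Zsub_regular_iff[OF om])
  have "len {\<zero>\<^bsub>A\<^esub>} (carrier A) \<noteq> \<infinity>"
  proof
    assume inf: "len {\<zero>\<^bsub>A\<^esub>} (carrier A) = \<infinity>"
    have zero: "Zsub {\<zero>\<^bsub>A\<^esub>}" using Zsub_zero by simp
    let ?F = "{I. Zsub I \<and> len {\<zero>\<^bsub>A\<^esub>} I = \<infinity>}"
    have "?F \<noteq> {}" using inf Zsub_carrier by auto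
    moreover have "ideal I A" if "I \<in> ?F" for I using that ideal by blast
    ultimately obtain I where IF: "I \<in> ?F" and Imin: "\<And>J. J \<in> ?F \<Longrightarrow> J \<subseteq> I \<Longrightarrow> J = I"
      using A.minimal_ideal[of ?F] by blast
    from IF have I: "Zsub I" "len {\<zero>\<^bsub>A\<^esub>} I = \<infinity>" by auto
    have min: "len {\<zero>\<^bsub>A\<^esub>} J \<noteq> \<infinity>" if "Zsub J" "J \<subseteq> I" "J \<noteq> I" for J
    proof
      assume "len {\<zero>\<^bsub>A\<^esub>} J = \<infinity>"
      then have "J = I" using that by (intro Imin) simp_all
      then show False using that by simp
    qed
    have Icar: "v \<in> carrier A" if "v \<in> I" for v using ZsubD(1)[OF I(1) that] by simp
    have zI: "\<zero>\<^bsub>A\<^esub> \<in> I" using ZsubD(2)[OF I(1)] by simp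
    define p where "p = {a \<in> carrier A. \<forall>v\<in>I. a \<otimes>\<^bsub>A\<^esub> v = \<zero>\<^bsub>A\<^esub>}"
    have surj: "smul a I = I" if a: "a \<in> carrier A" "a \<notin> p" for a
    proof (rule ccontr)
      assume ne: "smul a I \<noteq> I"
      have Z1: "Zsub (preim a {\<zero>\<^bsub>A\<^esub>} I)" by (rule Zsub_preim[OF a(1) zero I(1)])
      have Z2: "Zsub (smul a I)" by (rule Zsub_smul[OF a(1) I(1)])
      have sub2: "smul a I \<subseteq> I" using ZsubD(4)[OF I(1) a(1)] by (auto simp: smul_def)
      have "preim a {\<zero>\<^bsub>A\<^esub>} I \<noteq> I" using a by (auto simp: p_def preim_def)
      then have f1: "len {\<zero>\<^bsub>A\<^esub>} (preim a {\<zero>\<^bsub>A\<^esub>} I) \<noteq> \<infinity>"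
        by (intro min Z1) (auto simp: preim_def)
      have f2: "len {\<zero>\<^bsub>A\<^esub>} (smul a I) \<noteq> \<infinity>" using min[OF Z2 sub2 ne] .
      have "ssum {\<zero>\<^bsub>A\<^esub>} (smul a I) = smul a I"
        using ssum_upper2[OF zero Z2] ssum_least[OF Z2, of "{\<zero>\<^bsub>A\<^esub>}" "smul a I"] ZsubD(2)[OF Z2] by auto
      then have "len (preim a {\<zero>\<^bsub>A\<^esub>} I) I = len {\<zero>\<^bsub>A\<^esub>} (smul a I)"
        using len_mult[OF a(1) zero I(1)] by simp
      moreover have "len {\<zero>\<^bsub>A\<^esub>} I = len {\<zero>\<^bsub>A\<^esub>} (preim a {\<zero>\<^bsub>A\<^esub>} I) + len (preim a {\<zero>\<^bsub>A\<^esub>} I) I"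
        using ZsubD(2)[OF Z1] by (intro len_add zero Z1 I(1)) (auto simp: preim_def)
      ultimately show False using f1 f2 I(2) by auto
    qed
    have "I \<noteq> {\<zero>\<^bsub>A\<^esub>}" using I(2) by (auto simp: len_same)
    then obtain v0 where v0: "v0 \<in> I" "v0 \<noteq> \<zero>\<^bsub>A\<^esub>" using zI by blast
    have p_ideal: "ideal p A"
      unfolding ideal[symmetric] Zsub_def p_def
      using Icar by (auto simp: A.l_distr A.m_assoc)
    interpret p: ideal p A by (rule p_ideal)
    have p_prime: "primeideal p A"
    proof (rule primeidealI[OF p_ideal A.is_cring])
      have "\<one>\<^bsub>A\<^esub> \<otimes>\<^bsub>A\<^esub> v0 \<noteq> \<zero>\<^bsub>A\<^esub>" using v0 Icar[OF v0(1)] by simp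
      then have "\<one>\<^bsub>A\<^esub> \<notin> p" using v0(1) unfolding p_def by blast
      then show "carrier A \<noteq> p" by auto
      fix a b assume ab: "a \<in> carrier A" "b \<in> carrier A" "a \<otimes>\<^bsub>A\<^esub> b \<in> p"
      show "a \<in> p \<or> b \<in> p"
      proof (rule ccontr)
        assume "\<not> (a \<in> p \<or> b \<in> p)"
        then have sa: "smul a I = I" and sb: "smul b I = I" using surj ab by auto
        have "v0 \<in> smul a I" using v0(1) by (simp only: sa)
        then obtain v where v: "v \<in> I" "v0 = a \<otimes>\<^bsub>A\<^esub> v" unfolding smul_def by auto
        have "v \<in> smul b I" using v(1) by (simp only: sb)
        then obtain w where w: "w \<in> I" "v = b \<otimes>\<^bsub>A\<^esub> w" unfolding smul_def by auto
        have "v0 = (a \<otimes>\<^bsub>A\<^esub> b) \<otimes>\<^bsub>A\<^esub> w" using v(2) w ab(1,2) Icar[OF w(1)] by (simp add: A.m_assoc)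
        moreover have "(a \<otimes>\<^bsub>A\<^esub> b) \<otimes>\<^bsub>A\<^esub> w = \<zero>\<^bsub>A\<^esub>" using ab(3) w(1) unfolding p_def by blast
        ultimately show False using v0(2) by simp
      qed
    qed
    \<comment> \<open>A maximal subspace that avoids v0 is a hyperplane: everything strictly above it is all of I.\<close>
    let ?F = "{W. Zsub W \<and> W \<subseteq> I \<and> v0 \<notin> W}"
    have "\<exists>W\<in>?F. \<forall>X\<in>?F. W \<subseteq> X \<longrightarrow> X = W"
    proof (rule subset_Zorn_nonempty)
      show "?F \<noteq> {}" using zero zI v0 by blast
      fix \<C> assume \<C>: "\<C> \<noteq> {}" "subset.chain ?F \<C>"
      have CZ: "Zsub X" if "X \<in> \<C>" for X using \<C>(2) that unfolding subset_chain_def by blast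
      have "Zsub (\<Union>\<C>)"
        unfolding Zsub_def
      proof (intro conjI ballI)
        show "\<Union>\<C> \<subseteq> carrier ?M" using ZsubD(1)[OF CZ] by (intro Union_least subsetI)
        obtain X where X: "X \<in> \<C>" using \<C>(1) by blast
        show "\<zero>\<^bsub>?M\<^esub> \<in> \<Union>\<C>" by (rule UnionI[OF X ZsubD(2)[OF CZ[OF X]]])
        show "z \<odot>\<^bsub>?M\<^esub> x \<in> \<Union>\<C>" if z: "z \<in> carrier A" and x: "x \<in> \<Union>\<C>" for z x
        proof -
          from x obtain X where X: "X \<in> \<C>" "x \<in> X" by blast
          show ?thesis by (rule UnionI[OF X(1) ZsubD(4)[OF CZ[OF X(1)] z X(2)]])
        qed
        fix x y assume "x \<in> \<Union>\<C>" "y \<in> \<Union>\<C>"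
        then obtain X Y where XY: "X \<in> \<C>" "Y \<in> \<C>" "x \<in> X" "y \<in> Y" by blast
        then consider "X \<subseteq> Y" | "Y \<subseteq> X" using \<C>(2) unfolding subset_chain_def by blast
        then show "x \<oplus>\<^bsub>?M\<^esub> y \<in> \<Union>\<C>"
        proof cases
          case 1
          then show ?thesis using XY by (intro UnionI[OF XY(2)] ZsubD(3)[OF CZ]) auto
        next
          case 2
          then show ?thesis using XY by (intro UnionI[OF XY(1)] ZsubD(3)[OF CZ]) auto
        qed
      qed
      then show "\<Union>\<C> \<in> ?F" using \<C>(2) unfolding subset_chain_def by blast
    qed
    then obtain W where WF: "W \<in> ?F" and WM: "\<forall>X\<in>?F. W \<subseteq> X \<longrightarrow> X = W" ..
    from WF have W: "Zsub W" "W \<subseteq> I" "v0 \<notin> W" by simp_all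
    have Wmax: "X = W" if "Zsub X" "X \<subseteq> I" "v0 \<notin> X" "W \<subseteq> X" for X
      using WM that by simp
    have Wcar: "w \<in> carrier A" if "w \<in> W" for w using Icar W(2) that by blast
    \<comment> \<open>For u outside W, maximality puts v0 = w + uc into W + Au; here c is invertible modulo p.\<close>
    have top: "D = I" if D: "Zsub D" "W \<subset> D" "D \<subseteq> I" for D
    proof -
      have v0D: "v0 \<in> D" using Wmax[OF D(1,3)] D(2) by blast
      have "u \<in> D" if u: "u \<in> I" for u
      proof (cases "u \<in> W")
        case False
        have Zu: "Zsub (smul u (carrier A))" using Zsub_smul[OF Icar[OF u] Zsub_carrier] by simp
        have uu: "u \<in> smul u (carrier A)" unfolding smul_def using Icar[OF u]
          by (intro image_eqI[of _ _ "\<one>\<^bsub>A\<^esub>"]) auto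
        have "v0 \<in> ssum W (smul u (carrier A))"
        proof (rule ccontr)
          assume "v0 \<notin> ssum W (smul u (carrier A))"
          moreover have "smul u (carrier A) \<subseteq> I"
            using ZsubD(4)[OF I(1) _ u] Icar[OF u] by (auto simp: smul_def A.m_comm)
          ultimately have "ssum W (smul u (carrier A)) = W"
            by (intro Wmax Zsub_ssum W(1) Zu ssum_least[OF I(1) W(2)] ssum_upper1)
          then show False using False uu ssum_upper2[OF W(1) Zu] by blast
        qed
        then obtain w c where wc: "w \<in> W" "c \<in> carrier A" "v0 = w \<oplus>\<^bsub>A\<^esub> u \<otimes>\<^bsub>A\<^esub> c"
          by (auto simp: ssum_def smul_def)
        have "c \<notin> p"
        proof
          assume "c \<in> p"
          then have "c \<otimes>\<^bsub>A\<^esub> u = \<zero>\<^bsub>A\<^esub>" using u unfolding p_def by blast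
          then have "u \<otimes>\<^bsub>A\<^esub> c = \<zero>\<^bsub>A\<^esub>" using Icar[OF u] wc(2) by (simp add: A.m_comm)
          then show False using wc W(3) Wcar by auto
        qed
        then obtain b where b: "b \<in> carrier A" "\<one>\<^bsub>A\<^esub> \<ominus>\<^bsub>A\<^esub> c \<otimes>\<^bsub>A\<^esub> b \<in> p"
          using artinian_prime_inverse[OF assms p_prime wc(2)] by blast
        have "(\<one>\<^bsub>A\<^esub> \<ominus>\<^bsub>A\<^esub> c \<otimes>\<^bsub>A\<^esub> b) \<otimes>\<^bsub>A\<^esub> u = \<zero>\<^bsub>A\<^esub>" using b(2) u unfolding p_def by blast
        then have "u \<ominus>\<^bsub>A\<^esub> (c \<otimes>\<^bsub>A\<^esub> b) \<otimes>\<^bsub>A\<^esub> u = \<zero>\<^bsub>A\<^esub>"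
          using Icar[OF u] wc(2) b(1) by (simp add: a_minus_def A.l_distr A.l_minus)
        then have ueq: "u = b \<otimes>\<^bsub>A\<^esub> (u \<otimes>\<^bsub>A\<^esub> c)"
          using Icar[OF u] wc(2) b(1) by (simp add: A.m_ac)
        have "w \<oplus>\<^bsub>A\<^esub> u \<otimes>\<^bsub>A\<^esub> c \<in> D" using v0D wc(3) by simp
        then have "u \<otimes>\<^bsub>A\<^esub> c \<in> D"
          using Zsub_cancel_left[OF D(1), of w "u \<otimes>\<^bsub>A\<^esub> c"] wc D(2) Icar[OF u] by auto
        then have "b \<otimes>\<^bsub>A\<^esub> (u \<otimes>\<^bsub>A\<^esub> c) \<in> D" using ZsubD(4)[OF D(1) b(1)] by simp
        then show ?thesis using ueq by simp
      qed (use D in blast)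
      then show ?thesis using D(3) by blast
    qed
    have "len W I \<le> 1"
    proof (rule len_le)
      fix l assume "chain_between W I l"
      then obtain C where C: "\<forall>i\<le>l. Zsub (C i) \<and> W \<subseteq> C i \<and> C i \<subseteq> I" "\<forall>i<l. C i \<subset> C (Suc i)"
        unfolding chain_between_def by blast
      have "\<not> 2 \<le> l"
      proof
        assume l: "2 \<le> l"
        have "W \<subseteq> C 0" "C 0 \<subset> C 1" "C 1 \<subset> C 2" "Zsub (C 1)" "C 1 \<subseteq> I" "C 2 \<subseteq> I"
          using C l by (auto simp: numeral_2_eq_2 One_nat_def)
        then show False using top[of "C 1"] by blast
      qed
      then show "enat l \<le> 1" by (simp add: one_enat_def)
    qed
    moreover have "len {\<zero>\<^bsub>A\<^esub>} W \<noteq> \<infinity>" using min[OF W(1,2)] W(3) v0(1) by blast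
    moreover have "len {\<zero>\<^bsub>A\<^esub>} I = len {\<zero>\<^bsub>A\<^esub>} W + len W I"
      using ZsubD(2)[OF W(1)] by (intro len_add zero W I(1)) auto
    ultimately show False using I(2) by (cases "len W I") auto
  qed
  then obtain B where B: "len {\<zero>\<^bsub>A\<^esub>} (carrier A) = enat B" by auto
  show ?thesis
  proof (intro exI[of _ B] allI impI)
    fix C and l :: nat assume C: "\<forall>i\<le>l. ideal (C i) A" "\<forall>i<l. C i \<subset> C (Suc i)"
    have "Zsub (C i) \<and> {\<zero>\<^bsub>A\<^esub>} \<subseteq> C i \<and> C i \<subseteq> carrier A" if "i \<le> l" for i
    proof -
      have Ci: "Zsub (C i)" using C(1) that ideal by simp
      then show ?thesis using ZsubD(1,2)[OF Ci] by auto
    qed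
    then have "chain_between {\<zero>\<^bsub>A\<^esub>} (carrier A) l" unfolding chain_between_def using C(2) by blast
    from len_ge[OF this] show "l \<le> B" by (simp add: B)
  qed
qed

section \<open>Graded submodules\<close>

lemma (in ring) minus_plus_cancel: "u \<in> carrier R \<Longrightarrow> t \<in> carrier R \<Longrightarrow> u \<oplus> \<ominus> t \<oplus> t = u"
  by (simp add: a_assoc l_neg)

lemma (in ring) plus_minus_cancel: "u \<in> carrier R \<Longrightarrow> t \<in> carrier R \<Longrightarrow> u \<oplus> t \<oplus> \<ominus> t = u"
  by (simp add: a_assoc r_neg)

lemma (in ring) minus_self: "s \<in> carrier R \<Longrightarrow> s \<ominus> s = \<zero>"
  by (simp add: a_minus_def r_neg)

lemma (in cring) ring_diff_identity:
  assumes "y \<in> carrier R" "c \<in> carrier R" "c' \<in> carrier R" "z \<in> carrier R"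
  shows "(y \<oplus> c \<otimes> z) \<oplus> \<ominus> (y \<oplus> c' \<otimes> z) = (c \<ominus> c') \<otimes> z"
  using assms by algebra

text \<open>
  What is used of a finitely generated standard graded algebra, in terms of homogeneous elements.  \<open>Z\<close> is the
  image of the base ring and \<open>zs j\<close> a finite set of generators of degree \<open>e\<^sub>j\<close>.  Generation is stated as an
  induction principle for families of subgroups, which avoids writing elements as sums of monomials.
\<close>

locale graded_ring = cring S for S :: "('a, 'b) ring_scheme" (structure) and Sg :: "nat ^ 'd::finite \<Rightarrow> 'a set"
    and Z :: "'a set" and zs :: "'d \<Rightarrow> 'a set" +
  assumes Sg_carrier: "s \<in> Sg n \<Longrightarrow> s \<in> carrier S"
    and Sg_zero: "\<zero> \<in> Sg n"
    and Sg_add: "s \<in> Sg n \<Longrightarrow> t \<in> Sg n \<Longrightarrow> s \<oplus> t \<in> Sg n"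
    and Sg_mult: "s \<in> Sg a \<Longrightarrow> t \<in> Sg b \<Longrightarrow> s \<otimes> t \<in> Sg (a + b)"
    and Z_subring: "subring Z S"
    and Z_Sg: "Z \<subseteq> Sg 0"
    and Z_finite_length: "\<exists>B. \<forall>C l. (\<forall>i\<le>l. C i \<subseteq> Z \<and> \<zero> \<in> C i \<and> (\<forall>x\<in>C i. \<forall>y\<in>C i. x \<oplus> y \<in> C i) \<and>
        (\<forall>z\<in>Z. \<forall>x\<in>C i. z \<otimes> x \<in> C i)) \<longrightarrow> (\<forall>i<l. C i \<subset> C (Suc i)) \<longrightarrow> l \<le> (B :: nat)"
    and zs_finite: "finite (zs j)"
    and zs_Sg: "zs j \<subseteq> Sg (axis j 1)"
    and Sg_generated: "\<lbrakk>\<And>n. T n \<subseteq> Sg n; Z \<subseteq> T 0; \<And>n. \<zero> \<in> T n; \<And>n s t. s \<in> T n \<Longrightarrow> t \<in> T n \<Longrightarrow> s \<oplus> t \<in> T n;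
        \<And>n z t. z \<in> Z \<Longrightarrow> t \<in> T n \<Longrightarrow> z \<otimes> t \<in> T n;
        \<And>j n z t. z \<in> zs j \<Longrightarrow> t \<in> T n \<Longrightarrow> z \<otimes> t \<in> T (axis j 1 + n)\<rbrakk> \<Longrightarrow> Sg n \<subseteq> T n"

text \<open>
  Here \<open>G b\<close> is a finite set of generators of degree \<open>b\<close>, and again generation is an induction principle.
\<close>

locale graded_module = graded_ring S Sg Z zs + operator_module S M Z
  for S :: "('a, 'b) ring_scheme" and Sg :: "nat ^ 'd::finite \<Rightarrow> 'a set" and Z and zs
    and M :: "('a, 'm) module" (structure) +
  fixes Mg :: "nat ^ 'd \<Rightarrow> 'm set" and G :: "nat ^ 'd \<Rightarrow> 'm set"
  assumes Mg_carrier: "x \<in> Mg n \<Longrightarrow> x \<in> carrier M"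
    and Mg_zero: "\<zero> \<in> Mg n"
    and Mg_add: "x \<in> Mg n \<Longrightarrow> y \<in> Mg n \<Longrightarrow> x \<oplus> y \<in> Mg n"
    and Mg_smult: "s \<in> Sg a \<Longrightarrow> x \<in> Mg b \<Longrightarrow> s \<odot> x \<in> Mg (a + b)"
    and G_finite: "finite (G b)" "finite {b. G b \<noteq> {}}"
    and G_Mg: "G b \<subseteq> Mg b"
    and Mg_generated: "\<lbrakk>\<And>n. T n \<subseteq> Mg n; \<And>n. \<zero> \<in> T n; \<And>n x y. x \<in> T n \<Longrightarrow> y \<in> T n \<Longrightarrow> x \<oplus> y \<in> T n;
        \<And>a n s x. s \<in> Sg a \<Longrightarrow> x \<in> T n \<Longrightarrow> s \<odot> x \<in> T (a + n); \<And>b. G b \<subseteq> T b\<rbrakk> \<Longrightarrow> Mg n \<subseteq> T n"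
begin

definition gsub :: "(nat ^ 'd \<Rightarrow> 'm set) \<Rightarrow> bool"
  where "gsub N \<longleftrightarrow> (\<forall>n. N n \<subseteq> Mg n \<and> \<zero> \<in> N n \<and> (\<forall>x\<in>N n. \<forall>y\<in>N n. x \<oplus> y \<in> N n)) \<and>
     (\<forall>a n. \<forall>s\<in>Sg a. \<forall>x\<in>N n. s \<odot> x \<in> N (a + n))"

definition gsum :: "(nat ^ 'd \<Rightarrow> 'm set) \<Rightarrow> (nat ^ 'd \<Rightarrow> 'm set) \<Rightarrow> nat ^ 'd \<Rightarrow> 'm set"
  where "gsum N K n = ssum (N n) (K n)"

text \<open>
  The family \<open>xL\<close> for \<open>x\<close> of degree \<open>c\<close>.  Subtraction of degrees is truncated, so degrees not above \<open>c\<close> need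
  a case of their own.
\<close>

definition gmul :: "'a \<Rightarrow> nat ^ 'd \<Rightarrow> (nat ^ 'd \<Rightarrow> 'm set) \<Rightarrow> nat ^ 'd \<Rightarrow> 'm set"
  where "gmul x c L n = (if c \<le> n then smul x (L (n - c)) else {\<zero>})"

text \<open>
  The graded submodule \<open>Sm\<close> generated by \<open>m\<close> of degree \<open>b\<close>.
\<close>

definition gcyc :: "nat ^ 'd \<Rightarrow> 'm \<Rightarrow> nat ^ 'd \<Rightarrow> 'm set"
  where "gcyc b m n = (if b \<le> n then (\<lambda>s. s \<odot> m) ` Sg (n - b) else {\<zero>})"

definition gcolon :: "'a \<Rightarrow> nat ^ 'd \<Rightarrow> (nat ^ 'd \<Rightarrow> 'm set) \<Rightarrow> (nat ^ 'd \<Rightarrow> 'm set) \<Rightarrow> nat ^ 'd \<Rightarrow> 'm set"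
  where "gcolon x c N L n = preim x (N (c + n)) (L n)"

definition gadd :: "'a \<Rightarrow> nat ^ 'd \<Rightarrow> (nat ^ 'd \<Rightarrow> 'm set) \<Rightarrow> (nat ^ 'd \<Rightarrow> 'm set) \<Rightarrow> nat ^ 'd \<Rightarrow> 'm set"
  where "gadd x c N L = gsum N (gmul x c L)"

lemma gsubI:
  assumes "\<And>n. N n \<subseteq> Mg n" "\<And>n. \<zero> \<in> N n" "\<And>n x y. x \<in> N n \<Longrightarrow> y \<in> N n \<Longrightarrow> x \<oplus> y \<in> N n"
    "\<And>a n s x. s \<in> Sg a \<Longrightarrow> x \<in> N n \<Longrightarrow> s \<odot> x \<in> N (a + n)"
  shows "gsub N"
  using assms unfolding gsub_def by blast

lemma gsubD:
  assumes "gsub N"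
  shows "x \<in> N n \<Longrightarrow> x \<in> Mg n" "\<zero> \<in> N n" "x \<in> N n \<Longrightarrow> y \<in> N n \<Longrightarrow> x \<oplus> y \<in> N n"
    "s \<in> Sg a \<Longrightarrow> x \<in> N n \<Longrightarrow> s \<odot> x \<in> N (a + n)"
  using assms unfolding gsub_def by blast+

lemma gsub_smult_deg: "gsub N \<Longrightarrow> s \<in> Sg a \<Longrightarrow> x \<in> N n \<Longrightarrow> a + n = k \<Longrightarrow> s \<odot> x \<in> N k"
  using gsubD(4) by blast

lemma gsub_carrier: "gsub N \<Longrightarrow> x \<in> N n \<Longrightarrow> x \<in> carrier M"
  using gsubD(1) Mg_carrier by blast

lemma gsub_Zsub: "gsub N \<Longrightarrow> Zsub (N n)"
  unfolding Zsub_def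
proof (intro conjI ballI)
  assume N: "gsub N"
  show "N n \<subseteq> carrier M" using gsub_carrier[OF N] by blast
  show "\<zero> \<in> N n" by (rule gsubD(2)[OF N])
  show "x \<oplus> y \<in> N n" if "x \<in> N n" "y \<in> N n" for x y by (rule gsubD(3)[OF N that])
  show "z \<odot> x \<in> N n" if "z \<in> Z" "x \<in> N n" for z x
    using gsub_smult_deg[OF N _ that(2), of z 0 n] that(1) Z_Sg by auto
qed

lemma gsub_Mg: "gsub Mg"
  by (rule gsubI) (auto intro: Mg_zero Mg_add Mg_smult)

lemma gsub_zero: "gsub (\<lambda>_. {\<zero>})"
  by (rule gsubI) (auto simp: Mg_zero smult_r_null Sg_carrier)

lemma zero_le_gsub: "gsub N \<Longrightarrow> (\<lambda>_. {\<zero>}) \<le> N"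
  using gsubD(2) by (auto simp: le_fun_def)

lemma gsub_gsum:
  assumes N: "gsub N" and K: "gsub K"
  shows "gsub (gsum N K)"
proof (rule gsubI)
  fix n
  have Z: "Zsub (gsum N K n)" unfolding gsum_def by (intro Zsub_ssum gsub_Zsub N K)
  show "gsum N K n \<subseteq> Mg n" unfolding gsum_def
    using gsubD(1)[OF N] gsubD(1)[OF K] by (intro ssum_least gsub_Zsub gsub_Mg) blast+
  show "\<zero> \<in> gsum N K n" by (rule ZsubD(2)[OF Z])
  show "x \<oplus> y \<in> gsum N K n" if "x \<in> gsum N K n" "y \<in> gsum N K n" for x y
    by (rule ZsubD(3)[OF Z that])
  fix a s x assume s: "s \<in> Sg a" and "x \<in> gsum N K n"
  then obtain u v where uv: "x = u \<oplus> v" "u \<in> N n" "v \<in> K n" unfolding gsum_def ssum_def by blast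
  have "s \<odot> x = s \<odot> u \<oplus> s \<odot> v"
    unfolding uv(1) by (intro smult_r_distr Sg_carrier[OF s] gsub_carrier[OF N uv(2)] gsub_carrier[OF K uv(3)])
  then show "s \<odot> x \<in> gsum N K (a + n)"
    unfolding gsum_def ssum_def using gsubD(4)[OF N s uv(2)] gsubD(4)[OF K s uv(3)] by blast
qed

lemma gsum_upper1: "gsub N \<Longrightarrow> gsub K \<Longrightarrow> N \<le> gsum N K"
  by (auto simp: le_fun_def gsum_def intro: ssum_upper1[THEN subsetD] gsub_Zsub)

lemma gsum_upper2: "gsub N \<Longrightarrow> gsub K \<Longrightarrow> K \<le> gsum N K"
  by (auto simp: le_fun_def gsum_def intro: ssum_upper2[THEN subsetD] gsub_Zsub)

lemma gsum_least: "gsub L \<Longrightarrow> N \<le> L \<Longrightarrow> K \<le> L \<Longrightarrow> gsum N K \<le> L"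
  unfolding le_fun_def gsum_def by (intro allI ssum_least gsub_Zsub) blast+

lemma gsum_mono: "N \<le> N' \<Longrightarrow> K \<le> K' \<Longrightarrow> gsum N K \<le> gsum N' K'"
  unfolding le_fun_def gsum_def by (intro allI ssum_mono) blast+

lemma gsub_gmul:
  assumes x: "x \<in> Sg c" and L: "gsub L"
  shows "gsub (gmul x c L)"
proof (rule gsubI)
  fix n
  have Z: "Zsub (gmul x c L n)" unfolding gmul_def
    using Zsub_smul[OF Sg_carrier[OF x] gsub_Zsub[OF L]] Zsub_zero by simp
  show "gmul x c L n \<subseteq> Mg n"
  proof (cases "c \<le> n")
    case True
    have "c + (n - c) = n" using vec_le_minus_add[OF True] by (simp add: add.commute)
    then show ?thesis using Mg_smult[OF x gsubD(1)[OF L]] True by (fastforce simp: gmul_def smul_def)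
  qed (simp add: gmul_def Mg_zero)
  show "\<zero> \<in> gmul x c L n" by (rule ZsubD(2)[OF Z])
  show "u \<oplus> v \<in> gmul x c L n" if "u \<in> gmul x c L n" "v \<in> gmul x c L n" for u v
    by (rule ZsubD(3)[OF Z that])
  fix a s u assume s: "s \<in> Sg a" and u: "u \<in> gmul x c L n"
  show "s \<odot> u \<in> gmul x c L (a + n)"
  proof (cases "c \<le> n")
    case True
    then obtain v where v: "u = x \<odot> v" "v \<in> L (n - c)" using u by (auto simp: gmul_def smul_def)
    have le: "c \<le> a + n" using True by (auto simp: less_eq_vec_def intro: trans_le_add2)
    have deg: "a + (n - c) = a + n - c" using True by (auto simp: vec_eq_iff less_eq_vec_def)
    have "s \<odot> u = x \<odot> (s \<odot> v)"
      unfolding v(1) using Sg_carrier[OF s] Sg_carrier[OF x] gsub_carrier[OF L v(2)]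
      by (simp add: smult_assoc1[symmetric] m_comm)
    moreover have "s \<odot> v \<in> L (a + n - c)" using gsubD(4)[OF L s v(2)] deg by simp
    ultimately show ?thesis using le by (simp add: gmul_def smul_def)
  next
    case False
    then have "u = \<zero>" using u by (simp add: gmul_def)
    moreover have "Zsub (gmul x c L (a + n))" unfolding gmul_def
      using Zsub_smul[OF Sg_carrier[OF x] gsub_Zsub[OF L]] Zsub_zero by simp
    ultimately show ?thesis using ZsubD(2) by (simp add: smult_r_null Sg_carrier[OF s])
  qed
qed

lemma gmul_le: "gsub L \<Longrightarrow> x \<in> Sg c \<Longrightarrow> gmul x c L \<le> L"
  unfolding le_fun_def
proof (intro allI subsetI)
  fix n u assume L: "gsub L" and x: "x \<in> Sg c" and u: "u \<in> gmul x c L n"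
  show "u \<in> L n"
  proof (cases "c \<le> n")
    case True
    then obtain v where v: "u = x \<odot> v" "v \<in> L (n - c)" using u by (auto simp: gmul_def smul_def)
    have "c + (n - c) = n" using vec_le_minus_add[OF True] by (simp add: add.commute)
    then show ?thesis using gsub_smult_deg[OF L x v(2)] v(1) by simp
  next
    case False
    then show ?thesis using u gsubD(2)[OF L] by (simp add: gmul_def)
  qed
qed

lemma gsub_gcyc:
  assumes m: "m \<in> Mg b"
  shows "gsub (gcyc b m)"
proof (rule gsubI)
  have mc: "m \<in> carrier M" by (rule Mg_carrier[OF m])
  have z: "\<zero> \<in> gcyc b m n" for n
    unfolding gcyc_def using smult_l_null[OF mc] Sg_zero[of "n - b"] by (auto intro!: image_eqI[of _ _ "\<zero>\<^bsub>S\<^esub>"])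
  fix n
  show "\<zero> \<in> gcyc b m n" by (rule z)
  show "gcyc b m n \<subseteq> Mg n"
  proof (cases "b \<le> n")
    case True
    then show ?thesis using Mg_smult[OF _ m, of _ "n - b"] vec_le_minus_add[OF True] by (auto simp: gcyc_def)
  qed (simp add: gcyc_def Mg_zero)
  show "x \<oplus> y \<in> gcyc b m n" if xy: "x \<in> gcyc b m n" "y \<in> gcyc b m n" for x y
  proof (cases "b \<le> n")
    case True
    then obtain s t where st: "x = s \<odot> m" "y = t \<odot> m" "s \<in> Sg (n - b)" "t \<in> Sg (n - b)"
      using xy by (auto simp: gcyc_def)
    then have "x \<oplus> y = (s \<oplus>\<^bsub>S\<^esub> t) \<odot> m" by (simp add: smult_l_distr Sg_carrier mc)
    then show ?thesis using True Sg_add[OF st(3,4)] by (simp add: gcyc_def)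
  qed (use xy in \<open>simp add: gcyc_def\<close>)
  fix a s x assume s: "s \<in> Sg a" and x: "x \<in> gcyc b m n"
  show "s \<odot> x \<in> gcyc b m (a + n)"
  proof (cases "b \<le> n")
    case True
    then obtain t where t: "x = t \<odot> m" "t \<in> Sg (n - b)" using x by (auto simp: gcyc_def)
    have "s \<odot> x = (s \<otimes>\<^bsub>S\<^esub> t) \<odot> m" using t s by (simp add: smult_assoc1 Sg_carrier mc)
    moreover have "a + (n - b) = a + n - b" using True by (auto simp: vec_eq_iff less_eq_vec_def)
    then have "s \<otimes>\<^bsub>S\<^esub> t \<in> Sg (a + n - b)" using Sg_mult[OF s t(2)] by simp
    moreover have "b \<le> a + n" using True by (auto simp: less_eq_vec_def intro: trans_le_add2)
    ultimately show ?thesis by (simp add: gcyc_def)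
  next
    case False
    then have "x = \<zero>" using x by (simp add: gcyc_def)
    then show ?thesis using z by (simp add: smult_r_null Sg_carrier[OF s])
  qed
qed

lemma one_Z: "\<one>\<^bsub>S\<^esub> \<in> Z" by (rule subringE(3)[OF Z_subring])

lemma one_Sg: "\<one>\<^bsub>S\<^esub> \<in> Sg 0" using one_Z Z_Sg by blast

lemma gcyc_self: "m \<in> Mg b \<Longrightarrow> m \<in> gcyc b m b"
  unfolding gcyc_def using one_Sg Mg_carrier[of m b] by (auto intro!: image_eqI[of _ _ "\<one>\<^bsub>S\<^esub>"])

lemma gcyc_least: "gsub L \<Longrightarrow> m \<in> L b \<Longrightarrow> gcyc b m \<le> L"
  unfolding le_fun_def gcyc_def
  using gsub_smult_deg[of L _ _ m b] vec_le_minus_add[of b] gsubD(2)[of L] by auto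

lemma gsub_gcolon:
  assumes x: "x \<in> Sg c" and N: "gsub N" and L: "gsub L"
  shows "gsub (gcolon x c N L)"
proof (rule gsubI)
  fix n
  have Z: "Zsub (gcolon x c N L n)" unfolding gcolon_def by (intro Zsub_preim Sg_carrier[OF x] gsub_Zsub N L)
  show "gcolon x c N L n \<subseteq> Mg n" unfolding gcolon_def preim_def using gsubD(1)[OF L] by blast
  show "\<zero> \<in> gcolon x c N L n" by (rule ZsubD(2)[OF Z])
  show "u \<oplus> v \<in> gcolon x c N L n" if "u \<in> gcolon x c N L n" "v \<in> gcolon x c N L n" for u v
    by (rule ZsubD(3)[OF Z that])
  fix a s u assume s: "s \<in> Sg a" and "u \<in> gcolon x c N L n"
  then have u: "u \<in> L n" "x \<odot> u \<in> N (c + n)" by (auto simp: gcolon_def preim_def)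
  have "x \<odot> (s \<odot> u) = s \<odot> (x \<odot> u)"
    using Sg_carrier[OF s] Sg_carrier[OF x] gsub_carrier[OF L u(1)]
    by (simp add: smult_assoc1[symmetric] m_comm)
  moreover have "s \<odot> (x \<odot> u) \<in> N (c + (a + n))"
    by (rule gsub_smult_deg[OF N s u(2)]) (simp add: ac_simps)
  ultimately show "s \<odot> u \<in> gcolon x c N L (a + n)"
    using gsubD(4)[OF L s u(1)] by (simp add: gcolon_def preim_def)
qed

lemma gcolon_le: "gcolon x c N L \<le> L"
  by (auto simp: le_fun_def gcolon_def preim_def)

lemma gcolon_ge: "gsub N \<Longrightarrow> x \<in> Sg c \<Longrightarrow> N \<le> L \<Longrightarrow> N \<le> gcolon x c N L"
  using gsubD(4)[of N x c] by (auto simp: le_fun_def gcolon_def preim_def)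

lemma gcolon_mono: "N \<le> N' \<Longrightarrow> gcolon x c N L \<le> gcolon x c N' L"
  by (auto simp: le_fun_def gcolon_def preim_def)

lemma gsub_gadd: "x \<in> Sg c \<Longrightarrow> gsub N \<Longrightarrow> gsub L \<Longrightarrow> gsub (gadd x c N L)"
  unfolding gadd_def by (intro gsub_gsum gsub_gmul)

lemma gadd_upper: "x \<in> Sg c \<Longrightarrow> gsub N \<Longrightarrow> gsub L \<Longrightarrow> N \<le> gadd x c N L"
  unfolding gadd_def by (intro gsum_upper1 gsub_gmul)

lemma gadd_mult: 
  assumes "x \<in> Sg c" "gsub N" "gsub L" "v \<in> L n"
  shows "x \<odot> v \<in> gadd x c N L (c + n)"
proof -
  have "c + n - c = n" "c \<le> c + n" by (simp_all add: vec_eq_iff less_eq_vec_def)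
  then have "x \<odot> v \<in> gmul x c L (c + n)" using assms(4) by (simp add: gmul_def smul_def)
  then show ?thesis
    using gsum_upper2[OF assms(2) gsub_gmul[OF assms(1,3)]] unfolding gadd_def le_fun_def by blast
qed

lemma gadd_least: "x \<in> Sg c \<Longrightarrow> gsub L \<Longrightarrow> N \<le> L \<Longrightarrow> gadd x c N L \<le> L"
  unfolding gadd_def by (intro gsum_least gmul_le)

text \<open>
  Exactness of \<open>0 \<rightarrow> (N : x)/N \<rightarrow> L/N \<rightarrow> L/N \<rightarrow> L/(N + xL) \<rightarrow> 0\<close>, read off in one degree.
\<close>

lemma len_gadd:
  assumes x: "x \<in> Sg c" and N: "gsub N" and L: "gsub L" and NL: "N \<le> L" and c: "c \<le> n"
  shows "len (N n) (L n) + len (N (n - c)) (gcolon x c N L (n - c)) =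
         len (N (n - c)) (L (n - c)) + len (gadd x c N L n) (L n)"
proof -
  have cn: "c + (n - c) = n" using vec_le_minus_add[OF c] by (simp add: add.commute)
  have eq: "gadd x c N L n = ssum (N n) (smul x (L (n - c)))"
    using c by (simp add: gadd_def gsum_def gmul_def)
  have eq': "gcolon x c N L (n - c) = preim x (N n) (L (n - c))" by (simp add: gcolon_def cn)
  have "len (N n) (L n) = len (N n) (gadd x c N L n) + len (gadd x c N L n) (L n)"
    using gadd_upper[OF x N L] gadd_least[OF x L NL]
    by (intro len_add gsub_Zsub N L gsub_gadd x) (auto simp: le_fun_def)
  moreover have "len (N n) (gadd x c N L n) = len (gcolon x c N L (n - c)) (L (n - c))"
    unfolding eq eq' by (rule len_mult[symmetric]) (intro Sg_carrier[OF x] gsub_Zsub N L)+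
  moreover have "len (N (n - c)) (L (n - c)) =
      len (N (n - c)) (gcolon x c N L (n - c)) + len (gcolon x c N L (n - c)) (L (n - c))"
    using gcolon_ge[OF N x NL] gcolon_le[of x c N L]
    by (intro len_add gsub_Zsub N L gsub_gcolon x) (auto simp: le_fun_def)
  ultimately show ?thesis by (simp add: ac_simps)
qed


section \<open>Chain conditions and finite length\<close>

text \<open>
  The ascending chain condition for graded submodules above \<open>U\<close>, that is, for \<open>M/U\<close>.
\<close>

definition acc_above :: "(nat ^ 'd \<Rightarrow> 'm set) \<Rightarrow> bool"
  where "acc_above U \<longleftrightarrow> (\<forall>C :: nat \<Rightarrow> nat ^ 'd \<Rightarrow> 'm set.
     (\<forall>j. gsub (C j) \<and> U \<le> C j \<and> C j \<le> C (Suc j)) \<longrightarrow> (\<exists>J. \<forall>j\<ge>J. C j = C J))"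

lemma Zsub_Z_multiples: "m \<in> carrier M \<Longrightarrow> Zsub ((\<lambda>z. z \<odot> m) ` Z)"
  unfolding Zsub_def
proof (intro conjI ballI)
  assume m: "m \<in> carrier M"
  show "(\<lambda>z. z \<odot> m) ` Z \<subseteq> carrier M" using m Z_carrier by auto
  show "\<zero> \<in> (\<lambda>z. z \<odot> m) ` Z"
    using smult_l_null[OF m] subringE(2)[OF Z_subring] by (auto intro!: image_eqI[of _ _ "\<zero>\<^bsub>S\<^esub>"])
  fix x y assume "x \<in> (\<lambda>z. z \<odot> m) ` Z" "y \<in> (\<lambda>z. z \<odot> m) ` Z"
  then obtain s t where st: "s \<in> Z" "t \<in> Z" "x = s \<odot> m" "y = t \<odot> m" by blast
  then have "x \<oplus> y = (s \<oplus>\<^bsub>S\<^esub> t) \<odot> m" using m Z_carrier by (simp add: smult_l_distr)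
  then show "x \<oplus> y \<in> (\<lambda>z. z \<odot> m) ` Z" using subringE(7)[OF Z_subring st(1,2)] by blast
next
  assume m: "m \<in> carrier M"
  fix z x assume z: "z \<in> Z" and "x \<in> (\<lambda>z. z \<odot> m) ` Z"
  then obtain s where s: "s \<in> Z" "x = s \<odot> m" by blast
  then have "z \<odot> x = (z \<otimes>\<^bsub>S\<^esub> s) \<odot> m" using m z Z_carrier by (simp add: smult_assoc1)
  then show "z \<odot> x \<in> (\<lambda>z. z \<odot> m) ` Z" using subringE(6)[OF Z_subring z s(1)] by blast
qed

text \<open>
  A chain between \<open>N\<close> and \<open>N + Zm\<close> is determined by the ideals of scalars that carry \<open>m\<close> into its members.
\<close>

lemma len_cyclic:
  assumes N: "Zsub N" and m: "m \<in> carrier M"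
  shows "len N (ssum N ((\<lambda>z. z \<odot> m) ` Z)) \<noteq> \<infinity>"
proof -
  from Z_finite_length obtain B where B: "\<And>C l. (\<forall>i\<le>l. C i \<subseteq> Z \<and> \<zero>\<^bsub>S\<^esub> \<in> C i \<and> (\<forall>x\<in>C i. \<forall>y\<in>C i. x \<oplus>\<^bsub>S\<^esub> y \<in> C i) \<and>
        (\<forall>z\<in>Z. \<forall>x\<in>C i. z \<otimes>\<^bsub>S\<^esub> x \<in> C i)) \<Longrightarrow> (\<forall>i<l. C i \<subset> C (Suc i)) \<Longrightarrow> l \<le> (B :: nat)" by blast
  have "len N (ssum N ((\<lambda>z. z \<odot> m) ` Z)) \<le> enat B"
  proof (rule len_le)
    fix l assume "chain_between N (ssum N ((\<lambda>z. z \<odot> m) ` Z)) l"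
    then obtain C where C: "\<forall>i\<le>l. Zsub (C i) \<and> N \<subseteq> C i \<and> C i \<subseteq> ssum N ((\<lambda>z. z \<odot> m) ` Z)"
      "\<forall>i<l. C i \<subset> C (Suc i)" unfolding chain_between_def by blast
    define I where "I i = {z \<in> Z. z \<odot> m \<in> C i}" for i
    have "l \<le> B"
    proof (rule B[of l I]; intro allI impI conjI ballI)
      fix i assume "i \<le> l"
      then have Ci: "Zsub (C i)" using C(1) by blast
      show "I i \<subseteq> Z" by (auto simp: I_def)
      show "\<zero>\<^bsub>S\<^esub> \<in> I i" using ZsubD(2)[OF Ci] subringE(2)[OF Z_subring] by (simp add: I_def smult_l_null m)
      show "x \<oplus>\<^bsub>S\<^esub> y \<in> I i" if "x \<in> I i" "y \<in> I i" for x y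
        using that ZsubD(3)[OF Ci] subringE(7)[OF Z_subring] Z_carrier m by (auto simp: I_def smult_l_distr)
      show "z \<otimes>\<^bsub>S\<^esub> x \<in> I i" if "z \<in> Z" "x \<in> I i" for z x
        using that ZsubD(4)[OF Ci] subringE(6)[OF Z_subring] Z_carrier m by (auto simp: I_def smult_assoc1)
    next
      fix i assume i: "i < l"
      then have Ci: "Zsub (C i)" "N \<subseteq> C i" and Ci': "Zsub (C (Suc i))" "N \<subseteq> C (Suc i)"
         "C (Suc i) \<subseteq> ssum N ((\<lambda>z. z \<odot> m) ` Z)" and sub: "C i \<subset> C (Suc i)"
        using C by (meson Suc_leI less_imp_le)+
      then obtain x where x: "x \<in> C (Suc i)" "x \<notin> C i" by blast
      then obtain n z where nz: "x = n \<oplus> z \<odot> m" "n \<in> N" "z \<in> Z" using Ci'(3) unfolding ssum_def by blast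
      have zm: "z \<odot> m \<in> carrier M" using Z_carrier[OF nz(3)] m by simp
      have "n \<oplus> z \<odot> m \<in> C (Suc i)" "n \<in> C (Suc i)" using x(1) nz(1,2) Ci'(2) by auto
      then have "z \<odot> m \<in> C (Suc i)" using Zsub_cancel_left[OF Ci'(1) _ zm] by blast
      moreover have "z \<odot> m \<notin> C i" using x(2) nz(1,2) Ci(2) ZsubD(3)[OF Ci(1)] by blast
      ultimately have "z \<in> I (Suc i)" "z \<notin> I i" using nz(3) by (auto simp: I_def)
      moreover have "I i \<subseteq> I (Suc i)" using sub unfolding I_def by blast
      ultimately show "I i \<subset> I (Suc i)" by blast
    qed
    then show "enat l \<le> enat B" by simp
  qed
  then show ?thesis by (metis enat_ord_simps(5) infinity_ne_i0 enat.distinct(2))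
qed

text \<open>
  The submodule generated by \<open>U\<close> and finitely many elements, built up one element at a time.
\<close>

lemma finite_extension:
  assumes U: "Zsub U" and "finite F" "F \<subseteq> carrier M"
  shows "\<exists>V. Zsub V \<and> U \<subseteq> V \<and> F \<subseteq> V \<and> (\<forall>W. Zsub W \<longrightarrow> U \<subseteq> W \<longrightarrow> F \<subseteq> W \<longrightarrow> V \<subseteq> W) \<and> len U V \<noteq> \<infinity>"
  using assms(2,3)
proof (induction F)
  case empty
  show ?case by (rule exI[of _ U]) (simp add: U len_same)
next
  case (insert m F)
  then obtain V where V: "Zsub V" "U \<subseteq> V" "F \<subseteq> V" and Vmin: "\<forall>W. Zsub W \<longrightarrow> U \<subseteq> W \<longrightarrow> F \<subseteq> W \<longrightarrow> V \<subseteq> W"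
    and fin: "len U V \<noteq> \<infinity>" by auto
  have m: "m \<in> carrier M" using insert.prems by simp
  let ?K = "(\<lambda>z. z \<odot> m) ` Z"
  have mK: "m \<in> ?K" using one_Z m by (auto intro!: image_eqI[of _ _ "\<one>\<^bsub>S\<^esub>"])
  have ZW: "Zsub (ssum V ?K)" by (intro Zsub_ssum V Zsub_Z_multiples m)
  have VW: "V \<subseteq> ssum V ?K" by (intro ssum_upper1 V Zsub_Z_multiples m)
  have KW: "?K \<subseteq> ssum V ?K" by (intro ssum_upper2 V Zsub_Z_multiples m)
  show ?case
  proof (intro exI[of _ "ssum V ?K"] conjI allI impI)
    show "U \<subseteq> ssum V ?K" using V(2) VW by (rule subset_trans)
    show "insert m F \<subseteq> ssum V ?K" using V(3) VW KW mK by blast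
    show "ssum V ?K \<subseteq> W" if W: "Zsub W" "U \<subseteq> W" "insert m F \<subseteq> W" for W
    proof (rule ssum_least[OF W(1)])
      show "V \<subseteq> W" using Vmin W by simp
      show "?K \<subseteq> W" using ZsubD(4)[OF W(1)] W(3) by auto
    qed
    have "len U (ssum V ?K) = len U V + len V (ssum V ?K)" by (intro len_add U V ZW VW)
    then show "len U (ssum V ?K) \<noteq> \<infinity>" using fin len_cyclic[OF V(1) m] by auto
  qed (rule ZW)
qed

lemma Zsub_chain_stable:
  assumes D: "\<And>j. Zsub (D j)" "\<And>j. N \<subseteq> D j" "\<And>j. D j \<subseteq> L" "\<And>j. D j \<subseteq> D (Suc j)"
    and N: "Zsub N" and fin: "len N L \<noteq> \<infinity>"
  shows "\<exists>J. \<forall>j\<ge>J. D j = D J"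
proof -
  from fin obtain b where b: "len N L = enat b" by auto
  have le: "len N (D j) \<le> enat b" for j unfolding b[symmetric] by (rule len_mono[OF order_refl D(3)])
  have bd: "the_enat (len N (D j)) \<le> b" for j
  proof -
    obtain c where "len N (D j) = enat c" using le[of j] by (cases "len N (D j)") auto
    then show ?thesis using le[of j] by simp
  qed
  have "\<exists>J. \<forall>j. the_enat (len N (D j)) \<le> the_enat (len N (D J))"
    using ex_has_greatest_nat[of "\<lambda>_. True" 0 "\<lambda>j. the_enat (len N (D j))" "Suc b"] bd by (simp add: less_Suc_eq_le)
  then obtain J where J: "\<And>j. the_enat (len N (D j)) \<le> the_enat (len N (D J))" by blast
  have mono: "D J \<subseteq> D j" if "J \<le> j" for j using that by (rule lift_Suc_mono_le[of D, OF D(4)])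
  have "D j = D J" if "J \<le> j" for j
  proof (rule ccontr)
    assume "D j \<noteq> D J"
    then have "D J \<subset> D j" using mono[OF that] by blast
    then have "len N (D J) + 1 \<le> len N (D j)" by (intro len_strict N D)
    moreover obtain c where "len N (D j) = enat c" using le[of j] by (cases "len N (D j)") auto
    moreover obtain c' where "len N (D J) = enat c'" using le[of J] by (cases "len N (D J)") auto
    ultimately show False using J[of j] by (simp add: one_enat_def)
  qed
  then show ?thesis by blast
qed

text \<open>
  A graded form of Hilbert's basis theorem.  To a member \<open>C j\<close> of the chain attach the submodules
  \<open>(C j : z\<^sup>t) + zM + U\<close> for all \<open>t\<close>.  They increase in \<open>j\<close> and in \<open>t\<close> and contain \<open>U + zM\<close>, so from some \<open>J\<close> on
  they are independent of \<open>j\<close>, for all \<open>t\<close> at once.  An element of \<open>(C j : z\<^sup>t)\<close> is then an element of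
  \<open>(C J : z\<^sup>t)\<close> plus a multiple of \<open>z\<close>, and one may continue with the cofactor, whose degree is smaller.
\<close>

lemma acc_peel:
  assumes z: "z \<in> Sg c" and c: "1 \<le> c $ i" and U: "gsub U" and acc_above: "acc_above (gadd z c U Mg)"
  shows "acc_above U"
  unfolding acc_above_def
proof (intro allI impI)
  fix C :: "nat \<Rightarrow> nat ^ 'd \<Rightarrow> 'm set"
  assume C: "\<forall>j. gsub (C j) \<and> U \<le> C j \<and> C j \<le> C (Suc j)"
  define D where "D j t = ((\<lambda>N. gcolon z c N Mg) ^^ t) (C j)" for j t
  have D0: "D j 0 = C j" for j by (simp add: D_def)
  have DS: "D j (Suc t) = gcolon z c (D j t) Mg" for j t by (simp add: D_def)
  have gD: "gsub (D j t)" for j t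
    by (induction t) (simp_all add: D0 DS C gsub_gcolon z gsub_Mg)
  have gle: "gsub N \<Longrightarrow> N \<le> Mg" for N using gsubD(1) by (auto simp: le_fun_def)
  have Dt: "D j t \<le> D j (Suc t)" for j t unfolding DS by (rule gcolon_ge[OF gD z gle[OF gD]])
  have Dj: "D j t \<le> D (Suc j) t" for j t
    by (induction t) (simp_all add: D0 DS C gcolon_mono)
  have Dmono: "D j t \<le> D j' t'" if "j \<le> j'" "t \<le> t'" for j j' t t'
  proof -
    have "D j t \<le> D j' t" by (rule lift_Suc_mono_le[of "\<lambda>j. D j t", OF Dj that(1)])
    also have "\<dots> \<le> D j' t'" by (rule lift_Suc_mono_le[of "D j'", OF Dt that(2)])
    finally show ?thesis .
  qed
  have UD: "U \<le> D j t" for j t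
  proof -
    have "U \<le> C j" using C by blast
    also have "C j \<le> D j t" using Dmono[of j j 0 t] by (simp add: D0)
    finally show ?thesis .
  qed
  define E where "E j t = gsum (D j t) (gadd z c U Mg)" for j t
  have gz: "gsub (gadd z c U Mg)" by (rule gsub_gadd[OF z U gsub_Mg])
  have gE: "gsub (E j t)" for j t unfolding E_def by (rule gsub_gsum[OF gD gz])
  have zE: "gadd z c U Mg \<le> E j t" for j t unfolding E_def by (rule gsum_upper2[OF gD gz])
  have Emono: "E j t \<le> E j' t'" if "j \<le> j'" "t \<le> t'" for j j' t t'
    unfolding E_def by (rule gsum_mono[OF Dmono[OF that] order_refl])
  have accD: "\<exists>J. \<forall>j\<ge>J. F j = F J" if "\<And>j. gsub (F j)" "\<And>j. gadd z c U Mg \<le> F j" "\<And>j. F j \<le> F (Suc j)"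
    for F :: "nat \<Rightarrow> nat ^ 'd \<Rightarrow> 'm set" using acc_above that unfolding acc_above_def by blast
  have "\<exists>s. \<forall>j\<ge>s. E j j = E s s" by (rule accD) (simp_all add: gE zE Emono)
  then obtain s where s: "\<And>j. s \<le> j \<Longrightarrow> E j j = E s s" by blast
  have "\<exists>J. \<forall>j\<ge>J. E j t = E J t" for t by (rule accD) (simp_all add: gE zE Emono)
  then obtain Jt where Jt: "\<And>t j. Jt t \<le> j \<Longrightarrow> E j t = E (Jt t) t" by metis
  \<comment> \<open>Beyond s the diagonal controls all t at once; finitely many t remain.\<close>
  define J where "J = s + (\<Sum>t<s. Jt t)"
  have sJ: "s \<le> J" by (simp add: J_def)
  have EJ: "E j t = E J t" if "J \<le> j" for j t
  proof (cases "t < s")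
    case True
    then have "Jt t \<le> (\<Sum>t<s. Jt t)" by (intro member_le_sum) auto
    then have "Jt t \<le> J" by (simp add: J_def)
    then show ?thesis using Jt[of t j] Jt[of t J] that by simp
  next
    case False
    have eq: "E i t = E s s" if "J \<le> i" for i
    proof (rule antisym)
      have "E i t \<le> E (max i t) (max i t)" by (rule Emono) auto
      also have "\<dots> = E s s" by (rule s) (use False in auto)
      finally show "E i t \<le> E s s" .
      show "E s s \<le> E i t" using sJ that False by (intro Emono) auto
    qed
    show ?thesis using eq[OF that] eq[OF order_refl] by simp
  qed
  have key: "D j t n \<subseteq> D J t n" if j: "J \<le> j" for j t n
  proof (induction "n $ i" arbitrary: n t rule: less_induct)
    case less
    show ?case
    proof
      fix v assume v: "v \<in> D j t n"
      have "D j t n \<subseteq> E j t n" using gsum_upper1[OF gD gz, of j t] unfolding E_def le_fun_def by blast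
      then have "v \<in> E J t n" using v EJ[OF j, of t] by auto
      then obtain u w where uw: "v = u \<oplus> w" "u \<in> D J t n" "w \<in> gadd z c U Mg n"
        unfolding E_def gsum_def ssum_def by blast
      then obtain u' w' where uw': "w = u' \<oplus> w'" "u' \<in> U n" "w' \<in> gmul z c Mg n"
        unfolding gadd_def gsum_def ssum_def by blast
      have car: "u \<in> carrier M" "u' \<in> carrier M" "w' \<in> carrier M"
        using gsub_carrier[OF gD uw(2)] gsub_carrier[OF U uw'(2)] gsub_carrier[OF gsub_gmul[OF z gsub_Mg] uw'(3)] by auto
      have u'': "u \<oplus> u' \<in> D J t n"
        using gsubD(3)[OF gD uw(2), of u'] uw'(2) UD[of J t] unfolding le_fun_def by blast
      have v': "v = (u \<oplus> u') \<oplus> w'" using car by (simp add: uw(1) uw'(1) M.a_assoc)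
      have "w' \<in> D J t n"
      proof (cases "c \<le> n")
        case True
        then obtain y where y: "w' = z \<odot> y" "y \<in> Mg (n - c)" using uw'(3) by (auto simp: gmul_def smul_def)
        have cn: "c + (n - c) = n" using vec_le_minus_add[OF True] by (simp add: add.commute)
        have "u \<oplus> u' \<in> D j t n" using u'' Dmono[OF j order_refl, of t] unfolding le_fun_def by blast
        moreover have "(u \<oplus> u') \<oplus> w' \<in> D j t n" using v v' by simp
        ultimately have "w' \<in> D j t n" using Zsub_cancel_left[OF gsub_Zsub[OF gD] _ car(3)] by blast
        then have "y \<in> D j (Suc t) (n - c)" using y by (simp add: DS gcolon_def preim_def cn)
        moreover have "(n - c) $ i < n $ i" using c True[unfolded less_eq_vec_def, rule_format, of i] by simp
        ultimately have "y \<in> D J (Suc t) (n - c)" using less[of "n - c" "Suc t"] by blast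
        then show ?thesis by (simp add: DS gcolon_def preim_def cn y(1))
      next
        case False
        then show ?thesis using uw'(3) gsubD(2)[OF gD] by (simp add: gmul_def)
      qed
      then show "v \<in> D J t n" unfolding v' by (rule gsubD(3)[OF gD u''])
    qed
  qed
  have "C j = C J" if j: "J \<le> j" for j
  proof (rule antisym)
    show "C j \<le> C J" using key[OF j, of 0] by (simp add: D0 le_fun_def)
    show "C J \<le> C j" using Dmono[OF j, of 0 0] by (simp add: D0)
  qed
  then show "\<exists>J. \<forall>j\<ge>J. C j = C J" by blast
qed

text \<open>
  Multiplication by \<open>z\<close> relates the length in degree \<open>n\<close> to the one in degree \<open>n - c\<close>, and degrees are bounded below.
\<close>

lemma finite_length_peel:
  assumes z: "z \<in> Sg c" and c: "1 \<le> c $ i" and U: "gsub U" and fin: "\<And>n. len (gadd z c U Mg n) (Mg n) \<noteq> \<infinity>"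
  shows "len (U n) (Mg n) \<noteq> \<infinity>"
proof (induction "n $ i" arbitrary: n rule: less_induct)
  case less
  have UM: "U \<le> Mg" using gsubD(1)[OF U] by (auto simp: le_fun_def)
  show ?case
  proof (cases "c \<le> n")
    case True
    have "(n - c) $ i < n $ i" using c True[unfolded less_eq_vec_def, rule_format, of i] by simp
    then have "len (U (n - c)) (Mg (n - c)) \<noteq> \<infinity>" by (rule less)
    then have "len (U n) (Mg n) + len (U (n - c)) (gcolon z c U Mg (n - c)) \<noteq> \<infinity>"
      using len_gadd[OF z U gsub_Mg UM True] fin[of n] by auto
    then show ?thesis by (auto simp: plus_eq_infty_iff_enat)
  next
    case False
    have "gadd z c U Mg n \<subseteq> U n"
      using False gsubD(2)[OF U] by (simp add: gadd_def gsum_def gmul_def ssum_least[OF gsub_Zsub[OF U]])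
    then have "gadd z c U Mg n = U n" using gadd_upper[OF z U gsub_Mg] unfolding le_fun_def by blast
    then show ?thesis using fin[of n] by simp
  qed
qed

text \<open>
  The sum of the submodules \<open>zM\<close>.  For all generators \<open>z\<close> this is the product of \<open>M\<close> with the irrelevant
  ideal; peeling off the generators one at a time leads from it to the zero submodule.
\<close>

definition irr_ext :: "('d \<times> 'a) list \<Rightarrow> nat ^ 'd \<Rightarrow> 'm set"
  where "irr_ext l = foldr (\<lambda>(j, z) N. gadd z (axis j 1) N Mg) l (\<lambda>_. {\<zero>})"

lemma gsub_irr_ext: "(\<forall>(j, z)\<in>set l. z \<in> zs j) \<Longrightarrow> gsub (irr_ext l)"
  unfolding irr_ext_def by (induction l) (use zs_Sg in \<open>auto intro!: gsub_zero gsub_gadd gsub_Mg\<close>)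

lemma irr_ext_mult:
  "(\<forall>(j, z)\<in>set l. z \<in> zs j) \<Longrightarrow> (j, z) \<in> set l \<Longrightarrow> v \<in> Mg n \<Longrightarrow> z \<odot> v \<in> irr_ext l (axis j 1 + n)"
proof (induction l)
  case (Cons p l)
  obtain j' z' where p: "p = (j', z')" by (cases p)
  have z': "z' \<in> Sg (axis j' 1)" using Cons.prems(1) zs_Sg p by auto
  have g: "gsub (irr_ext l)" using Cons.prems(1) by (intro gsub_irr_ext) auto
  have eq: "irr_ext (p # l) = gadd z' (axis j' 1) (irr_ext l) Mg" by (simp add: irr_ext_def p)
  show ?case
  proof (cases "(j, z) = p")
    case True
    then show ?thesis unfolding eq using gadd_mult[OF z' g gsub_Mg Cons.prems(3)] p by simp
  next
    case False
    then have "z \<odot> v \<in> irr_ext l (axis j 1 + n)" using Cons by auto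
    then show ?thesis unfolding eq using gadd_upper[OF z' g gsub_Mg] unfolding le_fun_def by blast
  qed
qed simp

lemma Sg_0: "Sg 0 = Z"
proof
  have "Sg 0 \<subseteq> (if (0 :: nat ^ 'd) = 0 then Z else Sg 0)"
  proof (rule Sg_generated[of "\<lambda>n. if n = 0 then Z else Sg n"], goal_cases)
    case 1
    then show ?case using Z_Sg by auto
  next
    case 3
    then show ?case using subringE(2)[OF Z_subring] Sg_zero by auto
  next
    case (4 n s t)
    then show ?case using subringE(7)[OF Z_subring] Sg_add by (auto split: if_splits)
  next
    case (5 n z t)
    then show ?case using subringE(6)[OF Z_subring] Sg_mult[of z 0 t n] Z_Sg by (auto split: if_splits)
  next
    case (6 j n z t)
    have "(axis j 1 + n) $ j \<noteq> 0" by (simp add: axis_def)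
    then have "axis j 1 + n \<noteq> 0" by (metis zero_index)
    moreover have "t \<in> Sg n" using 6(2) Z_Sg by (auto split: if_splits)
    ultimately show ?case using Sg_mult[of z "axis j 1" t n] 6(1) zs_Sg by auto
  qed simp
  then show "Sg 0 \<subseteq> Z" by simp
qed (rule Z_Sg)

lemma irrelevant_mult:
  assumes U: "gsub U" and zU: "\<And>j z n v. z \<in> zs j \<Longrightarrow> v \<in> Mg n \<Longrightarrow> z \<odot> v \<in> U (axis j 1 + n)"
    and a: "a \<noteq> 0" and s: "s \<in> Sg a" and v: "v \<in> Mg n"
  shows "s \<odot> v \<in> U (a + n)"
proof -
  have "Sg a \<subseteq> {s \<in> Sg a. a \<noteq> 0 \<longrightarrow> (\<forall>n. \<forall>v\<in>Mg n. s \<odot> v \<in> U (a + n))}"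
  proof (rule Sg_generated[of "\<lambda>a. {s \<in> Sg a. a \<noteq> 0 \<longrightarrow> (\<forall>n. \<forall>v\<in>Mg n. s \<odot> v \<in> U (a + n))}"], goal_cases)
    case 2
    then show ?case using Z_Sg by auto
  next
    case (3 n)
    then show ?case using Sg_zero gsubD(2)[OF U] by (auto simp: smult_l_null Mg_carrier)
  next
    case (4 n s t)
    then show ?case using Sg_add gsubD(3)[OF U] by (auto simp: smult_l_distr Mg_carrier Sg_carrier)
  next
    case (5 n z t)
    then have z: "z \<in> Sg 0" "z \<in> carrier S" using Z_Sg Z_carrier by auto
    have "z \<otimes>\<^bsub>S\<^esub> t \<in> Sg n" using Sg_mult[OF z(1), of t n] 5(2) by simp
    moreover have "(z \<otimes>\<^bsub>S\<^esub> t) \<odot> v \<in> U (n + k)" if "n \<noteq> 0" "v \<in> Mg k" for k v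
      using gsubD(4)[OF U z(1), of "t \<odot> v" "n + k"] 5(2) that z(2)
      by (auto simp: smult_assoc1 Sg_carrier Mg_carrier)
    ultimately show ?case by simp
  next
    case (6 j n z t)
    then have z: "z \<in> Sg (axis j 1)" using zs_Sg by auto
    have t: "t \<in> Sg n" using 6(2) by simp
    have "(z \<otimes>\<^bsub>S\<^esub> t) \<odot> v \<in> U (axis j 1 + n + k)" if "v \<in> Mg k" for k v
    proof -
      have "(z \<otimes>\<^bsub>S\<^esub> t) \<odot> v = z \<odot> (t \<odot> v)"
        by (intro smult_assoc1 Sg_carrier[OF z] Sg_carrier[OF t] Mg_carrier[OF that])
      then show ?thesis using zU[OF 6(1) Mg_smult[OF t that]] by (simp add: add.assoc)
    qed
    then show ?case using Sg_mult[OF z t] by simp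
  qed auto
  then show ?thesis using s v a by blast
qed

text \<open>
  Modulo the irrelevant ideal, \<open>M\<close> is generated over \<open>Z\<close> by the finitely many generators of \<open>M\<close>: it lives in
  finitely many degrees and has finite length there.
\<close>

lemma irrelevant_base:
  assumes U: "gsub U" and zU: "\<And>j z n v. z \<in> zs j \<Longrightarrow> v \<in> Mg n \<Longrightarrow> z \<odot> v \<in> U (axis j 1 + n)"
  shows "len (U n) (Mg n) \<noteq> \<infinity>" "G n = {} \<Longrightarrow> Mg n = U n"
proof -
  have "\<forall>n. \<exists>V. Zsub V \<and> U n \<subseteq> V \<and> G n \<subseteq> V \<and>
      (\<forall>W. Zsub W \<longrightarrow> U n \<subseteq> W \<longrightarrow> G n \<subseteq> W \<longrightarrow> V \<subseteq> W) \<and> len (U n) V \<noteq> \<infinity>"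
    using G_Mg Mg_carrier by (intro allI finite_extension gsub_Zsub U G_finite(1)) blast
  from choice[OF this] obtain V where V: "\<forall>n. Zsub (V n) \<and> U n \<subseteq> V n \<and> G n \<subseteq> V n \<and>
      (\<forall>W. Zsub W \<longrightarrow> U n \<subseteq> W \<longrightarrow> G n \<subseteq> W \<longrightarrow> V n \<subseteq> W) \<and> len (U n) (V n) \<noteq> \<infinity>" ..
  have VZ: "Zsub (V n)" and UV: "U n \<subseteq> V n" for n using V by blast+
  have VM: "V n \<subseteq> Mg n" for n
    using V G_Mg[of n] gsubD(1)[OF U] gsub_Zsub[OF gsub_Mg] by blast
  have "Mg n \<subseteq> V n" for n
  proof (rule Mg_generated[of V])
    show "V n \<subseteq> Mg n" for n by (rule VM)
    show "\<zero> \<in> V n" for n by (rule ZsubD(2)[OF VZ])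
    show "x \<oplus> y \<in> V n" if "x \<in> V n" "y \<in> V n" for n x y by (rule ZsubD(3)[OF VZ that])
    show "G b \<subseteq> V b" for b using V by blast
    show "s \<odot> x \<in> V (a + n)" if s: "s \<in> Sg a" and x: "x \<in> V n" for a n s x
    proof (cases "a = 0")
      case True
      then show ?thesis using ZsubD(4)[OF VZ _ x, of s] s Sg_0 by simp
    next
      case False
      have "x \<in> Mg n" using VM x by blast
      from irrelevant_mult[OF U zU False s this] show ?thesis using UV by blast
    qed
  qed
  then have VM': "V n = Mg n" for n using VM by blast
  show "len (U n) (Mg n) \<noteq> \<infinity>" using V VM' by metis
  show "Mg n = U n" if "G n = {}"
  proof -
    have "V n \<subseteq> U n" using V that gsub_Zsub[OF U] by blast
    then show ?thesis using VM' UV by blast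
  qed
qed

lemma irrelevant_acc:
  assumes U: "gsub U" and zU: "\<And>j z n v. z \<in> zs j \<Longrightarrow> v \<in> Mg n \<Longrightarrow> z \<odot> v \<in> U (axis j 1 + n)"
  shows "acc_above U"
  unfolding acc_above_def
proof (intro allI impI)
  fix C :: "nat \<Rightarrow> nat ^ 'd \<Rightarrow> 'm set"
  assume "\<forall>j. gsub (C j) \<and> U \<le> C j \<and> C j \<le> C (Suc j)"
  then have C: "gsub (C j)" "U n \<subseteq> C j n" "C j n \<subseteq> C (Suc j) n" for j n by (auto simp: le_fun_def)
  have CM: "C j n \<subseteq> Mg n" for j n using gsubD(1)[OF C(1)] by blast
  have "\<exists>J. \<forall>j\<ge>J. C j n = C J n" for n
    by (rule Zsub_chain_stable[of "\<lambda>j. C j n" "U n" "Mg n"])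
      (intro gsub_Zsub C CM U irrelevant_base(1)[OF U zU]; assumption)+
  then obtain J where J: "\<And>n j. J n \<le> j \<Longrightarrow> C j n = C (J n) n" by metis
  let ?B = "{b. G b \<noteq> {}}"
  \<comment> \<open>The sum serves as an upper bound for the finitely many J b; in degrees outside ?B already U is everything.\<close>
  define K where "K = (\<Sum>b\<in>?B. J b)"
  have "C j = C K" if "K \<le> j" for j
  proof
    fix n
    show "C j n = C K n"
    proof (cases "G n = {}")
      case True
      have "Mg n = U n" by (rule irrelevant_base(2)[OF U _ True]) (rule zU)
      then show ?thesis using C(2)[of n j] C(2)[of n K] CM[of j n] CM[of K n] by simp
    next
      case False
      then have "J n \<le> K" unfolding K_def by (intro member_le_sum) (auto simp: G_finite)
      then show ?thesis using J[of n j] J[of n K] that by simp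
    qed
  qed
  then show "\<exists>J. \<forall>j\<ge>J. C j = C J" by blast
qed

theorem noetherian: "acc_above (\<lambda>_. {\<zero>})"
  and finite_length: "len {\<zero>} (Mg n) \<noteq> \<infinity>"
proof -
  have "finite (SIGMA j:UNIV. zs j)" by (intro finite_SigmaI zs_finite) simp
  then obtain l where l: "set l = (SIGMA j:UNIV. zs j)" using finite_list by blast
  have g: "gsub (irr_ext l)" by (rule gsub_irr_ext) (simp add: l)
  have mult: "z \<odot> v \<in> irr_ext l (axis j 1 + n)" if "z \<in> zs j" "v \<in> Mg n" for j z n v
    by (rule irr_ext_mult) (use that l in auto)
  have "acc_above (irr_ext l) \<and> (\<forall>n. len (irr_ext l n) (Mg n) \<noteq> \<infinity>)"
    using irrelevant_acc[OF g mult] irrelevant_base(1)[OF g mult] by blast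
  moreover have "\<forall>(j, z)\<in>set l. z \<in> zs j" by (simp add: l)
  ultimately have "acc_above (irr_ext []) \<and> (\<forall>n. len (irr_ext [] n) (Mg n) \<noteq> \<infinity>)"
  proof (induction l)
    case (Cons p l)
    obtain j z where p: "p = (j, z)" by (cases p)
    have z: "z \<in> Sg (axis j 1)" using Cons.prems(2) zs_Sg p by auto
    have g: "gsub (irr_ext l)" using Cons.prems(2) by (intro gsub_irr_ext) auto
    have eq: "irr_ext (p # l) = gadd z (axis j 1) (irr_ext l) Mg" by (simp add: irr_ext_def p)
    have c: "1 \<le> axis j (1::nat) $ j" by (simp add: axis_def)
    have "acc_above (irr_ext l)" using acc_peel[OF z c g] Cons.prems(1) by (simp add: eq)
    moreover have "len (irr_ext l n) (Mg n) \<noteq> \<infinity>" for n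
      using finite_length_peel[OF z c g] Cons.prems(1) by (simp add: eq)
    ultimately show ?case using Cons.IH Cons.prems(2) by simp
  qed simp
  then show "acc_above (\<lambda>_. {\<zero>})" "len {\<zero>} (Mg n) \<noteq> \<infinity>" by (auto simp: irr_ext_def)
qed

end

section \<open>Graded prime ideals\<close>

context graded_ring
begin

definition gideal :: "(nat ^ 'd \<Rightarrow> 'a set) \<Rightarrow> bool"
  where "gideal P \<longleftrightarrow> (\<forall>n. P n \<subseteq> Sg n \<and> \<zero> \<in> P n \<and> (\<forall>x\<in>P n. \<forall>y\<in>P n. x \<oplus> y \<in> P n)) \<and>
     (\<forall>a n. \<forall>s\<in>Sg a. \<forall>x\<in>P n. s \<otimes> x \<in> P (a + n))"

definition gprime :: "(nat ^ 'd \<Rightarrow> 'a set) \<Rightarrow> bool"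
  where "gprime P \<longleftrightarrow> gideal P \<and> \<one> \<notin> P 0 \<and>
     (\<forall>a b. \<forall>s\<in>Sg a. \<forall>t\<in>Sg b. s \<otimes> t \<in> P (a + b) \<longrightarrow> s \<in> P a \<or> t \<in> P b)"

lemma gidealD:
  assumes "gideal P"
  shows "x \<in> P n \<Longrightarrow> x \<in> Sg n" "\<zero> \<in> P n" "x \<in> P n \<Longrightarrow> y \<in> P n \<Longrightarrow> x \<oplus> y \<in> P n"
    "s \<in> Sg a \<Longrightarrow> x \<in> P n \<Longrightarrow> s \<otimes> x \<in> P (a + n)"
  using assms unfolding gideal_def by blast+

lemma gprimeD:
  assumes "gprime P"
  shows "gideal P" "\<one> \<notin> P 0" "s \<in> Sg a \<Longrightarrow> t \<in> Sg b \<Longrightarrow> s \<otimes> t \<in> P (a + b) \<Longrightarrow> s \<in> P a \<or> t \<in> P b"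
  using assms unfolding gprime_def by blast+

lemma Sg_neg: "s \<in> Sg n \<Longrightarrow> \<ominus> s \<in> Sg n"
proof -
  assume s: "s \<in> Sg n"
  have "\<ominus> \<one> \<in> Sg 0" using subringE(5)[OF Z_subring subringE(3)[OF Z_subring]] Z_Sg by blast
  from Sg_mult[OF this s] show ?thesis using Sg_carrier[OF s] by (simp add: l_minus)
qed

lemma gideal_neg: "gideal P \<Longrightarrow> s \<in> P n \<Longrightarrow> \<ominus> s \<in> P n"
proof -
  assume P: "gideal P" and s: "s \<in> P n"
  have "\<ominus> \<one> \<in> Sg 0" using subringE(5)[OF Z_subring subringE(3)[OF Z_subring]] Z_Sg by blast
  from gidealD(4)[OF P this s] show ?thesis using Sg_carrier[OF gidealD(1)[OF P s]] by (simp add: l_minus)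
qed

lemma one_Sg0: "\<one> \<in> Sg 0" using subringE(3)[OF Z_subring] Z_Sg by blast

text \<open>
  The ring as a graded module, generated by \<open>1\<close>: so ideals satisfy the chain condition as well.
\<close>

lemma regular_graded_module:
  "graded_module S Sg Z zs (regular_module S) Sg (\<lambda>b. if b = 0 then {\<one>} else {})"
proof -
  have om: "operator_module S (regular_module S) Z"
    by (intro operator_module.intro operator_module_axioms.intro module_regular_module Z_subring)
  show ?thesis
  proof (intro graded_module.intro om graded_module_axioms.intro graded_ring_axioms)
    show "finite {b. (if b = 0 then {\<one>} else {}) \<noteq> {}}" by (rule finite_subset[of _ "{0}"]) auto
    fix T n
    assume T: "\<And>n. T n \<subseteq> Sg n" "\<And>a n s x. s \<in> Sg a \<Longrightarrow> x \<in> T n \<Longrightarrow> s \<odot>\<^bsub>regular_module S\<^esub> x \<in> T (a + n)"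
      "\<And>b. (if b = 0 then {\<one>} else {}) \<subseteq> T b"
    have "\<one> \<in> T 0" using T(3)[of 0] by simp
    then show "Sg n \<subseteq> T n" using T(2)[of _ n \<one> 0] Sg_carrier by auto
  qed (auto simp: one_Sg0 Sg_carrier Sg_zero Sg_add Sg_mult)
qed

lemma gideal_maximal:
  assumes "F \<noteq> {}" "\<And>P. P \<in> F \<Longrightarrow> gideal P"
  shows "\<exists>P\<in>F. \<forall>Q\<in>F. P \<le> Q \<longrightarrow> Q = P"
proof -
  interpret reg: graded_module S Sg Z zs "regular_module S" Sg "\<lambda>b. if b = 0 then {\<one>} else {}"
    by (rule regular_graded_module)
  have gsub: "reg.gsub P \<longleftrightarrow> gideal P" for P
    by (simp add: reg.gsub_def gideal_def)
  show ?thesis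
  proof (rule ccontr)
    assume "\<not> ?thesis"
    then have "\<forall>P. \<exists>Q. P \<in> F \<longrightarrow> Q \<in> F \<and> P \<le> Q \<and> Q \<noteq> P" by blast
    then obtain f where f: "\<And>P. P \<in> F \<Longrightarrow> f P \<in> F \<and> P \<le> f P \<and> f P \<noteq> P" by metis
    from assms(1) obtain P0 where P0: "P0 \<in> F" by blast
    define C where "C j = (f ^^ j) P0" for j
    have C: "C j \<in> F" for j by (induction j) (simp_all add: C_def P0 f)
    have CS: "C (Suc j) = f (C j)" for j by (simp add: C_def)
    have "\<exists>J. \<forall>j\<ge>J. C j = C J"
      using reg.noetherian[unfolded reg.acc_above_def, rule_format, of C] C assms(2) f[OF C]
      by (simp add: gsub CS le_fun_def gidealD(2))
    then obtain J where "C (Suc J) = C J" by (meson le_SucI order_refl)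
    then show False using f[OF C[of J]] CS by simp
  qed
qed

end

context graded_module
begin

lemma gsub_maximal:
  assumes "F \<noteq> {}" "\<And>N. N \<in> F \<Longrightarrow> gsub N"
  shows "\<exists>N\<in>F. \<forall>K\<in>F. N \<le> K \<longrightarrow> K = N"
proof (rule ccontr)
  assume "\<not> ?thesis"
  then have "\<forall>P. \<exists>Q. P \<in> F \<longrightarrow> Q \<in> F \<and> P \<le> Q \<and> Q \<noteq> P" by blast
  then obtain f where f: "\<And>P. P \<in> F \<Longrightarrow> f P \<in> F \<and> P \<le> f P \<and> f P \<noteq> P" by metis
  from assms(1) obtain P0 where P0: "P0 \<in> F" by blast
  define C where "C j = (f ^^ j) P0" for j
  have C: "C j \<in> F" for j by (induction j) (simp_all add: C_def P0 f)
  have CS: "C (Suc j) = f (C j)" for j by (simp add: C_def)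
  have "\<exists>J. \<forall>j\<ge>J. C j = C J"
  proof (rule noetherian[unfolded acc_above_def, rule_format])
    fix j
    show "gsub (C j) \<and> (\<lambda>_. {\<zero>}) \<le> C j \<and> C j \<le> C (Suc j)"
      using assms(2)[OF C[of j]] f[OF C[of j]] by (simp add: CS zero_le_gsub)
  qed
  then obtain J where "C (Suc J) = C J" by (meson le_SucI order_refl)
  then show False using f[OF C[of J]] CS by simp
qed

lemma gsub_noetherian_induct [consumes 1, case_names step]:
  assumes "gsub N" and step: "\<And>N. gsub N \<Longrightarrow> (\<And>N'. gsub N' \<Longrightarrow> N < N' \<Longrightarrow> P N') \<Longrightarrow> P N"
  shows "P N"
proof (rule ccontr)
  assume "\<not> P N"
  then have "{N. gsub N \<and> \<not> P N} \<noteq> {}" using assms(1) by blast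
  then have "\<exists>K\<in>{N. gsub N \<and> \<not> P N}. \<forall>K'\<in>{N. gsub N \<and> \<not> P N}. K \<le> K' \<longrightarrow> K' = K"
    by (rule gsub_maximal) simp
  then obtain K where K: "K \<in> {N. gsub N \<and> \<not> P N}"
    and max: "\<forall>K'\<in>{N. gsub N \<and> \<not> P N}. K \<le> K' \<longrightarrow> K' = K" ..
  have "P K"
  proof (rule step)
    show "gsub K" using K by simp
    show "P N'" if "gsub N'" "K < N'" for N' using max that by (auto simp: less_le)
  qed
  then show False using K by simp
qed

section \<open>Annihilators and devissage\<close>

text \<open>
  The graded ideal \<open>(N : m)\<close> for \<open>m\<close> of degree \<open>b\<close>.
\<close>

definition ann :: "(nat ^ 'd \<Rightarrow> 'm set) \<Rightarrow> 'm \<Rightarrow> nat ^ 'd \<Rightarrow> nat ^ 'd \<Rightarrow> 'a set"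
  where "ann N m b n = {s \<in> Sg n. s \<odot> m \<in> N (n + b)}"

lemma gideal_ann:
  assumes N: "gsub N" and m: "m \<in> Mg b"
  shows "gideal (ann N m b)"
  unfolding gideal_def
proof (intro conjI allI ballI)
  have mc: "m \<in> carrier M" by (rule Mg_carrier[OF m])
  show "ann N m b n \<subseteq> Sg n" for n by (auto simp: ann_def)
  show "\<zero>\<^bsub>S\<^esub> \<in> ann N m b n" for n using Sg_zero gsubD(2)[OF N] mc by (simp add: ann_def smult_l_null)
  show "x \<oplus>\<^bsub>S\<^esub> y \<in> ann N m b n" if "x \<in> ann N m b n" "y \<in> ann N m b n" for n x y
    using that Sg_add[of x n y] gsubD(3)[OF N, of "x \<odot> m" "n + b" "y \<odot> m"] mc
      Sg_carrier[of x n] Sg_carrier[of y n]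
    by (simp add: ann_def smult_l_distr)
  show "s \<otimes>\<^bsub>S\<^esub> x \<in> ann N m b (a + n)" if "s \<in> Sg a" "x \<in> ann N m b n" for a n s x
    using that Sg_mult[of s a x n] gsubD(4)[OF N that(1), of "x \<odot> m" "n + b"] mc
      Sg_carrier[of s a] Sg_carrier[of x n]
    by (simp add: ann_def smult_assoc1 add.assoc)
qed

lemma ann_mono: "N \<le> N' \<Longrightarrow> ann N m b \<le> ann N' m b"
  by (auto simp: ann_def le_fun_def)

lemma one_ann: "m \<in> Mg b \<Longrightarrow> \<one>\<^bsub>S\<^esub> \<in> ann N m b 0 \<longleftrightarrow> m \<in> N b"
  by (simp add: ann_def one_Sg0 Mg_carrier)

text \<open>
  A maximal element among the annihilators modulo \<open>N\<close> of homogeneous elements of \<open>L\<close> is prime.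
\<close>

lemma prime_annihilator_exists:
  assumes N: "gsub N" and L: "gsub L" and "N \<le> L" "N \<noteq> L"
  shows "\<exists>b m. m \<in> L b \<and> m \<notin> N b \<and> gprime (ann N m b)"
proof -
  let ?F = "{ann N m b | m b. m \<in> L b \<and> m \<notin> N b}"
  from assms(3,4) obtain b0 m0 where "m0 \<in> L b0" "m0 \<notin> N b0" unfolding le_fun_def fun_eq_iff by blast
  then have "?F \<noteq> {}" by blast
  then have "\<exists>P\<in>?F. \<forall>Q\<in>?F. P \<le> Q \<longrightarrow> Q = P"
    by (rule gideal_maximal) (use gideal_ann[OF N] gsubD(1)[OF L] in blast)
  then obtain P where PF: "P \<in> ?F" and Pmax: "\<forall>Q\<in>?F. P \<le> Q \<longrightarrow> Q = P" ..
  from PF obtain m b where m: "m \<in> L b" "m \<notin> N b" and P: "P = ann N m b" by blast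
  have mM: "m \<in> Mg b" by (rule gsubD(1)[OF L m(1)])
  have mc: "m \<in> carrier M" by (rule Mg_carrier[OF mM])
  have idl: "gideal P" unfolding P by (rule gideal_ann[OF N mM])
  have pr: "t \<in> P c \<or> s \<in> P a" if s: "s \<in> Sg a" and t: "t \<in> Sg c" and st: "s \<otimes>\<^bsub>S\<^esub> t \<in> P (a + c)" for a c s t
  proof (rule disjCI)
    assume "s \<notin> P a"
    then have sm: "s \<odot> m \<notin> N (a + b)" using s by (simp add: P ann_def)
    have smL: "s \<odot> m \<in> L (a + b)" by (rule gsubD(4)[OF L s m(1)])
    have "P \<le> ann N (s \<odot> m) (a + b)"
      unfolding le_fun_def
    proof (intro allI subsetI)
      fix n r assume r: "r \<in> P n"
      then have rS: "r \<in> Sg n" by (simp add: P ann_def)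
      have "s \<otimes>\<^bsub>S\<^esub> r \<in> P (a + n)" by (rule gidealD(4)[OF idl s r])
      then have "s \<odot> (r \<odot> m) \<in> N (a + n + b)" using Sg_carrier[OF s] Sg_carrier[OF rS] mc
        by (simp add: P ann_def smult_assoc1)
      moreover have "s \<odot> (r \<odot> m) = r \<odot> (s \<odot> m)" using Sg_carrier[OF s] Sg_carrier[OF rS] mc
        by (simp add: smult_assoc1[symmetric] m_comm)
      moreover have "a + n + b = n + (a + b)" by (simp add: ac_simps)
      ultimately show "r \<in> ann N (s \<odot> m) (a + b) n" using rS by (simp add: ann_def)
    qed
    then have eq: "ann N (s \<odot> m) (a + b) = P" using Pmax sm smL by blast
    have "s \<otimes>\<^bsub>S\<^esub> t \<odot> m \<in> N (a + c + b)" using st by (simp add: P ann_def)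
    moreover have "s \<otimes>\<^bsub>S\<^esub> t \<odot> m = t \<odot> (s \<odot> m)"
      using Sg_carrier[OF s] Sg_carrier[OF t] mc by (simp add: smult_assoc1[symmetric] m_comm)
    moreover have "a + c + b = c + (a + b)" by (simp add: ac_simps)
    ultimately have "t \<in> ann N (s \<odot> m) (a + b) c" using t by (simp add: ann_def)
    then show "t \<in> P c" by (simp add: eq)
  qed
  have "\<one>\<^bsub>S\<^esub> \<notin> P 0" using one_ann[OF mM] m(2) by (simp add: P)
  then have "gprime P" unfolding gprime_def
  proof (intro conjI allI ballI impI idl)
    fix a c s t assume "s \<in> Sg a" "t \<in> Sg c" "s \<otimes>\<^bsub>S\<^esub> t \<in> P (a + c)"
    from pr[OF this] show "s \<in> P a \<or> t \<in> P c" by blast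
  qed
  then show ?thesis using m P by blast
qed

abbreviation cyc_ext :: "(nat ^ 'd \<Rightarrow> 'm set) \<Rightarrow> nat ^ 'd \<Rightarrow> 'm \<Rightarrow> nat ^ 'd \<Rightarrow> 'm set"
  where "cyc_ext N b m \<equiv> gsum N (gcyc b m)"

lemma cyc_ext_gsub: "gsub N \<Longrightarrow> m \<in> Mg b \<Longrightarrow> gsub (cyc_ext N b m)"
  by (intro gsub_gsum gsub_gcyc)

lemma cyc_ext_upper: "gsub N \<Longrightarrow> m \<in> Mg b \<Longrightarrow> N \<le> cyc_ext N b m"
  by (intro gsum_upper1 gsub_gcyc)

lemma cyc_ext_self: "gsub N \<Longrightarrow> m \<in> Mg b \<Longrightarrow> m \<in> cyc_ext N b m b"
  using gsum_upper2[OF _ gsub_gcyc, of N m b] gcyc_self[of m b] unfolding le_fun_def by blast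

lemma cyc_ext_least: "gsub L \<Longrightarrow> N \<le> L \<Longrightarrow> m \<in> L b \<Longrightarrow> cyc_ext N b m \<le> L"
  by (intro gsum_least gcyc_least)

lemma cyc_ext_less: "gsub N \<Longrightarrow> m \<in> Mg b \<Longrightarrow> m \<notin> N b \<Longrightarrow> N < cyc_ext N b m"
  using cyc_ext_upper[of N m b] cyc_ext_self[of N m b] by (auto simp: less_le)

text \<open>
  Elements of \<open>N + Sm\<close>; in degrees not above that of \<open>m\<close> only the first case occurs.
\<close>

lemma cyc_ext_cases:
  assumes "gsub N" "m \<in> Mg b" "v \<in> cyc_ext N b m n"
  shows "v \<in> N n \<or> (\<exists>u s. b \<le> n \<and> u \<in> N n \<and> s \<in> Sg (n - b) \<and> v = u \<oplus> s \<odot> m)"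
proof -
  from assms(3) obtain u w where uw: "v = u \<oplus> w" "u \<in> N n" "w \<in> gcyc b m n" unfolding gsum_def ssum_def by blast
  show ?thesis
  proof (cases "b \<le> n")
    case True
    then show ?thesis using uw by (auto simp: gcyc_def)
  next
    case False
    then show ?thesis using uw gsub_carrier[OF assms(1) uw(2)] by (simp add: gcyc_def)
  qed
qed

text \<open>
  Noetherian induction on \<open>N\<close>, for all \<open>L\<close> simultaneously: in the step the claim may be used for every pair whose
  lower member is strictly larger than \<open>N\<close>, such as \<open>(N + Sm, L)\<close> and \<open>(N + x(N + Sm), N + Sm)\<close>.
\<close>

theorem devissage:
  assumes same: "\<And>N. gsub N \<Longrightarrow> P N N"
    and step: "\<And>N L b m. gsub N \<Longrightarrow> gsub L \<Longrightarrow> N \<le> L \<Longrightarrow> m \<in> L b \<Longrightarrow> m \<notin> N b \<Longrightarrow> gprime (ann N m b) \<Longrightarrow>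
      (\<And>N' L'. gsub N' \<Longrightarrow> gsub L' \<Longrightarrow> N' \<le> L' \<Longrightarrow> N < N' \<Longrightarrow> P N' L') \<Longrightarrow> P N L"
    and "gsub N" "gsub L" "N \<le> L"
  shows "P N L"
proof -
  have "\<forall>L. gsub L \<longrightarrow> N \<le> L \<longrightarrow> P N L"
    using assms(3)
  proof (induction N rule: gsub_noetherian_induct)
    case (step N)
    note 1 = step
    show ?case
    proof (intro allI impI)
      fix L assume L: "gsub L" "N \<le> L"
      show "P N L"
      proof (cases "N = L")
        case True
        then show ?thesis using same[OF 1(1)] by simp
      next
        case False
        from prime_annihilator_exists[OF 1(1) L False] obtain b m where
          m: "m \<in> L b" "m \<notin> N b" "gprime (ann N m b)" by blast
        show ?thesis by (rule assms(2)[OF 1(1) L m]) (use 1(2) in blast)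
      qed
    qed
  qed
  then show ?thesis using assms(4,5) by blast
qed

text \<open>
  The algebra is standard: an element of degree \<open>n\<close> with \<open>n\<^sub>i > 0\<close> is a combination of elements of \<open>S\<^sub>i\<close>.
\<close>

lemma Sg_subset_gideal:
  assumes P: "gideal P" and sub: "Sg (axis i 1) \<subseteq> P (axis i 1)" and n: "1 \<le> n $ i"
  shows "Sg n \<subseteq> P n"
proof -
  have "Sg n \<subseteq> {s \<in> Sg n. 1 \<le> n $ i \<longrightarrow> s \<in> P n}"
  proof (rule Sg_generated[of "\<lambda>n. {s \<in> Sg n. 1 \<le> n $ i \<longrightarrow> s \<in> P n}"], goal_cases)
    case 2
    then show ?case using Z_Sg by auto
  next
    case (3 n)
    then show ?case using Sg_zero gidealD(2)[OF P] by simp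
  next
    case (4 n s t)
    then show ?case using Sg_add gidealD(3)[OF P] by simp
  next
    case (5 n z t)
    have z: "z \<in> Sg 0" using 5(1) Z_Sg by auto
    show ?case using 5 Sg_mult[OF z, of t n] gidealD(4)[OF P z, of t n] by simp
  next
    case (6 j n z t)
    have z: "z \<in> Sg (axis j 1)" using 6(1) zs_Sg by auto
    have t: "t \<in> Sg n" using 6(2) by simp
    have "z \<otimes>\<^bsub>S\<^esub> t \<in> P (axis j 1 + n)" if "1 \<le> (axis j 1 + n) $ i"
    proof (cases "j = i")
      case True
      then have "z \<in> P (axis i 1)" using z sub by auto
      then have "t \<otimes>\<^bsub>S\<^esub> z \<in> P (n + axis i 1)" by (rule gidealD(4)[OF P t])
      then show ?thesis using True Sg_carrier[OF z] Sg_carrier[OF t] by (simp add: m_comm add.commute)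
    next
      case False
      then have "1 \<le> n $ i" using that by (simp add: axis_def)
      then have "t \<in> P n" using 6(2) by simp
      then show ?thesis by (rule gidealD(4)[OF P z])
    qed
    then show ?case using Sg_mult[OF z t] by simp
  qed auto
  then show ?thesis using n by blast
qed

text \<open>
  If \<open>S\<^sub>i\<close> annihilates \<open>m\<close> modulo \<open>N\<close>, then \<open>(N + Sm)/N\<close> is concentrated in degrees with small \<open>i\<close>-th coordinate.
  This covers the primes that contain the irrelevant part of the ring.
\<close>

lemma cyc_ext_vanish:
  assumes N: "gsub N" and m: "m \<in> Mg b" and sub: "Sg (axis i 1) \<subseteq> ann N m b (axis i 1)" and n: "b $ i < n $ i"
  shows "cyc_ext N b m n = N n"
proof
  show "N n \<subseteq> cyc_ext N b m n" using cyc_ext_upper[OF N m] by (simp add: le_fun_def)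
  show "cyc_ext N b m n \<subseteq> N n"
  proof
    fix v assume "v \<in> cyc_ext N b m n"
    from cyc_ext_cases[OF N m this] show "v \<in> N n"
    proof (elim disjE exE conjE)
      fix u s assume 2: "b \<le> n" "u \<in> N n" "s \<in> Sg (n - b)" "v = u \<oplus> s \<odot> m"
      have "Sg (n - b) \<subseteq> ann N m b (n - b)"
        by (rule Sg_subset_gideal[OF gideal_ann[OF N m] sub]) (use n in simp)
      then have "s \<odot> m \<in> N (n - b + b)" using 2(3) by (auto simp: ann_def)
      then show ?thesis using gsubD(3)[OF N 2(2)] 2(4) vec_le_minus_add[OF 2(1)] by simp
    qed
  qed
qed

lemma cyc_ext_vanish_large:
  assumes N: "gsub N" and m: "m \<in> Mg b" and sub: "Sg (axis i 1) \<subseteq> ann N m b (axis i 1)"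
  shows "for_all_large (\<lambda>n. cyc_ext N b m n = N n)"
  unfolding for_all_large_def
proof (intro exI[of _ "Suc (b $ i)"] allI impI)
  fix n :: "nat ^ 'd" assume "\<forall>i'. Suc (b $ i) \<le> n $ i'"
  then have "b $ i < n $ i" by (simp add: Suc_le_eq)
  then show "cyc_ext N b m n = N n" by (rule cyc_ext_vanish[OF N m sub])
qed

text \<open>
  An element outside the prime \<open>P = (N : m)\<close> acts injectively on \<open>(N + Sm)/N\<close>, a shifted copy of \<open>S/P\<close>.
\<close>

lemma cyc_ext_cancel:
  assumes N: "gsub N" and m: "m \<in> Mg b" and P: "gprime (ann N m b)" and x: "x \<in> Sg c" "x \<notin> ann N m b c"
    and v: "v \<in> cyc_ext N b m n" "x \<odot> v \<in> N (c + n)"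
  shows "v \<in> N n"
  using cyc_ext_cases[OF N m v(1)]
proof (elim disjE exE conjE)
  fix u s assume 2: "b \<le> n" "u \<in> N n" "s \<in> Sg (n - b)" "v = u \<oplus> s \<odot> m"
  have mc: "m \<in> carrier M" by (rule Mg_carrier[OF m])
  have xc: "x \<in> carrier S" "s \<in> carrier S" "u \<in> carrier M"
    using Sg_carrier x(1) 2(3) gsub_carrier[OF N 2(2)] by auto
  have sum: "x \<odot> u \<oplus> (x \<otimes>\<^bsub>S\<^esub> s) \<odot> m \<in> N (c + n)"
    using v(2) xc mc by (simp add: 2(4) smult_r_distr smult_assoc1)
  have xu: "x \<odot> u \<in> N (c + n)" by (rule gsubD(4)[OF N x(1) 2(2)])
  have "(x \<otimes>\<^bsub>S\<^esub> s) \<odot> m \<in> carrier M" using xc mc by simp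
  then have "(x \<otimes>\<^bsub>S\<^esub> s) \<odot> m \<in> N (c + n)"
    by (rule Zsub_cancel_left[OF gsub_Zsub[OF N] xu _ sum])
  moreover have deg: "c + n = c + (n - b) + b" using vec_le_minus_add[OF 2(1)] by (simp add: add.assoc)
  ultimately have "x \<otimes>\<^bsub>S\<^esub> s \<in> ann N m b (c + (n - b))" using Sg_mult[OF x(1) 2(3)] by (simp add: ann_def)
  then have "s \<in> ann N m b (n - b)" using gprimeD(3)[OF P x(1) 2(3)] x(2) by blast
  then have "s \<odot> m \<in> N n" using vec_le_minus_add[OF 2(1)] by (simp add: ann_def)
  then show ?thesis using gsubD(3)[OF N 2(2)] 2(4) by simp
qed

lemma cyc_ext_colon:
  assumes N: "gsub N" and m: "m \<in> Mg b" and P: "gprime (ann N m b)" and x: "x \<in> Sg c" "x \<notin> ann N m b c"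
  shows "gcolon x c N (cyc_ext N b m) = N"
proof (rule antisym)
  show "gcolon x c N (cyc_ext N b m) \<le> N"
    using cyc_ext_cancel[OF assms] by (auto simp: le_fun_def gcolon_def preim_def)
  show "N \<le> gcolon x c N (cyc_ext N b m)" by (rule gcolon_ge[OF N x(1) cyc_ext_upper[OF N m]])
qed

lemma cyc_ext_gadd_less:
  assumes N: "gsub N" and m: "m \<in> Mg b" and x: "x \<in> Sg c" "x \<notin> ann N m b c"
  shows "N < gadd x c N (cyc_ext N b m)"
proof -
  note g = cyc_ext_gsub[OF N m]
  have "x \<odot> m \<in> gadd x c N (cyc_ext N b m) (c + b)"
    by (rule gadd_mult[OF x(1) N g cyc_ext_self[OF N m]])
  moreover have "x \<odot> m \<notin> N (c + b)" using x by (simp add: ann_def)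
  ultimately have "N \<noteq> gadd x c N (cyc_ext N b m)" by auto
  then show ?thesis using gadd_upper[OF x(1) N g] by (simp add: less_le)
qed

section \<open>Hilbert polynomials\<close>

definition hilb_fn :: "(nat ^ 'd \<Rightarrow> 'm set) \<Rightarrow> (nat ^ 'd \<Rightarrow> 'm set) \<Rightarrow> nat ^ 'd \<Rightarrow> nat"
  where "hilb_fn N L n = the_enat (len (N n) (L n))"

lemma len_hilb_fn: "gsub N \<Longrightarrow> gsub L \<Longrightarrow> len (N n) (L n) = enat (hilb_fn N L n)"
proof -
  assume N: "gsub N" and L: "gsub L"
  have "len (N n) (L n) \<le> len {\<zero>} (Mg n)"
    using gsubD(1)[OF L] gsubD(2)[OF N] by (intro len_mono) auto
  then have "len (N n) (L n) \<noteq> \<infinity>" using finite_length[of n] by (cases "len (N n) (L n)") auto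
  then show ?thesis by (auto simp: hilb_fn_def)
qed

lemma hilb_fn_add:
  assumes "gsub N" "gsub L" "gsub K" "N \<le> L" "L \<le> K"
  shows "hilb_fn N K n = hilb_fn N L n + hilb_fn L K n"
proof -
  have "len (N n) (K n) = len (N n) (L n) + len (L n) (K n)"
    using assms(4,5) by (intro len_add gsub_Zsub assms(1-3)) (simp_all add: le_fun_def)
  then show ?thesis by (simp add: len_hilb_fn assms)
qed

lemma hilb_fn_same: "hilb_fn N N n = 0" by (simp add: hilb_fn_def len_same zero_enat_def)

lemma hilb_fn_eq_0: "gsub N \<Longrightarrow> gsub L \<Longrightarrow> N \<le> L \<Longrightarrow> hilb_fn N L n = 0 \<longleftrightarrow> N n = L n"
  using len_hilb_fn[of N L n] len_eq_0[OF gsub_Zsub gsub_Zsub, of N L n n] by (simp add: le_fun_def zero_enat_def)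

lemma hilb_fn_gadd:
  assumes x: "x \<in> Sg c" and N: "gsub N" and L: "gsub L" and NL: "N \<le> L" and c: "c \<le> n"
  shows "hilb_fn N L n + hilb_fn N (gcolon x c N L) (n - c) = hilb_fn N L (n - c) + hilb_fn (gadd x c N L) L n"
  using len_gadd[OF assms] by (simp add: len_hilb_fn gsub_gcolon gsub_gadd x N L)

definition is_hilb :: "(nat ^ 'd \<Rightarrow> 'm set) \<Rightarrow> (nat ^ 'd \<Rightarrow> 'm set) \<Rightarrow> (int ^ 'd \<Rightarrow> rat) \<Rightarrow> bool"
  where "is_hilb N L P \<longleftrightarrow> numerical_poly P \<and> for_all_large (\<lambda>n. of_nat (hilb_fn N L n) = P (int_vec n))"

text \<open>
  In the devissage step either some \<open>S\<^sub>i\<close> lies in the prime, and \<open>(N + Sm)/N\<close> vanishes in large degrees, or every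
  direction has a nonzerodivisor \<open>x\<close> on it.  Then the difference in that direction is the Hilbert function of
  \<open>(N + Sm)/(N + x(N + Sm))\<close>, known by induction, and one integrates.
\<close>

theorem hilbert_exists:
  assumes "gsub N" "gsub L" "N \<le> L"
  shows "\<exists>P. is_hilb N L P"
proof (rule devissage[of "\<lambda>N L. \<exists>P. is_hilb N L P"])
  fix N assume "gsub N"
  then show "\<exists>P. is_hilb N N P"
    using numerical_poly_const[of 0] by (intro exI[of _ "\<lambda>_. 0"]) (simp add: is_hilb_def hilb_fn_same for_all_large_def)
next
  fix N L b m
  assume N: "gsub N" and L: "gsub L" and NL: "N \<le> L" and m: "m \<in> L b" "m \<notin> N b" and P: "gprime (ann N m b)"
    and IH: "\<And>N' L'. gsub N' \<Longrightarrow> gsub L' \<Longrightarrow> N' \<le> L' \<Longrightarrow> N < N' \<Longrightarrow> \<exists>P. is_hilb N' L' P"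
  have mM: "m \<in> Mg b" by (rule gsubD(1)[OF L m(1)])
  let ?L1 = "cyc_ext N b m"
  note g1 = cyc_ext_gsub[OF N mM] and NL1 = cyc_ext_upper[OF N mM] and L1L = cyc_ext_least[OF L NL m(1)]
  obtain P2 where P2: "is_hilb ?L1 L P2" using IH[OF g1 L L1L cyc_ext_less[OF N mM m(2)]] by blast
  have "\<exists>P1. is_hilb N ?L1 P1"
  proof (cases "\<exists>i. Sg (axis i 1) \<subseteq> ann N m b (axis i 1)")
    case True
    then obtain i where "Sg (axis i 1) \<subseteq> ann N m b (axis i 1)" by blast
    from cyc_ext_vanish_large[OF N mM this] have "for_all_large (\<lambda>n. hilb_fn N ?L1 n = 0)"
      by (rule for_all_large_mono) (simp add: hilb_fn_def len_same zero_enat_def)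
    then have "is_hilb N ?L1 (\<lambda>_. 0)"
      unfolding is_hilb_def using numerical_poly_const[of 0] for_all_large_mono by fastforce
    then show ?thesis by blast
  next
    case False
    have "\<exists>Q. numerical_poly Q \<and> for_all_large (\<lambda>n. of_int (int (hilb_fn N ?L1 n) - int (hilb_fn N ?L1 (n - axis i 1))) = Q (int_vec n))" for i
    proof -
      from False obtain x where x: "x \<in> Sg (axis i 1)" "x \<notin> ann N m b (axis i 1)" by blast
      note g2 = gsub_gadd[OF x(1) N g1]
      obtain Q where Q: "is_hilb (gadd x (axis i 1) N ?L1) ?L1 Q"
        using IH[OF g2 g1 gadd_least[OF x(1) g1 NL1] cyc_ext_gadd_less[OF N mM x]] by blast
      have eq: "hilb_fn N ?L1 n = hilb_fn N ?L1 (n - axis i 1) + hilb_fn (gadd x (axis i 1) N ?L1) ?L1 n" if "axis i 1 \<le> n" for n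
        using hilb_fn_gadd[OF x(1) N g1 NL1 that] by (simp add: cyc_ext_colon[OF N mM P x] hilb_fn_same)
      have "for_all_large (\<lambda>n. of_int (int (hilb_fn N ?L1 n) - int (hilb_fn N ?L1 (n - axis i 1))) = Q (int_vec n))"
        using for_all_large_conj[OF for_all_large_ge[of "axis i 1"] Q[unfolded is_hilb_def, THEN conjunct2]]
        by (rule for_all_large_mono) (simp add: eq)
      then show ?thesis using Q unfolding is_hilb_def by blast
    qed
    from numerical_poly_integrate[OF this] show ?thesis unfolding is_hilb_def by simp
  qed
  then obtain P1 where P1: "is_hilb N ?L1 P1" by blast
  have "is_hilb N L (\<lambda>n. P1 n + P2 n)"
    unfolding is_hilb_def
  proof
    show "numerical_poly (\<lambda>n. P1 n + P2 n)" using P1 P2 unfolding is_hilb_def by (blast intro: numerical_poly_add)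
    show "for_all_large (\<lambda>n. of_nat (hilb_fn N L n) = P1 (int_vec n) + P2 (int_vec n))"
      using for_all_large_conj[OF P1[unfolded is_hilb_def, THEN conjunct2] P2[unfolded is_hilb_def, THEN conjunct2]]
      by (rule for_all_large_mono) (simp add: hilb_fn_add[OF N g1 L NL1 L1L])
  qed
  then show "\<exists>P. is_hilb N L P" by blast
qed (use assms in auto)

lemma is_hilb_sep: "is_hilb N L P \<Longrightarrow> sep_poly P"
  unfolding is_hilb_def using numerical_poly_polynomial_fun sep_poly_polynomial_fun by blast

lemma is_hilb_unique: "is_hilb N L P \<Longrightarrow> is_hilb N L Q \<Longrightarrow> P = Q"
proof -
  assume P: "is_hilb N L P" and Q: "is_hilb N L Q"
  show ?thesis
    using for_all_large_conj[OF P[unfolded is_hilb_def, THEN conjunct2] Q[unfolded is_hilb_def, THEN conjunct2]]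
    by (intro sep_poly_eq is_hilb_sep[OF P] is_hilb_sep[OF Q]) (auto elim: for_all_large_mono)
qed

definition hilb_poly :: "(nat ^ 'd \<Rightarrow> 'm set) \<Rightarrow> (nat ^ 'd \<Rightarrow> 'm set) \<Rightarrow> int ^ 'd \<Rightarrow> rat"
  where "hilb_poly N L = (SOME P. is_hilb N L P)"

lemma hilb_poly: "gsub N \<Longrightarrow> gsub L \<Longrightarrow> N \<le> L \<Longrightarrow> is_hilb N L (hilb_poly N L)"
  unfolding hilb_poly_def using someI_ex[OF hilbert_exists] .

lemma hilb_poly_eqI: "gsub N \<Longrightarrow> gsub L \<Longrightarrow> N \<le> L \<Longrightarrow> numerical_poly P \<Longrightarrow>
   for_all_large (\<lambda>n. of_nat (hilb_fn N L n) = P (int_vec n)) \<Longrightarrow> hilb_poly N L = P"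
  using is_hilb_unique[OF hilb_poly] unfolding is_hilb_def by blast

lemma hilb_poly_add:
  assumes "gsub N" "gsub L" "gsub K" "N \<le> L" "L \<le> K"
  shows "hilb_poly N K = (\<lambda>n. hilb_poly N L n + hilb_poly L K n)"
proof (rule hilb_poly_eqI)
  note 1 = hilb_poly[OF assms(1,2,4)] and 2 = hilb_poly[OF assms(2,3,5)]
  show "numerical_poly (\<lambda>n. hilb_poly N L n + hilb_poly L K n)"
    using 1 2 unfolding is_hilb_def by (blast intro: numerical_poly_add)
  show "for_all_large (\<lambda>n. of_nat (hilb_fn N K n) = hilb_poly N L (int_vec n) + hilb_poly L K (int_vec n))"
    using for_all_large_conj[OF 1[unfolded is_hilb_def, THEN conjunct2] 2[unfolded is_hilb_def, THEN conjunct2]]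
    by (rule for_all_large_mono) (simp add: hilb_fn_add[OF assms])
qed (use assms in auto)

lemma hilb_poly_zero: "gsub N \<Longrightarrow> gsub L \<Longrightarrow> N \<le> L \<Longrightarrow> for_all_large (\<lambda>n. L n = N n) \<Longrightarrow> hilb_poly N L = (\<lambda>_. 0)"
proof (rule hilb_poly_eqI)
  assume "for_all_large (\<lambda>n. L n = N n)"
  then show "for_all_large (\<lambda>n. rat_of_nat (hilb_fn N L n) = 0)"
    by (rule for_all_large_mono) (simp add: hilb_fn_def len_same zero_enat_def)
  show "numerical_poly (\<lambda>_. 0 :: rat)" using numerical_poly_const[of 0] by simp
qed auto

text \<open>
  The identity of lengths of \<open>len_gadd\<close> holds in all large degrees, hence between the polynomials; the last term measures how far \<open>x\<close> is from being
  filter-regular.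
\<close>

theorem hilb_poly_unit_difference:
  assumes x: "x \<in> Sg (axis i 1)" and N: "gsub N" and L: "gsub L" and NL: "N \<le> L"
  shows "unit_difference i (hilb_poly N L) =
    (\<lambda>n. hilb_poly (gadd x (axis i 1) N L) L n - hilb_poly N (gcolon x (axis i 1) N L) (n - axis i 1))"
proof -
  let ?K = "gcolon x (axis i 1) N L" and ?A = "gadd x (axis i 1) N L"
  note gK = gsub_gcolon[OF x N L] and gA = gsub_gadd[OF x N L]
  note h1 = hilb_poly[OF N L NL] and h2 = hilb_poly[OF gA L gadd_least[OF x L NL]] and h3 = hilb_poly[OF N gK gcolon_ge[OF N x NL]]
  have shift: "(\<lambda>n. hilb_poly N ?K (n - axis i 1)) = (\<lambda>n. hilb_poly N ?K n - unit_difference i (hilb_poly N ?K) n)"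
    by (simp add: unit_difference_def)
  show ?thesis
  proof (rule sep_poly_eq)
    show "sep_poly (unit_difference i (hilb_poly N L))" by (intro sep_poly_unit_difference is_hilb_sep[OF h1])
    have "sep_poly (\<lambda>n. hilb_poly N ?K (n - axis i 1))" unfolding shift
      by (intro sep_poly_diff is_hilb_sep[OF h3] sep_poly_unit_difference)
    then show "sep_poly (\<lambda>n. hilb_poly ?A L n - hilb_poly N ?K (n - axis i 1))"
      by (intro sep_poly_diff[OF is_hilb_sep[OF h2]])
    let ?l = "\<lambda>N L n. rat_of_nat (hilb_fn N L n) = hilb_poly N L (int_vec n)"
    have L1: "for_all_large (?l N L)" and L2: "for_all_large (?l ?A L)" and L3: "for_all_large (?l N ?K)"
      using h1 h2 h3 by (auto simp: is_hilb_def)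
    have "for_all_large (\<lambda>n. axis i 1 \<le> n \<and> ?l N L n \<and> ?l N L (n - axis i 1) \<and> ?l ?A L n \<and> ?l N ?K (n - axis i 1))"
      by (intro for_all_large_conj for_all_large_ge L1 L2 L3 for_all_large_minus[OF L1] for_all_large_minus[OF L3])
    then show "for_all_large (\<lambda>n. unit_difference i (hilb_poly N L) (int_vec n) =
        hilb_poly ?A L (int_vec n) - hilb_poly N ?K (int_vec n - axis i 1))"
    proof (rule for_all_large_mono)
      fix n :: "nat ^ 'd"
      assume *: "axis i 1 \<le> n \<and> ?l N L n \<and> ?l N L (n - axis i 1) \<and> ?l ?A L n \<and> ?l N ?K (n - axis i 1)"
      then have "hilb_fn N L n + hilb_fn N ?K (n - axis i 1) = hilb_fn N L (n - axis i 1) + hilb_fn ?A L n"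
        by (intro hilb_fn_gadd[OF x N L NL]) auto
      then have "rat_of_nat (hilb_fn N L n) + rat_of_nat (hilb_fn N ?K (n - axis i 1)) =
          rat_of_nat (hilb_fn N L (n - axis i 1)) + rat_of_nat (hilb_fn ?A L n)" by (metis of_nat_add)
      moreover have "int_vec (n - axis i 1) = int_vec n - axis i 1" using * by (simp add: int_vec_minus)
      ultimately show "unit_difference i (hilb_poly N L) (int_vec n) =
        hilb_poly ?A L (int_vec n) - hilb_poly N ?K (int_vec n - axis i 1)"
        using * by (simp add: unit_difference_def algebra_simps)
    qed
  qed
qed

section \<open>Relevant support\<close>

text \<open>
  By \<open>Sg_subset_gideal\<close>, a graded prime contains all elements of degree at least \<open>(1,\<dots>,1)\<close> as soon as it
  contains some \<open>S\<^sub>i\<close>; a product of elements outside it, one from each \<open>S\<^sub>i\<close>, gives the converse.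
\<close>

definition relevant :: "(nat ^ 'd \<Rightarrow> 'a set) \<Rightarrow> bool"
  where "relevant P \<longleftrightarrow> gprime P \<and> (\<forall>i. \<not> Sg (axis i 1) \<subseteq> P (axis i 1))"

text \<open>
  The support of \<open>L/N\<close>: the localization at \<open>P\<close> is nonzero iff \<open>P\<close> contains the annihilator of some homogeneous
  element.
\<close>

definition relevant_supp :: "(nat ^ 'd \<Rightarrow> 'm set) \<Rightarrow> (nat ^ 'd \<Rightarrow> 'm set) \<Rightarrow> (nat ^ 'd \<Rightarrow> 'a set) set"
  where "relevant_supp N L = {P. relevant P \<and> (\<exists>b. \<exists>m\<in>L b. ann N m b \<le> P)}"

text \<open>
  Dimension at most zero: no strict inclusions in the support.
\<close>

definition dim_le_0 :: "(nat ^ 'd \<Rightarrow> 'm set) \<Rightarrow> (nat ^ 'd \<Rightarrow> 'm set) \<Rightarrow> bool"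
  where "dim_le_0 N L \<longleftrightarrow> (\<forall>P\<in>relevant_supp N L. \<forall>Q\<in>relevant_supp N L. P \<le> Q \<longrightarrow> P = Q)"

lemma relevant_supp_mono: "N \<le> N' \<Longrightarrow> L' \<le> L \<Longrightarrow> relevant_supp N' L' \<subseteq> relevant_supp N L"
proof
  fix P assume le: "N \<le> N'" "L' \<le> L" and P: "P \<in> relevant_supp N' L'"
  then obtain b m where m: "m \<in> L' b" "ann N' m b \<le> P" unfolding relevant_supp_def by blast
  have "ann N m b \<le> P" using ann_mono[OF le(1)] m(2) by (rule order_trans)
  moreover have "m \<in> L b" using m(1) le(2) unfolding le_fun_def by blast
  ultimately show "P \<in> relevant_supp N L" using P unfolding relevant_supp_def by blast
qed

lemma dim_le_0_mono: "relevant_supp N' L' \<subseteq> relevant_supp N L \<Longrightarrow> dim_le_0 N L \<Longrightarrow> dim_le_0 N' L'"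
  unfolding dim_le_0_def by blast

lemma large_eq_trans:
  "for_all_large (\<lambda>n. K n = N n) \<Longrightarrow> for_all_large (\<lambda>n. L n = K n) \<Longrightarrow> for_all_large (\<lambda>n. L n = N n)"
  by (drule (1) for_all_large_conj, erule for_all_large_mono) simp

text \<open>
  In the devissage step the prime \<open>(N : m)\<close> is not relevant, so it contains some \<open>S\<^sub>i\<close>.
\<close>

theorem relevant_supp_empty:
  assumes "gsub N" "gsub L" "N \<le> L" "relevant_supp N L = {}"
  shows "for_all_large (\<lambda>n. L n = N n)"
proof -
  have "relevant_supp N L = {} \<longrightarrow> for_all_large (\<lambda>n. L n = N n)"
  proof (rule devissage[of "\<lambda>N L. relevant_supp N L = {} \<longrightarrow> for_all_large (\<lambda>n. L n = N n)"])
    fix N L b m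
    assume N: "gsub N" and L: "gsub L" and NL: "N \<le> L" and m: "m \<in> L b" "m \<notin> N b" and P: "gprime (ann N m b)"
      and IH: "\<And>N' L'. gsub N' \<Longrightarrow> gsub L' \<Longrightarrow> N' \<le> L' \<Longrightarrow> N < N' \<Longrightarrow>
        relevant_supp N' L' = {} \<longrightarrow> for_all_large (\<lambda>n. L' n = N' n)"
    have mM: "m \<in> Mg b" by (rule gsubD(1)[OF L m(1)])
    let ?L1 = "cyc_ext N b m"
    note g1 = cyc_ext_gsub[OF N mM] and NL1 = cyc_ext_upper[OF N mM] and L1L = cyc_ext_least[OF L NL m(1)]
    show "relevant_supp N L = {} \<longrightarrow> for_all_large (\<lambda>n. L n = N n)"
    proof
      assume empty: "relevant_supp N L = {}"
      have "relevant_supp ?L1 L = {}" using relevant_supp_mono[OF NL1 order_refl] empty by blast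
      then have 1: "for_all_large (\<lambda>n. L n = ?L1 n)" using IH[OF g1 L L1L cyc_ext_less[OF N mM m(2)]] by blast
      have "ann N m b \<notin> relevant_supp N L" using empty by simp
      then obtain i where "Sg (axis i 1) \<subseteq> ann N m b (axis i 1)"
        using P m(1) unfolding relevant_supp_def relevant_def by blast
      from cyc_ext_vanish_large[OF N mM this] have 2: "for_all_large (\<lambda>n. ?L1 n = N n)" .
      show "for_all_large (\<lambda>n. L n = N n)" by (rule large_eq_trans[OF 2 1])
    qed
  qed (use assms in \<open>simp_all add: for_all_large_def\<close>)
  then show ?thesis using assms(4) by blast
qed

text \<open>
  In the devissage step let \<open>P = (N : m)\<close> be relevant and \<open>x \<in> S\<^sub>i - P\<close>.  A prime in the support of
  \<open>(N + Sm)/(N + x(N + Sm))\<close> contains \<open>P\<close> and \<open>x\<close>, hence is strictly larger than \<open>P\<close>, and both lie in the support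
  of \<open>L/N\<close>.  So that support is empty, and the difference of the Hilbert polynomial in direction \<open>i\<close> is zero.
\<close>

theorem dim_le_0_hilb_poly_const:
  assumes "gsub N" "gsub L" "N \<le> L" "dim_le_0 N L"
  shows "\<exists>c. \<forall>n. hilb_poly N L n = c"
proof -
  have "dim_le_0 N L \<longrightarrow> (\<exists>c. \<forall>n. hilb_poly N L n = c)"
  proof (rule devissage[of "\<lambda>N L. dim_le_0 N L \<longrightarrow> (\<exists>c. \<forall>n. hilb_poly N L n = c)"])
    fix N assume "gsub N"
    then show "dim_le_0 N N \<longrightarrow> (\<exists>c. \<forall>n. hilb_poly N N n = c)"
      using hilb_poly_zero[of N N] by (simp add: for_all_large_def)
  next
    fix N L b m
    assume N: "gsub N" and L: "gsub L" and NL: "N \<le> L" and m: "m \<in> L b" "m \<notin> N b" and P: "gprime (ann N m b)"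
      and IH: "\<And>N' L'. gsub N' \<Longrightarrow> gsub L' \<Longrightarrow> N' \<le> L' \<Longrightarrow> N < N' \<Longrightarrow>
        dim_le_0 N' L' \<longrightarrow> (\<exists>c. \<forall>n. hilb_poly N' L' n = c)"
    have mM: "m \<in> Mg b" by (rule gsubD(1)[OF L m(1)])
    have mc: "m \<in> carrier M" by (rule Mg_carrier[OF mM])
    let ?L1 = "cyc_ext N b m"
    note g1 = cyc_ext_gsub[OF N mM] and NL1 = cyc_ext_upper[OF N mM] and L1L = cyc_ext_least[OF L NL m(1)]
    show "dim_le_0 N L \<longrightarrow> (\<exists>c. \<forall>n. hilb_poly N L n = c)"
    proof
      assume dim: "dim_le_0 N L"
      have "dim_le_0 ?L1 L" by (rule dim_le_0_mono[OF relevant_supp_mono[OF NL1 order_refl] dim])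
      then obtain c2 where c2: "\<And>n. hilb_poly ?L1 L n = c2" using IH[OF g1 L L1L cyc_ext_less[OF N mM m(2)]] by blast
      have "\<exists>c1. \<forall>n. hilb_poly N ?L1 n = c1"
      proof (cases "\<exists>i. Sg (axis i 1) \<subseteq> ann N m b (axis i 1)")
        case True
        then obtain i where "Sg (axis i 1) \<subseteq> ann N m b (axis i 1)" by blast
        from hilb_poly_zero[OF N g1 NL1 cyc_ext_vanish_large[OF N mM this]] show ?thesis by simp
      next
        case False
        then have rel: "relevant (ann N m b)" using P unfolding relevant_def by blast
        then have PS: "ann N m b \<in> relevant_supp N L" using m(1) unfolding relevant_supp_def by blast
        show ?thesis
        proof (rule numerical_poly_constI)
          show "numerical_poly (hilb_poly N ?L1)" using hilb_poly[OF N g1 NL1] by (simp add: is_hilb_def)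
          fix i
          from False obtain x where x: "x \<in> Sg (axis i 1)" "x \<notin> ann N m b (axis i 1)" by blast
          let ?A = "gadd x (axis i 1) N ?L1"
          note gA = gsub_gadd[OF x(1) N g1] and NA = gadd_upper[OF x(1) N g1] and AL = gadd_least[OF x(1) g1 NL1]
          have "relevant_supp ?A ?L1 = {}"
          proof (rule ccontr)
            assume "relevant_supp ?A ?L1 \<noteq> {}"
            then obtain Q b' m' where Q: "relevant Q" and m': "m' \<in> ?L1 b'" "ann ?A m' b' \<le> Q"
              unfolding relevant_supp_def by blast
            have "Q \<in> relevant_supp ?A ?L1" using Q m' unfolding relevant_supp_def by blast
            then have QS: "Q \<in> relevant_supp N L" using relevant_supp_mono[OF NA L1L] by blast
            have "ann N m b \<le> Q"
            proof (rule order_trans[OF _ m'(2)], unfold le_fun_def, intro allI subsetI)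
              fix n s assume "s \<in> ann N m b n"
              then have s: "s \<in> Sg n" "s \<odot> m \<in> N (n + b)" by (auto simp: ann_def)
              have "s \<odot> m' \<in> N (n + b')"
                using cyc_ext_cases[OF N mM m'(1)]
              proof (elim disjE exE conjE)
                assume "m' \<in> N b'"
                then show ?thesis by (rule gsubD(4)[OF N s(1)])
              next
                fix u t assume t: "b \<le> b'" "u \<in> N b'" "t \<in> Sg (b' - b)" "m' = u \<oplus> t \<odot> m"
                have car: "s \<in> carrier S" "t \<in> carrier S" "u \<in> carrier M"
                  using Sg_carrier[OF s(1)] Sg_carrier[OF t(3)] gsub_carrier[OF N t(2)] by auto
                have "s \<odot> m' = s \<odot> u \<oplus> t \<odot> (s \<odot> m)"
                  using car mc by (simp add: t(4) smult_r_distr smult_assoc1[symmetric] m_comm)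
                moreover have "s \<odot> u \<in> N (n + b')" by (rule gsubD(4)[OF N s(1) t(2)])
                moreover have "t \<odot> (s \<odot> m) \<in> N (n + b')"
                  by (rule gsub_smult_deg[OF N t(3) s(2)])
                    (use vec_le_minus_add[OF t(1)] in \<open>simp add: add.left_commute\<close>)
                ultimately show ?thesis using gsubD(3)[OF N] by simp
              qed
              then have "s \<odot> m' \<in> ?A (n + b')" using NA unfolding le_fun_def by blast
              then show "s \<in> ann ?A m' b' n" using s(1) by (simp add: ann_def)
            qed
            then have eq: "ann N m b = Q" using dim PS QS unfolding dim_le_0_def by blast
            have "x \<odot> m' \<in> ?A (axis i 1 + b')" by (rule gadd_mult[OF x(1) N g1 m'(1)])
            then have "x \<in> ann ?A m' b' (axis i 1)" using x(1) by (simp add: ann_def)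
            then have "x \<in> Q (axis i 1)" using m'(2) unfolding le_fun_def by blast
            then show False using x(2) eq by blast
          qed
          from hilb_poly_zero[OF gA g1 AL relevant_supp_empty[OF gA g1 AL this]] have "hilb_poly ?A ?L1 = (\<lambda>_. 0)" .
          moreover have "hilb_poly N N = (\<lambda>_. 0)" by (rule hilb_poly_zero[OF N N order_refl]) (simp add: for_all_large_def)
          ultimately show "unit_difference i (hilb_poly N ?L1) = (\<lambda>_. 0)"
            by (simp add: hilb_poly_unit_difference[OF x(1) N g1 NL1] cyc_ext_colon[OF N mM P x])
        qed
      qed
      then obtain c1 where "\<And>n. hilb_poly N ?L1 n = c1" by blast
      then have "\<forall>n. hilb_poly N L n = c1 + c2" using c2 by (simp add: hilb_poly_add[OF N g1 L NL1 L1L])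
      then show "\<exists>c. \<forall>n. hilb_poly N L n = c" by blast
    qed
  qed (use assms in simp_all)
  then show ?thesis using assms(4) by blast
qed

text \<open>
  The finite set consists of the relevant primes \<open>(N : m)\<close> met in the devissage.
\<close>

theorem filter_regular_primes:
  assumes "gsub N" "gsub L" "N \<le> L"
  shows "\<exists>F. finite F \<and> (\<forall>P\<in>F. relevant P) \<and>
    (\<forall>c. \<forall>x\<in>Sg c. (\<forall>P\<in>F. x \<notin> P c) \<longrightarrow> for_all_large (\<lambda>n. gcolon x c N L n \<subseteq> N n))"
proof (rule devissage[of "\<lambda>N L. \<exists>F. finite F \<and> (\<forall>P\<in>F. relevant P) \<and>
    (\<forall>c. \<forall>x\<in>Sg c. (\<forall>P\<in>F. x \<notin> P c) \<longrightarrow> for_all_large (\<lambda>n. gcolon x c N L n \<subseteq> N n))"])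
  fix N assume "gsub N"
  have "gcolon x c N N n \<subseteq> N n" for x c n by (auto simp: gcolon_def preim_def)
  then show "\<exists>F. finite F \<and> (\<forall>P\<in>F. relevant P) \<and>
    (\<forall>c. \<forall>x\<in>Sg c. (\<forall>P\<in>F. x \<notin> P c) \<longrightarrow> for_all_large (\<lambda>n. gcolon x c N N n \<subseteq> N n))"
    by (intro exI[of _ "{}"]) (simp add: for_all_large_def)
next
  fix N L b m
  assume N: "gsub N" and L: "gsub L" and NL: "N \<le> L" and m: "m \<in> L b" "m \<notin> N b" and P: "gprime (ann N m b)"
    and IH: "\<And>N' L'. gsub N' \<Longrightarrow> gsub L' \<Longrightarrow> N' \<le> L' \<Longrightarrow> N < N' \<Longrightarrow>
      \<exists>F. finite F \<and> (\<forall>P\<in>F. relevant P) \<and>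
    (\<forall>c. \<forall>x\<in>Sg c. (\<forall>P\<in>F. x \<notin> P c) \<longrightarrow> for_all_large (\<lambda>n. gcolon x c N' L' n \<subseteq> N' n))"
  have mM: "m \<in> Mg b" by (rule gsubD(1)[OF L m(1)])
  let ?L1 = "cyc_ext N b m"
  note g1 = cyc_ext_gsub[OF N mM] and NL1 = cyc_ext_upper[OF N mM] and L1L = cyc_ext_least[OF L NL m(1)]
  from IH[OF g1 L L1L cyc_ext_less[OF N mM m(2)]] obtain F where F: "finite F" "\<forall>P\<in>F. relevant P"
    and reg: "\<forall>c. \<forall>x\<in>Sg c. (\<forall>P\<in>F. x \<notin> P c) \<longrightarrow> for_all_large (\<lambda>n. gcolon x c ?L1 L n \<subseteq> ?L1 n)" by blast
  have sub: "gcolon x c N L n \<subseteq> gcolon x c ?L1 L n" for x c n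
    using gcolon_mono[OF NL1] by (simp add: le_fun_def)
  show "\<exists>F. finite F \<and> (\<forall>P\<in>F. relevant P) \<and>
    (\<forall>c. \<forall>x\<in>Sg c. (\<forall>P\<in>F. x \<notin> P c) \<longrightarrow> for_all_large (\<lambda>n. gcolon x c N L n \<subseteq> N n))"
  proof (cases "\<exists>i. Sg (axis i 1) \<subseteq> ann N m b (axis i 1)")
    case True
    then obtain i where i: "Sg (axis i 1) \<subseteq> ann N m b (axis i 1)" by blast
    have "for_all_large (\<lambda>n. gcolon x c N L n \<subseteq> N n)" if "x \<in> Sg c" "\<forall>P\<in>F. x \<notin> P c" for c x
    proof -
      have "for_all_large (\<lambda>n. gcolon x c ?L1 L n \<subseteq> ?L1 n)" using reg that by blast
      from for_all_large_conj[OF this cyc_ext_vanish_large[OF N mM i]] show ?thesis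
        by (rule for_all_large_mono) (use sub in blast)
    qed
    then show ?thesis using F by blast
  next
    case False
    then have rel: "relevant (ann N m b)" using P unfolding relevant_def by blast
    have "for_all_large (\<lambda>n. gcolon x c N L n \<subseteq> N n)" if x: "x \<in> Sg c" "\<forall>P\<in>insert (ann N m b) F. x \<notin> P c" for c x
    proof -
      have "for_all_large (\<lambda>n. gcolon x c ?L1 L n \<subseteq> ?L1 n)" using reg x by blast
      then show ?thesis
      proof (rule for_all_large_mono)
        fix n assume le: "gcolon x c ?L1 L n \<subseteq> ?L1 n"
        show "gcolon x c N L n \<subseteq> N n"
        proof
          fix v assume v: "v \<in> gcolon x c N L n"
          then have "v \<in> ?L1 n" using sub[of x c n] le by blast
          then show "v \<in> N n"
            by (rule cyc_ext_cancel[OF N mM P x(1), rotated]) (use v x in \<open>auto simp: gcolon_def preim_def\<close>)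
        qed
      qed
    qed
    moreover have "finite (insert (ann N m b) F)" "\<forall>P\<in>insert (ann N m b) F. relevant P" using F rel by auto
    ultimately show ?thesis by blast
  qed
qed (use assms in simp_all)

section \<open>Nakayama's lemma for the relevant support\<close>

text \<open>
  The kernel of the map from \<open>L\<close> to the localization of \<open>L/K\<close> at \<open>P\<close>.
\<close>

definition saturation :: "(nat ^ 'd \<Rightarrow> 'a set) \<Rightarrow> (nat ^ 'd \<Rightarrow> 'm set) \<Rightarrow> (nat ^ 'd \<Rightarrow> 'm set) \<Rightarrow> nat ^ 'd \<Rightarrow> 'm set"
  where "saturation P K L n = {v \<in> L n. \<exists>a. \<exists>u\<in>Sg a. u \<notin> P a \<and> u \<odot> v \<in> K (a + n)}"

lemma saturation_le: "saturation P K L \<le> L"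
  by (auto simp: saturation_def le_fun_def)

lemma saturation_upper:
  assumes "gprime P" "gsub K" "K \<le> L"
  shows "K \<le> saturation P K L"
  unfolding le_fun_def
proof (intro allI subsetI)
  fix n v assume v: "v \<in> K n"
  have "\<one>\<^bsub>S\<^esub> \<odot> v \<in> K (0 + n)" using v gsub_carrier[OF assms(2) v] by simp
  then show "v \<in> saturation P K L n"
    unfolding saturation_def using v assms(3) one_Sg gprimeD(2)[OF assms(1)] unfolding le_fun_def by blast
qed

lemma gsub_saturation:
  assumes prime: "gprime P" and K: "gsub K" and L: "gsub L"
  shows "gsub (saturation P K L)"
proof (rule gsubI)
    show "saturation P K L n \<subseteq> Mg n" for n unfolding saturation_def using gsubD(1)[OF L] by blast
    show "\<zero> \<in> saturation P K L n" for n using gprimeD(2)[OF prime] one_Sg gsubD(2)[OF L] gsubD(2)[OF K, of "0 + n"]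
    unfolding saturation_def by (auto intro!: exI[of _ 0] bexI[of _ "\<one>\<^bsub>S\<^esub>"] simp del: add_0)
    show "x \<oplus> y \<in> saturation P K L n" if x: "x \<in> saturation P K L n" and y: "y \<in> saturation P K L n" for n x y
    proof -
      from x obtain a u where u: "x \<in> L n" "u \<in> Sg a" "u \<notin> P a" "u \<odot> x \<in> K (a + n)" unfolding saturation_def by blast
      from y obtain c w where w: "y \<in> L n" "w \<in> Sg c" "w \<notin> P c" "w \<odot> y \<in> K (c + n)" unfolding saturation_def by blast
      have car: "u \<in> carrier S" "w \<in> carrier S" "x \<in> carrier M" "y \<in> carrier M"
        using Sg_carrier[OF u(2)] Sg_carrier[OF w(2)] gsub_carrier[OF L u(1)] gsub_carrier[OF L w(1)] by auto
      have nP: "u \<otimes>\<^bsub>S\<^esub> w \<notin> P (a + c)" using gprimeD(3)[OF prime u(2) w(2)] u(3) w(3) by blast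
      have "(u \<otimes>\<^bsub>S\<^esub> w) \<odot> (x \<oplus> y) = w \<odot> (u \<odot> x) \<oplus> u \<odot> (w \<odot> y)"
        using car by (simp add: smult_r_distr smult_assoc1[symmetric] m_comm)
      moreover have "w \<odot> (u \<odot> x) \<in> K (a + c + n)"
        by (rule gsub_smult_deg[OF K w(2) u(4)]) (simp add: ac_simps)
      moreover have "u \<odot> (w \<odot> y) \<in> K (a + c + n)"
        by (rule gsub_smult_deg[OF K u(2) w(4)]) (simp add: ac_simps)
      ultimately have "(u \<otimes>\<^bsub>S\<^esub> w) \<odot> (x \<oplus> y) \<in> K (a + c + n)" using gsubD(3)[OF K] by simp
      then show ?thesis unfolding saturation_def using nP Sg_mult[OF u(2) w(2)] gsubD(3)[OF L u(1) w(1)] by blast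
    qed
    show "s \<odot> x \<in> saturation P K L (a + n)" if s: "s \<in> Sg a" and x: "x \<in> saturation P K L n" for a n s x
    proof -
      from x obtain c u where u: "x \<in> L n" "u \<in> Sg c" "u \<notin> P c" "u \<odot> x \<in> K (c + n)" unfolding saturation_def by blast
      have "u \<odot> (s \<odot> x) = s \<odot> (u \<odot> x)"
        using Sg_carrier[OF u(2)] Sg_carrier[OF s] gsub_carrier[OF L u(1)]
        by (simp add: smult_assoc1[symmetric] m_comm)
      moreover have "s \<odot> (u \<odot> x) \<in> K (c + (a + n))"
        by (rule gsub_smult_deg[OF K s u(4)]) (simp add: ac_simps)
      ultimately have "u \<odot> (s \<odot> x) \<in> K (c + (a + n))" by simp
      then show ?thesis unfolding saturation_def using u(2,3) gsubD(4)[OF L s u(1)] by blast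
    qed
  qed

lemma saturation_ann:
  assumes prime: "gprime P" and K: "gsub K" and L: "gsub L" and m: "m \<in> L b" "ann K m b \<le> P"
  shows "ann (saturation P K L) m b \<le> P"
    unfolding le_fun_def
proof (intro allI subsetI)
    have mc: "m \<in> carrier M" by (rule gsub_carrier[OF L m(1)])
    fix n s assume "s \<in> ann (saturation P K L) m b n"
    then have s: "s \<in> Sg n" "s \<odot> m \<in> saturation P K L (n + b)" by (auto simp: ann_def)
    from s(2) obtain a u where u: "u \<in> Sg a" "u \<notin> P a" "u \<odot> (s \<odot> m) \<in> K (a + (n + b))"
      unfolding saturation_def by blast
    have "(u \<otimes>\<^bsub>S\<^esub> s) \<odot> m \<in> K (a + n + b)"
      using u(3) Sg_carrier[OF u(1)] Sg_carrier[OF s(1)] mc by (simp add: smult_assoc1 add.assoc)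
    then have "u \<otimes>\<^bsub>S\<^esub> s \<in> ann K m b (a + n)" using Sg_mult[OF u(1) s(1)] by (simp add: ann_def)
    then have "u \<otimes>\<^bsub>S\<^esub> s \<in> P (a + n)" using m(2) unfolding le_fun_def by blast
    then show "s \<in> P n" using gprimeD(3)[OF prime u(1) s(1)] u(2) by blast
  qed

text \<open>
  If \<open>P\<close> is in the support of \<open>L/N\<close>, then it is in the support of \<open>L/(N + PL)\<close>.  Take \<open>K\<close> maximal between \<open>N\<close> and \<open>L\<close>
  with \<open>P\<close> in the support of \<open>L/K\<close>.  Then \<open>K\<close> is saturated, and the localization of \<open>L/K\<close> at \<open>P\<close> is simple,
  generated by some \<open>m\<close>.  Elements of \<open>P\<close> kill \<open>m\<close>, for otherwise \<open>xm\<close> would generate as well and \<open>u - sx \<notin> P\<close>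
  would annihilate \<open>m\<close>.  Hence \<open>PL \<le> K\<close>.
\<close>

lemma support_nakayama:
  assumes N: "gsub N" and L: "gsub L" and NL: "N \<le> L" and P: "P \<in> relevant_supp N L"
  shows "\<exists>K b. gsub K \<and> N \<le> K \<and> K \<le> L \<and> (\<exists>m\<in>L b. ann K m b \<le> P) \<and>
    (\<forall>a n. \<forall>x\<in>P a. \<forall>v\<in>L n. x \<odot> v \<in> K (a + n))"
proof -
  have prime: "gprime P" using P by (simp add: relevant_supp_def relevant_def)
  note idl = gprimeD(1)[OF prime]
  let ?F = "{K. gsub K \<and> N \<le> K \<and> K \<le> L \<and> (\<exists>b. \<exists>m\<in>L b. ann K m b \<le> P)}"
  have "N \<in> ?F" using N NL P by (simp add: relevant_supp_def)
  then have "?F \<noteq> {}" by blast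
  then have "\<exists>K\<in>?F. \<forall>K'\<in>?F. K \<le> K' \<longrightarrow> K' = K" by (rule gsub_maximal) simp
  then obtain K where KF: "K \<in> ?F" and Kmax: "\<forall>K'\<in>?F. K \<le> K' \<longrightarrow> K' = K" ..
  from KF have K: "gsub K" "N \<le> K" "K \<le> L" by simp_all
  from KF obtain b m where m: "m \<in> L b" "ann K m b \<le> P" by auto
  have mM: "m \<in> Mg b" by (rule gsubD(1)[OF L m(1)])
  have mc: "m \<in> carrier M" by (rule Mg_carrier[OF mM])
  have annD: "s \<in> P n" if "s \<in> Sg n" "s \<odot> m \<in> K (n + b)" for s n
  proof -
    have "s \<in> ann K m b n" using that by (simp add: ann_def)
    then show ?thesis using m(2) unfolding le_fun_def by blast
  qed
  let ?T = "saturation P K L"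
  note gT = gsub_saturation[OF prime K(1) L]
  have KT: "K \<le> ?T" by (rule saturation_upper[OF prime K(1,3)])
  have TL: "?T \<le> L" by (rule saturation_le)
  have aT: "ann ?T m b \<le> P" by (rule saturation_ann[OF prime K(1) L m(1,2)])
  have NT: "N \<le> ?T" using K(2) KT by (rule order_trans)
  have "?T \<in> ?F" using gT NT TL aT m(1) by blast
  then have TK: "?T = K" using Kmax KT by blast
  have sat: "v \<in> K n" if "v \<in> L n" "u \<in> Sg a" "u \<notin> P a" "u \<odot> v \<in> K (a + n)" for v n u a
  proof -
    have "v \<in> ?T n" unfolding saturation_def using that by blast
    then show ?thesis by (simp add: TK)
  qed
  \<comment> \<open>Maximality of K: modulo anything strictly larger, the localization at P is zero.\<close>
  have big: "\<exists>a. \<exists>u\<in>Sg a. u \<notin> P a \<and> u \<odot> v \<in> K' (a + n)"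
    if K': "gsub K'" "K < K'" "K' \<le> L" and v: "v \<in> L n" for K' n v
  proof (rule ccontr)
    assume *: "\<not> ?thesis"
    have "ann K' v n \<le> P" unfolding le_fun_def ann_def using * by blast
    moreover have "N \<le> K'" using K(2) K'(2) by (meson less_imp_le order_trans)
    ultimately have "K' \<in> ?F" using K' v by blast
    then show False using Kmax K'(2) by (auto simp: less_le)
  qed
  have xm: "x \<odot> m \<in> K (a + b)" if x: "x \<in> P a" for x a
  proof (rule ccontr)
    assume nK: "x \<odot> m \<notin> K (a + b)"
    have xS: "x \<in> Sg a" by (rule gidealD(1)[OF idl x])
    have xmL: "x \<odot> m \<in> L (a + b)" by (rule gsubD(4)[OF L xS m(1)])
    have xmM: "x \<odot> m \<in> Mg (a + b)" by (rule gsubD(1)[OF L xmL])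
    let ?K' = "cyc_ext K (a + b) (x \<odot> m)"
    from big[OF cyc_ext_gsub[OF K(1) xmM] cyc_ext_less[OF K(1) xmM nK] cyc_ext_least[OF L K(3) xmL] m(1)]
    obtain n u where u: "u \<in> Sg n" "u \<notin> P n" "u \<odot> m \<in> ?K' (n + b)" by blast
    from cyc_ext_cases[OF K(1) xmM u(3)] show False
    proof (elim disjE exE conjE)
      assume "u \<odot> m \<in> K (n + b)"
      from annD[OF u(1) this] u(2) show False by blast
    next
      fix k s assume ks: "a + b \<le> n + b" "k \<in> K (n + b)" "s \<in> Sg (n + b - (a + b))"
        "u \<odot> m = k \<oplus> s \<odot> (x \<odot> m)"
      have "n + b - (a + b) + a = n" using ks(1) by (simp add: vec_eq_iff less_eq_vec_def)
      then have sx: "s \<otimes>\<^bsub>S\<^esub> x \<in> P n" using gidealD(4)[OF idl ks(3) x] by simp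
      have sxS: "s \<otimes>\<^bsub>S\<^esub> x \<in> Sg n" by (rule gidealD(1)[OF idl sx])
      have car: "u \<in> carrier S" "s \<in> carrier S" "x \<in> carrier S" "k \<in> carrier M"
        using Sg_carrier[OF u(1)] Sg_carrier[OF ks(3)] Sg_carrier[OF xS] gsub_carrier[OF K(1) ks(2)] by auto
      let ?w = "u \<oplus>\<^bsub>S\<^esub> \<ominus>\<^bsub>S\<^esub> (s \<otimes>\<^bsub>S\<^esub> x)"
      have "?w \<odot> m = k"
        using car mc by (simp add: smult_l_distr smult_l_minus ks(4) smult_assoc1[symmetric] M.a_assoc M.r_neg)
      moreover have wS: "?w \<in> Sg n" by (rule Sg_add[OF u(1) Sg_neg[OF sxS]])
      ultimately have "?w \<in> P n" using annD[OF wS] ks(2) by simp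
      then have "?w \<oplus>\<^bsub>S\<^esub> s \<otimes>\<^bsub>S\<^esub> x \<in> P n" by (rule gidealD(3)[OF idl _ sx])
      moreover have "?w \<oplus>\<^bsub>S\<^esub> s \<otimes>\<^bsub>S\<^esub> x = u" using car by (intro minus_plus_cancel) auto
      ultimately show False using u(2) by simp
    qed
  qed
  have mK: "m \<notin> K b"
  proof
    assume "m \<in> K b"
    then have "\<one>\<^bsub>S\<^esub> \<odot> m \<in> K (0 + b)" using mc by simp
    from annD[OF one_Sg this] gprimeD(2)[OF prime] show False by blast
  qed
  have "x \<odot> v \<in> K (a + n)" if x: "x \<in> P a" and v: "v \<in> L n" for a n x v
  proof -
    have xS: "x \<in> Sg a" by (rule gidealD(1)[OF idl x])
    from big[OF cyc_ext_gsub[OF K(1) mM] cyc_ext_less[OF K(1) mM mK] cyc_ext_least[OF L K(3) m(1)] v]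
    obtain c u where u: "u \<in> Sg c" "u \<notin> P c" "u \<odot> v \<in> cyc_ext K b m (c + n)" by blast
    have vc: "v \<in> carrier M" by (rule gsub_carrier[OF L v])
    have "x \<odot> (u \<odot> v) \<in> K (a + (c + n))"
      using cyc_ext_cases[OF K(1) mM u(3)]
    proof (elim disjE exE conjE)
      assume "u \<odot> v \<in> K (c + n)"
      then show ?thesis by (rule gsubD(4)[OF K(1) xS])
    next
      fix k s assume ks: "b \<le> c + n" "k \<in> K (c + n)" "s \<in> Sg (c + n - b)" "u \<odot> v = k \<oplus> s \<odot> m"
      have car: "s \<in> carrier S" "x \<in> carrier S" "k \<in> carrier M"
        using Sg_carrier[OF ks(3)] Sg_carrier[OF xS] gsub_carrier[OF K(1) ks(2)] by auto
      have "x \<odot> (u \<odot> v) = x \<odot> k \<oplus> s \<odot> (x \<odot> m)"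
        using car mc by (simp add: ks(4) smult_r_distr smult_assoc1[symmetric] m_comm)
      moreover have "x \<odot> k \<in> K (a + (c + n))" by (rule gsubD(4)[OF K(1) xS ks(2)])
      moreover have "s \<odot> (x \<odot> m) \<in> K (a + (c + n))"
        by (rule gsub_smult_deg[OF K(1) ks(3) xm[OF x]])
          (use vec_le_minus_add[OF ks(1)] in \<open>simp add: add.left_commute\<close>)
      ultimately show ?thesis using gsubD(3)[OF K(1)] by simp
    qed
    moreover have "x \<odot> (u \<odot> v) = u \<odot> (x \<odot> v)"
      using Sg_carrier[OF u(1)] Sg_carrier[OF xS] vc by (simp add: smult_assoc1[symmetric] m_comm)
    moreover have "a + (c + n) = c + (a + n)" by (simp add: ac_simps)
    ultimately have "u \<odot> (x \<odot> v) \<in> K (c + (a + n))" by simp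
    from sat[OF gsubD(4)[OF L xS v] u(1,2) this] show ?thesis .
  qed
  then show ?thesis using K m by blast
qed

section \<open>Constant Hilbert polynomials\<close>

text \<open>
  Multiply elements outside \<open>Q\<close> from the various \<open>S\<^sub>i\<close>.
\<close>

lemma relevant_element:
  assumes "relevant Q"
  shows "\<exists>g\<in>Sg k. g \<notin> Q k"
proof (induction k rule: multidegree_induct)
  case zero
  show ?case using gprimeD(2)[of Q] assms one_Sg unfolding relevant_def by blast
next
  case (step k i)
  then obtain g where g: "g \<in> Sg k" "g \<notin> Q k" by blast
  obtain y where y: "y \<in> Sg (axis i 1)" "y \<notin> Q (axis i 1)" using assms unfolding relevant_def by blast
  have "g \<otimes>\<^bsub>S\<^esub> y \<notin> Q (k + axis i 1)" using gprimeD(3)[of Q g k y "axis i 1"] assms g y unfolding relevant_def by blast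
  then show ?case using Sg_mult[OF g(1) y(1)] by blast
qed

text \<open>
  Let \<open>P \<subset> Q\<close> be in the support and \<open>a \<in> Q - P\<close>.  Inside \<open>L\<close> modulo the saturation \<open>T\<close> of \<open>N\<close>, let \<open>m\<close> generate a
  copy of \<open>S/P\<close>; its lengths are bounded by the constant, so they attain a maximum among the large degrees.
  There the injective multiplication by \<open>a\<close> is bijective, so \<open>gm \<in> T + a S m\<close> for some \<open>g \<notin> Q\<close>, and \<open>g \<in> P + aS \<subseteq> Q\<close>.
\<close>

theorem hilb_poly_const_dim_le_0:
  assumes N: "gsub N" and L: "gsub L" and NL: "N \<le> L" and const: "\<And>n. hilb_poly N L n = c"
  shows "dim_le_0 N L"
  unfolding dim_le_0_def
proof (intro ballI impI, rule ccontr)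
  fix P Q assume P: "P \<in> relevant_supp N L" and Q: "Q \<in> relevant_supp N L" and PQ: "P \<le> Q" "P \<noteq> Q"
  have pP: "gprime P" and pQ: "gprime Q" and rQ: "relevant Q" using P Q unfolding relevant_supp_def relevant_def by auto
  note iP = gprimeD(1)[OF pP] and iQ = gprimeD(1)[OF pQ]
  from P obtain b m where m: "m \<in> L b" "ann N m b \<le> P" unfolding relevant_supp_def by blast
  have mM: "m \<in> Mg b" by (rule gsubD(1)[OF L m(1)])
  have mc: "m \<in> carrier M" by (rule Mg_carrier[OF mM])
  from PQ obtain d a where a: "a \<in> Q d" "a \<notin> P d" unfolding le_fun_def fun_eq_iff by blast
  have aS: "a \<in> Sg d" by (rule gidealD(1)[OF iQ a(1)])
  let ?T = "saturation P N L"
  note T = gsub_saturation[OF pP N L] and NT = saturation_upper[OF pP N NL] and TL = saturation_le[of P N L]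
  let ?L1 = "cyc_ext ?T b m"
  note g1 = cyc_ext_gsub[OF T mM] and TL1 = cyc_ext_upper[OF T mM] and L1L = cyc_ext_least[OF L TL m(1)]
  \<comment> \<open>Saturation with respect to P turns a into a nonzerodivisor.\<close>
  have inj: "gcolon a d ?T ?L1 = ?T"
  proof (rule antisym)
    show "?T \<le> gcolon a d ?T ?L1" by (rule gcolon_ge[OF T aS TL1])
    show "gcolon a d ?T ?L1 \<le> ?T"
      unfolding le_fun_def
    proof (intro allI subsetI)
      fix n v assume "v \<in> gcolon a d ?T ?L1 n"
      then have v: "v \<in> ?L1 n" "a \<odot> v \<in> ?T (d + n)" by (auto simp: gcolon_def preim_def)
      have vL: "v \<in> L n" using v(1) L1L unfolding le_fun_def by blast
      from v(2) obtain k u where u: "u \<in> Sg k" "u \<notin> P k" "u \<odot> (a \<odot> v) \<in> N (k + (d + n))"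
        unfolding saturation_def by blast
      have "(u \<otimes>\<^bsub>S\<^esub> a) \<odot> v \<in> N (k + d + n)"
        using u(3) Sg_carrier[OF u(1)] Sg_carrier[OF aS] gsub_carrier[OF L vL] by (simp add: smult_assoc1 add.assoc)
      moreover have "u \<otimes>\<^bsub>S\<^esub> a \<notin> P (k + d)" using gprimeD(3)[OF pP u(1) aS] u(2) a(2) by blast
      ultimately show "v \<in> ?T n" unfolding saturation_def using vL Sg_mult[OF u(1) aS] by blast
    qed
  qed
  have step: "hilb_fn ?T ?L1 n = hilb_fn ?T ?L1 (n - d) + hilb_fn (gadd a d ?T ?L1) ?L1 n" if "d \<le> n" for n
    using hilb_fn_gadd[OF aS T g1 TL1 that] by (simp add: inj hilb_fn_same)
  have "for_all_large (\<lambda>n. rat_of_nat (hilb_fn N L n) = c \<and> b \<le> n)"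
    using hilb_poly[OF N L NL] const unfolding is_hilb_def by (intro for_all_large_conj for_all_large_ge) simp
  then obtain N0 where N0: "\<And>n. (\<forall>i. N0 \<le> n $ i) \<Longrightarrow> rat_of_nat (hilb_fn N L n) = c \<and> b \<le> n"
    unfolding for_all_large_def by blast
  define n1 :: "nat ^ 'd" where "n1 = (\<chi> i. N0)"
  have bd: "hilb_fn ?T ?L1 n < Suc (hilb_fn N L n1)" if "\<forall>i. N0 \<le> n $ i" for n
  proof -
    have "hilb_fn N L n = hilb_fn N ?T n + (hilb_fn ?T ?L1 n + hilb_fn ?L1 L n)"
      using hilb_fn_add[OF N T L NT TL, of n] hilb_fn_add[OF T g1 L TL1 L1L, of n] by simp
    moreover have "rat_of_nat (hilb_fn N L n) = rat_of_nat (hilb_fn N L n1)" using N0[OF that] N0[of n1] by (simp add: n1_def)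
    ultimately show ?thesis by simp
  qed
  have "\<exists>n. (\<forall>i. N0 \<le> n $ i) \<and> (\<forall>n'. (\<forall>i. N0 \<le> n' $ i) \<longrightarrow> hilb_fn ?T ?L1 n' \<le> hilb_fn ?T ?L1 n)"
    using ex_has_greatest_nat[of "\<lambda>n. \<forall>i. N0 \<le> n $ i" n1 "hilb_fn ?T ?L1" "Suc (hilb_fn N L n1)"] bd by (simp add: n1_def)
  then obtain n where n: "\<forall>i. N0 \<le> n $ i" and nmax: "\<forall>n'. (\<forall>i. N0 \<le> n' $ i) \<longrightarrow> hilb_fn ?T ?L1 n' \<le> hilb_fn ?T ?L1 n" by blast
  have bn: "b \<le> n" using N0[OF n] by blast
  have dn: "d \<le> d + n" "d + n - d = n" by (auto simp: less_eq_vec_def vec_eq_iff)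
  have bdn: "b \<le> d + n" using bn by (auto simp: less_eq_vec_def intro: trans_le_add2)
  have "\<forall>i. N0 \<le> (d + n) $ i" using n by (simp add: trans_le_add2)
  then have "hilb_fn ?T ?L1 (d + n) \<le> hilb_fn ?T ?L1 n" using nmax by blast
  then have "hilb_fn (gadd a d ?T ?L1) ?L1 (d + n) = 0" using step[OF dn(1)] dn(2) by simp
  then have surj: "gadd a d ?T ?L1 (d + n) = ?L1 (d + n)"
    using hilb_fn_eq_0[OF gsub_gadd[OF aS T g1] g1 gadd_least[OF aS g1 TL1]] by simp
  from relevant_element[OF rQ] obtain g where g: "g \<in> Sg (d + n - b)" "g \<notin> Q (d + n - b)" by blast
  have "g \<odot> m \<in> ?L1 (d + n)"
    by (rule gsub_smult_deg[OF g1 g(1) cyc_ext_self[OF T mM] vec_le_minus_add[OF bdn]])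
  then have "g \<odot> m \<in> gadd a d ?T ?L1 (d + n)" using surj by simp
  then obtain t w where t: "g \<odot> m = t \<oplus> a \<odot> w" "t \<in> ?T (d + n)" "w \<in> ?L1 n"
    unfolding gadd_def gsum_def ssum_def gmul_def smul_def using dn by auto
  have "\<exists>s\<in>Sg (n - b). \<exists>t'\<in>?T n. w = t' \<oplus> s \<odot> m"
    using cyc_ext_cases[OF T mM t(3)]
  proof
    assume w: "w \<in> ?T n"
    then have "w = w \<oplus> \<zero>\<^bsub>S\<^esub> \<odot> m" using gsub_carrier[OF T w] mc by (simp add: smult_l_null)
    then show ?thesis using w Sg_zero by blast
  qed blast
  then obtain s t' where s: "s \<in> Sg (n - b)" "t' \<in> ?T n" "w = t' \<oplus> s \<odot> m" by blast
  have as: "s \<otimes>\<^bsub>S\<^esub> a \<in> Q (d + n - b)"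
  proof -
    have "n - b + d = d + n - b" using bn by (auto simp: less_eq_vec_def vec_eq_iff)
    then show ?thesis using gidealD(4)[OF iQ s(1) a(1)] by simp
  qed
  have asS: "s \<otimes>\<^bsub>S\<^esub> a \<in> Sg (d + n - b)" by (rule gidealD(1)[OF iQ as])
  have car: "g \<in> carrier S" "s \<in> carrier S" "a \<in> carrier S" "t \<in> carrier M" "t' \<in> carrier M"
    using Sg_carrier[OF g(1)] Sg_carrier[OF s(1)] Sg_carrier[OF aS] gsub_carrier[OF T t(2)] gsub_carrier[OF T s(2)] by auto
  let ?r = "g \<oplus>\<^bsub>S\<^esub> \<ominus>\<^bsub>S\<^esub> (s \<otimes>\<^bsub>S\<^esub> a)"
  have rS: "?r \<in> Sg (d + n - b)" by (rule Sg_add[OF g(1) Sg_neg[OF asS]])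
  have "a \<odot> w = a \<odot> t' \<oplus> (s \<otimes>\<^bsub>S\<^esub> a) \<odot> m"
    using car mc by (simp add: s(3) smult_r_distr smult_assoc1[symmetric] m_comm)
  then have "?r \<odot> m = t \<oplus> a \<odot> t'"
    using car mc by (simp add: smult_l_distr smult_l_minus t(1) M.a_assoc M.r_neg)
  moreover have "t \<oplus> a \<odot> t' \<in> ?T (d + n)"
    by (rule gsubD(3)[OF T t(2) gsubD(4)[OF T aS s(2)]])
  ultimately have "?r \<in> ann ?T m b (d + n - b)" using rS vec_le_minus_add[OF bdn] by (simp add: ann_def)
  then have "?r \<in> P (d + n - b)" using saturation_ann[OF pP N L m] unfolding le_fun_def by blast
  then have "?r \<in> Q (d + n - b)" using PQ(1) unfolding le_fun_def by blast
  then have "?r \<oplus>\<^bsub>S\<^esub> s \<otimes>\<^bsub>S\<^esub> a \<in> Q (d + n - b)" by (rule gidealD(3)[OF iQ _ as])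
  moreover have "?r \<oplus>\<^bsub>S\<^esub> s \<otimes>\<^bsub>S\<^esub> a = g" using car by (intro minus_plus_cancel) auto
  ultimately show False using g(2) by simp
qed

section \<open>Mixed multiplicity systems\<close>

text \<open>
  The submodule \<open>N + x\<^sub>1L + \<dots> + x\<^sub>tL\<close>; each \<open>x\<close> carries the index \<open>i\<close> of the \<open>S\<^sub>i\<close> containing it, as components of the
  ring share the zero element.
\<close>

primrec seq_ext :: "(nat ^ 'd \<Rightarrow> 'm set) \<Rightarrow> (nat ^ 'd \<Rightarrow> 'm set) \<Rightarrow> ('d \<times> 'a) list \<Rightarrow> nat ^ 'd \<Rightarrow> 'm set"
  where "seq_ext L N [] = N"
  | "seq_ext L N (p # ps) = seq_ext L (gadd (snd p) (axis (fst p) 1) N L) ps"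

definition homogeneous_seq :: "('d \<times> 'a) list \<Rightarrow> bool"
  where "homogeneous_seq ps \<longleftrightarrow> (\<forall>p\<in>set ps. snd p \<in> Sg (axis (fst p) 1))"

definition seq_type :: "('d \<times> 'a) list \<Rightarrow> nat ^ 'd"
  where "seq_type ps = (\<chi> j. count_list (map fst ps) j)"

lemma seq_type_Nil: "seq_type [] = 0" by (simp add: seq_type_def vec_eq_iff)

lemma seq_type_Cons: "seq_type (p # ps) = seq_type ps + axis (fst p) 1"
  by (auto simp: seq_type_def vec_eq_iff axis_def)

lemma seq_ext_props:
  assumes "homogeneous_seq ps" "gsub N" "gsub L" "N \<le> L"
  shows "gsub (seq_ext L N ps)" "N \<le> seq_ext L N ps" "seq_ext L N ps \<le> L"
    "\<And>p n v. p \<in> set ps \<Longrightarrow> v \<in> L n \<Longrightarrow> snd p \<odot> v \<in> seq_ext L N ps (axis (fst p) 1 + n)"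
proof -
  have "gsub (seq_ext L N ps) \<and> N \<le> seq_ext L N ps \<and> seq_ext L N ps \<le> L \<and>
    (\<forall>p\<in>set ps. \<forall>n. \<forall>v\<in>L n. snd p \<odot> v \<in> seq_ext L N ps (axis (fst p) 1 + n))"
    using assms
  proof (induction ps arbitrary: N)
    case (Cons p ps)
    have x: "snd p \<in> Sg (axis (fst p) 1)" and h: "homogeneous_seq ps"
      using Cons.prems(1) by (auto simp: homogeneous_seq_def)
    let ?A = "gadd (snd p) (axis (fst p) 1) N L"
    note gA = gsub_gadd[OF x Cons.prems(2,3)] and NA = gadd_upper[OF x Cons.prems(2,3)]
      and AL = gadd_least[OF x Cons.prems(3,4)]
    note IH = Cons.IH[OF h gA Cons.prems(3) AL]
    have "N \<le> seq_ext L ?A ps" using NA IH order_trans by blast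
    moreover have "snd p \<odot> v \<in> seq_ext L ?A ps (axis (fst p) 1 + n)" if "v \<in> L n" for n v
      using gadd_mult[OF x Cons.prems(2,3) that] IH unfolding le_fun_def by blast
    ultimately show ?case using IH by simp
  qed simp
  then show "gsub (seq_ext L N ps)" "N \<le> seq_ext L N ps" "seq_ext L N ps \<le> L"
    "\<And>p n v. p \<in> set ps \<Longrightarrow> v \<in> L n \<Longrightarrow> snd p \<odot> v \<in> seq_ext L N ps (axis (fst p) 1 + n)" by blast+
qed

lemma gadd_leI:
  assumes K: "gsub K" and "N \<le> K" and xK: "\<And>n v. v \<in> L n \<Longrightarrow> x \<odot> v \<in> K (c + n)"
  shows "gadd x c N L \<le> K"
  unfolding gadd_def
proof (rule gsum_least[OF K assms(2)], unfold le_fun_def, intro allI subsetI)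
  fix n u assume u: "u \<in> gmul x c L n"
  show "u \<in> K n"
  proof (cases "c \<le> n")
    case True
    then obtain v where "u = x \<odot> v" "v \<in> L (n - c)" using u by (auto simp: gmul_def smul_def)
    moreover have "c + (n - c) = n" using vec_le_minus_add[OF True] by (simp add: add.commute)
    ultimately show ?thesis using xK[of v "n - c"] by simp
  next
    case False
    then show ?thesis using u gsubD(2)[OF K] by (simp add: gmul_def)
  qed
qed

lemma seq_ext_least:
  assumes "gsub K" "N \<le> K" "\<And>p n v. p \<in> set ps \<Longrightarrow> v \<in> L n \<Longrightarrow> snd p \<odot> v \<in> K (axis (fst p) 1 + n)"
  shows "seq_ext L N ps \<le> K"
  using assms(2,3)
proof (induction ps arbitrary: N)
  case (Cons p ps)
  have "gadd (snd p) (axis (fst p) 1) N L \<le> K" by (rule gadd_leI[OF assms(1) Cons.prems(1)]) (simp add: Cons.prems(2))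
  then show ?case using Cons by simp
qed simp

text \<open>
  A prime in the support of \<open>C/(N + x\<^sub>2C + \<dots>)\<close> contains the remaining elements, and also \<open>x\<close>, since \<open>x\<close> annihilates
  \<open>C/N\<close>.  It is in the support of \<open>L/N\<close>, so Nakayama's lemma applies.
\<close>

lemma relevant_supp_colon:
  assumes x: "snd p \<in> Sg (axis (fst p) 1)" and ps: "homogeneous_seq ps"
    and N: "gsub N" and L: "gsub L" and NL: "N \<le> L"
  defines "C \<equiv> gcolon (snd p) (axis (fst p) 1) N L"
  shows "relevant_supp (seq_ext C N ps) C \<subseteq> relevant_supp (seq_ext L N (p # ps)) L"
proof
  fix P assume PC: "P \<in> relevant_supp (seq_ext C N ps) C"
  have C: "gsub C" unfolding C_def by (rule gsub_gcolon[OF x N L])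
  have NC: "N \<le> C" unfolding C_def by (rule gcolon_ge[OF N x NL])
  have CL: "C \<le> L" unfolding C_def by (rule gcolon_le)
  note ext = seq_ext_props[OF ps N C NC]
  from PC obtain b m where m: "m \<in> C b" "ann (seq_ext C N ps) m b \<le> P" unfolding relevant_supp_def by blast
  have mem: "s \<in> P n" if "s \<in> Sg n" "s \<odot> m \<in> seq_ext C N ps (n + b)" for s n
  proof -
    have "s \<in> ann (seq_ext C N ps) m b n" using that by (simp add: ann_def)
    then show ?thesis using m(2) unfolding le_fun_def by blast
  qed
  have "snd p \<odot> m \<in> N (axis (fst p) 1 + b)" using m(1) by (simp add: C_def gcolon_def preim_def)
  then have "snd p \<odot> m \<in> seq_ext C N ps (axis (fst p) 1 + b)" using ext(2) unfolding le_fun_def by blast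
  then have xP: "snd p \<in> P (axis (fst p) 1)" by (rule mem[OF x])
  have psP: "snd q \<in> P (axis (fst q) 1)" if "q \<in> set ps" for q
    by (rule mem[OF _ ext(4)[OF that m(1)]]) (use ps that in \<open>simp add: homogeneous_seq_def\<close>)
  have PL: "P \<in> relevant_supp N L" using relevant_supp_mono[OF ext(2) CL] PC by blast
  from support_nakayama[OF N L NL PL] obtain K b' m' where K: "gsub K" "N \<le> K" "K \<le> L"
    and m': "m' \<in> L b'" "ann K m' b' \<le> P" and PK: "\<forall>a n. \<forall>x\<in>P a. \<forall>v\<in>L n. x \<odot> v \<in> K (a + n)" by blast
  have "seq_ext L N (p # ps) \<le> K"
  proof (rule seq_ext_least[OF K(1,2)])
    fix q n v assume "q \<in> set (p # ps)" "v \<in> L n"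
    then show "snd q \<odot> v \<in> K (axis (fst q) 1 + n)" using PK xP psP by auto
  qed
  then have "ann (seq_ext L N (p # ps)) m' b' \<le> P" using ann_mono m'(2) order_trans by blast
  then show "P \<in> relevant_supp (seq_ext L N (p # ps)) L" using PC m'(1) unfolding relevant_supp_def by blast
qed

text \<open>
  Both terms of the difference formula fall under the induction hypothesis: \<open>L/(N + xL)\<close> trivially and the kernel
  \<open>(N : x)/N\<close> by \<open>relevant_supp_colon\<close>.
\<close>

theorem system_imp_difference_const:
  assumes "homogeneous_seq ps" "gsub N" "gsub L" "N \<le> L" "dim_le_0 (seq_ext L N ps) L"
  shows "\<exists>c. \<forall>n. multi_difference (seq_type ps) (hilb_poly N L) n = c"
  using assms
proof (induction ps arbitrary: N L)
  case Nil
  then show ?case using dim_le_0_hilb_poly_const[of N L] by (simp add: seq_type_Nil multi_difference_zero)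
next
  case (Cons p ps)
  have x: "snd p \<in> Sg (axis (fst p) 1)" and ps: "homogeneous_seq ps"
    using Cons.prems(1) by (auto simp: homogeneous_seq_def)
  note N = Cons.prems(2) and L = Cons.prems(3) and NL = Cons.prems(4)
  let ?C = "gcolon (snd p) (axis (fst p) 1) N L" and ?A = "gadd (snd p) (axis (fst p) 1) N L"
  have "dim_le_0 (seq_ext L ?A ps) L" using Cons.prems(5) by simp
  then obtain c1 where c1: "\<And>n. multi_difference (seq_type ps) (hilb_poly ?A L) n = c1"
    using Cons.IH[OF ps gsub_gadd[OF x N L] L gadd_least[OF x L NL]] by blast
  have "dim_le_0 (seq_ext ?C N ps) ?C"
    by (rule dim_le_0_mono[OF relevant_supp_colon[OF x ps N L NL] Cons.prems(5)])
  then obtain c2 where c2: "\<And>n. multi_difference (seq_type ps) (hilb_poly N ?C) n = c2"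
    using Cons.IH[OF ps N gsub_gcolon[OF x N L] gcolon_ge[OF N x NL]] by blast
  have "multi_difference (seq_type (p # ps)) (hilb_poly N L) = (\<lambda>n. c1 - c2)"
    by (simp add: seq_type_Cons multi_difference_add_axis hilb_poly_unit_difference[OF x N L NL] multi_difference_shift c1 c2)
  then show ?case by auto
qed

section \<open>Prime avoidance and filter-regular sequences\<close>

text \<open>
  A set of scalars with pairwise different residues; the condition is relative to the graded primes, so that it
  also makes sense for the zero ring.
\<close>

definition separating :: "'a set \<Rightarrow> bool"
  where "separating Y \<longleftrightarrow> Y \<subseteq> Sg 0 \<and>
    (\<forall>P. gprime P \<longrightarrow> infinite Y \<and> (\<forall>c\<in>Y. \<forall>c'\<in>Y. c \<noteq> c' \<longrightarrow> c \<ominus>\<^bsub>S\<^esub> c' \<notin> P 0))"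

text \<open>
  Given \<open>y\<close> outside the old primes and \<open>z\<close> outside the new one, look for \<open>y + cz\<close>.  Two bad scalars \<open>c\<close> for the same
  prime \<open>Q\<close> would put \<open>(c - c')z\<close>, hence \<open>z\<close>, into \<open>Q\<close>, and then also \<open>y\<close>.  So there are only finitely many.
\<close>

lemma prime_avoidance:
  assumes Y: "separating Y" and "finite F" "\<forall>P\<in>F. relevant P"
  shows "\<exists>y\<in>Sg (axis i 1). \<forall>P\<in>F. y \<notin> P (axis i 1)"
  using assms(2,3)
proof (induction F)
  case empty
  show ?case using Sg_zero by blast
next
  case (insert P F)
  let ?e = "axis i 1 :: nat ^ 'd"
  from insert obtain y where y: "y \<in> Sg ?e" "\<forall>Q\<in>F. y \<notin> Q ?e" by auto
  from insert.prems obtain z where z: "z \<in> Sg ?e" "z \<notin> P ?e" unfolding relevant_def by blast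
  have YS: "c \<in> Sg 0" if "c \<in> Y" for c using Y that unfolding separating_def by blast
  have cz: "c \<otimes>\<^bsub>S\<^esub> z \<in> Sg ?e" if "c \<in> Y" for c using Sg_mult[OF YS[OF that] z(1)] by simp
  define bad where "bad Q = {c \<in> Y. y \<oplus>\<^bsub>S\<^esub> c \<otimes>\<^bsub>S\<^esub> z \<in> Q ?e}" for Q
  have uniq: "c = c'" if Q: "Q \<in> insert P F" and c: "c \<in> bad Q" "c' \<in> bad Q" for Q c c'
  proof (rule ccontr)
    assume ne: "c \<noteq> c'"
    have pQ: "gprime Q" using Q insert.prems unfolding relevant_def by blast
    note iQ = gprimeD(1)[OF pQ]
    have cY: "c \<in> Y" "c' \<in> Y" and w: "y \<oplus>\<^bsub>S\<^esub> c \<otimes>\<^bsub>S\<^esub> z \<in> Q ?e" "y \<oplus>\<^bsub>S\<^esub> c' \<otimes>\<^bsub>S\<^esub> z \<in> Q ?e"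
      using c by (auto simp: bad_def)
    have car: "c \<in> carrier S" "c' \<in> carrier S" "y \<in> carrier S" "z \<in> carrier S"
      using Sg_carrier[OF YS[OF cY(1)]] Sg_carrier[OF YS[OF cY(2)]] Sg_carrier[OF y(1)] Sg_carrier[OF z(1)] by auto
    have "(y \<oplus>\<^bsub>S\<^esub> c \<otimes>\<^bsub>S\<^esub> z) \<oplus>\<^bsub>S\<^esub> \<ominus>\<^bsub>S\<^esub> (y \<oplus>\<^bsub>S\<^esub> c' \<otimes>\<^bsub>S\<^esub> z) \<in> Q ?e"
      by (intro gidealD(3)[OF iQ] gideal_neg[OF iQ] w)
    moreover have "(y \<oplus>\<^bsub>S\<^esub> c \<otimes>\<^bsub>S\<^esub> z) \<oplus>\<^bsub>S\<^esub> \<ominus>\<^bsub>S\<^esub> (y \<oplus>\<^bsub>S\<^esub> c' \<otimes>\<^bsub>S\<^esub> z) = (c \<ominus>\<^bsub>S\<^esub> c') \<otimes>\<^bsub>S\<^esub> z"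
      using car by (intro ring_diff_identity)
    ultimately have "(c \<ominus>\<^bsub>S\<^esub> c') \<otimes>\<^bsub>S\<^esub> z \<in> Q (0 + ?e)" by simp
    moreover have "c \<ominus>\<^bsub>S\<^esub> c' \<in> Sg 0" unfolding a_minus_def by (intro Sg_add Sg_neg YS cY)
    moreover have "c \<ominus>\<^bsub>S\<^esub> c' \<notin> Q 0" using Y pQ cY ne unfolding separating_def by blast
    ultimately have zQ: "z \<in> Q ?e" using gprimeD(3)[OF pQ _ z(1)] by blast
    then have "Q \<in> F" using Q z(2) by blast
    have "c \<otimes>\<^bsub>S\<^esub> z \<in> Q ?e" using gidealD(4)[OF iQ YS[OF cY(1)] zQ] by simp
    then have "(y \<oplus>\<^bsub>S\<^esub> c \<otimes>\<^bsub>S\<^esub> z) \<oplus>\<^bsub>S\<^esub> \<ominus>\<^bsub>S\<^esub> (c \<otimes>\<^bsub>S\<^esub> z) \<in> Q ?e"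
      by (intro gidealD(3)[OF iQ] gideal_neg[OF iQ] w)
    moreover have "(y \<oplus>\<^bsub>S\<^esub> c \<otimes>\<^bsub>S\<^esub> z) \<oplus>\<^bsub>S\<^esub> \<ominus>\<^bsub>S\<^esub> (c \<otimes>\<^bsub>S\<^esub> z) = y"
      using car by (intro plus_minus_cancel) auto
    ultimately show False using y(2) \<open>Q \<in> F\<close> by auto
  qed
  have "finite (bad Q)" if "Q \<in> insert P F" for Q
  proof (cases "bad Q = {}")
    case False
    then obtain c where "c \<in> bad Q" by blast
    then have "bad Q \<subseteq> {c}" using uniq[OF that] by blast
    then show ?thesis by (rule finite_subset) simp
  qed simp
  then have "finite (\<Union>Q\<in>insert P F. bad Q)" using insert.hyps(1) by blast
  moreover have "infinite Y" using Y insert.prems unfolding separating_def relevant_def by blast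
  ultimately obtain c where c: "c \<in> Y" "c \<notin> (\<Union>Q\<in>insert P F. bad Q)"
    by (meson finite_subset subsetI)
  then have "\<forall>Q\<in>insert P F. y \<oplus>\<^bsub>S\<^esub> c \<otimes>\<^bsub>S\<^esub> z \<notin> Q ?e" unfolding bad_def by blast
  then show ?case using Sg_add[OF y(1) cz[OF c(1)]] by blast
qed

primrec regular_seq :: "(nat ^ 'd \<Rightarrow> 'm set) \<Rightarrow> (nat ^ 'd \<Rightarrow> 'm set) \<Rightarrow> ('d \<times> 'a) list \<Rightarrow> bool"
  where "regular_seq L N [] = True"
  | "regular_seq L N (p # ps) = (for_all_large (\<lambda>n. gcolon (snd p) (axis (fst p) 1) N L n \<subseteq> N n) \<and>
       regular_seq L (gadd (snd p) (axis (fst p) 1) N L) ps)"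

text \<open>
  A filter-regular element has an eventually vanishing kernel term in the difference formula, so passing to the
  quotient by it takes exactly one difference of the Hilbert polynomial.
\<close>

theorem difference_const_imp_system:
  assumes Y: "separating Y" and L: "gsub L"
  shows "gsub N \<Longrightarrow> N \<le> L \<Longrightarrow> (\<exists>c. \<forall>n. multi_difference k (hilb_poly N L) n = c) \<Longrightarrow>
    \<exists>ps. homogeneous_seq ps \<and> seq_type ps = k \<and> regular_seq L N ps \<and> dim_le_0 (seq_ext L N ps) L"
proof (induction k arbitrary: N rule: multidegree_induct)
  case zero
  then obtain c where "\<And>n. hilb_poly N L n = c" by (auto simp: multi_difference_zero)
  then have "dim_le_0 N L" by (rule hilb_poly_const_dim_le_0[OF zero(1) L zero(2)])
  then show ?case by (intro exI[of _ "[]"]) (simp add: homogeneous_seq_def seq_type_Nil)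
next
  case (step k i)
  note N = step.prems(1) and NL = step.prems(2)
  from filter_regular_primes[OF N L NL] obtain F where F: "finite F" "\<forall>P\<in>F. relevant P"
    and reg: "\<forall>c. \<forall>x\<in>Sg c. (\<forall>P\<in>F. x \<notin> P c) \<longrightarrow> for_all_large (\<lambda>n. gcolon x c N L n \<subseteq> N n)" by blast
  from prime_avoidance[OF Y F, of i] obtain x where x: "x \<in> Sg (axis i 1)" "\<forall>P\<in>F. x \<notin> P (axis i 1)" by blast
  let ?C = "gcolon x (axis i 1) N L" and ?A = "gadd x (axis i 1) N L"
  have large: "for_all_large (\<lambda>n. ?C n \<subseteq> N n)" using reg x by blast
  have NC: "N \<le> ?C" by (rule gcolon_ge[OF N x(1) NL])
  have "for_all_large (\<lambda>n. ?C n = N n)"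
    by (rule for_all_large_mono[OF large]) (use NC in \<open>simp add: le_fun_def subset_antisym\<close>)
  then have "hilb_poly N ?C = (\<lambda>_. 0)" by (rule hilb_poly_zero[OF N gsub_gcolon[OF x(1) N L] NC])
  then have "unit_difference i (hilb_poly N L) = hilb_poly ?A L" by (simp add: hilb_poly_unit_difference[OF x(1) N L NL])
  then have "\<exists>c. \<forall>n. multi_difference k (hilb_poly ?A L) n = c"
    using step.prems(3) by (simp add: multi_difference_add_axis)
  from step.IH[OF gsub_gadd[OF x(1) N L] gadd_least[OF x(1) L NL] this] obtain ps where
    ps: "homogeneous_seq ps" "seq_type ps = k" "regular_seq L ?A ps" "dim_le_0 (seq_ext L ?A ps) L" by blast
  show ?case
    by (rule exI[of _ "(i, x) # ps"]) (use ps x large in \<open>simp add: homogeneous_seq_def seq_type_Cons\<close>)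
qed

end

section \<open>Homogeneous components in a direct sum\<close>

locale direct_sum = abelian_group G for G (structure) +
  fixes Gr :: "'i \<Rightarrow> 'a set"
  assumes decomp: "direct_sum_decomp G Gr"
begin

definition hcomp :: "'a \<Rightarrow> 'i \<Rightarrow> 'a"
  where "hcomp x = (THE f. (\<forall>n. f n \<in> Gr n) \<and> finite {n. f n \<noteq> \<zero>} \<and> x = finsum G f {n. f n \<noteq> \<zero>})"

lemma Gr_subgroup: "additive_subgroup (Gr n) G"
  using decomp unfolding direct_sum_decomp_def by blast

lemma Gr_carrier: "x \<in> Gr n \<Longrightarrow> x \<in> carrier G"
  using additive_subgroup.a_subset[OF Gr_subgroup] by blast

lemma Gr_zero: "\<zero> \<in> Gr n"
  by (rule additive_subgroup.zero_closed[OF Gr_subgroup])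

lemma Gr_add: "x \<in> Gr n \<Longrightarrow> y \<in> Gr n \<Longrightarrow> x \<oplus> y \<in> Gr n"
  by (rule additive_subgroup.a_closed[OF Gr_subgroup])

lemma hcomp_props:
  assumes "x \<in> carrier G"
  shows "hcomp x n \<in> Gr n" "finite {n. hcomp x n \<noteq> \<zero>}" "x = finsum G (hcomp x) {n. hcomp x n \<noteq> \<zero>}"
proof -
  have "\<exists>!f. (\<forall>n. f n \<in> Gr n) \<and> finite {n. f n \<noteq> \<zero>} \<and> x = finsum G f {n. f n \<noteq> \<zero>}"
    using decomp assms unfolding direct_sum_decomp_def by blast
  from theI'[OF this] have "(\<forall>n. hcomp x n \<in> Gr n) \<and> finite {n. hcomp x n \<noteq> \<zero>} \<and>
      x = finsum G (hcomp x) {n. hcomp x n \<noteq> \<zero>}" unfolding hcomp_def .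
  then show "hcomp x n \<in> Gr n" "finite {n. hcomp x n \<noteq> \<zero>}" "x = finsum G (hcomp x) {n. hcomp x n \<noteq> \<zero>}"
    by blast+
qed

lemma hcomp_carrier: "x \<in> carrier G \<Longrightarrow> hcomp x n \<in> carrier G"
  using hcomp_props(1) Gr_carrier by blast

lemma finsum_support:
  assumes "finite F" "{n. f n \<noteq> \<zero>} \<subseteq> F" "\<And>n. f n \<in> carrier G"
  shows "finsum G f {n. f n \<noteq> \<zero>} = finsum G f F"
  by (rule add.finprod_mono_neutral_cong_left) (use assms in auto)

lemma hcomp_eqI:
  assumes "\<And>n. f n \<in> Gr n" "finite F" "{n. f n \<noteq> \<zero>} \<subseteq> F" "x = finsum G f F"
  shows "hcomp x = f"
proof -
  have car: "\<And>n. f n \<in> carrier G" using assms(1) Gr_carrier by blast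
  have x: "x = finsum G f {n. f n \<noteq> \<zero>}" using finsum_support[OF assms(2,3) car] assms(4) by simp
  have "x \<in> carrier G" unfolding assms(4) by (rule finsum_closed) (use car in auto)
  then have ex: "\<exists>!f. (\<forall>n. f n \<in> Gr n) \<and> finite {n. f n \<noteq> \<zero>} \<and> x = finsum G f {n. f n \<noteq> \<zero>}"
    using decomp unfolding direct_sum_decomp_def by blast
  have f: "(\<forall>n. f n \<in> Gr n) \<and> finite {n. f n \<noteq> \<zero>} \<and> x = finsum G f {n. f n \<noteq> \<zero>}"
    using assms(1) finite_subset[OF assms(3,2)] x by blast
  show ?thesis unfolding hcomp_def by (rule the1_equality[OF ex, OF f])
qed

lemma hcomp_homogeneous: "x \<in> Gr n \<Longrightarrow> hcomp x k = (if k = n then x else \<zero>)"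
proof -
  assume x: "x \<in> Gr n"
  have "hcomp x = (\<lambda>k. if k = n then x else \<zero>)"
  proof (rule hcomp_eqI[of _ "{n}"])
    show "x = (\<Oplus>k\<in>{n}. if k = n then x else \<zero>)"
      using Gr_carrier[OF x] by (simp add: finsum_insert)
  qed (use x Gr_zero in auto)
  then show ?thesis by simp
qed

lemma hcomp_add:
  assumes x: "x \<in> carrier G" and y: "y \<in> carrier G"
  shows "hcomp (x \<oplus> y) n = hcomp x n \<oplus> hcomp y n"
proof -
  let ?F = "{n. hcomp x n \<noteq> \<zero>} \<union> {n. hcomp y n \<noteq> \<zero>}"
  have fin: "finite ?F" using hcomp_props(2)[OF x] hcomp_props(2)[OF y] by simp
  have "hcomp (x \<oplus> y) = (\<lambda>n. hcomp x n \<oplus> hcomp y n)"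
  proof (rule hcomp_eqI[OF _ fin])
    show "hcomp x n \<oplus> hcomp y n \<in> Gr n" for n by (intro Gr_add hcomp_props(1) x y)
    show "{n. hcomp x n \<oplus> hcomp y n \<noteq> \<zero>} \<subseteq> ?F" by auto
    have "x = finsum G (hcomp x) ?F"
      using finsum_support[OF fin, of "hcomp x"] hcomp_props(3)[OF x] hcomp_carrier[OF x] by auto
    moreover have "y = finsum G (hcomp y) ?F"
      using finsum_support[OF fin, of "hcomp y"] hcomp_props(3)[OF y] hcomp_carrier[OF y] by auto
    moreover have "(\<Oplus>n\<in>?F. hcomp x n \<oplus> hcomp y n) = finsum G (hcomp x) ?F \<oplus> finsum G (hcomp y) ?F"
      by (rule finsum_addf) (auto intro: hcomp_carrier x y)
    ultimately show "x \<oplus> y = (\<Oplus>n\<in>?F. hcomp x n \<oplus> hcomp y n)" by simp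
  qed
  then show ?thesis by simp
qed

lemma hcomp_zero: "hcomp \<zero> n = \<zero>"
  using hcomp_homogeneous[OF Gr_zero[of n], of n] by simp

lemma hcomp_finsum:
  assumes "finite F" "\<And>i. i \<in> F \<Longrightarrow> f i \<in> carrier G"
  shows "hcomp (finsum G f F) n = finsum G (\<lambda>i. hcomp (f i) n) F"
  using assms
proof (induction F)
  case empty
  show ?case by (simp add: hcomp_zero)
next
  case (insert a F)
  then have f: "f \<in> F \<rightarrow> carrier G" "f a \<in> carrier G" by auto
  then have h: "(\<lambda>i. hcomp (f i) n) \<in> F \<rightarrow> carrier G" "hcomp (f a) n \<in> carrier G"
    using hcomp_carrier by auto
  show ?case
    unfolding finsum_insert[OF insert.hyps f] finsum_insert[OF insert.hyps h]
    using insert f by (simp add: hcomp_add finsum_closed)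
qed

text \<open>
  The subset with components in the given family; this links families to subsets of the whole group.
\<close>

definition tot :: "('i \<Rightarrow> 'a set) \<Rightarrow> 'a set"
  where "tot T = {x \<in> carrier G. \<forall>n. hcomp x n \<in> T n}"

lemma finsum_in:
  assumes "finite F" "\<And>n. n \<in> F \<Longrightarrow> f n \<in> D" "D \<subseteq> carrier G" "\<zero> \<in> D" "\<And>x y. x \<in> D \<Longrightarrow> y \<in> D \<Longrightarrow> x \<oplus> y \<in> D"
  shows "finsum G f F \<in> D"
  using assms(1,2)
proof (induction F)
  case empty
  then show ?case using assms(4) by simp
next
  case (insert a F)
  have "f \<in> F \<rightarrow> carrier G" "f a \<in> carrier G" using insert.prems assms(3) by auto
  then have "finsum G f (insert a F) = f a \<oplus> finsum G f F" by (rule finsum_insert[OF insert.hyps])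
  then show ?case using insert assms(5) by simp
qed

lemma tot_induct [consumes 1, case_names zero homogeneous add]:
  assumes "x \<in> tot T" and "P \<zero>" and "\<And>n y. y \<in> T n \<Longrightarrow> y \<in> Gr n \<Longrightarrow> P y"
    and "\<And>x y. x \<in> carrier G \<Longrightarrow> y \<in> carrier G \<Longrightarrow> P x \<Longrightarrow> P y \<Longrightarrow> P (x \<oplus> y)"
  shows "P x"
proof -
  have x: "x \<in> carrier G" and c: "\<And>n. hcomp x n \<in> T n" using assms(1) unfolding tot_def by auto
  have "finsum G (hcomp x) {n. hcomp x n \<noteq> \<zero>} \<in> {y \<in> carrier G. P y}"
    by (rule finsum_in[OF hcomp_props(2)[OF x]])
      (use assms(2,4) assms(3)[OF c hcomp_props(1)[OF x]] hcomp_carrier[OF x] in auto)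
  then show ?thesis using hcomp_props(3)[OF x] by simp
qed

lemma tot_Gr: "tot Gr = carrier G"
  unfolding tot_def using hcomp_props(1) by blast

lemma carrier_induct [consumes 1, case_names zero homogeneous add]:
  assumes "x \<in> carrier G" and "P \<zero>" and "\<And>n y. y \<in> Gr n \<Longrightarrow> P y"
    and "\<And>x y. x \<in> carrier G \<Longrightarrow> y \<in> carrier G \<Longrightarrow> P x \<Longrightarrow> P y \<Longrightarrow> P (x \<oplus> y)"
  shows "P x"
  using assms by (intro tot_induct[of x Gr P]) (auto simp: tot_Gr)

lemma tot_zero: "(\<And>n. \<zero> \<in> T n) \<Longrightarrow> \<zero> \<in> tot T"
  by (simp add: tot_def hcomp_zero)

lemma tot_add: "(\<And>n x y. x \<in> T n \<Longrightarrow> y \<in> T n \<Longrightarrow> x \<oplus> y \<in> T n) \<Longrightarrow> x \<in> tot T \<Longrightarrow> y \<in> tot T \<Longrightarrow> x \<oplus> y \<in> tot T"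
  by (simp add: tot_def hcomp_add)

lemma tot_homogeneous: "(\<And>n. \<zero> \<in> T n) \<Longrightarrow> x \<in> T n \<Longrightarrow> x \<in> Gr n \<Longrightarrow> x \<in> tot T"
  by (simp add: tot_def hcomp_homogeneous Gr_carrier)

lemma tot_Int_Gr: "x \<in> tot T \<Longrightarrow> x \<in> Gr n \<Longrightarrow> x \<in> T n"
proof -
  assume "x \<in> tot T" "x \<in> Gr n"
  then have "hcomp x n \<in> T n" by (simp add: tot_def)
  moreover have "hcomp x n = x" using \<open>x \<in> Gr n\<close> by (simp add: hcomp_homogeneous)
  ultimately show ?thesis by simp
qed

lemma tot_mono: "(\<And>n. T n \<subseteq> T' n) \<Longrightarrow> tot T \<subseteq> tot T'"
  unfolding tot_def by blast

end

section \<open>Standard graded algebras\<close>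

text \<open>
  An element of a generated subring involves only finitely many generators.
\<close>

lemma generate_ring_finite:
  assumes "x \<in> generate_ring S (K \<union> H)"
  shows "\<exists>F. finite F \<and> F \<subseteq> H \<and> x \<in> generate_ring S (K \<union> F)"
  using assms
proof (induction rule: generate_ring.induct)
  have mono: "x \<in> generate_ring S J" if "x \<in> generate_ring S I" "I \<subseteq> J" for x I J
    using that(1)
  proof (induction rule: generate_ring.induct)
    case one
    show ?case by (rule generate_ring.one)
  next
    case (incl h)
    then show ?case using that(2) by (intro generate_ring.incl) blast
  qed (auto intro: generate_ring.intros)
  {
    case one
    show ?case by (intro exI[of _ "{}"]) (simp add: generate_ring.one)
  next
    case (incl h)
    show ?case
    proof (cases "h \<in> H")
      case True
      then show ?thesis by (intro exI[of _ "{h}"]) (simp add: generate_ring.incl)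
    next
      case False
      then show ?thesis using incl by (intro exI[of _ "{}"]) (simp add: generate_ring.incl)
    qed
  next
    case (a_inv h)
    then show ?case by (blast intro: generate_ring.a_inv)
  next
    case (eng_add h1 h2)
    then obtain F1 F2 where F: "finite F1" "F1 \<subseteq> H" "h1 \<in> generate_ring S (K \<union> F1)"
      "finite F2" "F2 \<subseteq> H" "h2 \<in> generate_ring S (K \<union> F2)" by blast
    have "h1 \<in> generate_ring S (K \<union> (F1 \<union> F2))" by (rule mono[OF F(3)]) blast
    moreover have "h2 \<in> generate_ring S (K \<union> (F1 \<union> F2))" by (rule mono[OF F(6)]) blast
    ultimately show ?case using F by (intro exI[of _ "F1 \<union> F2"]) (simp add: generate_ring.eng_add)
  next
    case (eng_mult h1 h2)
    then obtain F1 F2 where F: "finite F1" "F1 \<subseteq> H" "h1 \<in> generate_ring S (K \<union> F1)"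
      "finite F2" "F2 \<subseteq> H" "h2 \<in> generate_ring S (K \<union> F2)" by blast
    have "h1 \<in> generate_ring S (K \<union> (F1 \<union> F2))" by (rule mono[OF F(3)]) blast
    moreover have "h2 \<in> generate_ring S (K \<union> (F1 \<union> F2))" by (rule mono[OF F(6)]) blast
    ultimately show ?case using F by (intro exI[of _ "F1 \<union> F2"]) (simp add: generate_ring.eng_mult)
  }
qed

lemma (in ring) generate_ring_finite_subset:
  assumes KH: "K \<union> H \<subseteq> carrier R" and X: "finite X" "generate_ring R (K \<union> X) = carrier R"
    and gen: "generate_ring R (K \<union> H) = carrier R" and XR: "X \<subseteq> carrier R"
  shows "\<exists>F. finite F \<and> F \<subseteq> H \<and> generate_ring R (K \<union> F) = carrier R"
proof -
  have "\<forall>x\<in>X. \<exists>F. finite F \<and> F \<subseteq> H \<and> x \<in> generate_ring R (K \<union> F)"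
  proof
    fix x assume "x \<in> X"
    then have "x \<in> generate_ring R (K \<union> H)" using gen XR by blast
    then show "\<exists>F. finite F \<and> F \<subseteq> H \<and> x \<in> generate_ring R (K \<union> F)" by (rule generate_ring_finite)
  qed
  from bchoice[OF this] obtain f where f: "\<forall>x\<in>X. finite (f x) \<and> f x \<subseteq> H \<and> x \<in> generate_ring R (K \<union> f x)" ..
  let ?F = "\<Union>x\<in>X. f x"
  have sub: "K \<union> ?F \<subseteq> carrier R" using KH f by blast
  have "generate_ring R (K \<union> X) \<subseteq> generate_ring R (K \<union> ?F)"
  proof (rule generate_ring_min_subring1)
    show "K \<union> X \<subseteq> carrier R" using KH XR by blast
    show "subring (generate_ring R (K \<union> ?F)) R" by (rule generate_ring_is_subring[OF sub])
    have "x \<in> generate_ring R (K \<union> ?F)" if "x \<in> X" for x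
    proof -
      have "generate_ring R (K \<union> f x) \<subseteq> generate_ring R (K \<union> ?F)" using that sub by (intro mono_generate_ring) auto
      then show ?thesis using f that by blast
    qed
    moreover have "K \<subseteq> generate_ring R (K \<union> ?F)" by (auto intro: generate_ring.incl)
    ultimately show "K \<union> X \<subseteq> generate_ring R (K \<union> ?F)" by blast
  qed
  then have "generate_ring R (K \<union> ?F) = carrier R" using X(2) generate_ring_incl[OF sub] by blast
  then show ?thesis using X(1) f by (intro exI[of _ ?F]) blast
qed

context multigraded_algebra
begin

lemma cring_S: "cring S" and cring_A: "cring A"
  using algebra_axioms unfolding algebra_def module_def by auto

lemma direct_sum_S: "direct_sum S Sg"
  using cring_S ring_decomp by (simp add: direct_sum_def direct_sum_axioms_def cring_def ring_def)

abbreviation scalars :: "'s set" where "scalars \<equiv> structure_map S ` carrier A"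

end

context fin_gen_standard_algebra
begin

lemma hcomp_mult:
  assumes s: "s \<in> Sg a" and x: "x \<in> carrier S"
  shows "direct_sum.hcomp S Sg (s \<otimes>\<^bsub>S\<^esub> x) (a + n) = s \<otimes>\<^bsub>S\<^esub> direct_sum.hcomp S Sg x n"
proof -
  interpret S: direct_sum S Sg by (rule direct_sum_S)
  have sc: "s \<in> carrier S" by (rule S.Gr_carrier[OF s])
  show ?thesis
    using x
  proof (induction rule: S.carrier_induct)
    case zero
    show ?case using sc by (simp add: S.hcomp_zero)
  next
    case (homogeneous k y)
    then show ?case using sc by (simp add: S.hcomp_homogeneous[OF ring_mult[OF s]] S.hcomp_homogeneous)
  next
    case (add x y)
    then show ?case using sc by (simp add: r_distr S.hcomp_add S.hcomp_carrier)
  qed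
qed

text \<open>
  The component \<open>e\<close> of degree zero of \<open>1\<close> satisfies \<open>s = se\<close> for homogeneous \<open>s\<close>, by comparing components in
  \<open>s = s1\<close>.  So \<open>e\<close> is a unit element.
\<close>

lemma one_Sg: "\<one>\<^bsub>S\<^esub> \<in> Sg 0"
proof -
  interpret S: direct_sum S Sg by (rule direct_sum_S)
  let ?e = "S.hcomp \<one>\<^bsub>S\<^esub> 0"
  have e: "?e \<in> carrier S" by (rule S.hcomp_carrier) simp
  have "x \<otimes>\<^bsub>S\<^esub> ?e = x" if "x \<in> carrier S" for x
    using that
  proof (induction rule: S.carrier_induct)
    case zero
    show ?case using e by simp
  next
    case (homogeneous k y)
    have "S.hcomp (y \<otimes>\<^bsub>S\<^esub> \<one>\<^bsub>S\<^esub>) (k + 0) = y \<otimes>\<^bsub>S\<^esub> ?e" by (rule hcomp_mult[OF homogeneous]) simp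
    then show ?case using S.Gr_carrier[OF homogeneous] S.hcomp_homogeneous[OF homogeneous] by simp
  next
    case (add x y)
    then show ?case using e by (simp add: l_distr)
  qed
  from this[of "\<one>\<^bsub>S\<^esub>"] have "?e = \<one>\<^bsub>S\<^esub>" using e by simp
  then show ?thesis using S.hcomp_props(1)[of "\<one>\<^bsub>S\<^esub>" 0] by simp
qed

lemma structure_map_hom: "structure_map S \<in> ring_hom A S"
proof -
  have ab: "(a \<odot>\<^bsub>S\<^esub> \<one>\<^bsub>S\<^esub>) \<otimes>\<^bsub>S\<^esub> (b \<odot>\<^bsub>S\<^esub> \<one>\<^bsub>S\<^esub>) = (a \<otimes>\<^bsub>A\<^esub> b) \<odot>\<^bsub>S\<^esub> \<one>\<^bsub>S\<^esub>" if "a \<in> carrier A" "b \<in> carrier A" for a b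
    using that by (simp add: smult_assoc1 smult_assoc2)
  show ?thesis
    by (rule ring_hom_memI) (auto simp: structure_map_def ab smult_l_distr)
qed

lemma subring_scalars: "subring scalars S"
proof -
  interpret h: ring_hom_ring A S "structure_map S"
    by (rule ring_hom_ringI2[OF R.ring_axioms ring_axioms structure_map_hom])
  show ?thesis by (rule h.img_is_subring[OF R.carrier_is_subring])
qed

lemma scalars_Sg: "scalars \<subseteq> Sg 0"
  using ring_smult[OF _ one_Sg] by (auto simp: structure_map_def)

text \<open>
  The set of elements that multiply the span of \<open>T\<close> into itself is a subring; it contains the generators, so it is
  everything, and the span of \<open>T\<close> contains \<open>1\<close>.
\<close>

lemma Sg_generated:
  assumes H: "generate_ring S (scalars \<union> F) = carrier S" and FH: "F \<subseteq> (\<Union>j. Sg (axis j 1))"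
    and T: "\<And>n. T n \<subseteq> Sg n" "scalars \<subseteq> T 0" "\<And>n. \<zero>\<^bsub>S\<^esub> \<in> T n" "\<And>n s t. s \<in> T n \<Longrightarrow> t \<in> T n \<Longrightarrow> s \<oplus>\<^bsub>S\<^esub> t \<in> T n"
      "\<And>n z t. z \<in> scalars \<Longrightarrow> t \<in> T n \<Longrightarrow> z \<otimes>\<^bsub>S\<^esub> t \<in> T n"
      "\<And>j n z t. z \<in> F \<inter> Sg (axis j 1) \<Longrightarrow> t \<in> T n \<Longrightarrow> z \<otimes>\<^bsub>S\<^esub> t \<in> T (axis j 1 + n)"
  shows "Sg n \<subseteq> T n"
proof -
  interpret S: direct_sum S Sg by (rule direct_sum_S)
  let ?D = "S.tot T"
  have DS: "t \<in> carrier S" if "t \<in> ?D" for t using that by (simp add: S.tot_def)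
  have TD: "t \<in> ?D" if "t \<in> T n" for n t using that T(1,3) by (intro S.tot_homogeneous) auto
  have scal: "z \<in> carrier S" if "z \<in> scalars" for z using that subringE(1)[OF subring_scalars] by blast
  have key: "z \<otimes>\<^bsub>S\<^esub> t \<in> ?D" if z: "z \<in> carrier S" and zT: "\<And>n t. t \<in> T n \<Longrightarrow> \<exists>k. z \<otimes>\<^bsub>S\<^esub> t \<in> T k" and t: "t \<in> ?D" for z t
    using t
  proof (induction rule: S.tot_induct)
    case zero
    show ?case using z S.tot_zero[OF T(3)] by simp
  next
    case (homogeneous n y)
    then show ?case using zT TD by blast
  next
    case (add x y)
    then show ?case using z by (simp add: r_distr S.tot_add[OF T(4)])
  qed
  have "w \<otimes>\<^bsub>S\<^esub> t \<in> ?D" if "w \<in> generate_ring S (scalars \<union> F)" "t \<in> ?D" for w t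
  proof -
    have sub: "scalars \<union> F \<subseteq> carrier S" using scal FH S.Gr_carrier by blast
    show ?thesis
      using that
    proof (induction w arbitrary: t rule: generate_ring.induct)
      case one
      then show ?case using DS by simp
    next
      case (incl h)
      show ?case
      proof (rule key[OF _ _ incl(2)])
        show "h \<in> carrier S" using incl(1) sub by blast
        fix n t assume t: "t \<in> T n"
        show "\<exists>k. h \<otimes>\<^bsub>S\<^esub> t \<in> T k"
        proof (cases "h \<in> scalars")
          case True
          then show ?thesis using T(5) t by blast
        next
          case False
          then obtain j where "h \<in> F \<inter> Sg (axis j 1)" using incl(1) FH by blast
          then show ?thesis using T(6) t by blast
        qed
      qed
    next
      case (a_inv h)
      have h: "h \<in> carrier S" using a_inv(1) generate_ring_in_carrier[OF sub] by blast
      have m1: "\<ominus>\<^bsub>S\<^esub> \<one>\<^bsub>S\<^esub> \<in> scalars" by (intro subringE(5)[OF subring_scalars] subringE(3)[OF subring_scalars])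
      have "(\<ominus>\<^bsub>S\<^esub> \<one>\<^bsub>S\<^esub>) \<otimes>\<^bsub>S\<^esub> (h \<otimes>\<^bsub>S\<^esub> t) \<in> ?D"
        by (rule key[OF scal[OF m1] _ a_inv.IH[OF a_inv.prems]]) (use T(5)[OF m1] in blast)
      then show ?case using h DS[OF a_inv.prems] by (simp add: l_minus)
    next
      case (eng_add h1 h2)
      have "h1 \<in> carrier S" "h2 \<in> carrier S" using eng_add(1,2) generate_ring_in_carrier[OF sub] by blast+
      then have "(h1 \<oplus>\<^bsub>S\<^esub> h2) \<otimes>\<^bsub>S\<^esub> t = h1 \<otimes>\<^bsub>S\<^esub> t \<oplus>\<^bsub>S\<^esub> h2 \<otimes>\<^bsub>S\<^esub> t" using DS[OF eng_add.prems] by (simp add: l_distr)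
      then show ?case using S.tot_add[of T, OF T(4) eng_add.IH(1)[OF eng_add.prems] eng_add.IH(2)[OF eng_add.prems]] by simp
    next
      case (eng_mult h1 h2)
      have "h1 \<in> carrier S" "h2 \<in> carrier S" using eng_mult(1,2) generate_ring_in_carrier[OF sub] by blast+
      then have "(h1 \<otimes>\<^bsub>S\<^esub> h2) \<otimes>\<^bsub>S\<^esub> t = h1 \<otimes>\<^bsub>S\<^esub> (h2 \<otimes>\<^bsub>S\<^esub> t)" using DS[OF eng_mult.prems] by (simp add: m_assoc)
      then show ?case using eng_mult.IH(1)[OF eng_mult.IH(2)[OF eng_mult.prems]] by simp
    qed
  qed
  moreover have oneD: "\<one>\<^bsub>S\<^esub> \<in> ?D" using TD[of _ 0] T(2) subringE(3)[OF subring_scalars] by blast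
  ultimately have all: "s \<in> ?D" if "s \<in> carrier S" for s
    using that H by (metis r_one)
  show ?thesis
  proof
    fix s assume s: "s \<in> Sg n"
    show "s \<in> T n" by (rule S.tot_Int_Gr[OF all[OF S.Gr_carrier[OF s]] s])
  qed
qed

text \<open>
  Pull chains back to ideals of \<open>A\<close>.
\<close>

lemma scalars_finite_length:
  assumes "artinian_ring A"
  shows "\<exists>B. \<forall>C l. (\<forall>i\<le>l. C i \<subseteq> scalars \<and> \<zero>\<^bsub>S\<^esub> \<in> C i \<and> (\<forall>x\<in>C i. \<forall>y\<in>C i. x \<oplus>\<^bsub>S\<^esub> y \<in> C i) \<and>
        (\<forall>z\<in>scalars. \<forall>x\<in>C i. z \<otimes>\<^bsub>S\<^esub> x \<in> C i)) \<longrightarrow> (\<forall>i<l. C i \<subset> C (Suc i)) \<longrightarrow> l \<le> (B :: nat)"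
proof -
  interpret h: ring_hom_ring A S "structure_map S"
    by (rule ring_hom_ringI2[OF R.ring_axioms ring_axioms structure_map_hom])
  let ?h = "structure_map S"
  from artinian_finite_length[OF assms cring_A] obtain B where
    B: "\<And>C l. (\<forall>i\<le>l. ideal (C i) A) \<Longrightarrow> (\<forall>i<l. C i \<subset> C (Suc i)) \<Longrightarrow> l \<le> (B :: nat)" by blast
  show ?thesis
  proof (intro exI[of _ B] allI impI)
    fix C :: "nat \<Rightarrow> 'c set" and l :: nat
    assume C: "\<forall>i\<le>l. C i \<subseteq> scalars \<and> \<zero>\<^bsub>S\<^esub> \<in> C i \<and> (\<forall>x\<in>C i. \<forall>y\<in>C i. x \<oplus>\<^bsub>S\<^esub> y \<in> C i) \<and>
        (\<forall>z\<in>scalars. \<forall>x\<in>C i. z \<otimes>\<^bsub>S\<^esub> x \<in> C i)" and strict: "\<forall>i<l. C i \<subset> C (Suc i)"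
    define I where "I i = {a \<in> carrier A. ?h a \<in> C i}" for i
    have "ideal (I i) A" if i: "i \<le> l" for i
    proof -
      have Ci: "\<zero>\<^bsub>S\<^esub> \<in> C i" "\<And>x y. x \<in> C i \<Longrightarrow> y \<in> C i \<Longrightarrow> x \<oplus>\<^bsub>S\<^esub> y \<in> C i"
        "\<And>a x. a \<in> carrier A \<Longrightarrow> x \<in> C i \<Longrightarrow> ?h a \<otimes>\<^bsub>S\<^esub> x \<in> C i" using C i by auto
      have mult: "a \<otimes>\<^bsub>A\<^esub> x \<in> I i" if "a \<in> carrier A" "x \<in> I i" for a x
        using that Ci(3) by (auto simp: I_def)
      have om: "operator_module A (regular_module A) (carrier A)"
        by (intro operator_module.intro operator_module_axioms.intro R.module_regular_module R.carrier_is_subring)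
      have "operator_module.Zsub (regular_module A) (carrier A) (I i)"
        unfolding operator_module.Zsub_def[OF om]
        using Ci(1,2) mult by (auto simp: I_def h.hom_zero)
      then show ?thesis using R.Zsub_regular_iff[OF om] by blast
    qed
    moreover have "I i \<subset> I (Suc i)" if i: "i < l" for i
    proof -
      have sub: "C i \<subset> C (Suc i)" using strict i by blast
      then obtain x where x: "x \<in> C (Suc i)" "x \<notin> C i" by blast
      have "C (Suc i) \<subseteq> scalars" using C i by simp
      then obtain a where a: "a \<in> carrier A" "x = ?h a" using x(1) by blast
      then have "a \<in> I (Suc i)" "a \<notin> I i" using x by (auto simp: I_def)
      moreover have "I i \<subseteq> I (Suc i)" using sub by (auto simp: I_def)
      ultimately show ?thesis by blast
    qed
    ultimately show "l \<le> B" by (intro B[of l I] allI impI)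
  qed
qed

theorem graded_ring_exists:
  assumes "artinian_ring A"
  shows "\<exists>zs. graded_ring S Sg scalars zs"
proof -
  interpret S: direct_sum S Sg by (rule direct_sum_S)
  have scal: "scalars \<subseteq> carrier S" using subringE(1)[OF subring_scalars] .
  obtain X where X: "finite X" "X \<subseteq> carrier S" "generate_ring S (scalars \<union> X) = carrier S"
    using fin_gen unfolding gen_subalgebra_def by blast
  have st: "generate_ring S (scalars \<union> (\<Union>i. Sg (axis i 1))) = carrier S"
    using standard unfolding gen_subalgebra_def .
  have car: "scalars \<union> (\<Union>i. Sg (axis i 1)) \<subseteq> carrier S" using scal S.Gr_carrier by blast
  obtain F where F: "finite F" "F \<subseteq> (\<Union>i. Sg (axis i 1))" "generate_ring S (scalars \<union> F) = carrier S"
    using generate_ring_finite_subset[OF car X(1,3) st X(2)] by blast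
  have "graded_ring S Sg scalars (\<lambda>j. F \<inter> Sg (axis j 1))"
  proof (intro graded_ring.intro graded_ring_axioms.intro cring_S)
    show "\<exists>B. \<forall>C l. (\<forall>i\<le>l. C i \<subseteq> scalars \<and> \<zero>\<^bsub>S\<^esub> \<in> C i \<and> (\<forall>x\<in>C i. \<forall>y\<in>C i. x \<oplus>\<^bsub>S\<^esub> y \<in> C i) \<and>
        (\<forall>z\<in>scalars. \<forall>x\<in>C i. z \<otimes>\<^bsub>S\<^esub> x \<in> C i)) \<longrightarrow> (\<forall>i<l. C i \<subset> C (Suc i)) \<longrightarrow> l \<le> (B :: nat)"
      by (rule scalars_finite_length[OF assms])
    show "Sg n \<subseteq> T n"
      if "\<And>n. T n \<subseteq> Sg n" "scalars \<subseteq> T 0" "\<And>n. \<zero>\<^bsub>S\<^esub> \<in> T n" "\<And>n s t. s \<in> T n \<Longrightarrow> t \<in> T n \<Longrightarrow> s \<oplus>\<^bsub>S\<^esub> t \<in> T n"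
        "\<And>n z t. z \<in> scalars \<Longrightarrow> t \<in> T n \<Longrightarrow> z \<otimes>\<^bsub>S\<^esub> t \<in> T n"
        "\<And>j n z t. z \<in> F \<inter> Sg (axis j 1) \<Longrightarrow> t \<in> T n \<Longrightarrow> z \<otimes>\<^bsub>S\<^esub> t \<in> T (axis j 1 + n)" for T n
      by (rule Sg_generated[OF F(3,2) that])
    show "subring scalars S" by (rule subring_scalars)
    show "scalars \<subseteq> Sg 0" by (rule scalars_Sg)
  qed (use F(1) S.Gr_carrier S.Gr_zero S.Gr_add ring_mult in auto)
  then show ?thesis by blast
qed

end

section \<open>Finitely generated graded modules\<close>

context multigraded_module
begin

lemma direct_sum_M: "direct_sum M Mg"
  using module_decomp abelian_group_axioms by (simp add: direct_sum_def direct_sum_axioms_def)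

end

text \<open>
  Homogeneous generators are the components of given generators.
\<close>

lemma graded_module_exists:
  assumes alg: "fin_gen_standard_algebra A S Sg" and art: "artinian_ring A"
    and mg: "multigraded_module S Sg M Mg" and fg: "fin_gen_module S M"
  shows "\<exists>zs G. graded_module S Sg (structure_map S ` carrier A) zs M Mg G"
proof -
  interpret alg: fin_gen_standard_algebra A S Sg by fact
  interpret mg: multigraded_module S Sg M Mg by fact
  interpret S: direct_sum S Sg by (rule alg.direct_sum_S)
  interpret M: direct_sum M Mg by (rule mg.direct_sum_M)
  from alg.graded_ring_exists[OF art] obtain zs where zs: "graded_ring S Sg (structure_map S ` carrier A) zs" ..
  from fg obtain Y where Y: "finite Y" "Y \<subseteq> carrier M" "gen_submodule S M Y = carrier M"
    unfolding fin_gen_module_def by blast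
  define G where "G b = {M.hcomp y b | y. y \<in> Y \<and> M.hcomp y b \<noteq> \<zero>\<^bsub>M\<^esub>}" for b
  have Gfin: "finite (G b)" for b
    by (rule finite_subset[of _ "(\<lambda>y. M.hcomp y b) ` Y"]) (auto simp: G_def Y(1))
  have "{b. G b \<noteq> {}} \<subseteq> (\<Union>y\<in>Y. {b. M.hcomp y b \<noteq> \<zero>\<^bsub>M\<^esub>})" by (auto simp: G_def)
  moreover have "finite (\<Union>y\<in>Y. {b. M.hcomp y b \<noteq> \<zero>\<^bsub>M\<^esub>})" using Y(1,2) M.hcomp_props(2) by blast
  ultimately have Gfin': "finite {b. G b \<noteq> {}}" by (rule finite_subset)
  have "graded_module S Sg (structure_map S ` carrier A) zs M Mg G"
  proof (intro graded_module.intro zs graded_module_axioms.intro operator_module.intro operator_module_axioms.intro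
      mg.module_axioms alg.subring_scalars Gfin Gfin')
    show "G b \<subseteq> Mg b" for b using M.hcomp_props(1) Y(2) by (auto simp: G_def)
    fix T n
    assume T: "\<And>n. T n \<subseteq> Mg n" "\<And>n. \<zero>\<^bsub>M\<^esub> \<in> T n" "\<And>n x y. x \<in> T n \<Longrightarrow> y \<in> T n \<Longrightarrow> x \<oplus>\<^bsub>M\<^esub> y \<in> T n"
      "\<And>a n s x. s \<in> Sg a \<Longrightarrow> x \<in> T n \<Longrightarrow> s \<odot>\<^bsub>M\<^esub> x \<in> T (a + n)" "\<And>b. G b \<subseteq> T b"
    let ?D = "M.tot T"
    have Dcar: "?D \<subseteq> carrier M" by (auto simp: M.tot_def)
    have smult: "s \<odot>\<^bsub>M\<^esub> x \<in> ?D" if s: "s \<in> carrier S" and x: "x \<in> ?D" for s x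
      using s
    proof (induction rule: S.carrier_induct)
      case zero
      show ?case using x Dcar M.tot_zero[OF T(2)] by (simp add: mg.smult_l_null subset_iff)
    next
      case (homogeneous a s)
      note s = homogeneous
      have sc: "s \<in> carrier S" by (rule S.Gr_carrier[OF s])
      show ?case
        using x
      proof (induction rule: M.tot_induct)
        case zero
        show ?case using sc M.tot_zero[OF T(2)] by (simp add: mg.smult_r_null)
      next
        case (homogeneous n y)
        have "s \<odot>\<^bsub>M\<^esub> y \<in> T (a + n)" by (rule T(4)[OF s homogeneous(1)])
        then show ?case using T(1,2) by (intro M.tot_homogeneous[of T _ "a + n"]) auto
      next
        case (add x y)
        then show ?case using sc by (simp add: mg.smult_r_distr M.tot_add[OF T(3)])
      qed
    next
      case (add s t)
      then show ?case using x Dcar by (simp add: mg.smult_l_distr subset_iff M.tot_add[OF T(3)])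
    qed
    have "submodule ?D S M"
    proof (rule mg.submoduleI[OF Dcar M.tot_zero[OF T(2)] _ M.tot_add[OF T(3)] smult])
      fix x assume x: "x \<in> ?D"
      have "(\<ominus>\<^bsub>S\<^esub> \<one>\<^bsub>S\<^esub>) \<odot>\<^bsub>M\<^esub> x \<in> ?D" by (rule smult[OF _ x]) simp
      then show "\<ominus>\<^bsub>M\<^esub> x \<in> ?D" using x Dcar by (simp add: mg.smult_l_minus subset_iff)
    qed
    moreover have "Y \<subseteq> ?D"
    proof
      fix y assume y: "y \<in> Y"
      have "M.hcomp y b \<in> T b" for b
        using T(2,5)[of b] y by (cases "M.hcomp y b = \<zero>\<^bsub>M\<^esub>") (auto simp: G_def)
      then show "y \<in> ?D" using y Y(2) by (auto simp: M.tot_def)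
    qed
    ultimately have "carrier M \<subseteq> ?D" unfolding Y(3)[symmetric] gen_submodule_def by blast
    then show "Mg n \<subseteq> T n" using M.tot_Int_Gr[of _ T n] M.Gr_carrier by blast
  qed (use M.Gr_carrier M.Gr_zero M.Gr_add mg.module_smult in auto)
  then show ?thesis by blast
qed

section \<open>Quotient modules and localization\<close>

context module
begin

lemma coset_mem:
  assumes K: "submodule K R M" and m: "m \<in> carrier M"
  shows "x \<in> K +>\<^bsub>M\<^esub> m \<longleftrightarrow> x \<in> carrier M \<and> x \<ominus>\<^bsub>M\<^esub> m \<in> K"
proof
  note K' = submoduleE[OF K]
  assume "x \<in> K +>\<^bsub>M\<^esub> m"
  then obtain k where k: "k \<in> K" "x = k \<oplus>\<^bsub>M\<^esub> m" by (auto simp: a_r_coset_def')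
  then have "k \<in> carrier M" using K'(1) by blast
  then show "x \<in> carrier M \<and> x \<ominus>\<^bsub>M\<^esub> m \<in> K" using k m by (simp add: a_minus_def M.a_assoc M.r_neg)
next
  assume x: "x \<in> carrier M \<and> x \<ominus>\<^bsub>M\<^esub> m \<in> K"
  then have "x = (x \<ominus>\<^bsub>M\<^esub> m) \<oplus>\<^bsub>M\<^esub> m" using m by (simp add: a_minus_def M.a_assoc M.l_neg)
  then show "x \<in> K +>\<^bsub>M\<^esub> m" using x by (auto simp: a_r_coset_def')
qed

lemma submodule_diff: "submodule K R M \<Longrightarrow> x \<in> K \<Longrightarrow> y \<in> K \<Longrightarrow> x \<ominus>\<^bsub>M\<^esub> y \<in> K"
  unfolding a_minus_def by (intro submoduleE(5) submoduleE(3))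

lemma submodule_zero: "submodule K R M \<Longrightarrow> \<zero>\<^bsub>M\<^esub> \<in> K"
proof -
  assume K: "submodule K R M"
  then obtain x where "x \<in> K" using submoduleE(2) by blast
  then have "x \<ominus>\<^bsub>M\<^esub> x \<in> K" "x \<in> carrier M" using submodule_diff[OF K] submoduleE(1)[OF K] by blast+
  then show ?thesis by (simp add: a_minus_def M.r_neg)
qed

lemma coset_eq_iff:
  assumes K: "submodule K R M" and m: "m \<in> carrier M" and m': "m' \<in> carrier M"
  shows "K +>\<^bsub>M\<^esub> m = K +>\<^bsub>M\<^esub> m' \<longleftrightarrow> m \<ominus>\<^bsub>M\<^esub> m' \<in> K"
proof
  assume eq: "K +>\<^bsub>M\<^esub> m = K +>\<^bsub>M\<^esub> m'"
  have "m \<in> K +>\<^bsub>M\<^esub> m" using m submodule_zero[OF K] by (simp add: coset_mem[OF K m] a_minus_def M.r_neg)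
  then show "m \<ominus>\<^bsub>M\<^esub> m' \<in> K" using eq coset_mem[OF K m'] by blast
next
  assume d: "m \<ominus>\<^bsub>M\<^esub> m' \<in> K"
  have step: "x \<ominus>\<^bsub>M\<^esub> b \<in> K" if "a \<ominus>\<^bsub>M\<^esub> b \<in> K" "x \<ominus>\<^bsub>M\<^esub> a \<in> K" "x \<in> carrier M" "a \<in> carrier M" "b \<in> carrier M" for a b x
  proof -
    have "(x \<ominus>\<^bsub>M\<^esub> a) \<oplus>\<^bsub>M\<^esub> (a \<ominus>\<^bsub>M\<^esub> b) \<in> K" by (rule submoduleE(5)[OF K that(2,1)])
    moreover have "(x \<ominus>\<^bsub>M\<^esub> a) \<oplus>\<^bsub>M\<^esub> (a \<ominus>\<^bsub>M\<^esub> b) = x \<ominus>\<^bsub>M\<^esub> b"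
      using that(3-5) by (simp add: a_minus_def M.a_assoc M.r_neg1)
    ultimately show ?thesis by simp
  qed
  have "\<ominus>\<^bsub>M\<^esub> (m \<ominus>\<^bsub>M\<^esub> m') = m' \<ominus>\<^bsub>M\<^esub> m" using m m' by (simp add: a_minus_def M.minus_add M.a_comm)
  then have d': "m' \<ominus>\<^bsub>M\<^esub> m \<in> K" using submoduleE(3)[OF K d] by simp
  have "x \<ominus>\<^bsub>M\<^esub> m \<in> K \<longleftrightarrow> x \<ominus>\<^bsub>M\<^esub> m' \<in> K" if x: "x \<in> carrier M" for x
    using step[OF d _ x m m'] step[OF d' _ x m' m] by blast
  then show "K +>\<^bsub>M\<^esub> m = K +>\<^bsub>M\<^esub> m'" using coset_mem[OF K m] coset_mem[OF K m'] by blast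
qed

lemma minus_zero_right: "m \<in> carrier M \<Longrightarrow> m \<ominus>\<^bsub>M\<^esub> \<zero>\<^bsub>M\<^esub> = m"
  using M.r_neg[of "\<zero>\<^bsub>M\<^esub>"] by (simp add: a_minus_def)

lemma coset_zero:
  assumes "submodule K R M"
  shows "K +>\<^bsub>M\<^esub> \<zero>\<^bsub>M\<^esub> = K"
proof (rule Set.set_eqI)
  fix x
  show "x \<in> K +>\<^bsub>M\<^esub> \<zero>\<^bsub>M\<^esub> \<longleftrightarrow> x \<in> K"
    using coset_mem[OF assms M.zero_closed, of x] submoduleE(1)[OF assms] minus_zero_right[of x] by auto
qed

lemma coset_eq_self: "submodule K R M \<Longrightarrow> m \<in> carrier M \<Longrightarrow> K +>\<^bsub>M\<^esub> m = K \<longleftrightarrow> m \<in> K"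
  using coset_eq_iff[of K m "\<zero>\<^bsub>M\<^esub>"] coset_zero[of K] by (simp add: minus_zero_right)

end

locale plain_module = module R M for R :: "('a, 'b) ring_scheme" and M :: "('a, 'm) module"
begin

lemma quot_carrier: "carrier (quot_module M K) = (\<lambda>m. K +>\<^bsub>M\<^esub> m) ` carrier M"
  by (auto simp: quot_module_def A_RCOSETS_def')

lemma quot_smult:
  assumes K: "submodule K R M" and s: "s \<in> carrier R" and m: "m \<in> carrier M"
  shows "s \<odot>\<^bsub>quot_module M K\<^esub> (K +>\<^bsub>M\<^esub> m) = K +>\<^bsub>M\<^esub> (s \<odot>\<^bsub>M\<^esub> m)"
proof -
  have "K +>\<^bsub>M\<^esub> (s \<odot>\<^bsub>M\<^esub> x) = K +>\<^bsub>M\<^esub> (s \<odot>\<^bsub>M\<^esub> m)" if "x \<in> K +>\<^bsub>M\<^esub> m" for x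
  proof -
    have x: "x \<in> carrier M" "x \<ominus>\<^bsub>M\<^esub> m \<in> K" using that coset_mem[OF K m] by auto
    have "s \<odot>\<^bsub>M\<^esub> x \<ominus>\<^bsub>M\<^esub> s \<odot>\<^bsub>M\<^esub> m = s \<odot>\<^bsub>M\<^esub> (x \<ominus>\<^bsub>M\<^esub> m)"
      using x(1) m s by (simp add: a_minus_def smult_r_distr smult_r_minus)
    then have "s \<odot>\<^bsub>M\<^esub> x \<ominus>\<^bsub>M\<^esub> s \<odot>\<^bsub>M\<^esub> m \<in> K" using submoduleE(4)[OF K s x(2)] by simp
    then show ?thesis using coset_eq_iff[OF K] x(1) m s by simp
  qed
  moreover have "m \<in> K +>\<^bsub>M\<^esub> m" using m submodule_zero[OF K] by (simp add: coset_mem[OF K m] a_minus_def M.r_neg)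
  ultimately have "(\<Union>x\<in>K +>\<^bsub>M\<^esub> m. K +>\<^bsub>M\<^esub> (s \<odot>\<^bsub>M\<^esub> x)) = K +>\<^bsub>M\<^esub> (s \<odot>\<^bsub>M\<^esub> m)"
    by (intro UN_constant_eq) blast+
  then show ?thesis by (simp add: quot_module_def)
qed

text \<open>
  If every element is annihilated modulo \<open>K\<close> by something outside \<open>P\<close>, all fractions are related to each other and
  the localization is a single class.
\<close>

lemma localization_nonzero_iff:
  assumes K: "submodule K R M" and P: "primeideal P R"
  shows "carrier (localization R (quot_module M K) P) \<noteq> {\<zero>\<^bsub>localization R (quot_module M K) P\<^esub>} \<longleftrightarrow>
     (\<exists>m\<in>carrier M. \<forall>u\<in>carrier R - P. u \<odot>\<^bsub>M\<^esub> m \<notin> K)" (is "?L \<longleftrightarrow> ?R")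
proof -
  interpret P: primeideal P R by fact
  let ?Q = "quot_module M K"
  let ?r = "loc_rel R ?Q P"
  let ?c = "\<lambda>m. K +>\<^bsub>M\<^esub> m"
  have one: "\<one>\<^bsub>R\<^esub> \<in> carrier R - P" using P.I_notcarr P.one_imp_carrier by auto
  have mult: "u \<otimes>\<^bsub>R\<^esub> v \<in> carrier R - P" if "u \<in> carrier R - P" "v \<in> carrier R - P" for u v
    using that P.I_prime by auto
  have zeroQ: "\<zero>\<^bsub>?Q\<^esub> = ?c \<zero>\<^bsub>M\<^esub>" using coset_zero[OF K] by (simp add: quot_module_def)
  have rel: "((?c m, s), (?c m', s')) \<in> ?r \<longleftrightarrow> (\<exists>u\<in>carrier R - P. u \<odot>\<^bsub>M\<^esub> (s' \<odot>\<^bsub>M\<^esub> m) \<ominus>\<^bsub>M\<^esub> u \<odot>\<^bsub>M\<^esub> (s \<odot>\<^bsub>M\<^esub> m') \<in> K)"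
    if m: "m \<in> carrier M" "m' \<in> carrier M" and s: "s \<in> carrier R - P" "s' \<in> carrier R - P" for m m' s s'
  proof -
    have "u \<odot>\<^bsub>?Q\<^esub> (s' \<odot>\<^bsub>?Q\<^esub> ?c m) = u \<odot>\<^bsub>?Q\<^esub> (s \<odot>\<^bsub>?Q\<^esub> ?c m') \<longleftrightarrow>
        u \<odot>\<^bsub>M\<^esub> (s' \<odot>\<^bsub>M\<^esub> m) \<ominus>\<^bsub>M\<^esub> u \<odot>\<^bsub>M\<^esub> (s \<odot>\<^bsub>M\<^esub> m') \<in> K" if "u \<in> carrier R - P" for u
      using that m s by (simp add: quot_smult[OF K] coset_eq_iff[OF K])
    then show ?thesis using m s by (auto simp: loc_rel_def quot_carrier)
  qed
  have zero_class: "\<zero>\<^bsub>localization R ?Q P\<^esub> = ?r `` {(?c \<zero>\<^bsub>M\<^esub>, \<one>\<^bsub>R\<^esub>)}"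
    by (simp add: localization_def zeroQ)
  have carr: "carrier (localization R ?Q P) = (carrier ?Q \<times> (carrier R - P)) // ?r"
    by (simp add: localization_def)
  show ?thesis
  proof
    assume ?L
    show ?R
    proof (rule ccontr)
      assume "\<not> ?R"
      then have kill: "\<exists>u\<in>carrier R - P. u \<odot>\<^bsub>M\<^esub> m \<in> K" if "m \<in> carrier M" for m using that by blast
      have all: "((?c m, s), (?c m', s')) \<in> ?r"
        if m: "m \<in> carrier M" "m' \<in> carrier M" and s: "s \<in> carrier R - P" "s' \<in> carrier R - P" for m m' s s'
      proof -
        from kill[OF m(1)] obtain u where u: "u \<in> carrier R - P" "u \<odot>\<^bsub>M\<^esub> m \<in> K" by blast
        from kill[OF m(2)] obtain v where v: "v \<in> carrier R - P" "v \<odot>\<^bsub>M\<^esub> m' \<in> K" by blast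
        have car: "u \<in> carrier R" "v \<in> carrier R" "s \<in> carrier R" "s' \<in> carrier R" using u v s by auto
        have "(u \<otimes>\<^bsub>R\<^esub> v) \<odot>\<^bsub>M\<^esub> (s' \<odot>\<^bsub>M\<^esub> m) = (v \<otimes>\<^bsub>R\<^esub> s') \<odot>\<^bsub>M\<^esub> (u \<odot>\<^bsub>M\<^esub> m)"
          using car m by (simp add: smult_assoc1[symmetric] R.m_ac)
        moreover have "(v \<otimes>\<^bsub>R\<^esub> s') \<odot>\<^bsub>M\<^esub> (u \<odot>\<^bsub>M\<^esub> m) \<in> K" using car by (intro submoduleE(4)[OF K _ u(2)]) simp
        moreover have "(u \<otimes>\<^bsub>R\<^esub> v) \<odot>\<^bsub>M\<^esub> (s \<odot>\<^bsub>M\<^esub> m') = (u \<otimes>\<^bsub>R\<^esub> s) \<odot>\<^bsub>M\<^esub> (v \<odot>\<^bsub>M\<^esub> m')"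
          using car m by (simp add: smult_assoc1[symmetric] R.m_ac)
        moreover have "(u \<otimes>\<^bsub>R\<^esub> s) \<odot>\<^bsub>M\<^esub> (v \<odot>\<^bsub>M\<^esub> m') \<in> K" using car by (intro submoduleE(4)[OF K _ v(2)]) simp
        ultimately have "(u \<otimes>\<^bsub>R\<^esub> v) \<odot>\<^bsub>M\<^esub> (s' \<odot>\<^bsub>M\<^esub> m) \<ominus>\<^bsub>M\<^esub> (u \<otimes>\<^bsub>R\<^esub> v) \<odot>\<^bsub>M\<^esub> (s \<odot>\<^bsub>M\<^esub> m') \<in> K"
          using submodule_diff[OF K] by simp
        then show ?thesis using rel[OF m s] mult[OF u(1) v(1)] by blast
      qed
      have cls: "?r `` {(?c m, s)} = carrier ?Q \<times> (carrier R - P)" if "m \<in> carrier M" "s \<in> carrier R - P" for m s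
      proof
        show "?r `` {(?c m, s)} \<subseteq> carrier ?Q \<times> (carrier R - P)" by (auto simp: loc_rel_def)
        show "carrier ?Q \<times> (carrier R - P) \<subseteq> ?r `` {(?c m, s)}"
          using all[OF that(1) _ that(2)] by (auto simp: quot_carrier)
      qed
      have "carrier (localization R ?Q P) = {carrier ?Q \<times> (carrier R - P)}"
      proof -
        have "(carrier ?Q \<times> (carrier R - P)) // ?r = {carrier ?Q \<times> (carrier R - P)}"
        proof
          show "(carrier ?Q \<times> (carrier R - P)) // ?r \<subseteq> {carrier ?Q \<times> (carrier R - P)}"
          proof
            fix X assume "X \<in> (carrier ?Q \<times> (carrier R - P)) // ?r"
            then obtain y where y: "y \<in> carrier ?Q \<times> (carrier R - P)" "X = ?r `` {y}" by (rule quotientE)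
            then obtain m s where "y = (?c m, s)" "m \<in> carrier M" "s \<in> carrier R - P" by (auto simp: quot_carrier)
            then show "X \<in> {carrier ?Q \<times> (carrier R - P)}" using y(2) cls by simp
          qed
          have "(?c \<zero>\<^bsub>M\<^esub>, \<one>\<^bsub>R\<^esub>) \<in> carrier ?Q \<times> (carrier R - P)" using one by (auto simp: quot_carrier)
          then have "?r `` {(?c \<zero>\<^bsub>M\<^esub>, \<one>\<^bsub>R\<^esub>)} \<in> (carrier ?Q \<times> (carrier R - P)) // ?r" by (rule quotientI)
          then show "{carrier ?Q \<times> (carrier R - P)} \<subseteq> (carrier ?Q \<times> (carrier R - P)) // ?r"
            using cls[OF M.zero_closed one] by simp
        qed
        then show ?thesis by (simp add: carr)
      qed
      moreover have "\<zero>\<^bsub>localization R ?Q P\<^esub> = carrier ?Q \<times> (carrier R - P)"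
        using cls[OF M.zero_closed one] by (simp add: zero_class)
      ultimately show False using \<open>?L\<close> by simp
    qed
  next
    assume ?R
    then obtain m where m: "m \<in> carrier M" "\<And>u. u \<in> carrier R - P \<Longrightarrow> u \<odot>\<^bsub>M\<^esub> m \<notin> K" by blast
    have "(?c m, \<one>\<^bsub>R\<^esub>) \<in> carrier ?Q \<times> (carrier R - P)" using m one by (auto simp: quot_carrier)
    then have "?r `` {(?c m, \<one>\<^bsub>R\<^esub>)} \<in> carrier (localization R ?Q P)" unfolding carr by (rule quotientI)
    moreover have "?r `` {(?c m, \<one>\<^bsub>R\<^esub>)} \<noteq> \<zero>\<^bsub>localization R ?Q P\<^esub>"
    proof
      assume eq: "?r `` {(?c m, \<one>\<^bsub>R\<^esub>)} = \<zero>\<^bsub>localization R ?Q P\<^esub>"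
      have "((?c m, \<one>\<^bsub>R\<^esub>), (?c m, \<one>\<^bsub>R\<^esub>)) \<in> ?r"
        unfolding rel[OF m(1) m(1) one one]
        using one m(1) submodule_zero[OF K] by (intro bexI[of _ "\<one>\<^bsub>R\<^esub>"]) (simp_all add: a_minus_def M.r_neg)
      then have "((?c \<zero>\<^bsub>M\<^esub>, \<one>\<^bsub>R\<^esub>), (?c m, \<one>\<^bsub>R\<^esub>)) \<in> ?r" using eq zero_class by blast
      then obtain u where u: "u \<in> carrier R - P" "u \<odot>\<^bsub>M\<^esub> (\<one>\<^bsub>R\<^esub> \<odot>\<^bsub>M\<^esub> \<zero>\<^bsub>M\<^esub>) \<ominus>\<^bsub>M\<^esub> u \<odot>\<^bsub>M\<^esub> (\<one>\<^bsub>R\<^esub> \<odot>\<^bsub>M\<^esub> m) \<in> K"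
        unfolding rel[OF M.zero_closed m(1) one one] by blast
      then have "\<ominus>\<^bsub>M\<^esub> (u \<odot>\<^bsub>M\<^esub> m) \<in> K" using m(1) by (simp add: a_minus_def smult_r_null)
      then have "\<ominus>\<^bsub>M\<^esub> (\<ominus>\<^bsub>M\<^esub> (u \<odot>\<^bsub>M\<^esub> m)) \<in> K" by (rule submoduleE(3)[OF K])
      then have "u \<odot>\<^bsub>M\<^esub> m \<in> K" using u(1) m(1) by simp
      then show False using m(2)[OF u(1)] by blast
    qed
    ultimately show ?L by (metis singletonD)
  qed
qed

end

lemma chain_dim_le_0_iff: "chain_dim X \<le> 0 \<longleftrightarrow> (\<forall>P\<in>X. \<forall>Q\<in>X. \<not> P \<subset> Q)"
proof
  assume le: "chain_dim X \<le> 0"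
  show "\<forall>P\<in>X. \<forall>Q\<in>X. \<not> P \<subset> Q"
  proof (intro ballI notI)
    fix P Q assume PQ: "P \<in> X" "Q \<in> X" "P \<subset> Q"
    have "\<exists>R :: nat \<Rightarrow> 'a set. (\<forall>i\<le>1. R i \<in> X) \<and> (\<forall>i<1. R i \<subset> R (Suc i))"
      by (rule exI[of _ "\<lambda>i. if i = 0 then P else Q"]) (use PQ in \<open>simp add: One_nat_def\<close>)
    then have "ereal (real 1) \<in> {ereal (real l) | l. \<exists>P :: nat \<Rightarrow> 'a set. (\<forall>i\<le>l. P i \<in> X) \<and> (\<forall>i<l. P i \<subset> P (Suc i))}"
      by blast
    then have "ereal (real 1) \<le> chain_dim X" unfolding chain_dim_def by (rule Sup_upper)
    then have "ereal (real 1) \<le> 0" using le by (rule order_trans)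
    then show False by simp
  qed
next
  assume no: "\<forall>P\<in>X. \<forall>Q\<in>X. \<not> P \<subset> Q"
  show "chain_dim X \<le> 0" unfolding chain_dim_def
  proof (rule Sup_least)
    fix z assume "z \<in> {ereal (real l) | l. \<exists>P :: nat \<Rightarrow> 'a set. (\<forall>i\<le>l. P i \<in> X) \<and> (\<forall>i<l. P i \<subset> P (Suc i))}"
    then obtain l and P :: "nat \<Rightarrow> 'a set" where l: "z = ereal (real l)" "\<forall>i\<le>l. P i \<in> X" "\<forall>i<l. P i \<subset> P (Suc i)" by blast
    have "l = 0"
    proof (rule ccontr)
      assume "l \<noteq> 0"
      then have "P 0 \<in> X" "P (Suc 0) \<in> X" "P 0 \<subset> P (Suc 0)" using l(2,3) by auto
      then show False using no by blast
    qed
    then show "z \<le> 0" using l(1) by simp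
  qed
qed

section \<open>Submodules and their homogeneous components\<close>

text \<open>
  A name for the ring instance, as the module has its own instance of the same fact.
\<close>

lemmas (in graded_ring) S_finsum_insert = finsum_insert

text \<open>
  The passage between families and actual submodules and ideals, where both direct sum decompositions are available.
\<close>

locale graded_setting = graded_module S Sg Z zs M Mg G
  for S :: "('a, 'b) ring_scheme" and Sg :: "nat ^ 'd::finite \<Rightarrow> 'a set" and Z zs
    and M :: "('a, 'm) module" (structure) and Mg G +
  assumes S_decomp: "direct_sum_decomp S Sg" and M_decomp: "direct_sum_decomp M Mg"

sublocale graded_setting \<subseteq> SD: direct_sum S Sg
  by (intro direct_sum.intro direct_sum_axioms.intro S_decomp abelian_group_axioms ring.axioms(1) cring.axioms(1) cring_axioms)

sublocale graded_setting \<subseteq> MD: direct_sum M Mg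
  by (intro direct_sum.intro direct_sum_axioms.intro M_decomp M.abelian_group_axioms)

sublocale graded_setting \<subseteq> PM: plain_module S M
  by (intro plain_module.intro module_axioms)

context graded_setting
begin

lemma hcomp_smult:
  assumes s: "s \<in> carrier S" and x: "x \<in> Mg b"
  shows "MD.hcomp (s \<odot> x) (n + b) = SD.hcomp s n \<odot> x"
proof -
  have xc: "x \<in> carrier M" by (rule Mg_carrier[OF x])
  show ?thesis
    using s
  proof (induction rule: SD.carrier_induct)
    case zero
    show ?case using xc by (simp add: SD.hcomp_zero MD.hcomp_zero smult_l_null)
  next
    case (homogeneous a s)
    have "s \<odot> x \<in> Mg (a + b)" by (rule Mg_smult[OF homogeneous x])
    then show ?case using xc by (simp add: MD.hcomp_homogeneous SD.hcomp_homogeneous[OF homogeneous] smult_l_null)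
  next
    case (add s t)
    then show ?case using xc by (simp add: smult_l_distr MD.hcomp_add SD.hcomp_add SD.hcomp_carrier)
  qed
qed

lemma gsub_tot: "gsub N \<Longrightarrow> x \<in> N n \<Longrightarrow> x \<in> MD.tot N"
  by (rule MD.tot_homogeneous[of N x n]) (auto simp: gsubD)

lemma gsub_tot_zero: "gsub N \<Longrightarrow> \<zero> \<in> MD.tot N"
  by (rule MD.tot_zero[of N]) (rule gsubD(2))

lemma gsub_tot_add: "gsub N \<Longrightarrow> x \<in> MD.tot N \<Longrightarrow> y \<in> MD.tot N \<Longrightarrow> x \<oplus> y \<in> MD.tot N"
  by (rule MD.tot_add[of N]) (rule gsubD(3))

lemma gideal_tot_zero: "gideal P \<Longrightarrow> \<zero>\<^bsub>S\<^esub> \<in> SD.tot P"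
  by (rule SD.tot_zero[of P]) (rule gidealD(2))

lemma gideal_tot_add: "gideal P \<Longrightarrow> x \<in> SD.tot P \<Longrightarrow> y \<in> SD.tot P \<Longrightarrow> x \<oplus>\<^bsub>S\<^esub> y \<in> SD.tot P"
  by (rule SD.tot_add[of P]) (rule gidealD(3))

lemma gideal_tot: "gideal P \<Longrightarrow> x \<in> P n \<Longrightarrow> x \<in> SD.tot P"
  by (rule SD.tot_homogeneous[of P x n]) (auto simp: gidealD)

lemma submodule_tot:
  assumes N: "gsub N"
  shows "submodule (MD.tot N) S M"
proof -
  have sub: "MD.tot N \<subseteq> carrier M" by (auto simp: MD.tot_def)
  have smult: "s \<odot> x \<in> MD.tot N" if s: "s \<in> carrier S" and x: "x \<in> MD.tot N" for s x
    using s
  proof (induction rule: SD.carrier_induct)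
    case zero
    have "x \<in> carrier M" using x sub by blast
    then show ?case using gsub_tot_zero[OF N] by (simp add: smult_l_null)
  next
    case (homogeneous a s)
    note s = homogeneous
    have sc: "s \<in> carrier S" by (rule Sg_carrier[OF s])
    show ?case
      using x
    proof (induction rule: MD.tot_induct)
      case zero
      show ?case using sc gsub_tot_zero[OF N] by (simp add: smult_r_null)
    next
      case (homogeneous n y)
      have y: "s \<odot> y \<in> N (a + n)" by (rule gsubD(4)[OF N s homogeneous(1)])
      show ?case by (rule gsub_tot[OF N y])
    next
      case (add x y)
      then show ?case using sc by (simp add: smult_r_distr gsub_tot_add[OF N])
    qed
  next
    case (add s t)
    have "x \<in> carrier M" using x sub by blast
    then show ?case using add by (simp add: smult_l_distr gsub_tot_add[OF N])
  qed
  show ?thesis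
  proof (rule submoduleI[OF sub gsub_tot_zero[OF N] _ gsub_tot_add[OF N] smult])
    fix x assume x: "x \<in> MD.tot N"
    have "(\<ominus>\<^bsub>S\<^esub> \<one>\<^bsub>S\<^esub>) \<odot> x \<in> MD.tot N" by (rule smult[OF Z_carrier[OF Z_minus_one] x])
    moreover have "x \<in> carrier M" using x sub by blast
    ultimately show "\<ominus> x \<in> MD.tot N" using Z_carrier[OF one_Z] by (simp add: smult_l_minus)
  qed
qed

lemma tot_subset_submodule:
  assumes "gsub N" "submodule K S M" "\<And>n. N n \<subseteq> K"
  shows "MD.tot N \<subseteq> K"
proof
  fix x assume "x \<in> MD.tot N"
  then show "x \<in> K"
  proof (induction rule: MD.tot_induct)
    case zero
    show ?case by (rule submodule_zero[OF assms(2)])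
  next
    case (homogeneous n y)
    then show ?case using assms(3) by blast
  next
    case (add x y)
    then show ?case using submoduleE(5)[OF assms(2)] by blast
  qed
qed

text \<open>
  The submodule is homogeneous since its generators \<open>xm\<close> are sums of homogeneous ones.
\<close>

lemma seq_submodule_tot:
  assumes ps: "homogeneous_seq ps"
  shows "seq_submodule S M (map snd ps) = MD.tot (seq_ext Mg (\<lambda>_. {\<zero>}) ps)" (is "_ = MD.tot ?N")
proof -
  note ext = seq_ext_props[OF ps gsub_zero gsub_Mg zero_le_gsub[OF gsub_Mg]]
  let ?X = "{x \<odot> m | x m. x \<in> set (map snd ps) \<and> m \<in> carrier M}"
  have Xtot: "?X \<subseteq> MD.tot ?N"
  proof
    fix y assume "y \<in> ?X"
    then obtain p m where p: "p \<in> set ps" "y = snd p \<odot> m" "m \<in> carrier M" by auto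
    have x: "snd p \<in> carrier S" using ps p(1) Sg_carrier unfolding homogeneous_seq_def by blast
    have "snd p \<odot> m \<in> MD.tot ?N"
      using p(3)
    proof (induction rule: MD.carrier_induct)
      case zero
      show ?case using x gsub_tot_zero[OF ext(1)] by (simp add: smult_r_null)
    next
      case (homogeneous n v)
      have v: "snd p \<odot> v \<in> ?N (axis (fst p) 1 + n)" by (rule ext(4)[OF p(1) homogeneous])
      show ?case by (rule gsub_tot[OF ext(1) v])
    next
      case (add u v)
      then show ?case using x by (simp add: smult_r_distr gsub_tot_add[OF ext(1)])
    qed
    then show "y \<in> MD.tot ?N" using p(2) by simp
  qed
  show ?thesis
  proof
    show "seq_submodule S M (map snd ps) \<subseteq> MD.tot ?N"
      unfolding seq_submodule_def gen_submodule_def using submodule_tot[OF ext(1)] Xtot by blast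
    show "MD.tot ?N \<subseteq> seq_submodule S M (map snd ps)"
      unfolding seq_submodule_def gen_submodule_def
    proof (rule Inter_greatest)
      fix K assume "K \<in> {N. submodule N S M \<and> ?X \<subseteq> N}"
      then have K: "submodule K S M" and XK: "?X \<subseteq> K" by auto
      define Kf where "Kf n = K \<inter> Mg n" for n
      have gK: "gsub Kf"
      proof (rule gsubI)
        show "\<zero> \<in> Kf n" for n using submodule_zero[OF K] Mg_zero by (simp add: Kf_def)
        show "x \<oplus> y \<in> Kf n" if "x \<in> Kf n" "y \<in> Kf n" for n x y
          using that submoduleE(5)[OF K] Mg_add by (simp add: Kf_def)
        show "s \<odot> x \<in> Kf (a + n)" if "s \<in> Sg a" "x \<in> Kf n" for a n s x
          using that submoduleE(4)[OF K Sg_carrier[OF that(1)], of x] Mg_smult[OF that(1), of x n] by (simp add: Kf_def)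
      qed (auto simp: Kf_def)
      have "?N \<le> Kf"
      proof (rule seq_ext_least[OF gK zero_le_gsub[OF gK]])
        fix p n v assume p: "p \<in> set ps" and v: "v \<in> Mg n"
        have "snd p \<in> Sg (axis (fst p) 1)" using ps p unfolding homogeneous_seq_def by blast
        from Mg_smult[OF this v] have "snd p \<odot> v \<in> Mg (axis (fst p) 1 + n)" .
        moreover have "snd p \<odot> v \<in> ?X" using p Mg_carrier[OF v] by auto
        ultimately show "snd p \<odot> v \<in> Kf (axis (fst p) 1 + n)" using XK unfolding Kf_def by blast
      qed
      then have "?N n \<subseteq> K" for n unfolding Kf_def le_fun_def by blast
      then show "MD.tot ?N \<subseteq> K" by (rule tot_subset_submodule[OF ext(1) K])
    qed
  qed
qed

lemma sequence_of_type_iff: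
  "sequence_of_type Sg xs k \<longleftrightarrow> (\<exists>ps. homogeneous_seq ps \<and> map snd ps = xs \<and> seq_type ps = k)"
proof
  assume "sequence_of_type Sg xs k"
  then obtain js where js: "list_all2 (\<lambda>x j. x \<in> Sg (axis j 1)) xs js" "\<forall>j. count_list js j = k $ j"
    unfolding sequence_of_type_def by blast
  have len: "length js = length xs" using list_all2_lengthD[OF js(1)] by simp
  have "homogeneous_seq (zip js xs)"
    using js(1) by (auto simp: homogeneous_seq_def list_all2_conv_all_nth set_zip)
  moreover have "seq_type (zip js xs) = k" using js(2) len by (simp add: seq_type_def vec_eq_iff)
  ultimately show "\<exists>ps. homogeneous_seq ps \<and> map snd ps = xs \<and> seq_type ps = k"
    using len by (intro exI[of _ "zip js xs"]) simp
next
  assume "\<exists>ps. homogeneous_seq ps \<and> map snd ps = xs \<and> seq_type ps = k"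
  then obtain ps where ps: "homogeneous_seq ps" "map snd ps = xs" "seq_type ps = k" by blast
  have "list_all2 (\<lambda>x j. x \<in> Sg (axis j 1)) xs (map fst ps)"
    using ps(1) unfolding ps(2)[symmetric] homogeneous_seq_def by (simp add: list_all2_map1 list_all2_map2 list_all2_same)
  moreover have "\<forall>j. count_list (map fst ps) j = k $ j" using ps(3) by (auto simp: seq_type_def)
  ultimately show "sequence_of_type Sg xs k" unfolding sequence_of_type_def by blast
qed

end

section \<open>Homogeneous prime ideals\<close>

text \<open>
  The degree set is a unique product monoid.  Maximize the first coordinate in both sets, then the second one
  among the remaining elements, and so on; in the induction the hypothesis compares sums only on the coordinates
  already treated.
\<close>

lemma unique_sum_pair:
  fixes F G :: "(nat ^ 'd::finite) set"
  assumes "finite F" "F \<noteq> {}" "finite G" "G \<noteq> {}"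
  shows "\<exists>\<alpha>\<in>F. \<exists>\<beta>\<in>G. \<forall>\<gamma>\<in>F. \<forall>\<delta>\<in>G. \<gamma> + \<delta> = \<alpha> + \<beta> \<longrightarrow> \<gamma> = \<alpha> \<and> \<delta> = \<beta>"
proof -
  have "\<exists>\<alpha>\<in>F. \<exists>\<beta>\<in>G. \<forall>\<gamma>\<in>F. \<forall>\<delta>\<in>G. (\<forall>j\<in>J. \<gamma> $ j + \<delta> $ j = \<alpha> $ j + \<beta> $ j) \<longrightarrow>
      (\<forall>j\<in>J. \<gamma> $ j = \<alpha> $ j \<and> \<delta> $ j = \<beta> $ j)" if "finite J" for J
    using that
  proof induction
    case empty
    then show ?case using assms by auto
  next
    case (insert i J)
    then obtain \<alpha> \<beta> where ab: "\<alpha> \<in> F" "\<beta> \<in> G"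
      and un: "\<forall>\<gamma>\<in>F. \<forall>\<delta>\<in>G. (\<forall>j\<in>J. \<gamma> $ j + \<delta> $ j = \<alpha> $ j + \<beta> $ j) \<longrightarrow>
      (\<forall>j\<in>J. \<gamma> $ j = \<alpha> $ j \<and> \<delta> $ j = \<beta> $ j)" by blast
    define F' where "F' = {\<gamma> \<in> F. \<forall>j\<in>J. \<gamma> $ j = \<alpha> $ j}"
    define G' where "G' = {\<delta> \<in> G. \<forall>j\<in>J. \<delta> $ j = \<beta> $ j}"
    have F': "finite F'" "F' \<noteq> {}" and G': "finite G'" "G' \<noteq> {}"
      using assms(1,3) ab by (auto simp: F'_def G'_def)
    obtain \<alpha>' where a: "\<alpha>' \<in> F'" "\<forall>\<gamma>\<in>F'. \<gamma> $ i \<le> \<alpha>' $ i"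
      using Max_in[of "(\<lambda>\<gamma>. \<gamma> $ i) ` F'"] Max_ge[of "(\<lambda>\<gamma>. \<gamma> $ i) ` F'"] F' by (fastforce simp: image_iff)
    obtain \<beta>' where b: "\<beta>' \<in> G'" "\<forall>\<gamma>\<in>G'. \<gamma> $ i \<le> \<beta>' $ i"
      using Max_in[of "(\<lambda>\<gamma>. \<gamma> $ i) ` G'"] Max_ge[of "(\<lambda>\<gamma>. \<gamma> $ i) ` G'"] G' by (fastforce simp: image_iff)
    have a': "\<alpha>' \<in> F" "\<forall>j\<in>J. \<alpha>' $ j = \<alpha> $ j" and b': "\<beta>' \<in> G" "\<forall>j\<in>J. \<beta>' $ j = \<beta> $ j"
      using a b by (auto simp: F'_def G'_def)
    have "\<forall>j\<in>insert i J. \<gamma> $ j = \<alpha>' $ j \<and> \<delta> $ j = \<beta>' $ j"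
      if g: "\<gamma> \<in> F" "\<delta> \<in> G" and eq: "\<forall>j\<in>insert i J. \<gamma> $ j + \<delta> $ j = \<alpha>' $ j + \<beta>' $ j" for \<gamma> \<delta>
    proof -
      have "\<forall>j\<in>J. \<gamma> $ j + \<delta> $ j = \<alpha> $ j + \<beta> $ j" using eq a'(2) b'(2) by simp
      then have J: "\<forall>j\<in>J. \<gamma> $ j = \<alpha> $ j \<and> \<delta> $ j = \<beta> $ j" using un g by blast
      then have "\<gamma> \<in> F'" "\<delta> \<in> G'" using g by (simp_all add: F'_def G'_def)
      then have "\<gamma> $ i \<le> \<alpha>' $ i" "\<delta> $ i \<le> \<beta>' $ i" using a(2) b(2) by blast+
      moreover have "\<gamma> $ i + \<delta> $ i = \<alpha>' $ i + \<beta>' $ i" using eq by simp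
      ultimately have "\<gamma> $ i = \<alpha>' $ i \<and> \<delta> $ i = \<beta>' $ i" by linarith
      then show ?thesis using J a'(2) b'(2) by simp
    qed
    then show ?case using a'(1) b'(1) by blast
  qed
  from this[of UNIV] show ?thesis by (simp add: vec_eq_iff all_conj_distrib)
qed

context graded_setting
begin

lemma gideal_tot_ideal:
  assumes P: "gideal P"
  shows "ideal (SD.tot P) S"
proof -
  have mult: "s \<otimes>\<^bsub>S\<^esub> x \<in> SD.tot P" if s: "s \<in> carrier S" and x: "x \<in> SD.tot P" for s x
    using s
  proof (induction rule: SD.carrier_induct)
    case zero
    then show ?case using x gideal_tot_zero[OF P] by (simp add: SD.tot_def)
  next
    case (homogeneous a s)
    note s = homogeneous
    show ?case
      using x
    proof (induction rule: SD.tot_induct)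
      case zero
      show ?case using Sg_carrier[OF s] gideal_tot_zero[OF P] by simp
    next
      case (homogeneous n y)
      have y: "s \<otimes>\<^bsub>S\<^esub> y \<in> P (a + n)" by (rule gidealD(4)[OF P s homogeneous(1)])
      show ?case by (rule gideal_tot[OF P y])
    next
      case (add x y)
      then show ?case using Sg_carrier[OF s] by (simp add: r_distr gideal_tot_add[OF P])
    qed
  next
    case (add s t)
    have "x \<in> carrier S" using x by (simp add: SD.tot_def)
    then show ?case using add by (simp add: l_distr gideal_tot_add[OF P])
  qed
  have om: "operator_module S (regular_module S) (carrier S)"
    by (intro operator_module.intro operator_module_axioms.intro module_regular_module carrier_is_subring)
  have "operator_module.Zsub (regular_module S) (carrier S) (SD.tot P)"
    unfolding operator_module.Zsub_def[OF om]
    using gideal_tot_zero[OF P] gideal_tot_add[OF P] mult by (simp add: SD.tot_def subset_iff)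
  then show ?thesis using Zsub_regular_iff[OF om] by blast
qed

lemma hcomp_mult:
  assumes s: "s \<in> Sg a" and t: "t \<in> carrier S"
  shows "SD.hcomp (s \<otimes>\<^bsub>S\<^esub> t) k = (if a \<le> k then s \<otimes>\<^bsub>S\<^esub> SD.hcomp t (k - a) else \<zero>\<^bsub>S\<^esub>)"
  using t
proof (induction rule: SD.carrier_induct)
  case zero
  show ?case using Sg_carrier[OF s] by (simp add: SD.hcomp_zero)
next
  case (homogeneous n y)
  have "a \<le> k \<and> k - a = n \<longleftrightarrow> k = a + n"
    by (auto simp: less_eq_vec_def vec_eq_iff) (metis le_add_diff_inverse)
  then show ?case using Sg_carrier[OF s]
    by (auto simp: SD.hcomp_homogeneous[OF Sg_mult[OF s homogeneous]] SD.hcomp_homogeneous[OF homogeneous])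
next
  case (add x y)
  then show ?case using Sg_carrier[OF s] by (simp add: r_distr SD.hcomp_add SD.hcomp_carrier)
qed

text \<open>
  Primality may be tested on homogeneous elements: if \<open>s\<close> and \<open>t\<close> are outside, choose by \<open>unique_sum_pair\<close> degrees \<open>\<alpha>\<close> and
  \<open>\<beta>\<close> of components outside \<open>P\<close> such that the component of \<open>st\<close> of degree \<open>\<alpha> + \<beta>\<close> is \<open>s\<^sub>\<alpha>t\<^sub>\<beta>\<close> modulo \<open>P\<close>.
\<close>

lemma gprime_tot_prime:
  assumes P: "gprime P"
  shows "primeideal (SD.tot P) S"
proof (rule primeidealI)
  note iP = gprimeD(1)[OF P]
  show "ideal (SD.tot P) S" by (rule gideal_tot_ideal[OF iP])
  then interpret T: ideal "SD.tot P" S .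
  show "cring S" by (rule cring_axioms)
  have "\<one>\<^bsub>S\<^esub> \<notin> SD.tot P" using SD.tot_Int_Gr[of "\<one>\<^bsub>S\<^esub>" P 0] one_Sg gprimeD(2)[OF P] by blast
  then show "carrier S \<noteq> SD.tot P" by auto
  fix s t assume s: "s \<in> carrier S" and t: "t \<in> carrier S" and st: "s \<otimes>\<^bsub>S\<^esub> t \<in> SD.tot P"
  show "s \<in> SD.tot P \<or> t \<in> SD.tot P"
  proof (rule ccontr)
    assume *: "\<not> (s \<in> SD.tot P \<or> t \<in> SD.tot P)"
    define F where "F = {n. SD.hcomp s n \<notin> P n}"
    define H where "H = {n. SD.hcomp t n \<notin> P n}"
    let ?supp = "{n. SD.hcomp s n \<noteq> \<zero>\<^bsub>S\<^esub>}"
    have F: "F \<subseteq> ?supp" and H: "H \<subseteq> {n. SD.hcomp t n \<noteq> \<zero>\<^bsub>S\<^esub>}"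
      using gidealD(2)[OF iP] by (auto simp: F_def H_def)
    have fin: "finite ?supp" by (rule SD.hcomp_props(2)[OF s])
    have finF: "finite F" by (rule finite_subset[OF F fin])
    have finH: "finite H" by (rule finite_subset[OF H SD.hcomp_props(2)[OF t]])
    have neF: "F \<noteq> {}"
    proof
      assume "F = {}"
      then have "s \<in> SD.tot P" using s unfolding F_def SD.tot_def by blast
      then show False using * by blast
    qed
    have neH: "H \<noteq> {}"
    proof
      assume "H = {}"
      then have "t \<in> SD.tot P" using t unfolding H_def SD.tot_def by blast
      then show False using * by blast
    qed
    from unique_sum_pair[OF finF neF finH neH] obtain \<alpha> \<beta> where ab: "\<alpha> \<in> F" "\<beta> \<in> H"
      and un: "\<forall>\<gamma>\<in>F. \<forall>\<delta>\<in>H. \<gamma> + \<delta> = \<alpha> + \<beta> \<longrightarrow> \<gamma> = \<alpha> \<and> \<delta> = \<beta>" by blast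
    let ?k = "\<alpha> + \<beta>"
    let ?g = "\<lambda>\<gamma>. SD.hcomp (SD.hcomp s \<gamma> \<otimes>\<^bsub>S\<^esub> t) ?k"
    have gc: "?g \<in> A \<rightarrow> carrier S" for A using SD.hcomp_carrier s t by simp
    have hs: "SD.hcomp s \<gamma> \<in> Sg \<gamma>" "SD.hcomp t \<gamma> \<in> Sg \<gamma>" for \<gamma> using SD.hcomp_props(1) s t by auto
    have "finsum S (\<lambda>\<gamma>. SD.hcomp s \<gamma> \<otimes>\<^bsub>S\<^esub> t) ?supp = finsum S (SD.hcomp s) ?supp \<otimes>\<^bsub>S\<^esub> t"
      by (rule finsum_ldistr[symmetric, OF fin t]) (simp add: SD.hcomp_carrier s)
    then have "s \<otimes>\<^bsub>S\<^esub> t = finsum S (\<lambda>\<gamma>. SD.hcomp s \<gamma> \<otimes>\<^bsub>S\<^esub> t) ?supp" using SD.hcomp_props(3)[OF s] by simp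
    then have "SD.hcomp (s \<otimes>\<^bsub>S\<^esub> t) ?k = finsum S ?g ?supp"
      using SD.hcomp_finsum[OF fin, of "\<lambda>\<gamma>. SD.hcomp s \<gamma> \<otimes>\<^bsub>S\<^esub> t" ?k] SD.hcomp_carrier[OF s] t by simp
    also have "\<dots> = finsum S ?g (insert \<alpha> (?supp - {\<alpha>}))"
      using ab(1) F by (intro arg_cong[of _ _ "finsum S ?g"]) blast
    also have "\<dots> = ?g \<alpha> \<oplus>\<^bsub>S\<^esub> finsum S ?g (?supp - {\<alpha>})"
      by (rule S_finsum_insert) (use fin gc[of UNIV] gc in auto)
    finally have eq: "SD.hcomp (s \<otimes>\<^bsub>S\<^esub> t) ?k = ?g \<alpha> \<oplus>\<^bsub>S\<^esub> finsum S ?g (?supp - {\<alpha>})" .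
    have "SD.hcomp (s \<otimes>\<^bsub>S\<^esub> t) ?k \<in> P ?k" using st unfolding SD.tot_def by blast
    then have sumP: "?g \<alpha> \<oplus>\<^bsub>S\<^esub> finsum S ?g (?supp - {\<alpha>}) \<in> P ?k" unfolding eq .
    have rest: "finsum S ?g (?supp - {\<alpha>}) \<in> P ?k"
    proof (rule SD.finsum_in)
      show "finite (?supp - {\<alpha>})" using fin by simp
      show "P ?k \<subseteq> carrier S" using gidealD(1)[OF iP] Sg_carrier by blast
      show "\<zero>\<^bsub>S\<^esub> \<in> P ?k" by (rule gidealD(2)[OF iP])
      show "x \<oplus>\<^bsub>S\<^esub> y \<in> P ?k" if "x \<in> P ?k" "y \<in> P ?k" for x y by (rule gidealD(3)[OF iP that])
      fix \<gamma> assume g: "\<gamma> \<in> ?supp - {\<alpha>}"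
      show "?g \<gamma> \<in> P ?k"
      proof (cases "\<gamma> \<le> ?k")
        case True
        let ?\<delta> = "?k - \<gamma>"
        have sum': "?\<delta> + \<gamma> = ?k" by (rule vec_le_minus_add[OF True])
        then have sum: "\<gamma> + ?\<delta> = ?k" by (simp add: add.commute)
        have eq: "?g \<gamma> = SD.hcomp s \<gamma> \<otimes>\<^bsub>S\<^esub> SD.hcomp t ?\<delta>" using True by (simp add: hcomp_mult[OF hs(1) t])
        show ?thesis
        proof (cases "\<gamma> \<in> F")
          case True
          then have "?\<delta> \<notin> H" using un sum g by blast
          then have "SD.hcomp t ?\<delta> \<in> P ?\<delta>" by (simp add: H_def)
          from gidealD(4)[OF iP hs(1)[of \<gamma>] this] show ?thesis by (simp only: eq sum)
        next
          case False
          then have "SD.hcomp s \<gamma> \<in> P \<gamma>" by (simp add: F_def)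
          from gidealD(4)[OF iP hs(2)[of ?\<delta>] this] have "SD.hcomp t ?\<delta> \<otimes>\<^bsub>S\<^esub> SD.hcomp s \<gamma> \<in> P ?k"
            unfolding sum' .
          then show ?thesis unfolding eq using SD.hcomp_carrier[OF s] SD.hcomp_carrier[OF t] by (simp add: m_comm)
        qed
      next
        case False
        then show ?thesis using gidealD(2)[OF iP] by (simp add: hcomp_mult[OF hs(1) t])
      qed
    qed
    have ga: "?g \<alpha> = SD.hcomp s \<alpha> \<otimes>\<^bsub>S\<^esub> SD.hcomp t \<beta>"
    proof -
      have "\<alpha> \<le> ?k" "?k - \<alpha> = \<beta>" by (auto simp: less_eq_vec_def vec_eq_iff)
      then show ?thesis by (simp add: hcomp_mult[OF hs(1) t])
    qed
    have rc: "finsum S ?g (?supp - {\<alpha>}) \<in> carrier S" by (rule Sg_carrier[OF gidealD(1)[OF iP rest]])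
    have gac: "?g \<alpha> \<in> carrier S" using gc[of UNIV] by blast
    have "?g \<alpha> \<oplus>\<^bsub>S\<^esub> finsum S ?g (?supp - {\<alpha>}) \<oplus>\<^bsub>S\<^esub> \<ominus>\<^bsub>S\<^esub> finsum S ?g (?supp - {\<alpha>}) \<in> P ?k"
      by (rule gidealD(3)[OF iP sumP gideal_neg[OF iP rest]])
    then have "?g \<alpha> \<in> P ?k" unfolding plus_minus_cancel[OF gac rc] .
    then have "SD.hcomp s \<alpha> \<otimes>\<^bsub>S\<^esub> SD.hcomp t \<beta> \<in> P ?k" unfolding ga .
    then have "SD.hcomp s \<alpha> \<in> P \<alpha> \<or> SD.hcomp t \<beta> \<in> P \<beta>" by (rule gprimeD(3)[OF P hs(1) hs(2)])
    then show False using ab unfolding F_def H_def by blast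
  qed
qed

lemma tot_Int: "gideal P \<Longrightarrow> SD.tot P \<inter> Sg n = P n"
  using SD.tot_Int_Gr SD.tot_homogeneous[of P] gidealD(1,2) by blast

lemma tot_less:
  assumes "gideal P" "gideal Q" "P \<le> Q" "P \<noteq> Q"
  shows "SD.tot P \<subset> SD.tot Q"
proof -
  have "SD.tot P \<subseteq> SD.tot Q" by (rule SD.tot_mono) (use assms(3) in \<open>simp add: le_fun_def\<close>)
  moreover have "SD.tot P \<noteq> SD.tot Q"
  proof
    assume eq: "SD.tot P = SD.tot Q"
    have "P = Q"
    proof
      fix n show "P n = Q n" using tot_Int[OF assms(1), of n] tot_Int[OF assms(2), of n] eq by simp
    qed
    then show False using assms(4) by simp
  qed
  ultimately show ?thesis by (simp add: psubset_eq)
qed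

lemma relevant_tot_Proj:
  assumes P: "relevant P"
  shows "SD.tot P \<in> Proj S Sg"
proof -
  have pP: "gprime P" using P by (simp add: relevant_def)
  note iP = gprimeD(1)[OF pP]
  interpret I: ideal "SD.tot P" S by (rule gideal_tot_ideal[OF iP])
  have sub: "(\<Union>n. P n) \<subseteq> SD.tot P" using tot_Int[OF iP] by blast
  have "SD.tot P = Idl\<^bsub>S\<^esub> (\<Union>n. P n)"
  proof
    show "Idl\<^bsub>S\<^esub> (\<Union>n. P n) \<subseteq> SD.tot P" by (rule genideal_minimal[OF I.is_ideal sub])
    have car: "(\<Union>n. P n) \<subseteq> carrier S" using gidealD(1)[OF iP] Sg_carrier by blast
    interpret J: ideal "Idl\<^bsub>S\<^esub> (\<Union>n. P n)" S by (rule genideal_ideal[OF car])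
    show "SD.tot P \<subseteq> Idl\<^bsub>S\<^esub> (\<Union>n. P n)"
    proof
      fix x assume "x \<in> SD.tot P"
      then show "x \<in> Idl\<^bsub>S\<^esub> (\<Union>n. P n)"
      proof (induction rule: SD.tot_induct)
        case (homogeneous n y)
        then show ?case using genideal_self[OF car] by blast
      qed (auto intro: J.a_closed J.zero_closed)
    qed
  qed
  moreover have "(\<Union>n. P n) \<subseteq> (\<Union>n. Sg n)" using gidealD(1)[OF iP] by blast
  ultimately have hom: "homogeneous_ideal S Sg (SD.tot P)" unfolding homogeneous_ideal_def by blast
  have "\<not> S_plus_plus S Sg \<subseteq> SD.tot P"
  proof
    assume le: "S_plus_plus S Sg \<subseteq> SD.tot P"
    let ?one = "(\<chi> i. 1) :: nat ^ 'd"
    obtain g where g: "g \<in> Sg ?one" "g \<notin> P ?one" using relevant_element[OF P] by blast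
    have "finsum S (\<lambda>_. g) {?one} = g" using Sg_carrier[OF g(1)] by (simp add: S_finsum_insert)
    then have "g \<in> S_plus_plus S Sg" unfolding S_plus_plus_def
      using g(1) by (intro CollectI exI[of _ "\<lambda>_. g"] exI[of _ "{?one}"]) simp
    then show False using le SD.tot_Int_Gr[OF _ g(1)] g(2) by blast
  qed
  then show ?thesis unfolding Proj_def using gprime_tot_prime[OF pP] hom by blast
qed

lemma Proj_family:
  assumes P: "P \<in> Proj S Sg"
  shows "relevant (\<lambda>n. P \<inter> Sg n)" "SD.tot (\<lambda>n. P \<inter> Sg n) = P"
proof -
  let ?P = "\<lambda>n. P \<inter> Sg n"
  have prime: "primeideal P S" and hom: "homogeneous_ideal S Sg P" and pp: "\<not> S_plus_plus S Sg \<subseteq> P"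
    using P by (auto simp: Proj_def)
  interpret P: primeideal P S by (rule prime)
  have iP: "gideal ?P" unfolding gideal_def
    using P.zero_closed Sg_zero P.a_closed Sg_add P.I_l_closed Sg_mult Sg_carrier by auto
  have pP: "gprime ?P" unfolding gprime_def
  proof (intro conjI allI ballI impI iP)
    show "\<one>\<^bsub>S\<^esub> \<notin> P \<inter> Sg 0" using P.one_imp_carrier P.I_notcarr by blast
    fix a b s t assume "s \<in> Sg a" "t \<in> Sg b" "s \<otimes>\<^bsub>S\<^esub> t \<in> P \<inter> Sg (a + b)"
    then show "s \<in> P \<inter> Sg a \<or> t \<in> P \<inter> Sg b" using P.I_prime[of s t] Sg_carrier by blast
  qed
  show tot: "SD.tot ?P = P"
  proof
    show "SD.tot ?P \<subseteq> P"
    proof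
      fix x assume "x \<in> SD.tot ?P"
      then show "x \<in> P"
        by (induction rule: SD.tot_induct) (auto intro: P.a_closed P.zero_closed)
    qed
    from hom obtain H where H: "H \<subseteq> (\<Union>n. Sg n)" "P = Idl\<^bsub>S\<^esub> H" unfolding homogeneous_ideal_def by blast
    have HP: "H \<subseteq> P" using H genideal_self[of H] Sg_carrier by blast
    have "H \<subseteq> SD.tot ?P"
    proof
      fix x assume x: "x \<in> H"
      then obtain n where n: "x \<in> Sg n" using H(1) by blast
      show "x \<in> SD.tot ?P" by (rule SD.tot_homogeneous[of ?P x n]) (use x n HP P.zero_closed Sg_zero in auto)
    qed
    then show "P \<subseteq> SD.tot ?P" using genideal_minimal[OF gideal_tot_ideal[OF iP]] H(2) by blast
  qed
  have "\<not> Sg (axis i 1) \<subseteq> ?P (axis i 1)" for i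
  proof
    assume sub: "Sg (axis i 1) \<subseteq> ?P (axis i 1)"
    have "S_plus_plus S Sg \<subseteq> P"
    proof
      fix x assume "x \<in> S_plus_plus S Sg"
      then obtain f F where f: "x = finsum S f F" "finite F" "F \<subseteq> {n. \<forall>i. 1 \<le> n $ i}" "\<forall>n\<in>F. f n \<in> Sg n"
        unfolding S_plus_plus_def by blast
      show "x \<in> P" unfolding f(1)
      proof (rule SD.finsum_in[OF f(2)])
        fix n assume n: "n \<in> F"
        have "Sg n \<subseteq> ?P n" by (rule Sg_subset_gideal[OF iP sub]) (use f(3) n in blast)
        then show "f n \<in> P" using f(4) n by blast
      qed (use P.a_subset P.zero_closed P.a_closed in auto)
    qed
    then show False using pp by blast
  qed
  then show "relevant ?P" using pP unfolding relevant_def by blast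
qed

text \<open>
  The left side says that the localization at \<open>P\<close> is nonzero.  If all homogeneous elements are killed by something
  outside \<open>P\<close>, so are their sums; conversely the components of an annihilator of a homogeneous \<open>m\<close> annihilate \<open>m\<close>.
\<close>

lemma relevant_supp_tot_iff:
  assumes N: "gsub N" and P: "relevant P"
  shows "(\<exists>m\<in>carrier M. \<forall>u\<in>carrier S - SD.tot P. u \<odot> m \<notin> MD.tot N) \<longleftrightarrow> P \<in> relevant_supp N Mg" (is "?L \<longleftrightarrow> _")
proof
  have pP: "gprime P" using P by (simp add: relevant_def)
  note iP = gprimeD(1)[OF pP]
  interpret T: primeideal "SD.tot P" S by (rule gprime_tot_prime[OF pP])
  note K = submodule_tot[OF N]
  {
    assume ?L
    show "P \<in> relevant_supp N Mg"
    proof (rule ccontr)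
      assume not: "P \<notin> relevant_supp N Mg"
      have "\<exists>u\<in>carrier S - SD.tot P. u \<odot> m \<in> MD.tot N" if "m \<in> carrier M" for m
        using that
      proof (induction rule: MD.carrier_induct)
        case zero
        have "\<one>\<^bsub>S\<^esub> \<in> carrier S - SD.tot P" using T.one_imp_carrier T.I_notcarr by auto
        then show ?case using submodule_zero[OF K] by (intro bexI[of _ "\<one>\<^bsub>S\<^esub>"]) (simp_all add: smult_r_null)
      next
        case (homogeneous b y)
        then have "\<not> ann N y b \<le> P" using not P unfolding relevant_supp_def by blast
        then obtain n u where u: "u \<in> Sg n" "u \<odot> y \<in> N (n + b)" "u \<notin> P n" by (auto simp: le_fun_def ann_def)
        have "u \<notin> SD.tot P" using SD.tot_Int_Gr[OF _ u(1)] u(3) by blast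
        moreover have "u \<odot> y \<in> MD.tot N" by (rule gsub_tot[OF N u(2)])
        ultimately show ?case using Sg_carrier[OF u(1)] by blast
      next
        case (add x y)
        then obtain u v where u: "u \<in> carrier S - SD.tot P" "u \<odot> x \<in> MD.tot N"
          and v: "v \<in> carrier S - SD.tot P" "v \<odot> y \<in> MD.tot N" by blast
        have car: "u \<in> carrier S" "v \<in> carrier S" using u v by auto
        have "(u \<otimes>\<^bsub>S\<^esub> v) \<odot> (x \<oplus> y) = v \<odot> (u \<odot> x) \<oplus> u \<odot> (v \<odot> y)"
          using car add(1,2) by (simp add: smult_r_distr smult_assoc1[symmetric] m_comm)
        moreover have "v \<odot> (u \<odot> x) \<oplus> u \<odot> (v \<odot> y) \<in> MD.tot N"
          by (intro submoduleE(5)[OF K] submoduleE(4)[OF K] car u(2) v(2))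
        moreover have "u \<otimes>\<^bsub>S\<^esub> v \<in> carrier S - SD.tot P" using T.I_prime[OF car] car u(1) v(1) by auto
        ultimately show ?case by (metis (no_types))
      qed
      then show False using \<open>?L\<close> by blast
    qed
  next
    assume "P \<in> relevant_supp N Mg"
    then obtain b m where m: "m \<in> Mg b" "ann N m b \<le> P" unfolding relevant_supp_def by blast
    have "u \<odot> m \<notin> MD.tot N" if u: "u \<in> carrier S - SD.tot P" for u
    proof
      assume um: "u \<odot> m \<in> MD.tot N"
      have uc: "u \<in> carrier S" using u by blast
      have "SD.hcomp u n \<in> P n" for n
      proof -
        have "MD.hcomp (u \<odot> m) (n + b) \<in> N (n + b)" using um by (simp add: MD.tot_def)
        then have "SD.hcomp u n \<in> ann N m b n"
          using hcomp_smult[OF uc m(1)] SD.hcomp_props(1)[OF uc] by (simp add: ann_def)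
        then show ?thesis using m(2) unfolding le_fun_def by blast
      qed
      then have "u \<in> SD.tot P" unfolding SD.tot_def by (intro CollectI conjI uc allI)
      then show False using u by simp
    qed
    then show ?L by (intro bexI[OF _ Mg_carrier[OF m(1)]] ballI)
  }
qed

text \<open>
  Taking homogeneous components is an isomorphism of ordered sets between the two kinds of support.
\<close>

theorem chain_dim_Supp_iff:
  assumes N: "gsub N"
  shows "chain_dim (Supp_plus_plus S Sg (quot_module M (MD.tot N))) \<le> 0 \<longleftrightarrow> dim_le_0 N Mg"
proof -
  have supp: "SD.tot P \<in> Supp_plus_plus S Sg (quot_module M (MD.tot N)) \<longleftrightarrow> P \<in> relevant_supp N Mg" if P: "relevant P" for P
  proof -
    have pr: "primeideal (SD.tot P) S" using P by (intro gprime_tot_prime) (simp add: relevant_def)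
    show ?thesis
      unfolding Supp_plus_plus_def
      using relevant_tot_Proj[OF P] PM.localization_nonzero_iff[OF submodule_tot[OF N] pr] relevant_supp_tot_iff[OF N P]
      by simp
  qed
  show ?thesis
    unfolding chain_dim_le_0_iff
  proof
    assume no: "\<forall>P\<in>Supp_plus_plus S Sg (quot_module M (MD.tot N)).
      \<forall>Q\<in>Supp_plus_plus S Sg (quot_module M (MD.tot N)). \<not> P \<subset> Q"
    show "dim_le_0 N Mg" unfolding dim_le_0_def
    proof (intro ballI impI, rule ccontr)
      fix P Q assume PQ: "P \<in> relevant_supp N Mg" "Q \<in> relevant_supp N Mg" "P \<le> Q" "P \<noteq> Q"
      have r: "relevant P" "relevant Q" using PQ(1,2) by (auto simp: relevant_supp_def)
      have "SD.tot P \<subset> SD.tot Q" by (rule tot_less[OF _ _ PQ(3,4)]) (use r in \<open>auto simp: relevant_def gprime_def\<close>)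
      then show False using no supp[OF r(1)] supp[OF r(2)] PQ(1,2) by blast
    qed
  next
    assume dim: "dim_le_0 N Mg"
    show "\<forall>P\<in>Supp_plus_plus S Sg (quot_module M (MD.tot N)).
      \<forall>Q\<in>Supp_plus_plus S Sg (quot_module M (MD.tot N)). \<not> P \<subset> Q"
    proof (intro ballI notI)
      fix P Q assume P: "P \<in> Supp_plus_plus S Sg (quot_module M (MD.tot N))"
        and Q: "Q \<in> Supp_plus_plus S Sg (quot_module M (MD.tot N))" and PQ: "P \<subset> Q"
      have pr: "P \<in> Proj S Sg" "Q \<in> Proj S Sg" using P Q by (auto simp: Supp_plus_plus_def)
      let ?P = "\<lambda>n. P \<inter> Sg n" and ?Q = "\<lambda>n. Q \<inter> Sg n"
      note fP = Proj_family[OF pr(1)] and fQ = Proj_family[OF pr(2)]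
      have "?P \<in> relevant_supp N Mg" using supp[OF fP(1)] fP(2) P by simp
      moreover have "?Q \<in> relevant_supp N Mg" using supp[OF fQ(1)] fQ(2) Q by simp
      moreover have "?P \<le> ?Q" using PQ by (auto simp: le_fun_def)
      ultimately have "?P = ?Q" using dim unfolding dim_le_0_def by blast
      then have "P = Q" using fP(2) fQ(2) by metis
      then show False using PQ by blast
    qed
  qed
qed

section \<open>Filter-regularity on quotient modules\<close>

lemma regular_seq_nth:
  "regular_seq L N ps \<Longrightarrow> i < length ps \<Longrightarrow>
    for_all_large (\<lambda>n. gcolon (snd (ps ! i)) (axis (fst (ps ! i)) 1) (seq_ext L N (take i ps)) L n \<subseteq> seq_ext L N (take i ps) n)"
proof (induction ps arbitrary: i N)
  case (Cons p ps)
  then show ?case by (cases i) auto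
qed simp

lemma regular_seq_filter_regular:
  assumes ps: "homogeneous_seq ps" and reg: "regular_seq Mg (\<lambda>_. {\<zero>}) ps"
  shows "filter_regular_sequence S Sg M Mg (map snd ps)"
  unfolding filter_regular_sequence_def Let_def
proof (intro allI impI)
  fix i assume "i < length (map snd ps)"
  then have i: "i < length ps" by simp
  define x where "x = snd (ps ! i)"
  define e :: "nat ^ 'd" where "e = axis (fst (ps ! i)) 1"
  have x: "x \<in> Sg e" using ps i unfolding homogeneous_seq_def x_def e_def by auto
  have xc: "x \<in> carrier S" by (rule Sg_carrier[OF x])
  have hs: "homogeneous_seq (take i ps)" using ps unfolding homogeneous_seq_def by (auto dest: in_set_takeD)
  let ?N = "seq_ext Mg (\<lambda>_. {\<zero>}) (take i ps)"
  have N: "gsub ?N" by (rule seq_ext_props(1)[OF hs gsub_zero gsub_Mg zero_le_gsub[OF gsub_Mg]])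
  note K = submodule_tot[OF N]
  let ?K = "MD.tot ?N"
  have seq: "seq_submodule S M (take i (map snd ps)) = ?K" using seq_submodule_tot[OF hs] by (simp add: take_map)
  have large: "for_all_large (\<lambda>n. gcolon x e ?N Mg n \<subseteq> ?N n)" using regular_seq_nth[OF reg i] unfolding x_def e_def .
  have zeroQ: "\<zero>\<^bsub>quot_module M ?K\<^esub> = ?K" by (simp add: quot_module_def)
  have "for_all_large (\<lambda>n. annihilated_by (quot_module M ?K) x \<inter> quot_grading M Mg ?K n = {\<zero>\<^bsub>quot_module M ?K\<^esub>})"
  proof (rule for_all_large_mono[OF large])
    fix n assume sub: "gcolon x e ?N Mg n \<subseteq> ?N n"
    show "annihilated_by (quot_module M ?K) x \<inter> quot_grading M Mg ?K n = {\<zero>\<^bsub>quot_module M ?K\<^esub>}"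
    proof
      show "annihilated_by (quot_module M ?K) x \<inter> quot_grading M Mg ?K n \<subseteq> {\<zero>\<^bsub>quot_module M ?K\<^esub>}"
      proof
        fix X assume X: "X \<in> annihilated_by (quot_module M ?K) x \<inter> quot_grading M Mg ?K n"
        then obtain m where m: "m \<in> Mg n" "X = ?K +> m" by (auto simp: quot_grading_def)
        have mc: "m \<in> carrier M" by (rule Mg_carrier[OF m(1)])
        have "x \<odot>\<^bsub>quot_module M ?K\<^esub> X = ?K" using X by (simp add: annihilated_by_def zeroQ)
        then have "?K +> (x \<odot> m) = ?K" using PM.quot_smult[OF K xc mc] m(2) by simp
        then have "x \<odot> m \<in> ?K" using coset_eq_self[OF K] xc mc by simp
        then have "x \<odot> m \<in> ?N (e + n)" by (rule MD.tot_Int_Gr[OF _ Mg_smult[OF x m(1)]])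
        then have mN: "m \<in> ?N n" using sub m(1) by (auto simp: gcolon_def preim_def)
        have "m \<in> ?K" by (rule gsub_tot[OF N mN])
        then show "X \<in> {\<zero>\<^bsub>quot_module M ?K\<^esub>}" using coset_eq_self[OF K mc] m(2) by (simp add: zeroQ)
      qed
      have K0: "?K = ?K +> \<zero>" by (rule coset_zero[OF K, symmetric])
      have "?K \<in> carrier (quot_module M ?K)" unfolding PM.quot_carrier
        by (rule image_eqI[where f = "\<lambda>m. ?K +> m", OF K0 M.zero_closed])
      moreover have "x \<odot>\<^bsub>quot_module M ?K\<^esub> ?K = ?K"
        using PM.quot_smult[OF K xc M.zero_closed] xc by (simp add: smult_r_null coset_zero[OF K])
      moreover have "?K \<in> quot_grading M Mg ?K n" unfolding quot_grading_def
        by (rule image_eqI[where f = "\<lambda>m. ?K +> m", OF K0 Mg_zero])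
      ultimately show "{\<zero>\<^bsub>quot_module M ?K\<^esub>} \<subseteq> annihilated_by (quot_module M ?K) x \<inter> quot_grading M Mg ?K n"
        by (simp add: annihilated_by_def zeroQ)
    qed
  qed
  then have "filter_regular Sg (quot_module M ?K) (quot_grading M Mg ?K) x"
    unfolding filter_regular_def using x by blast
  then show "filter_regular Sg (quot_module M (seq_submodule S M (take i (map snd ps))))
      (quot_grading M Mg (seq_submodule S M (take i (map snd ps)))) (map snd ps ! i)"
    using i by (simp add: seq x_def)
qed

end

section \<open>The Hilbert polynomial of a module and its coefficients\<close>

locale hilbert_setting = graded_setting S Sg "structure_map S ` carrier A" zs M Mg G
  for A :: "('a, 'c) ring_scheme" and S :: "('a, 's) module" and Sg :: "nat ^ 'd::finite \<Rightarrow> 's set" and zs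
    and M :: "('s, 'm) module" (structure) and Mg G
begin

text \<open>
  Negatives are multiples by the scalar \<open>-1\<close>, which gives closure under inverses in the component module.
\<close>

lemma submodule_component_iff:
  "submodule D A (component_module S M (Mg n)) \<longleftrightarrow> Zsub D \<and> D \<subseteq> Mg n"
proof
  assume "submodule D A (component_module S M (Mg n))"
  then have D: "D \<subseteq> Mg n" "\<zero> \<in> D" "\<And>x y. x \<in> D \<Longrightarrow> y \<in> D \<Longrightarrow> x \<oplus> y \<in> D"
    "\<And>a x. a \<in> carrier A \<Longrightarrow> x \<in> D \<Longrightarrow> structure_map S a \<odot> x \<in> D"
    unfolding submodule_def submodule_axioms_def subgroup_def component_module_def by auto
  then show "Zsub D \<and> D \<subseteq> Mg n" unfolding Zsub_def using Mg_carrier by auto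
next
  assume D: "Zsub D \<and> D \<subseteq> Mg n"
  then have DZ: "Zsub D" and DM: "D \<subseteq> Mg n" by auto
  let ?C = "component_module S M (Mg n)"
  have inv: "inv\<^bsub>add_monoid ?C\<^esub> x = \<ominus> x" if x: "x \<in> D" for x
  proof -
    have nx: "\<ominus> x \<in> Mg n" using Zsub_neg[OF DZ x] DM by blast
    have xc: "x \<in> carrier M" by (rule ZsubD(1)[OF DZ x])
    show ?thesis
      unfolding m_inv_def
    proof (rule the_equality)
      show "\<ominus> x \<in> carrier (add_monoid ?C) \<and>
         x \<otimes>\<^bsub>add_monoid ?C\<^esub> (\<ominus> x) = \<one>\<^bsub>add_monoid ?C\<^esub> \<and> (\<ominus> x) \<otimes>\<^bsub>add_monoid ?C\<^esub> x = \<one>\<^bsub>add_monoid ?C\<^esub>"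
        using nx xc by (simp add: component_module_def M.r_neg M.l_neg)
      fix y assume "y \<in> carrier (add_monoid ?C) \<and>
         x \<otimes>\<^bsub>add_monoid ?C\<^esub> y = \<one>\<^bsub>add_monoid ?C\<^esub> \<and> y \<otimes>\<^bsub>add_monoid ?C\<^esub> x = \<one>\<^bsub>add_monoid ?C\<^esub>"
      then have "y \<in> carrier M" "y \<oplus> x = \<zero>" using Mg_carrier by (auto simp: component_module_def)
      then show "y = \<ominus> x" using xc by (simp add: M.minus_equality)
    qed
  qed
  show "submodule D A ?C"
  proof (intro submodule.intro submodule_axioms.intro subgroup.intro)
    show "inv\<^bsub>add_monoid ?C\<^esub> x \<in> D" if "x \<in> D" for x using inv[OF that] Zsub_neg[OF DZ that] by simp
  qed (use DM ZsubD[OF DZ] in \<open>auto simp: component_module_def\<close>)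
qed

lemma module_length_component: "module_length A (component_module S M (Mg n)) = enat (hilb_fn (\<lambda>_. {\<zero>}) Mg n)"
proof -
  have "(\<exists>C :: nat \<Rightarrow> 'm set. (\<forall>i\<le>l. submodule (C i) A (component_module S M (Mg n))) \<and> (\<forall>i<l. C i \<subset> C (Suc i)))
      \<longleftrightarrow> chain_between {\<zero>} (Mg n) l" for l
    unfolding chain_between_def submodule_component_iff using ZsubD(2) by (metis empty_subsetI insert_subset)
  then have "module_length A (component_module S M (Mg n)) = len {\<zero>} (Mg n)"
    unfolding module_length_def len_def by simp
  then show ?thesis using len_hilb_fn[OF gsub_zero gsub_Mg, of n] by simp
qed

abbreviation hilb_M where "hilb_M \<equiv> hilb_poly (\<lambda>_. {\<zero>}) Mg"

lemma is_hilb_hilb_M: "is_hilb (\<lambda>_. {\<zero>}) Mg hilb_M"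
  by (rule hilb_poly[OF gsub_zero gsub_Mg zero_le_gsub[OF gsub_Mg]])

lemma hilbert_poly_eq: "hilbert_poly A S M Mg = hilb_M"
  unfolding hilbert_poly_def
proof (rule the_equality)
  have char: "(\<exists>l. module_length A (component_module S M (Mg n)) = enat l \<and> P (\<chi> i. int (n $ i)) = of_nat l) \<longleftrightarrow>
     of_nat (hilb_fn (\<lambda>_. {\<zero>}) Mg n) = P (int_vec n)" for P :: "int ^ 'd \<Rightarrow> rat" and n
    by (auto simp: module_length_component int_vec_def)
  show "polynomial_fun hilb_M \<and> for_all_large (\<lambda>n. \<exists>l. module_length A (component_module S M (Mg n)) = enat l \<and>
      hilb_M (\<chi> i. int (n $ i)) = of_nat l)"
    unfolding char using is_hilb_hilb_M numerical_poly_polynomial_fun unfolding is_hilb_def by blast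
  fix P :: "int ^ 'd \<Rightarrow> rat"
  assume "polynomial_fun P \<and> for_all_large (\<lambda>n. \<exists>l. module_length A (component_module S M (Mg n)) = enat l \<and>
      P (\<chi> i. int (n $ i)) = of_nat l)"
  then have P: "polynomial_fun P" and large: "for_all_large (\<lambda>n. of_nat (hilb_fn (\<lambda>_. {\<zero>}) Mg n) = P (int_vec n))"
    unfolding char by auto
  have "for_all_large (\<lambda>n. of_nat (hilb_fn (\<lambda>_. {\<zero>}) Mg n) = hilb_M (int_vec n))"
    using is_hilb_hilb_M unfolding is_hilb_def by blast
  from for_all_large_conj[OF large this] have "for_all_large (\<lambda>n. P (int_vec n) = hilb_M (int_vec n))"
    by (rule for_all_large_mono) simp
  then show "P = hilb_M" by (intro sep_poly_eq sep_poly_polynomial_fun P is_hilb_sep[OF is_hilb_hilb_M])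
qed

text \<open>
  The defining description of the coefficients has a solution, with integer values, and only one.
\<close>

lemma hilbert_coeff_props:
  "finite {k. hilbert_coeff A S M Mg k \<noteq> 0}" "hilb_M = binom_sum (hilbert_coeff A S M Mg)"
proof -
  from is_hilb_hilb_M obtain e where e: "finite {k. e k \<noteq> 0}" "hilb_M = binom_sum e"
    unfolding is_hilb_def numerical_poly_def by blast
  have char: "(\<forall>n. hilb_M n = (\<Sum>k | e' k \<noteq> 0. of_int (e' k) *
      (\<Prod>i\<in>UNIV. (of_int (n $ i) + of_nat (k $ i)) gchoose (k $ i)))) \<longleftrightarrow> hilb_M = binom_sum e'" for e' :: "nat ^ 'd \<Rightarrow> int"
    by (simp add: fun_eq_iff binom_sum_def binom_basis_def)
  have "hilbert_coeff A S M Mg = e"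
    unfolding hilbert_coeff_def hilbert_poly_eq char
  proof (rule the_equality)
    fix e' assume "finite {k. e' k \<noteq> 0} \<and> hilb_M = binom_sum e'"
    then show "e' = e" using e by (intro binom_sum_inject) auto
  qed (use e in blast)
  then show "finite {k. hilbert_coeff A S M Mg k \<noteq> 0}" "hilb_M = binom_sum (hilbert_coeff A S M Mg)" using e by auto
qed

theorem difference_const_iff:
  "(\<exists>c. \<forall>n. multi_difference k (hilbert_poly A S M Mg) n = c) \<longleftrightarrow> mixed_multiplicity_defined A S M Mg k"
proof -
  let ?e = "hilbert_coeff A S M Mg"
  note e = hilbert_coeff_props
  have "(\<exists>c. \<forall>n. multi_difference k (hilbert_poly A S M Mg) n = c) \<longleftrightarrow> (\<exists>c. \<forall>n. binom_sum (\<lambda>h. ?e (h + k)) n = c)"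
    unfolding hilbert_poly_eq e(2) multi_difference_binom_sum[OF e(1)] ..
  also have "\<dots> \<longleftrightarrow> (\<forall>h. h \<noteq> 0 \<longrightarrow> ?e (h + k) = 0)" by (rule binom_sum_const_iff[OF finite_shift_support[OF e(1)]])
  also have "\<dots> \<longleftrightarrow> (\<forall>h>k. ?e h = 0)"
  proof
    assume *: "\<forall>h. h \<noteq> 0 \<longrightarrow> ?e (h + k) = 0"
    show "\<forall>h>k. ?e h = 0"
    proof (intro allI impI)
      fix h assume "k < h"
      then have le: "k \<le> h" "k \<noteq> h" by auto
      have eq: "h - k + k = h" by (rule vec_le_minus_add[OF le(1)])
      then have "h - k \<noteq> 0" using le(2) by auto
      then show "?e h = 0" using * eq by metis
    qed
  next
    assume *: "\<forall>h>k. ?e h = 0"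
    show "\<forall>h. h \<noteq> 0 \<longrightarrow> ?e (h + k) = 0"
    proof (intro allI impI)
      fix h :: "nat ^ 'd" assume h: "h \<noteq> 0"
      have "k \<le> h + k" by (simp add: less_eq_vec_def)
      moreover have "k \<noteq> h + k" using h by (simp add: vec_eq_iff)
      ultimately show "?e (h + k) = 0" using * by (simp add: order_less_le)
    qed
  qed
  finally show ?thesis unfolding mixed_multiplicity_defined_def .
qed

lemma mixed_multiplicity_system_iff:
  "mixed_multiplicity_system S Sg M xs k \<longleftrightarrow>
    (\<exists>ps. homogeneous_seq ps \<and> map snd ps = xs \<and> seq_type ps = k \<and> dim_le_0 (seq_ext Mg (\<lambda>_. {\<zero>}) ps) Mg)"
proof -
  have "chain_dim (Supp_plus_plus S Sg (quot_module M (seq_submodule S M (map snd ps)))) \<le> 0 \<longleftrightarrow>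
      dim_le_0 (seq_ext Mg (\<lambda>_. {\<zero>}) ps) Mg" if "homogeneous_seq ps" for ps
    unfolding seq_submodule_tot[OF that]
    by (rule chain_dim_Supp_iff[OF seq_ext_props(1)[OF that gsub_zero gsub_Mg zero_le_gsub[OF gsub_Mg]]])
  then show ?thesis unfolding mixed_multiplicity_system_def sequence_of_type_iff by blast
qed

theorem system_imp_const:
  assumes "mixed_multiplicity_system S Sg M xs k"
  shows "\<exists>c. \<forall>n. multi_difference k (hilbert_poly A S M Mg) n = c"
proof -
  from assms obtain ps where ps: "homogeneous_seq ps" "seq_type ps = k" "dim_le_0 (seq_ext Mg (\<lambda>_. {\<zero>}) ps) Mg"
    unfolding mixed_multiplicity_system_iff by blast
  from system_imp_difference_const[OF ps(1) gsub_zero gsub_Mg zero_le_gsub[OF gsub_Mg] ps(3)]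
  show ?thesis unfolding ps(2) hilbert_poly_eq .
qed

theorem const_imp_regular_system:
  assumes "separating Y" "\<exists>c. \<forall>n. multi_difference k (hilbert_poly A S M Mg) n = c"
  shows "\<exists>xs. filter_regular_sequence S Sg M Mg xs \<and> sequence_of_type Sg xs k \<and> mixed_multiplicity_system S Sg M xs k"
proof -
  from difference_const_imp_system[OF assms(1) gsub_Mg gsub_zero zero_le_gsub[OF gsub_Mg]
      assms(2)[unfolded hilbert_poly_eq]]
  obtain ps where ps: "homogeneous_seq ps" "seq_type ps = k" "regular_seq Mg (\<lambda>_. {\<zero>}) ps"
     "dim_le_0 (seq_ext Mg (\<lambda>_. {\<zero>}) ps) Mg" by blast
  have "filter_regular_sequence S Sg M Mg (map snd ps)" by (rule regular_seq_filter_regular[OF ps(1,3)])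
  moreover have "sequence_of_type Sg (map snd ps) k" unfolding sequence_of_type_iff using ps by blast
  moreover have "mixed_multiplicity_system S Sg M (map snd ps) k" unfolding mixed_multiplicity_system_iff using ps by blast
  ultimately show ?thesis by blast
qed

text \<open>
  Lift the elements of the infinite residue field.  A graded prime meets the scalars in a prime ideal of \<open>A\<close>, which is
  maximal and therefore equal to \<open>\<mm>\<close>; so it contains no difference of two lifts.
\<close>

lemma separating_exists:
  assumes art: "artinian_ring A" and loc: "local_ring A \<mm>" and inf: "infinite (carrier (A Quot \<mm>))"
    and hom: "structure_map S \<in> ring_hom A S"
  shows "\<exists>Y. separating Y"
proof -
  interpret L: local_ring A \<mm> by fact
  let ?h = "structure_map S"
  interpret h: ring_hom_cring A S ?h
    by (intro ring_hom_cringI L.is_cring cring_axioms hom) 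
  let ?Q = "carrier (A Quot \<mm>)"
  have cos: "\<exists>a. a \<in> carrier A \<and> X = \<mm> +>\<^bsub>A\<^esub> a" if "X \<in> ?Q" for X
    using that by (auto simp: FactRing_def A_RCOSETS_def')
  define r where "r X = (SOME a. a \<in> carrier A \<and> X = \<mm> +>\<^bsub>A\<^esub> a)" for X
  have r: "r X \<in> carrier A" "X = \<mm> +>\<^bsub>A\<^esub> r X" if "X \<in> ?Q" for X
    using someI_ex[OF cos[OF that]] unfolding r_def by auto
  have sep: "r X \<ominus>\<^bsub>A\<^esub> r X' \<notin> \<mm>" if "X \<in> ?Q" "X' \<in> ?Q" "X \<noteq> X'" for X X'
  proof
    assume d: "r X \<ominus>\<^bsub>A\<^esub> r X' \<in> \<mm>"
    have "\<mm> +>\<^bsub>A\<^esub> r X = \<mm> +>\<^bsub>A\<^esub> r X'"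
      using L.quotient_eq_iff_same_a_r_cos[OF L.is_ideal r(1)[OF that(1)] r(1)[OF that(2)]] d by blast
    then show False using r(2)[OF that(1)] r(2)[OF that(2)] that(3) by metis
  qed
  have notin: "?h a \<notin> P 0" if P: "gprime P" and a: "a \<in> carrier A" "a \<notin> \<mm>" for P a
  proof
    assume haP: "?h a \<in> P 0"
    note iP = gprimeD(1)[OF P]
    have hS: "?h b \<in> Sg 0" if "b \<in> carrier A" for b using Z_Sg that by blast
    define p where "p = {b \<in> carrier A. ?h b \<in> P 0}"
    have mult: "b \<otimes>\<^bsub>A\<^esub> c \<in> p" if "b \<in> carrier A" "c \<in> p" for b c
      using that gidealD(4)[OF iP hS, of b "?h c" 0] by (simp add: p_def)
    have "ideal p A"
    proof (rule idealI[OF L.ring_axioms])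
      show "subgroup p (add_monoid A)"
      proof
        show "inv\<^bsub>add_monoid A\<^esub> b \<in> p" if "b \<in> p" for b
          using that gideal_neg[OF iP, of "?h b" 0] by (simp add: p_def flip: a_inv_def)
      qed (use gidealD(2,3)[OF iP] in \<open>auto simp: p_def\<close>)
      show "c \<otimes>\<^bsub>A\<^esub> b \<in> p" if "b \<in> p" "c \<in> carrier A" for b c by (rule mult[OF that(2,1)])
      show "b \<otimes>\<^bsub>A\<^esub> c \<in> p" if "b \<in> p" "c \<in> carrier A" for b c
        using mult[OF that(2,1)] that by (simp add: p_def L.m_comm)
    qed
    then have "primeideal p A"
    proof (rule primeidealI[OF _ L.is_cring])
      have "\<one>\<^bsub>A\<^esub> \<notin> p" using gprimeD(2)[OF P] by (simp add: p_def)
      then show "carrier A \<noteq> p" by auto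
      show "b \<in> p \<or> c \<in> p" if "b \<in> carrier A" "c \<in> carrier A" "b \<otimes>\<^bsub>A\<^esub> c \<in> p" for b c
        using gprimeD(3)[OF P hS[OF that(1)] hS[OF that(2)]] that by (auto simp: p_def)
    qed
    then have "p = \<mm>" using artinian_prime_maximal[OF art L.is_cring] L.unique_maximalideal by blast
    then show False using a haP by (auto simp: p_def)
  qed
  have diff: "?h (r X) \<ominus>\<^bsub>S\<^esub> ?h (r X') \<notin> P 0" if P: "gprime P" and X: "X \<in> ?Q" "X' \<in> ?Q" "X \<noteq> X'" for P X X'
  proof -
    have "?h (r X \<ominus>\<^bsub>A\<^esub> r X') = ?h (r X) \<ominus>\<^bsub>S\<^esub> ?h (r X')"
      using r(1)[OF X(1)] r(1)[OF X(2)] by (simp add: a_minus_def)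
    then show ?thesis using notin[OF P _ sep[OF X]] r(1)[OF X(1)] r(1)[OF X(2)] by simp
  qed
  let ?Y = "(\<lambda>X. ?h (r X)) ` ?Q"
  have "separating ?Y"
    unfolding separating_def
  proof (intro conjI allI impI ballI)
    show "?Y \<subseteq> Sg 0" using Z_Sg r(1) by blast
    fix P assume P: "gprime P"
    have "inj_on (\<lambda>X. ?h (r X)) ?Q"
    proof (rule inj_onI, rule ccontr)
      fix X X' assume X: "X \<in> ?Q" "X' \<in> ?Q" "?h (r X) = ?h (r X')" "X \<noteq> X'"
      have "?h (r X) \<ominus>\<^bsub>S\<^esub> ?h (r X') = \<zero>\<^bsub>S\<^esub>" using X(3) r(1)[OF X(2)] by (simp add: minus_self)
      then show False using diff[OF P X(1,2,4)] gidealD(2)[OF gprimeD(1)[OF P]] by simp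
    qed
    then show "infinite ?Y" using inf by (simp add: finite_image_iff)
    show "c \<ominus>\<^bsub>S\<^esub> c' \<notin> P 0" if "c \<in> ?Y" "c' \<in> ?Y" "c \<noteq> c'" for c c' using that diff[OF P] by blast
  qed
  then show ?thesis by blast
qed

end

theorem proposition2p9:
  fixes A :: "'a ring" and \<mm> :: "'a set"
    and S :: "('a, 's) module" and Sg :: "nat ^ 'd::finite \<Rightarrow> 's set"
    and M :: "('s, 'm) module" and Mg :: "nat ^ 'd \<Rightarrow> 'm set"
    and k :: "nat ^ 'd"
  assumes "artinian_ring A" and "local_ring A \<mm>" and "infinite (carrier (A Quot \<mm>))"
    and "fin_gen_standard_algebra A S Sg"
    and "multigraded_module S Sg M Mg" and "fin_gen_module S M"
  defines "i \<equiv> \<exists>xs. filter_regular_sequence S Sg M Mg xs \<and> sequence_of_type Sg xs k \<and>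
                    mixed_multiplicity_system S Sg M xs k"
    and "ii \<equiv> \<exists>xs. mixed_multiplicity_system S Sg M xs k"
    and "iii \<equiv> \<exists>c. \<forall>n. multi_difference k (hilbert_poly A S M Mg) n = c"
    and "iv \<equiv> mixed_multiplicity_defined A S M Mg k"
  shows "(i \<longleftrightarrow> ii) \<and> (ii \<longleftrightarrow> iii) \<and> (iii \<longleftrightarrow> iv)"
proof -
  from graded_module_exists[OF assms(4,1,5,6)] obtain zs G where
    "graded_module S Sg (structure_map S ` carrier A) zs M Mg G" by blast
  moreover have "direct_sum_decomp S Sg"
    by (rule multigraded_algebra.ring_decomp[OF fin_gen_standard_algebra.axioms(1)[OF assms(4)]])
  moreover have "direct_sum_decomp M Mg" by (rule multigraded_module.module_decomp[OF assms(5)])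
  ultimately interpret hilbert_setting A S Sg zs M Mg G
    by (intro hilbert_setting.intro graded_setting.intro graded_setting_axioms.intro)
  from separating_exists[OF assms(1-3) fin_gen_standard_algebra.structure_map_hom[OF assms(4)]]
  obtain Y where Y: "separating Y" ..
  have "i \<Longrightarrow> ii" unfolding i_def ii_def by blast
  moreover have "ii \<Longrightarrow> iii" unfolding ii_def iii_def using system_imp_const by blast
  moreover have "iii \<Longrightarrow> i" unfolding iii_def i_def by (rule const_imp_regular_system[OF Y])
  moreover have "iii \<longleftrightarrow> iv" unfolding iii_def iv_def by (rule difference_const_iff)
  ultimately show ?thesis by blast
qed

end
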